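(* Assume $\alpha\ge1$, $\alpha\neq2$, and $\sum_{j=1}^n m_j=1$. For each positive integer $\mathfrak p$ there is an integer $\mathfrak q_0$ such that for each integer $\mathfrak q>\mathfrak q_0$ the restricted $(n+1)$-body problem has at least two $2\pi\mathfrak q$-periodic solutions of the form $$q(t)=\varepsilon^{-1}e^{J(\theta_j+\mathfrak p t/\mathfrak q)}x_0+\mathcal O(\varepsilon),\qquad \varepsilon=(\mathfrak p/\mathfrak q)^{2/(\alpha+1)},\quad j=1,2,$$ where $\theta_j\in[0,2\pi]$ and $\mathcal O(\varepsilon)$ is a $2\pi\mathfrak q$-periodic function of order $\varepsilon$ (bounded by a constant independent of $\mathfrak q$ times $\varepsilon$).
   Context: Let $n\ge2$, $\alpha\ge1$, masses $m_1,\dots,m_n>0$, and let $q_1,\dots,q_n:\mathbb R\to\mathbb R^2$ be a collision-free $2\pi$-periodic solution of the $n$-body problem $\ddot q_j=-\sum_{k\neq j}m_k\frac{q_j-q_k}{\|q_j-q_k\|^{\alpha+1}}$ with center of mass at the origin, $\sum_j m_jq_j(t)=0$. The restricted $(n+1)$-body problem is the equation $\ddot q(t)=-\sum_{j=1}^n m_j\frac{q(t)-q_j(t)}{\|q(t)-q_j(t)\|^{\alpha+1}}$ for $q:\mathbb R\to\mathbb R^2$. $J=\begin{pmatrix}0&1\\-1&0\end{pmatrix}$, $e^{J\theta}=\cos\theta\,I+\sin\theta\,J$, $x_0=(1,0)^T$, $\|\cdot\|$ the Euclidean norm. *)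

theory Defs
  imports "HOL-Analysis.Analysis"
begin

definition x0 :: "real^2" where
  "x0 = (\<chi> i. if i = 1 then 1 else 0)"

definition Jmat :: "real^2^2" where
  "Jmat = (\<chi> i j. if i = 1 \<and> j = 2 then 1 else if i = 2 \<and> j = 1 then -1 else 0)"

definition expJ :: "real \<Rightarrow> real^2^2" where
  "expJ \<theta> = cos \<theta> *\<^sub>R mat 1 + sin \<theta> *\<^sub>R Jmat"

definition solves_2nd :: "(real \<Rightarrow> real^2) \<Rightarrow> (real \<Rightarrow> real^2 \<Rightarrow> real^2) \<Rightarrow> bool" where
  "solves_2nd q F \<longleftrightarrow> (\<exists>v. \<forall>t. (q has_vector_derivative v t) (at t) \<and>
                              (v has_vector_derivative F t (q t)) (at t))"

definition nbody_periodic ::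
  "nat \<Rightarrow> real \<Rightarrow> (nat \<Rightarrow> real) \<Rightarrow> (nat \<Rightarrow> real \<Rightarrow> real^2) \<Rightarrow> bool" where
  "nbody_periodic n \<alpha> m qs \<longleftrightarrow>
     (\<forall>j<n. \<forall>k<n. j \<noteq> k \<longrightarrow> (\<forall>t. qs j t \<noteq> qs k t)) \<and>
     (\<forall>j<n. \<forall>t. qs j (t + 2 * pi) = qs j t) \<and>
     (\<forall>t. (\<Sum>j<n. m j *\<^sub>R qs j t) = 0) \<and>
     (\<forall>j<n. solves_2nd (qs j)
        (\<lambda>t x. - (\<Sum>k\<in>{..<n} - {j}. (m k / norm (qs j t - qs k t) powr (\<alpha> + 1)) *\<^sub>R
                                         (qs j t - qs k t))))"

definition restricted_field ::
  "nat \<Rightarrow> real \<Rightarrow> (nat \<Rightarrow> real) \<Rightarrow> (nat \<Rightarrow> real \<Rightarrow> real^2) \<Rightarrow> real \<Rightarrow> real^2 \<Rightarrow> real^2" where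
  "restricted_field n \<alpha> m qs t x =
     - (\<Sum>j<n. (m j / norm (x - qs j t) powr (\<alpha> + 1)) *\<^sub>R (x - qs j t))"

definition restricted_solution ::
  "nat \<Rightarrow> real \<Rightarrow> (nat \<Rightarrow> real) \<Rightarrow> (nat \<Rightarrow> real \<Rightarrow> real^2) \<Rightarrow> (real \<Rightarrow> real^2) \<Rightarrow> bool" where
  "restricted_solution n \<alpha> m qs q \<longleftrightarrow>
     (\<forall>j<n. \<forall>t. q t \<noteq> qs j t) \<and> solves_2nd q (restricted_field n \<alpha> m qs)"

end

theory Submission
  imports Defs
begin

text \<open>Far from the primaries the orbit is nearly Keplerian. For an orbit \<open>u(\<omega> t) / \<epsilon>\<close> with \<open>\<omega> = p / q = \<epsilon> powr \<mu>\<close>,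
  \<open>\<mu> = (\<alpha> + 1) / 2\<close>, one gets the force of a unit mass at the origin, perturbed by primaries at \<open>\<epsilon> qc\<^sub>j(s / \<omega>)\<close>.
  Writing \<open>u = cis (s + \<theta>) * (1 + x)\<close> leads to \<open>L x = N \<theta> x\<close> on functions of period \<open>2 \<pi> p\<close>, where the linear operator \<open>L\<close>
  has constant coefficients and is symmetric. Its kernel contains the constant \<open>\<i>\<close> (the phase) and, if
  \<open>\<kappa> = sqrt (4 - 2 * \<mu>)\<close> is resonant, a two-dimensional space of oscillations \<open>zeta z\<close>; the exclusion of \<open>\<alpha> = 2\<close> means that
  \<open>\<kappa> \<noteq> 1\<close>. Contraction solves the equation up to a kernel component, for each phase \<open>\<theta>\<close> and each amplitude
  \<open>norm z \<le> K * \<epsilon>\<^sup>2\<close>. This component vanishes at a minimum of the reduced action over \<open>(\<theta>, z)\<close>, provided the minimum is not on the boundary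
  \<open>norm z = K * \<epsilon>\<^sup>2\<close> of a resonant ball. There the averaged quadrupole moment of the primaries detunes the oscillation: it contributes
  \<open>\<mu> * (\<mu> - 1) * I0 * (norm z)\<^sup>2 * \<epsilon>\<^sup>2\<close> to the radial derivative, which is positive since resonance forces \<open>\<mu> > 1\<close> (for \<open>\<mu> = 1\<close>,
  \<open>\<kappa> = sqrt 2\<close> is irrational), and dominates for large \<open>K\<close>. A second solution is the first one delayed by
  a multiple of \<open>2 \<pi>\<close> that turns the phase by an angle between \<open>\<pi> / 2\<close> and \<open>\<pi>\<close>.\<close>

text \<open>The averaged leading term contains no \<theta>, so it offers no nondegenerate phase to
  continue from; a minimum asks only for compactness. Two choices keep it elementary. The values of
  \<open>ell\<close> are orthogonal to those of \<open>Linv\<close>, so the first variation of the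
  reduced action sees only kernel directions. The action contains no velocities, so bounds in the
  supremum norm suffice. The delicate point is the boundary of the resonant ball. Oscillation and
  correction \<open>Linv (Nf \<theta> x)\<close> are both of order \<open>\<epsilon>^2\<close>
  there, and the detuning has size \<open>K * \<rho> * \<epsilon>^4\<close>. Errors of size
  \<open>\<rho> * \<epsilon>^4\<close> free of \<open>K\<close> lose against large \<open>K\<close>,
  those with one more factor \<epsilon> against small \<epsilon>. Three contributions fit neither
  pattern. The pure forcing by the primaries is too large and is averaged over the fast time, which
  gains \<open>\<omega>^2\<close>. The term cubic in the amplitude grows like \<open>K^2\<close> and
  vanishes by its frequencies. The quadratic term mixing oscillation and correction is as large as
  the detuning and has to be computed: symmetry moves the linear operator from the unknown
  correction to the explicit second harmonic \<open>W\<close>, and the result enters the detuning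
  coefficient.\<close>

section \<open>Primitives and means of periodic functions\<close>

text \<open>Chosen on the whole real line, negative times included; \<open>prim_unique\<close> then
  evaluates it from any antiderivative at hand.\<close>

definition prim :: "(real \<Rightarrow> complex) \<Rightarrow> real \<Rightarrow> complex" where
  "prim g = (SOME H. H 0 = 0 \<and> (\<forall>s. (H has_vector_derivative g s) (at s)))"

definition avg :: "real \<Rightarrow> (real \<Rightarrow> complex) \<Rightarrow> complex" where
  "avg T g = prim g T / of_real T"

definition periodic :: "real \<Rightarrow> (real \<Rightarrow> complex) set" where
  "periodic T = {f. continuous_on UNIV f \<and> (\<forall>s. f (s + T) = f s)}"

lemma prim_spec:
  assumes "continuous_on UNIV g"
  shows "prim g 0 = 0 \<and> (\<forall>s. (prim g has_vector_derivative g s) (at s))"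
proof -
  have "\<exists>F. \<forall>x::real. - \<infinity> < ereal x \<longrightarrow> ereal x < \<infinity> \<longrightarrow> (F has_vector_derivative g x) (at x)"
    using assms by (intro einterval_antiderivative) (auto simp: continuous_on_eq_continuous_at)
  then obtain F where F: "\<And>x. (F has_vector_derivative g x) (at x)" by auto
  have "((\<lambda>x. F x - F 0) has_vector_derivative g x) (at x)" for x
    using has_vector_derivative_diff[OF F has_vector_derivative_const] by fastforce
  then have "\<exists>H. H 0 = 0 \<and> (\<forall>s. (H has_vector_derivative g s) (at s))"
    by (intro exI[of _ "\<lambda>x. F x - F 0"]) auto
  then show ?thesis unfolding prim_def by (rule someI_ex)
qed

lemma prim_0 [simp]: "continuous_on UNIV g \<Longrightarrow> prim g 0 = 0"
  using prim_spec by blast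

lemma prim_deriv: "continuous_on UNIV g \<Longrightarrow> (prim g has_vector_derivative g s) (at s)"
  using prim_spec by blast

lemma has_vector_derivative_imp_continuous:
  assumes "\<And>s. (f has_vector_derivative g s) (at s)"
  shows "continuous_on UNIV f"
  using assms by (meson continuous_at_imp_continuous_on has_vector_derivative_continuous)

lemma prim_cont [simp]: "continuous_on UNIV g \<Longrightarrow> continuous_on UNIV (prim g)"
  by (rule has_vector_derivative_imp_continuous[OF prim_deriv])

lemma prim_unique:
  assumes "\<And>s. (H has_vector_derivative g s) (at s)" and "continuous_on UNIV g"
  shows "prim g s = H s - H 0"
proof -
  have "((\<lambda>s. H s - prim g s) has_vector_derivative 0) (at s within UNIV)" for s
    using has_vector_derivative_diff[OF assms(1) prim_deriv[OF assms(2)]] by simp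
  then obtain c where c: "\<And>s. H s - prim g s = c"
    using has_vector_derivative_zero_constant[of UNIV "\<lambda>s. H s - prim g s"] by auto
  show ?thesis using c[of s] c[of 0] assms(2) by (simp add: algebra_simps)
qed

lemma prim_diff:
  assumes "continuous_on UNIV g" "continuous_on UNIV h"
  shows "prim (\<lambda>s. g s - h s) s = prim g s - prim h s"
  by (subst prim_unique[where H="\<lambda>s. prim g s - prim h s"])
     (auto intro!: derivative_eq_intros prim_deriv assms continuous_intros simp: assms)

lemma prim_add:
  assumes "continuous_on UNIV g" "continuous_on UNIV h"
  shows "prim (\<lambda>s. g s + h s) s = prim g s + prim h s"
  by (subst prim_unique[where H="\<lambda>s. prim g s + prim h s"])
     (auto intro!: derivative_eq_intros prim_deriv assms continuous_intros simp: assms)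

lemma prim_cmul:
  assumes "continuous_on UNIV g"
  shows "prim (\<lambda>s. c * g s) s = c * prim g s"
  by (subst prim_unique[where H="\<lambda>s. c * prim g s"])
     (auto intro!: derivative_eq_intros prim_deriv assms continuous_intros simp: assms)

lemma prim_const: "prim (\<lambda>s. c) s = of_real s * c"
  by (subst prim_unique[where H="\<lambda>s. s *\<^sub>R c"])
     (auto intro!: derivative_eq_intros simp: scaleR_conv_of_real)

lemma prim_bound:
  assumes "continuous_on UNIV g" "\<And>s. 0 \<le> s \<Longrightarrow> s \<le> T \<Longrightarrow> norm (g s) \<le> B" "0 \<le> s" "s \<le> T"
  shows "norm (prim g s) \<le> B * T"
proof -
  have B: "0 \<le> B" using norm_ge_zero[of "g 0"] assms(2)[of 0] assms(3,4) by linarith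
  have "norm (prim g s - prim g 0) \<le> B * norm (s - 0)"
  proof (rule differentiable_bound[of "{0..T}" _ "\<lambda>x h. h *\<^sub>R g x"])
    show "(prim g has_derivative (\<lambda>h. h *\<^sub>R g x)) (at x within {0..T})" for x
      using prim_deriv[OF assms(1), of x] has_derivative_at_withinI
      unfolding has_vector_derivative_def by blast
    show "onorm (\<lambda>h. h *\<^sub>R g x) \<le> B" if "x \<in> {0..T}" for x
    proof (rule onorm_le)
      show "norm (h *\<^sub>R g x) \<le> B * norm h" for h
        using mult_right_mono[OF assms(2)[of x], of "\<bar>h\<bar>"] that by (simp add: mult.commute)
    qed
  qed (use assms(3,4) in \<open>simp_all\<close>)
  also have "\<dots> \<le> B * T" using B assms by (simp add: mult_left_mono)
  finally show ?thesis using assms(1) by simp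
qed

lemma prim_integral:
  assumes "continuous_on UNIV g" "0 \<le> T"
  shows "integral {0..T} g = prim g T"
proof -
  have "(g has_integral prim g T - prim g 0) {0..T}"
    by (rule fundamental_theorem_of_calculus)
       (simp_all add: assms has_vector_derivative_at_within prim_deriv)
  then show ?thesis using assms by (simp add: integral_unique)
qed

lemma avg_integral: "continuous_on UNIV g \<Longrightarrow> 0 < T \<Longrightarrow> integral {0..T} g = of_real T * avg T g"
  by (simp add: prim_integral avg_def)

lemma periodicD: "f \<in> periodic T \<Longrightarrow> continuous_on UNIV f" "f \<in> periodic T \<Longrightarrow> f (s + T) = f s"
  by (auto simp: periodic_def)

lemma periodicI: "continuous_on UNIV f \<Longrightarrow> (\<And>s. f (s + T) = f s) \<Longrightarrow> f \<in> periodic T"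
  by (auto simp: periodic_def)

text \<open>Lets bounds be proved on one period, where exponentials with arbitrary complex exponent
  are under control, and then carried to all times by subtracting \<open>floor (s / T)\<close>
  periods.\<close>

lemma periodic_reduce:
  assumes "f \<in> periodic T" "T > 0" "\<And>s. 0 \<le> s \<Longrightarrow> s \<le> T \<Longrightarrow> P (f s)"
  shows "P (f s)"
proof -
  have st: "f (s + real n * T) = f s" for n s
  proof (induction n)
    case (Suc n)
    have "f (s + real (Suc n) * T) = f ((s + real n * T) + T)" by (simp add: algebra_simps)
    then show ?case using Suc periodicD(2)[OF assms(1)] by simp
  qed simp
  have st': "f (s + of_int k * T) = f s" for k :: int
  proof (cases "k \<ge> 0")
    case True then show ?thesis using st[of s "nat k"] by simp
  next
    case False
    then show ?thesis using st[of "s + of_int k * T" "nat (-k)"] by (simp add: algebra_simps)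
  qed
  define k where "k = \<lfloor>s / T\<rfloor>"
  have "of_int k \<le> s / T" "s / T < of_int k + 1" unfolding k_def by linarith+
  then have "of_int k * T \<le> s" "s \<le> of_int k * T + T" using assms(2) by (auto simp: field_simps)
  then have "P (f (s + of_int (- k) * T))" by (intro assms(3)) auto
  then show ?thesis using st'[of "-k"] by simp
qed

text \<open>A shift of the primitive by \<open>T\<close> is again an antiderivative of
  \<open>g\<close>, so the two differ by the constant \<open>prim g T\<close>, which is
  \<open>T\<close> times the mean.\<close>

lemma periodic_avg0_prim:
  assumes "g \<in> periodic T" "prim g T = 0"
  shows "prim g \<in> periodic T"
proof (rule periodicI)
  note c = periodicD(1)[OF assms(1)]
  show "prim g (s + T) = prim g s" for s
  proof -
    have "prim g s = (\<lambda>s. prim g (s + T)) s - (\<lambda>s. prim g (s + T)) 0"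
    proof (rule prim_unique[OF _ c])
      fix s
      have "((prim g \<circ> (\<lambda>s. s + T)) has_vector_derivative (1 *\<^sub>R g (s + T))) (at s)"
        by (rule vector_diff_chain_at) (auto intro!: derivative_eq_intros prim_deriv c)
      then show "((\<lambda>s. prim g (s + T)) has_vector_derivative g s) (at s)"
        using periodicD(2)[OF assms(1)] by (simp add: o_def)
    qed
    then show ?thesis using assms(2) by simp
  qed
qed (use assms periodicD in auto)

lemma avg_diff:
  assumes "continuous_on UNIV g" "continuous_on UNIV h"
  shows "avg T (\<lambda>s. g s - h s) = avg T g - avg T h"
  using assms by (simp add: avg_def prim_diff diff_divide_distrib)

lemma avg_add:
  assumes "continuous_on UNIV g" "continuous_on UNIV h"
  shows "avg T (\<lambda>s. g s + h s) = avg T g + avg T h"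
  using assms by (simp add: avg_def prim_add add_divide_distrib)

lemma avg_cmul:
  assumes "continuous_on UNIV g"
  shows "avg T (\<lambda>s. c * g s) = c * avg T g"
  using assms by (simp add: avg_def prim_cmul)

lemma avg_const: "T > 0 \<Longrightarrow> avg T (\<lambda>s. c) = c"
  by (simp add: avg_def prim_const)

lemma avg_bound:
  assumes "continuous_on UNIV g" "T > 0" "\<And>s. 0 \<le> s \<Longrightarrow> s \<le> T \<Longrightarrow> norm (g s) \<le> B"
  shows "norm (avg T g) \<le> B"
  using prim_bound[OF assms(1,3), of T T] assms(2) by (simp add: avg_def norm_divide field_simps)

text \<open>A \<open>T\<close>-periodic solution of \<open>y' = \<nu> * y + h\<close>; in the resonant case \<open>h\<close> first loses its component along \<open>exp (\<nu> * s)\<close>, with coefficient \<open>pc T \<nu> h\<close>.\<close>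

definition Sop :: "real \<Rightarrow> complex \<Rightarrow> (real \<Rightarrow> complex) \<Rightarrow> real \<Rightarrow> complex" where
  "Sop T \<nu> h =
    (let g = (\<lambda>s. exp (- \<nu> * of_real s) * h s); k = (\<lambda>s. g s - avg T g) in
     if exp (\<nu> * of_real T) = 1
     then (\<lambda>s. exp (\<nu> * of_real s) * (prim k s - avg T (prim k)))
     else (\<lambda>s. exp (\<nu> * of_real s) * (prim g s + exp (\<nu> * of_real T) / (1 - exp (\<nu> * of_real T)) * prim g T)))"

definition pc :: "real \<Rightarrow> complex \<Rightarrow> (real \<Rightarrow> complex) \<Rightarrow> complex" where
  "pc T \<nu> f = avg T (\<lambda>s. exp (- \<nu> * of_real s) * f s)"

lemma exp_deriv:
  "((\<lambda>s. exp (\<nu> * of_real s)) has_vector_derivative (\<nu> * exp (\<nu> * of_real s))) (at s)" for \<nu> :: complex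
proof -
  have "((exp \<circ> (\<lambda>s. \<nu> * of_real s)) has_vector_derivative \<nu> * exp (\<nu> * of_real s)) (at s)"
    by (rule field_vector_diff_chain_at)
       (auto intro!: derivative_eq_intros simp: scaleR_conv_of_real)
  then show ?thesis by (simp add: o_def)
qed

lemma exp_periodic:
  assumes "exp (\<nu> * of_real T) = (1::complex)"
  shows "(\<lambda>s. exp (\<nu> * of_real s)) \<in> periodic T"
  using assms by (intro periodicI) (auto intro!: continuous_intros simp: distrib_left exp_add)

lemma exp_minus_res: "exp (\<nu> * of_real T) = (1::complex) \<Longrightarrow> exp (- \<nu> * of_real T) = 1"
  by (simp add: exp_minus)

lemma periodic_mult: "f \<in> periodic T \<Longrightarrow> g \<in> periodic T \<Longrightarrow> (\<lambda>s. f s * g s) \<in> periodic T"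
  and periodic_add: "f \<in> periodic T \<Longrightarrow> g \<in> periodic T \<Longrightarrow> (\<lambda>s. f s + g s) \<in> periodic T"
  and periodic_diff: "f \<in> periodic T \<Longrightarrow> g \<in> periodic T \<Longrightarrow> (\<lambda>s. f s - g s) \<in> periodic T"
  and periodic_const: "(\<lambda>s. c) \<in> periodic T"
  by (auto simp: periodic_def intro!: continuous_intros)

lemma Sop_deriv:
  assumes h: "h \<in> periodic T"
  shows "(Sop T \<nu> h has_vector_derivative
     (\<nu> * Sop T \<nu> h s + h s - (if exp (\<nu> * of_real T) = 1 then exp (\<nu> * of_real s) * pc T \<nu> h else 0))) (at s)"
proof -
  note c = periodicD(1)[OF h]
  define g where "g = (\<lambda>s. exp (- \<nu> * of_real s) * h s)"
  define k where "k = (\<lambda>s. g s - avg T g)"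
  have cg: "continuous_on UNIV g" unfolding g_def by (intro continuous_intros c)
  have ck: "continuous_on UNIV k" unfolding k_def by (intro continuous_intros cg)
  have e: "exp (\<nu> * of_real s) * exp (- \<nu> * of_real s) = 1" by (simp flip: exp_add)
  have eg: "exp (\<nu> * of_real s) * g s = h s" unfolding g_def using e by (metis mult.assoc mult_1)
  have p: "pc T \<nu> h = avg T g" by (simp add: pc_def g_def)
  show ?thesis
  proof (cases "exp (\<nu> * of_real T) = 1")
    case True
    then have S: "Sop T \<nu> h = (\<lambda>s. exp (\<nu> * of_real s) * (prim k s - avg T (prim k)))"
      by (simp add: Sop_def k_def g_def Let_def)
    have "exp (\<nu> * of_real s) * k s = h s - exp (\<nu> * of_real s) * pc T \<nu> h"
      by (simp add: k_def right_diff_distrib eg p)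
    then show ?thesis unfolding S using True
      by (auto intro!: derivative_eq_intros prim_deriv ck exp_deriv simp: algebra_simps)
  next
    case False
    then have S: "Sop T \<nu> h = (\<lambda>s. exp (\<nu> * of_real s) * (prim g s + exp (\<nu> * of_real T) / (1 - exp (\<nu> * of_real T)) * prim g T))"
      by (simp add: Sop_def k_def g_def Let_def)
    show ?thesis unfolding S using False eg
      by (auto intro!: derivative_eq_intros prim_deriv cg exp_deriv simp: algebra_simps)
  qed
qed

lemma Sop_cont: "h \<in> periodic T \<Longrightarrow> continuous_on UNIV (Sop T \<nu> h)"
  by (rule has_vector_derivative_imp_continuous[OF Sop_deriv])

lemma Sop_periodic:
  assumes h: "h \<in> periodic T" and T: "T > 0"
  shows "Sop T \<nu> h \<in> periodic T"
proof (rule periodicI[OF Sop_cont[OF h]])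
  fix s
  note c = periodicD(1)[OF h]
  define g where "g = (\<lambda>s. exp (- \<nu> * of_real s) * h s)"
  define k where "k = (\<lambda>s. g s - avg T g)"
  have cg: "continuous_on UNIV g" unfolding g_def by (intro continuous_intros c)
  have ck: "continuous_on UNIV k" unfolding k_def by (intro continuous_intros cg)
  show "Sop T \<nu> h (s + T) = Sop T \<nu> h s"
  proof (cases "exp (\<nu> * of_real T) = 1")
    case True
    then have S: "Sop T \<nu> h = (\<lambda>s. exp (\<nu> * of_real s) * (prim k s - avg T (prim k)))"
      by (simp add: Sop_def k_def g_def Let_def)
    have gp: "g \<in> periodic T" unfolding g_def
      by (rule periodic_mult[OF exp_periodic[OF exp_minus_res[OF True]] h])
    have kp: "k \<in> periodic T" unfolding k_def by (rule periodic_diff[OF gp periodic_const])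
    have "prim k T = 0" using T unfolding k_def
      by (subst prim_diff) (auto simp: cg prim_const avg_def)
    then show ?thesis using periodicD(2)[OF periodic_avg0_prim[OF kp]] periodicD(2)[OF exp_periodic[OF True]]
      unfolding S by simp
  next
    case False
    define e where "e = exp (\<nu> * of_real T)"
    have e0: "e \<noteq> 0" "e \<noteq> 1" using False by (auto simp: e_def)
    \<comment> \<open>The added constant is the initial value forced by equality of the solution at
      \<open>0\<close> and \<open>T\<close>: it solves
      \<open>c = e * (prim g T + c)\<close>.\<close>
    have S: "Sop T \<nu> h = (\<lambda>s. exp (\<nu> * of_real s) * (prim g s + e / (1 - e) * prim g T))"
      using False by (simp add: Sop_def k_def g_def Let_def e_def)
    \<comment> \<open>The integrand \<open>g\<close> is not periodic but loses a factor
      \<open>e\<close> under the shift by \<open>T\<close>, so \<open>e * prim g (s + T)\<close> is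
      another antiderivative of it.\<close>
    have "prim g s = (\<lambda>s. e * prim g (s + T)) s - (\<lambda>s. e * prim g (s + T)) 0"
    proof (rule prim_unique[OF _ cg])
      fix s
      have "((prim g \<circ> (\<lambda>s. s + T)) has_vector_derivative (1 *\<^sub>R g (s + T))) (at s)"
        by (rule vector_diff_chain_at) (auto intro!: derivative_eq_intros prim_deriv cg)
      then have "((\<lambda>s. e * prim g (s + T)) has_vector_derivative e * g (s + T)) (at s)"
        by (intro has_vector_derivative_mult_right) (simp add: o_def)
      moreover have "e * g (s + T) = g s"
        using periodicD(2)[OF h, of s] by (simp add: g_def e_def distrib_left exp_add exp_minus exp_diff)
      ultimately show "((\<lambda>s. e * prim g (s + T)) has_vector_derivative g s) (at s)" by simp
    qed
    then have "e * prim g (s + T) = prim g s + e * prim g T" by simp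
    moreover have "exp (\<nu> * of_real (s + T)) = exp (\<nu> * of_real s) * e"
      by (simp add: e_def distrib_left exp_add mult.commute)
    ultimately have "Sop T \<nu> h (s + T) = exp (\<nu> * of_real s) * (prim g s + e * prim g T + e * (e / (1 - e) * prim g T))"
      unfolding S by (metis (no_types, lifting) distrib_left mult.assoc)
    also have "e * prim g T + e * (e / (1 - e) * prim g T) = e / (1 - e) * prim g T"
      using e0 by (simp add: field_simps)
    then have "exp (\<nu> * of_real s) * (prim g s + e * prim g T + e * (e / (1 - e) * prim g T)) = Sop T \<nu> h s"
      unfolding S by (simp add: add.assoc)
    finally show ?thesis .
  qed
qed

text \<open>In the resonant branch a solution is free up to a multiple of
  \<open>exp (\<nu> * s)\<close>; subtracting the mean of \<open>prim k\<close> fixes this multiple.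
  The normalization later makes the values of \<open>Linv\<close> orthogonal to those of
  \<open>ell\<close>.\<close>

lemma Sop_pc0:
  assumes h: "h \<in> periodic T" and T: "T > 0" and res: "exp (\<nu> * of_real T) = 1"
  shows "pc T \<nu> (Sop T \<nu> h) = 0"
proof -
  note c = periodicD(1)[OF h]
  define g where "g = (\<lambda>s. exp (- \<nu> * of_real s) * h s)"
  define k where "k = (\<lambda>s. g s - avg T g)"
  have cg: "continuous_on UNIV g" unfolding g_def by (intro continuous_intros c)
  have ck: "continuous_on UNIV k" unfolding k_def by (intro continuous_intros cg)
  have S: "Sop T \<nu> h = (\<lambda>s. exp (\<nu> * of_real s) * (prim k s - avg T (prim k)))"
    using res by (simp add: Sop_def k_def g_def Let_def)
  have e: "exp (- \<nu> * of_real s) * (exp (\<nu> * of_real s) * w) = w" for s w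
    by (simp add: exp_minus)
  show ?thesis unfolding pc_def S e
    using T by (subst avg_diff) (auto simp: ck avg_const)
qed

lemma Sop_diff:
  assumes h: "h \<in> periodic T" and h': "h' \<in> periodic T"
  shows "Sop T \<nu> (\<lambda>s. h s - h' s) s = Sop T \<nu> h s - Sop T \<nu> h' s"
proof -
  note c = periodicD(1)[OF h] periodicD(1)[OF h']
  define g where "g = (\<lambda>h s. exp (- \<nu> * of_real s) * (h s::complex))"
  define k where "k = (\<lambda>h s. g h s - avg T (g h))"
  have cg: "continuous_on UNIV (g h)" "continuous_on UNIV (g h')" unfolding g_def by (intro continuous_intros c)+
  have ck: "continuous_on UNIV (k h)" "continuous_on UNIV (k h')" unfolding k_def by (intro continuous_intros cg)+
  have gd: "g (\<lambda>s. h s - h' s) = (\<lambda>s. g h s - g h' s)" by (auto simp: g_def algebra_simps)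
  have pg: "prim (g (\<lambda>s. h s - h' s)) = (\<lambda>s. prim (g h) s - prim (g h') s)"
    using prim_diff[OF cg] by (auto simp: gd)
  have kd: "k (\<lambda>s. h s - h' s) = (\<lambda>s. k h s - k h' s)" unfolding k_def gd avg_diff[OF cg] by (auto simp: algebra_simps)
  have pk: "prim (k (\<lambda>s. h s - h' s)) = (\<lambda>s. prim (k h) s - prim (k h') s)"
    using prim_diff[OF ck] by (auto simp: kd)
  have S: "Sop T \<nu> f = (if exp (\<nu> * of_real T) = 1
     then (\<lambda>s. exp (\<nu> * of_real s) * (prim (k f) s - avg T (prim (k f))))
     else (\<lambda>s. exp (\<nu> * of_real s) * (prim (g f) s + exp (\<nu> * of_real T) / (1 - exp (\<nu> * of_real T)) * prim (g f) T)))" for f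
    by (simp add: Sop_def k_def g_def Let_def)
  have *: "a * (x - y + c * (u - v)) = a * (x + c * u) - a * (y + c * v)" for a x y c u v :: complex
    by (simp add: algebra_simps)
  show ?thesis unfolding S pk pg avg_diff[OF prim_cont[OF ck(1)] prim_cont[OF ck(2)]]
    by (cases "exp (\<nu> * of_real T) = 1", simp add: algebra_simps, simp only: if_False *)
qed

text \<open>The constant depends on \<open>T\<close> and \<nu> only, so it can be fixed before
  \<epsilon> is chosen. It is the sum of the constants of the two branches, with \<open>E\<close>
  bounding both exponentials over one period.\<close>

lemma Sop_bound:
  assumes T: "T > 0"
  shows "\<exists>C\<ge>0. \<forall>h\<in>periodic T. \<forall>B. (\<forall>s. norm (h s) \<le> B) \<longrightarrow> (\<forall>s. norm (Sop T \<nu> h s) \<le> C * B)"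
proof -
  define E where "E = exp (norm \<nu> * T)"
  define r where "r = norm (exp (\<nu> * of_real T) / (1 - exp (\<nu> * of_real T)))"
  define C where "C = E * (4 * E * T) + E * (E * T + r * (E * T))"
  have E0: "0 \<le> E" "r \<ge> 0" by (auto simp: E_def r_def)
  have Ep: "norm (exp (\<nu> * of_real s)) \<le> E" "norm (exp (- \<nu> * of_real s)) \<le> E" if "0 \<le> s" "s \<le> T" for s
  proof -
    have *: "norm (exp w) \<le> E" if "norm w \<le> norm \<nu> * T" for w :: complex
      using norm_exp[of w] that unfolding E_def by (meson exp_le_cancel_iff order_trans)
    show "norm (exp (\<nu> * of_real s)) \<le> E" "norm (exp (- \<nu> * of_real s)) \<le> E"
      using that by (intro *; simp add: norm_mult mult_left_mono)+
  qed
  have "norm (Sop T \<nu> h s) \<le> C * B" if h: "h \<in> periodic T" and B: "\<And>s. norm (h s) \<le> B" for h B s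
  proof (rule periodic_reduce[OF Sop_periodic[OF h T] T])
    fix s assume s: "0 \<le> s" "s \<le> T"
    have B0: "0 \<le> B" using B[of 0] norm_ge_zero order_trans by blast
    note c = periodicD(1)[OF h]
    define g where "g = (\<lambda>s. exp (- \<nu> * of_real s) * h s)"
    define k where "k = (\<lambda>s. g s - avg T g)"
    have cg: "continuous_on UNIV g" unfolding g_def by (intro continuous_intros c)
    have ck: "continuous_on UNIV k" unfolding k_def by (intro continuous_intros cg)
    have gb: "norm (g s) \<le> E * B" if "0 \<le> s" "s \<le> T" for s
      unfolding g_def norm_mult using Ep(2)[OF that] B E0 B0 by (intro mult_mono) auto
    have ab: "norm (avg T g) \<le> E * B" by (rule avg_bound[OF cg T gb])
    have kb: "norm (k s) \<le> 2 * (E * B)" if "0 \<le> s" "s \<le> T" for s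
      unfolding k_def using norm_triangle_ineq4[of "g s" "avg T g"] gb[OF that] ab by linarith
    have pk: "norm (prim k s) \<le> 2 * (E * B) * T" if "0 \<le> s" "s \<le> T" for s
      by (rule prim_bound[OF ck _ that]) (rule kb)
    have apk: "norm (avg T (prim k)) \<le> 2 * (E * B) * T"
      by (rule avg_bound[OF prim_cont[OF ck] T pk])
    show "norm (Sop T \<nu> h s) \<le> C * B"
    proof (cases "exp (\<nu> * of_real T) = 1")
      case True
      have S: "Sop T \<nu> h s = exp (\<nu> * of_real s) * (prim k s - avg T (prim k))"
        using True by (simp add: Sop_def k_def g_def Let_def)
      have "norm (prim k s - avg T (prim k)) \<le> 4 * E * T * B"
        using norm_triangle_ineq4[of "prim k s" "avg T (prim k)"] apk pk[OF s] by (simp add: algebra_simps)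
      then have "norm (Sop T \<nu> h s) \<le> E * (4 * E * T * B)"
        unfolding S norm_mult using Ep(1)[OF s] E0 by (intro mult_mono) auto
      also have "\<dots> \<le> C * B" unfolding C_def using E0 B0 T by (simp add: algebra_simps)
      finally show ?thesis .
    next
      case False
      have S: "Sop T \<nu> h s = exp (\<nu> * of_real s) * (prim g s + exp (\<nu> * of_real T) / (1 - exp (\<nu> * of_real T)) * prim g T)"
        using False by (simp add: Sop_def k_def g_def Let_def)
      have 1: "norm (prim g s) \<le> E * B * T" by (rule prim_bound[OF cg gb s])
      have "norm (prim g T) \<le> E * B * T" by (rule prim_bound[OF cg gb]) (use T in auto)
      then have 2: "norm (exp (\<nu> * of_real T) / (1 - exp (\<nu> * of_real T)) * prim g T) \<le> r * (E * B * T)"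
        unfolding norm_mult r_def by (intro mult_left_mono) auto
      have "norm (Sop T \<nu> h s) \<le> E * (E * B * T + r * (E * B * T))"
        unfolding S norm_mult[of "exp (\<nu> * of_real s)"]
        using Ep(1)[OF s] E0 1 2
        by (intro mult_mono) (auto intro: norm_triangle_le)
      also have "\<dots> \<le> C * B" unfolding C_def using E0 B0 T by (simp add: algebra_simps)
      finally show ?thesis .
    qed
  qed
  moreover have "C \<ge> 0" unfolding C_def using E0 T by auto
  ultimately show ?thesis by blast
qed

text \<open>Integration by parts over a period; the boundary terms cancel because \<open>f\<close>
  and, by resonance, the exponential return to their initial values.\<close>

lemma pc_deriv:
  assumes f: "f \<in> periodic T" and d: "\<And>s. (f has_vector_derivative g s) (at s)" and g: "continuous_on UNIV g"
    and T: "T > 0" and res: "exp (\<nu> * of_real T) = 1"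
  shows "pc T \<nu> g = \<nu> * pc T \<nu> f"
proof -
  note c = periodicD(1)[OF f]
  let ?e = "\<lambda>s. exp (- \<nu> * of_real s)"
  have "prim (\<lambda>s. ?e s * g s - \<nu> * (?e s * f s)) T = ?e T * f T - ?e 0 * f 0"
    by (rule prim_unique[where H="\<lambda>s. ?e s * f s"])
       (auto intro!: derivative_eq_intros d exp_deriv[of "-\<nu>", simplified] continuous_intros c g simp: algebra_simps)
  also have "\<dots> = 0" using periodicD(2)[OF f, of 0] exp_minus_res[OF res] by simp
  finally have "prim (\<lambda>s. ?e s * g s) T = \<nu> * prim (\<lambda>s. ?e s * f s) T"
    by (subst (asm) prim_diff) (auto intro!: continuous_intros c g prim_cmul)
  then show ?thesis by (simp add: pc_def avg_def)
qed

section \<open>Mean inner products\<close>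

definition ravg :: "real \<Rightarrow> (real \<Rightarrow> real) \<Rightarrow> real" where
  "ravg T g = Re (avg T (\<lambda>s. of_real (g s)))"

definition ip :: "real \<Rightarrow> (real \<Rightarrow> complex) \<Rightarrow> (real \<Rightarrow> complex) \<Rightarrow> real" where
  "ip T a b = ravg T (\<lambda>s. a s \<bullet> b s)"

lemma ravg_add: "continuous_on UNIV f \<Longrightarrow> continuous_on UNIV g \<Longrightarrow> ravg T (\<lambda>s. f s + g s) = ravg T f + ravg T g"
  by (simp add: ravg_def avg_add continuous_intros)

lemma ravg_diff: "continuous_on UNIV f \<Longrightarrow> continuous_on UNIV g \<Longrightarrow> ravg T (\<lambda>s. f s - g s) = ravg T f - ravg T g"
  by (simp add: ravg_def avg_diff continuous_intros)

lemma ravg_cmul: "continuous_on UNIV g \<Longrightarrow> ravg T (\<lambda>s. c * g s) = c * ravg T g"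
  by (simp add: ravg_def avg_cmul continuous_intros)

lemma ravg_const: "T > 0 \<Longrightarrow> ravg T (\<lambda>s. c) = c"
  by (simp add: ravg_def avg_const)

lemma ravg_bound:
  assumes "continuous_on UNIV g" "T > 0" "\<And>s. \<bar>g s\<bar> \<le> B"
  shows "\<bar>ravg T g\<bar> \<le> B"
  unfolding ravg_def
  by (rule order_trans[OF abs_Re_le_cmod avg_bound]) (auto intro!: continuous_intros assms)

lemma of_real_Re_vd:
  assumes "(f has_vector_derivative f') (at s)"
  shows "((\<lambda>s. complex_of_real (Re (f s))) has_vector_derivative complex_of_real (Re f')) (at s)"
  using bounded_linear.has_vector_derivative[OF bounded_linear_Re assms]
  by (intro has_vector_derivative_of_real) (simp add: has_real_derivative_iff_has_vector_derivative)

lemma ravg_Re: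
  assumes "continuous_on UNIV g" "T > 0"
  shows "ravg T (\<lambda>s. Re (g s)) = Re (avg T g)"
proof -
  have "((\<lambda>s. complex_of_real (Re (prim g s))) has_vector_derivative complex_of_real (Re (g s))) (at s)" for s
    by (intro of_real_Re_vd prim_deriv assms)
  then have "prim (\<lambda>s. of_real (Re (g s))) T = of_real (Re (prim g T)) - of_real (Re (prim g 0))"
    by (rule prim_unique) (intro continuous_intros assms)
  then show ?thesis using assms by (simp add: ravg_def avg_def)
qed

lemma ravg_deriv0:
  assumes "\<And>s. (H has_real_derivative g s) (at s)" "continuous_on UNIV g" "H T = H 0"
  shows "ravg T g = 0"
proof -
  have "prim (\<lambda>s. of_real (g s)) T = of_real (H T) - of_real (H 0)"
    by (rule prim_unique)
       (auto intro!: continuous_intros has_vector_derivative_of_real assms)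
  then show ?thesis using assms by (simp add: ravg_def avg_def)
qed

lemma avg_exp0:
  assumes "\<nu> \<noteq> 0" "exp (\<nu> * of_real T) = (1::complex)"
  shows "avg T (\<lambda>s. exp (\<nu> * of_real s)) = 0"
proof -
  have "prim (\<lambda>s. exp (\<nu> * of_real s)) T = exp (\<nu> * of_real T) / \<nu> - exp (\<nu> * of_real 0) / \<nu>"
    by (rule prim_unique)
       (auto intro!: continuous_intros derivative_eq_intros exp_deriv simp: assms)
  then show ?thesis using assms by (simp add: avg_def)
qed

lemma ip_add_left: "continuous_on UNIV a \<Longrightarrow> continuous_on UNIV b \<Longrightarrow> continuous_on UNIV c \<Longrightarrow>
    ip T (\<lambda>s. a s + b s) c = ip T a c + ip T b c"
  and ip_diff_left: "continuous_on UNIV a \<Longrightarrow> continuous_on UNIV b \<Longrightarrow> continuous_on UNIV c \<Longrightarrow>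
    ip T (\<lambda>s. a s - b s) c = ip T a c - ip T b c"
  and ip_add_right: "continuous_on UNIV a \<Longrightarrow> continuous_on UNIV b \<Longrightarrow> continuous_on UNIV c \<Longrightarrow>
    ip T c (\<lambda>s. a s + b s) = ip T c a + ip T c b"
  and ip_diff_right: "continuous_on UNIV a \<Longrightarrow> continuous_on UNIV b \<Longrightarrow> continuous_on UNIV c \<Longrightarrow>
    ip T c (\<lambda>s. a s - b s) = ip T c a - ip T c b"
  by (simp_all add: ip_def inner_simps ravg_add ravg_diff continuous_intros)

lemma ip_sym: "ip T a b = ip T b a"
  by (simp add: ip_def inner_commute)

lemma ip_bound:
  assumes "continuous_on UNIV a" "continuous_on UNIV b" "T > 0" "\<And>s. norm (a s) \<le> A" "\<And>s. norm (b s) \<le> B"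
  shows "\<bar>ip T a b\<bar> \<le> A * B"
  unfolding ip_def
proof (rule ravg_bound)
  fix s
  have "0 \<le> A" using assms(4)[of 0] norm_ge_zero order_trans by blast
  then have "norm (a s) * norm (b s) \<le> A * B" using assms by (intro mult_mono) auto
  then show "\<bar>a s \<bullet> b s\<bar> \<le> A * B" using Cauchy_Schwarz_ineq2[of "a s" "b s"] by linarith
qed (use assms in \<open>auto intro!: continuous_intros\<close>)

lemma ip_scale_right: "continuous_on UNIV a \<Longrightarrow> continuous_on UNIV b \<Longrightarrow> ip T a (\<lambda>s. of_real r * b s) = r * ip T a b"
proof -
  assume c: "continuous_on UNIV a" "continuous_on UNIV b"
  have "(\<lambda>s. a s \<bullet> (of_real r * b s)) = (\<lambda>s. r * (a s \<bullet> b s))" by (simp add: fun_eq_iff scaleR_conv_of_real[symmetric])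
  then show ?thesis unfolding ip_def by (simp only:) (intro ravg_cmul continuous_intros c)
qed

lemma periodic_vector_derivative:
  fixes x :: "real \<Rightarrow> complex"
  assumes "\<And>s. (x has_vector_derivative x' s) (at s)" "\<And>s. x (s + T) = x s"
  shows "x' (s + T) = x' s"
proof -
  have "((x \<circ> (\<lambda>s. s + T)) has_vector_derivative (1 *\<^sub>R x' (s + T))) (at s)"
    by (rule vector_diff_chain_at) (auto intro!: derivative_eq_intros assms)
  moreover have "x \<circ> (\<lambda>s. s + T) = x" using assms(2) by auto
  ultimately show ?thesis using assms(1)[of s] vector_derivative_unique_at by fastforce
qed

section \<open>The linearized equation\<close>

text \<open>The linearization at the circular orbit, in the frame rotating with it.\<close>

definition Lsol :: "real \<Rightarrow> (real \<Rightarrow> complex) \<Rightarrow> (real \<Rightarrow> complex) \<Rightarrow> bool" where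
  "Lsol \<mu> x g \<longleftrightarrow> (\<exists>x'. \<forall>s. (x has_vector_derivative x' s) (at s) \<and>
     (x' has_vector_derivative (g s - 2 * \<i> * x' s + of_real (2 * \<mu> * Re (x s)))) (at s))"

lemma Lsol_add: "Lsol \<mu> x g \<Longrightarrow> Lsol \<mu> y k \<Longrightarrow> Lsol \<mu> (\<lambda>s. x s + y s) (\<lambda>s. g s + k s)"
proof -
  assume "Lsol \<mu> x g" "Lsol \<mu> y k"
  then obtain x' y' where
    x: "\<And>s. (x has_vector_derivative x' s) (at s)"
       "\<And>s. (x' has_vector_derivative (g s - 2 * \<i> * x' s + of_real (2 * \<mu> * Re (x s)))) (at s)" and
    y: "\<And>s. (y has_vector_derivative y' s) (at s)"
       "\<And>s. (y' has_vector_derivative (k s - 2 * \<i> * y' s + of_real (2 * \<mu> * Re (y s)))) (at s)"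
    unfolding Lsol_def by blast
  show ?thesis unfolding Lsol_def
    by (rule exI[of _ "\<lambda>s. x' s + y' s"])
       (auto intro!: derivative_eq_intros x y simp: algebra_simps)
qed

text \<open>Lagrange's identity: the difference of the two integrands is the derivative of the
  periodic function \<open>H\<close>. The Coriolis term is symmetric because differentiation and
  multiplication by \<i> are both skew and commute; the term with \<open>Re x\<close> is visibly
  symmetric.\<close>

lemma Lsol_symmetric:
  assumes "Lsol \<mu> x g" "Lsol \<mu> y k" "x \<in> periodic T" "y \<in> periodic T"
    and c: "continuous_on UNIV g" "continuous_on UNIV k"
  shows "ip T g y = ip T x k"
proof -
  from assms(1,2) obtain x' y' where
    x: "\<And>s. (x has_vector_derivative x' s) (at s)"
       "\<And>s. (x' has_vector_derivative (g s - 2 * \<i> * x' s + of_real (2 * \<mu> * Re (x s)))) (at s)" and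
    y: "\<And>s. (y has_vector_derivative y' s) (at s)"
       "\<And>s. (y' has_vector_derivative (k s - 2 * \<i> * y' s + of_real (2 * \<mu> * Re (y s)))) (at s)"
    unfolding Lsol_def by blast
  note inn = bounded_bilinear.has_vector_derivative[OF bounded_bilinear_inner]
  define H where "H = (\<lambda>s. x' s \<bullet> y s - x s \<bullet> y' s + 2 * ((\<i> * x s) \<bullet> y s))"
  have "ravg T (\<lambda>s. g s \<bullet> y s - x s \<bullet> k s) = 0"
  proof (rule ravg_deriv0)
    fix s
    have ix: "((\<lambda>s. \<i> * x s) has_vector_derivative \<i> * x' s) (at s)"
      by (intro has_vector_derivative_mult_right x)
    have "(H has_vector_derivative (
        (x' s \<bullet> y' s + (g s - 2 * \<i> * x' s + of_real (2 * \<mu> * Re (x s))) \<bullet> y s)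
        - (x s \<bullet> (k s - 2 * \<i> * y' s + of_real (2 * \<mu> * Re (y s))) + x' s \<bullet> y' s)
        + 2 * ((\<i> * x s) \<bullet> y' s + (\<i> * x' s) \<bullet> y s))) (at s)" (is "(H has_vector_derivative ?d) _")
      unfolding H_def
      by (intro has_vector_derivative_add has_vector_derivative_diff inn x y ix has_vector_derivative_mult_right)
    moreover have "?d = g s \<bullet> y s - x s \<bullet> k s"
      by (simp add: inner_complex_def algebra_simps)
    ultimately show "(H has_real_derivative g s \<bullet> y s - x s \<bullet> k s) (at s)"
      by (simp add: has_real_derivative_iff_has_vector_derivative)
    show "H T = H 0"
      using periodic_vector_derivative[OF x(1) periodicD(2)[OF assms(3)], of 0]
        periodic_vector_derivative[OF y(1) periodicD(2)[OF assms(4)], of 0]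
        periodicD(2)[OF assms(3), of 0] periodicD(2)[OF assms(4), of 0] by (simp add: H_def)
  qed (intro continuous_intros c periodicD(1)[OF assms(3)] periodicD(1)[OF assms(4)])
  then show ?thesis unfolding ip_def
    by (subst (asm) ravg_diff) (auto intro!: continuous_intros c periodicD(1)[OF assms(3)] periodicD(1)[OF assms(4)])
qed

text \<open>The frequency \<kappa> is complex because \<open>4 - 2 * \<mu>\<close> is negative for
  \<mu> above 2.\<close>

locale circ =
  fixes T \<mu> :: real and \<kappa> :: complex
  assumes T0: "T > 0" and mu0: "\<mu> > 0" and kap: "\<kappa>\<^sup>2 = of_real (4 - 2 * \<mu>)"
begin

text \<open>Integrating the imaginary part of the equation for \<open>Lsol\<close> once expresses \<open>(Im x)'\<close> through \<open>Re x\<close>; what remains is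
  \<open>(D\<^sup>2 + \<kappa>\<^sup>2) (Re x) = hq f\<close> up to constants, solved by inverting the two first-order factors. For \<open>\<kappa> = 0\<close> there is no obstruction,
  because \<open>hq f\<close> has mean zero.\<close>

definition "res \<longleftrightarrow> \<kappa> \<noteq> 0 \<and> exp (\<i> * \<kappa> * of_real T) = 1"

definition "Bq f = Sop T 0 (\<lambda>s. of_real (Im (f s)))"
definition "hq f = (\<lambda>s. of_real (Re (f s)) - avg T (\<lambda>s. of_real (Re (f s))) + 2 * Bq f s)"
definition "wq f = Sop T (- \<i> * \<kappa>) (hq f)"
definition "Yq f = Sop T (\<i> * \<kappa>) (wq f)"
definition "bq f = (\<lambda>s. Bq f s - 2 * of_real (Re (Yq f s)))"
text \<open>The operator sends a real constant \<open>a\<close> to \<open>- 2 * \<mu> * a\<close>;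
  this constant balances the mean of the real part of the equation, including the constant of
  integration of the imaginary part.\<close>

definition "a0 f = Re (2 * avg T (bq f) - avg T (\<lambda>s. of_real (Re (f s)))) / (2 * \<mu>)"
definition "Linv f = (\<lambda>s. Complex (Re (Yq f s) + a0 f) (Re (Sop T 0 (bq f) s)))"
text \<open>The part of the right-hand side that \<open>Linv\<close> leaves unsolved. It is not a
  projection onto the kernel: a kernel oscillation has an imaginary part as well, while here the
  resonant harmonics stay in the real component and the imaginary component is a mere constant. This
  shape is what \<open>ell_orth\<close> relies on.\<close>

definition "ell f = (\<lambda>s. Complex
   (if res then Re (exp (\<i> * \<kappa> * of_real s) * pc T (\<i> * \<kappa>) (hq f) + exp (- \<i> * \<kappa> * of_real s) * pc T (- \<i> * \<kappa>) (hq f)) else 0)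
   (Re (avg T (\<lambda>s. of_real (Im (f s))))))"

lemma f12: "f \<in> periodic T \<Longrightarrow> (\<lambda>s. of_real (Im (f s))) \<in> periodic T" "f \<in> periodic T \<Longrightarrow> (\<lambda>s. of_real (Re (f s))) \<in> periodic T"
  by (auto simp: periodic_def intro!: continuous_intros)

lemma Bq_periodic: "f \<in> periodic T \<Longrightarrow> Bq f \<in> periodic T"
  unfolding Bq_def by (intro Sop_periodic T0 f12)
lemma hq_periodic: "f \<in> periodic T \<Longrightarrow> hq f \<in> periodic T"
  unfolding hq_def by (intro periodic_add periodic_diff periodic_mult periodic_const Bq_periodic f12)
lemma wq_periodic: "f \<in> periodic T \<Longrightarrow> wq f \<in> periodic T"
  unfolding wq_def by (intro Sop_periodic T0 hq_periodic)
lemma Yq_periodic: "f \<in> periodic T \<Longrightarrow> Yq f \<in> periodic T"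
  unfolding Yq_def by (intro Sop_periodic T0 wq_periodic)
lemma bq_periodic: "f \<in> periodic T \<Longrightarrow> bq f \<in> periodic T"
  unfolding bq_def by (intro periodic_diff periodic_mult periodic_const Bq_periodic Yq_periodic f12)

lemma Complex_periodic: "a \<in> periodic T \<Longrightarrow> b \<in> periodic T \<Longrightarrow> (\<lambda>s. Complex (Re (a s) + c) (Re (b s))) \<in> periodic T"
  unfolding periodic_def complex_eq_iff Complex_eq by (auto intro!: continuous_intros)

lemma Linv_periodic: "f \<in> periodic T \<Longrightarrow> Linv f \<in> periodic T"
  unfolding Linv_def by (intro Complex_periodic Sop_periodic T0 bq_periodic Yq_periodic)

lemma Linv_diff:
  assumes f: "f \<in> periodic T" and g: "g \<in> periodic T"
  defines "d \<equiv> \<lambda>s. f s - g s"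
  shows "Linv d s = Linv f s - Linv g s"
proof -
  note c = periodicD(1)[OF f12(1)[OF f]] periodicD(1)[OF f12(1)[OF g]] periodicD(1)[OF f12(2)[OF f]] periodicD(1)[OF f12(2)[OF g]]
  have B: "Bq d = (\<lambda>s. Bq f s - Bq g s)"
    using Sop_diff[OF f12(1)[OF f] f12(1)[OF g]] by (auto simp: Bq_def d_def)
  have A: "avg T (\<lambda>s. of_real (Re (d s))) = avg T (\<lambda>s. of_real (Re (f s))) - avg T (\<lambda>s. of_real (Re (g s)))"
    using avg_diff[OF c(3,4)] by (simp add: d_def)
  have h: "hq d = (\<lambda>s. hq f s - hq g s)"
    unfolding hq_def B A by (auto simp: d_def algebra_simps)
  have w: "wq d = (\<lambda>s. wq f s - wq g s)"
    unfolding wq_def h using Sop_diff[OF hq_periodic[OF f] hq_periodic[OF g]] by auto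
  have Y: "Yq d = (\<lambda>s. Yq f s - Yq g s)"
    unfolding Yq_def w using Sop_diff[OF wq_periodic[OF f] wq_periodic[OF g]] by auto
  have b: "bq d = (\<lambda>s. bq f s - bq g s)"
    unfolding bq_def B Y by (auto simp: algebra_simps)
  have a: "a0 d = a0 f - a0 g"
    unfolding a0_def A b avg_diff[OF periodicD(1)[OF bq_periodic[OF f]] periodicD(1)[OF bq_periodic[OF g]]]
    by (simp add: diff_divide_distrib[symmetric] algebra_simps)
  show ?thesis
    unfolding Linv_def a Y b Sop_diff[OF bq_periodic[OF f] bq_periodic[OF g]]
    by (simp add: complex_eq_iff)
qed

text \<open>Follows the definition of \<open>Linv\<close> through its chain of first-order
  inversions, three different exponents in all. Only \<open>T\<close>, \<mu> and \<kappa> enter the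
  constant, so the contraction becomes strong as \<epsilon> shrinks.\<close>

lemma Linv_bound: "\<exists>C\<ge>0. \<forall>f\<in>periodic T. \<forall>B. (\<forall>s. norm (f s) \<le> B) \<longrightarrow> (\<forall>s. norm (Linv f s) \<le> C * B)"
proof -
  obtain C0 where C0: "C0 \<ge> 0" "\<And>h B s. h \<in> periodic T \<Longrightarrow> (\<And>s. norm (h s) \<le> B) \<Longrightarrow> norm (Sop T 0 h s) \<le> C0 * B"
    using Sop_bound[OF T0, of 0] by blast
  obtain C1 where C1: "C1 \<ge> 0" "\<And>h B s. h \<in> periodic T \<Longrightarrow> (\<And>s. norm (h s) \<le> B) \<Longrightarrow> norm (Sop T (\<i> * \<kappa>) h s) \<le> C1 * B"
    using Sop_bound[OF T0, of "\<i> * \<kappa>"] by blast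
  obtain C2 where C2: "C2 \<ge> 0" "\<And>h B s. h \<in> periodic T \<Longrightarrow> (\<And>s. norm (h s) \<le> B) \<Longrightarrow> norm (Sop T (- \<i> * \<kappa>) h s) \<le> C2 * B"
    using Sop_bound[OF T0, of "- \<i> * \<kappa>"] by blast
  define D1 where "D1 = C1 * (C2 * (2 + 2 * C0))"
  define D2 where "D2 = C0 + 2 * D1"
  define C where "C = D1 + (2 * D2 + 1) / (2 * \<mu>) + C0 * D2"
  have D0: "D1 \<ge> 0" "D2 \<ge> 0" using C0 C1 C2 by (auto simp: D1_def D2_def)
  have "norm (Linv f s) \<le> C * B" if f: "f \<in> periodic T" and B: "\<And>s. norm (f s) \<le> B" for f B s
  proof -
    have f1: "norm (complex_of_real (Re (f s))) \<le> B" "norm (complex_of_real (Im (f s))) \<le> B" for s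
      using B[of s] abs_Re_le_cmod[of "f s"] abs_Im_le_cmod[of "f s"] by auto
    have Bq: "norm (Bq f s) \<le> C0 * B" for s unfolding Bq_def by (intro C0 f12 f f1)
    have av: "norm (avg T (\<lambda>s. of_real (Re (f s)))) \<le> B"
      by (rule avg_bound[OF periodicD(1)[OF f12(2)[OF f]] T0 f1(1)])
    have hq: "norm (hq f s) \<le> (2 + 2 * C0) * B" for s
    proof -
      have "norm (hq f s) \<le> norm (complex_of_real (Re (f s))) + norm (avg T (\<lambda>s. of_real (Re (f s)))) + norm (2 * Bq f s)"
        unfolding hq_def by (meson norm_triangle_le norm_triangle_ineq4 add_mono order_refl order_trans)
      then show ?thesis using f1(1)[of s] av Bq[of s] by (simp add: norm_mult algebra_simps)
    qed
    have wq: "norm (wq f s) \<le> C2 * ((2 + 2 * C0) * B)" for s unfolding wq_def by (intro C2 hq_periodic f hq)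
    have Yq: "norm (Yq f s) \<le> C1 * (C2 * ((2 + 2 * C0) * B))" for s unfolding Yq_def by (intro C1 wq_periodic f wq)
    have Yq': "norm (Yq f s) \<le> D1 * B" for s using Yq[of s] by (simp add: D1_def algebra_simps)
    have bq: "norm (bq f s) \<le> D2 * B" for s
    proof -
      have "norm (bq f s) \<le> norm (Bq f s) + norm (2 * complex_of_real (Re (Yq f s)))"
        unfolding bq_def by (rule norm_triangle_ineq4)
      then show ?thesis using Bq[of s] Yq'[of s] abs_Re_le_cmod[of "Yq f s"]
        by (simp add: norm_mult D2_def algebra_simps)
    qed
    have abq: "norm (avg T (bq f)) \<le> D2 * B" by (rule avg_bound[OF periodicD(1)[OF bq_periodic[OF f]] T0 bq])
    have "\<bar>Re (2 * avg T (bq f) - avg T (\<lambda>s. of_real (Re (f s))))\<bar> \<le> (2 * D2 + 1) * B"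
      using abq av abs_Re_le_cmod[of "avg T (bq f)"] abs_Re_le_cmod[of "avg T (\<lambda>s. of_real (Re (f s)))"]
      by (simp add: algebra_simps)
    then have a0: "\<bar>a0 f\<bar> \<le> (2 * D2 + 1) / (2 * \<mu>) * B"
      unfolding a0_def abs_divide using mu0 by (simp add: divide_right_mono)
    have Sb: "norm (Sop T 0 (bq f) s) \<le> C0 * (D2 * B)" by (intro C0 bq_periodic f bq)
    have "norm (Linv f s) \<le> \<bar>Re (Linv f s)\<bar> + \<bar>Im (Linv f s)\<bar>" by (rule cmod_le)
    also have "\<dots> \<le> norm (Yq f s) + \<bar>a0 f\<bar> + norm (Sop T 0 (bq f) s)"
      using abs_Re_le_cmod[of "Yq f s"] abs_Re_le_cmod[of "Sop T 0 (bq f) s"] by (simp add: Linv_def)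
    also have "\<dots> \<le> C * B" using Yq'[of s] a0 Sb by (simp add: C_def algebra_simps)
    finally show ?thesis .
  qed
  moreover have "C \<ge> 0" using D0 C0 mu0 by (simp add: C_def)
  ultimately show ?thesis by blast
qed

lemma res_minus: "exp (- \<i> * \<kappa> * of_real T) = 1 \<longleftrightarrow> exp (\<i> * \<kappa> * of_real T) = 1"
  by (simp add: exp_minus)

lemma Bq_avg: "f \<in> periodic T \<Longrightarrow> avg T (Bq f) = 0"
  using Sop_pc0[OF f12(1) T0, of f 0] by (simp add: pc_def Bq_def)

lemma hq_avg: "f \<in> periodic T \<Longrightarrow> avg T (hq f) = 0"
  unfolding hq_def using periodicD(1)[OF f12(2)] periodicD(1)[OF Bq_periodic] T0
  by (simp add: avg_add avg_diff avg_cmul avg_const Bq_avg continuous_intros)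

text \<open>\<open>Yq\<close> composes the inverses of \<open>D + \<i> * \<kappa>\<close> and
  \<open>D - \<i> * \<kappa>\<close>. The inner one drops a harmonic of \<open>hq f\<close>, the
  outer one a harmonic of the intermediate function \<open>wq f\<close>; the work is to express the
  second loss through \<open>hq f\<close> as well.\<close>

lemma Yq_deriv2:
  assumes f: "f \<in> periodic T"
  shows "\<exists>Y'. \<forall>s. (Yq f has_vector_derivative Y' s) (at s) \<and>
     (Y' has_vector_derivative (- \<kappa>\<^sup>2 * Yq f s + hq f s - (if res then
       exp (\<i> * \<kappa> * of_real s) * pc T (\<i> * \<kappa>) (hq f) + exp (- \<i> * \<kappa> * of_real s) * pc T (- \<i> * \<kappa>) (hq f) else 0))) (at s)"
proof -
  define r where "r \<longleftrightarrow> exp (\<i> * \<kappa> * of_real T) = 1"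
  define ep where "ep = (\<lambda>s. exp (\<i> * \<kappa> * of_real s))"
  define em where "em = (\<lambda>s. exp (- \<i> * \<kappa> * of_real s))"
  define cp where "cp = pc T (\<i> * \<kappa>)"
  define cm where "cm = pc T (- \<i> * \<kappa>)"
  define Y where "Y = Yq f"
  define w where "w = wq f"
  define h where "h = hq f"
  note periodic = hq_periodic[OF f, folded h_def] wq_periodic[OF f, folded w_def] Yq_periodic[OF f, folded Y_def]
  define Rp where "Rp = (\<lambda>s. if r then ep s * cp w else 0)"
  have dw: "(w has_vector_derivative (- \<i> * \<kappa> * w s + h s - (if r then em s * cm h else 0))) (at s)" for s
    using Sop_deriv[OF periodic(1), of "- \<i> * \<kappa>" s] unfolding res_minus
    unfolding w_def wq_def h_def r_def em_def cm_def by simp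
  have dY: "(Y has_vector_derivative (\<i> * \<kappa> * Y s + w s - Rp s)) (at s)" for s
    using Sop_deriv[OF periodic(2), of "\<i> * \<kappa>" s]
    unfolding w_def Y_def Yq_def r_def ep_def cp_def Rp_def by simp
  have dR: "(Rp has_vector_derivative (\<i> * \<kappa> * Rp s)) (at s)" for s
    unfolding Rp_def ep_def
    by (cases r) (auto intro!: derivative_eq_intros exp_deriv)
  define Y' where "Y' = (\<lambda>s. \<i> * \<kappa> * Y s + w s - Rp s)"
  have dY': "(Y' has_vector_derivative (- \<kappa>\<^sup>2 * Y s + h s - (if r then em s * cm h else 0) - 2 * \<i> * \<kappa> * Rp s)) (at s)" for s
    unfolding Y'_def
    by (rule derivative_eq_intros dY dw dR refl)+ (simp add: algebra_simps power2_eq_square)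
  have "(if r then em s * cm h else 0) + 2 * \<i> * \<kappa> * Rp s = (if res then ep s * cp h + em s * cm h else 0)" for s
  proof (cases "r \<and> \<kappa> \<noteq> 0")
    case True
    then have res and r: "exp (\<i> * \<kappa> * of_real T) = 1" by (auto simp: res_def r_def)
    have rm: "exp (- \<i> * \<kappa> * of_real T) = 1" using r res_minus by simp
    \<comment> \<open>The \<open>\<i> * \<kappa>\<close> component of \<open>w'\<close> is computed
      twice, by parts and from the equation for \<open>w\<close>; comparison gives
      \<open>2 * \<i> * \<kappa> * cp w = cp h\<close>, since the opposite harmonic has no such
      component.\<close>
    have "cp (\<lambda>s. - \<i> * \<kappa> * w s + h s - em s * cm h) = \<i> * \<kappa> * cp w"
      unfolding cp_def
    proof (rule pc_deriv[OF periodic(2) _ _ T0 r])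
      show "(w has_vector_derivative (- \<i> * \<kappa> * w s + h s - em s * cm h)) (at s)" for s
        using dw[of s] True by simp
      show "continuous_on UNIV (\<lambda>s. - \<i> * \<kappa> * w s + h s - em s * cm h)"
        unfolding em_def by (intro continuous_intros periodicD(1)[OF periodic(1)] periodicD(1)[OF periodic(2)])
    qed
    moreover have "cp (\<lambda>s. - \<i> * \<kappa> * w s + h s - em s * cm h) = - \<i> * \<kappa> * cp w + cp h - cp em * cm h"
    proof -
      let ?e = "\<lambda>s. exp (- (\<i> * \<kappa>) * of_real s)"
      have "cp (\<lambda>s. - \<i> * \<kappa> * w s + h s - em s * cm h) =
         avg T (\<lambda>s. (- \<i> * \<kappa>) * (?e s * w s) + ?e s * h s - cm h * (?e s * em s))"
        unfolding cp_def pc_def by (simp add: algebra_simps)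
      also have "\<dots> = (- \<i> * \<kappa>) * avg T (\<lambda>s. ?e s * w s) + avg T (\<lambda>s. ?e s * h s) - cm h * avg T (\<lambda>s. ?e s * em s)"
        unfolding em_def
        by (subst avg_diff avg_add avg_cmul; (intro continuous_intros periodicD(1)[OF periodic(1)] periodicD(1)[OF periodic(2)])?)+ simp
      finally show ?thesis by (simp add: cp_def pc_def)
    qed
    moreover have "cp em = 0"
    proof -
      have "cp em = avg T (\<lambda>s. exp ((- 2 * \<i> * \<kappa>) * of_real s))"
        unfolding cp_def pc_def em_def by (simp flip: exp_add) (simp add: algebra_simps)
      also have "\<dots> = 0"
      proof (rule avg_exp0)
        have "exp ((- 2 * \<i> * \<kappa>) * of_real T) = exp (- \<i> * \<kappa> * of_real T) * exp (- \<i> * \<kappa> * of_real T)"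
          by (simp flip: exp_add) (simp add: algebra_simps)
        then show "exp ((- 2 * \<i> * \<kappa>) * of_real T) = 1" using rm by simp
      qed (use True in auto)
      finally show ?thesis .
    qed
    ultimately have "2 * \<i> * \<kappa> * cp w = cp h" by (simp add: algebra_simps)
    then have "2 * \<i> * \<kappa> * (ep s * cp w) = ep s * cp h" by (metis mult.left_commute)
    then show ?thesis using True \<open>res\<close> by (simp add: Rp_def)
  next
    case False
    then have nr: "\<not> res" by (auto simp: res_def r_def)
    show ?thesis
    proof (cases "\<kappa> = 0")
      \<comment> \<open>For \<kappa> = 0 the harmonic lost is the mean of \<open>hq f\<close>, which
        is zero by construction.\<close>
      case True
      then show ?thesis using nr hq_avg[OF f] by (simp add: cm_def pc_def h_def)
    qed (use False nr in \<open>auto simp: Rp_def\<close>)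
  qed
  then have "(Y' has_vector_derivative (- \<kappa>\<^sup>2 * Y s + h s - (if res then ep s * cp h + em s * cm h else 0))) (at s)" for s
    using dY'[of s] by (simp only: diff_diff_eq)
  then show ?thesis using dY unfolding Y'_def Y_def h_def ep_def em_def cp_def cm_def
    by (intro exI[of _ "\<lambda>s. \<i> * \<kappa> * Yq f s + w s - Rp s"] allI conjI)
qed

lemma Linv_Lsol:
  assumes f: "f \<in> periodic T"
  shows "Lsol \<mu> (Linv f) (\<lambda>s. f s - ell f s)"
proof -
  define rr where "rr = (\<lambda>s. if res then
       exp (\<i> * \<kappa> * of_real s) * pc T (\<i> * \<kappa>) (hq f) + exp (- \<i> * \<kappa> * of_real s) * pc T (- \<i> * \<kappa>) (hq f) else 0)"
  obtain Y' where Y': "\<And>s. (Yq f has_vector_derivative Y' s) (at s)"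
     "\<And>s. (Y' has_vector_derivative (- \<kappa>\<^sup>2 * Yq f s + hq f s - rr s)) (at s)"
    using Yq_deriv2[OF f] unfolding rr_def by blast
  define b where "b = Sop T 0 (bq f)"
  define av where "av = avg T (bq f)"
  have db: "(b has_vector_derivative (bq f s - av)) (at s)" for s
    using Sop_deriv[OF bq_periodic[OF f], of 0 s] by (simp add: b_def av_def pc_def)
  define l0 where "l0 = avg T (\<lambda>s. of_real (Im (f s)))"
  have dB: "(Bq f has_vector_derivative (of_real (Im (f s)) - l0)) (at s)" for s
    using Sop_deriv[OF f12(1)[OF f], of 0 s] by (simp add: Bq_def l0_def pc_def)
  have dbq: "(bq f has_vector_derivative (of_real (Im (f s)) - l0 - 2 * of_real (Re (Y' s)))) (at s)" for s
    unfolding bq_def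
    by (intro has_vector_derivative_diff dB has_vector_derivative_mult_right of_real_Re_vd Y'(1))
  define X' where "X' = (\<lambda>s. complex_of_real (Re (Y' s)) + \<i> * complex_of_real (Re (bq f s - av)))"
  have X: "Linv f = (\<lambda>s. complex_of_real (Re (Yq f s)) + of_real (a0 f) + \<i> * complex_of_real (Re (b s)))"
    by (auto simp: Linv_def complex_eq_iff b_def)
  have dX: "(Linv f has_vector_derivative X' s) (at s)" for s
    unfolding X X'_def
    by (rule derivative_eq_intros of_real_Re_vd Y'(1) db refl)+ simp
  have dX': "(X' has_vector_derivative (complex_of_real (Re (- \<kappa>\<^sup>2 * Yq f s + hq f s - rr s))
      + \<i> * complex_of_real (Re (of_real (Im (f s)) - l0 - 2 * of_real (Re (Y' s)))))) (at s)" for s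
    unfolding X'_def
    by (rule derivative_eq_intros of_real_Re_vd Y'(2) dbq refl)+ simp
  have a0: "2 * \<mu> * a0 f = 2 * Re av - Re (avg T (\<lambda>s. of_real (Re (f s))))"
    using mu0 by (simp add: a0_def av_def)
  have "complex_of_real (Re (- \<kappa>\<^sup>2 * Yq f s + hq f s - rr s))
      + \<i> * complex_of_real (Re (of_real (Im (f s)) - l0 - 2 * of_real (Re (Y' s))))
     = (f s - ell f s) - 2 * \<i> * X' s + of_real (2 * \<mu> * Re (Linv f s))" for s
    using a0 unfolding kap
    by (simp add: complex_eq_iff X'_def Linv_def ell_def l0_def hq_def rr_def bq_def algebra_simps)
  then show ?thesis unfolding Lsol_def using dX dX' by metis
qed

lemma ell_periodic:
  assumes "f \<in> periodic T"
  shows "ell f \<in> periodic T"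
proof (cases res)
  case True
  then have r: "exp (\<i> * \<kappa> * of_real T) = 1" "exp (- \<i> * \<kappa> * of_real T) = 1" using res_minus by (auto simp: res_def)
  have "(\<lambda>s. Complex (Re ((\<lambda>s. exp (\<i> * \<kappa> * of_real s) * pc T (\<i> * \<kappa>) (hq f) + exp (- \<i> * \<kappa> * of_real s) * pc T (- \<i> * \<kappa>) (hq f)) s) + 0)
     (Re ((\<lambda>s. avg T (\<lambda>s. of_real (Im (f s)))) s))) \<in> periodic T"
    by (intro Complex_periodic periodic_add periodic_mult periodic_const exp_periodic r)
  then show ?thesis using True by (simp add: ell_def)
qed (auto simp: ell_def periodic_def)

text \<open>Displays the defect through three real coefficients, whose vanishing is then a matter of
  pairing with three kernel directions.\<close>

lemma ell_res_form:
  assumes res "Im \<kappa> = 0"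
  shows "\<exists>A B. \<forall>s. ell f s = Complex (A * cos (Re \<kappa> * s) + B * sin (Re \<kappa> * s)) (Re (avg T (\<lambda>s. of_real (Im (f s)))))"
proof -
  have k: "\<kappa> = of_real (Re \<kappa>)" using assms(2) by (simp add: complex_eq_iff)
  have e: "exp (\<i> * \<kappa> * of_real s) = cis (Re \<kappa> * s)" "exp (- \<i> * \<kappa> * of_real s) = cis (- (Re \<kappa> * s))" for s
    by (subst k, simp add: cis_conv_exp mult.assoc)+
  define p q where "p = pc T (\<i> * \<kappa>) (hq f)" and "q = pc T (- \<i> * \<kappa>) (hq f)"
  show ?thesis
    by (rule exI[of _ "Re p + Re q"], rule exI[of _ "Im q - Im p"])
       (simp only: ell_def complex_eq_iff e assms(1) if_True complex.sel flip: p_def q_def, simp add: algebra_simps)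
qed

text \<open>One component vanishes by the normalization of the outer inversion. For the other the
  inner normalization gives it for \<open>wq f\<close>, and taking components in the first-order
  equation of \<open>Yq f\<close> passes it on with the factor
  \<open>2 * \<i> * \<kappa>\<close>.\<close>

lemma Yq_pc0:
  assumes f: "f \<in> periodic T" and res
  shows "pc T (\<i> * \<kappa>) (Yq f) = 0" "pc T (- \<i> * \<kappa>) (Yq f) = 0"
proof -
  have r: "exp (\<i> * \<kappa> * of_real T) = 1" "exp (- \<i> * \<kappa> * of_real T) = 1" and k: "\<kappa> \<noteq> 0"
    using res_minus \<open>res\<close> by (auto simp: res_def)
  show "pc T (\<i> * \<kappa>) (Yq f) = 0" unfolding Yq_def by (rule Sop_pc0[OF wq_periodic[OF f] T0 r(1)])
  have w: "pc T (- \<i> * \<kappa>) (wq f) = 0" unfolding wq_def by (rule Sop_pc0[OF hq_periodic[OF f] T0 r(2)])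
  let ?c = "pc T (\<i> * \<kappa>) (wq f)"
  let ?e = "\<lambda>s. exp (- (- \<i> * \<kappa>) * of_real s)"
  have "(Yq f has_vector_derivative (\<i> * \<kappa> * Yq f s + wq f s - exp (\<i> * \<kappa> * of_real s) * ?c)) (at s)" for s
    using Sop_deriv[OF wq_periodic[OF f], of "\<i> * \<kappa>" s] r by (simp add: Yq_def)
  then have "pc T (- \<i> * \<kappa>) (\<lambda>s. \<i> * \<kappa> * Yq f s + wq f s - exp (\<i> * \<kappa> * of_real s) * ?c) = (- \<i> * \<kappa>) * pc T (- \<i> * \<kappa>) (Yq f)"
    by (intro pc_deriv Yq_periodic f T0 r continuous_intros periodicD(1)[OF Yq_periodic] periodicD(1)[OF wq_periodic]) auto
  moreover have "pc T (- \<i> * \<kappa>) (\<lambda>s. \<i> * \<kappa> * Yq f s + wq f s - exp (\<i> * \<kappa> * of_real s) * ?c) =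
      \<i> * \<kappa> * pc T (- \<i> * \<kappa>) (Yq f) + pc T (- \<i> * \<kappa>) (wq f) - ?c * avg T (\<lambda>s. exp (2 * \<i> * \<kappa> * of_real s))"
  proof -
    have "pc T (- \<i> * \<kappa>) (\<lambda>s. \<i> * \<kappa> * Yq f s + wq f s - exp (\<i> * \<kappa> * of_real s) * ?c) =
       avg T (\<lambda>s. (\<i> * \<kappa>) * (?e s * Yq f s) + ?e s * wq f s - ?c * (?e s * exp (\<i> * \<kappa> * of_real s)))"
      unfolding pc_def by (simp add: algebra_simps)
    also have "\<dots> = (\<i> * \<kappa>) * avg T (\<lambda>s. ?e s * Yq f s) + avg T (\<lambda>s. ?e s * wq f s) - ?c * avg T (\<lambda>s. ?e s * exp (\<i> * \<kappa> * of_real s))"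
      by (subst avg_diff avg_add avg_cmul; (intro continuous_intros periodicD(1)[OF Yq_periodic] periodicD(1)[OF wq_periodic] f)?)+ simp
    also have "(\<lambda>s. ?e s * exp (\<i> * \<kappa> * of_real s)) = (\<lambda>s. exp (2 * \<i> * \<kappa> * of_real s))"
      by (simp flip: exp_add) (simp add: algebra_simps)
    finally show ?thesis by (simp add: pc_def)
  qed
  moreover have "avg T (\<lambda>s. exp (2 * \<i> * \<kappa> * of_real s)) = 0"
  proof (rule avg_exp0)
    have "exp (2 * \<i> * \<kappa> * of_real T) = exp (\<i> * \<kappa> * of_real T) * exp (\<i> * \<kappa> * of_real T)"
      by (simp flip: exp_add) (simp add: algebra_simps)
    then show "exp (2 * \<i> * \<kappa> * of_real T) = 1" using r by simp
  qed (use k in auto)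
  ultimately have "2 * \<i> * \<kappa> * pc T (- \<i> * \<kappa>) (Yq f) = 0" using w by (simp add: algebra_simps)
  then show "pc T (- \<i> * \<kappa>) (Yq f) = 0" using k by simp
qed

text \<open>The harmonics of \<open>ell\<close> meet only the components of \<open>Yq\<close> that
  were normalized away, and its imaginary constant meets a mean-zero function. Hence a change of the
  \<open>Linv\<close> part of a solution does not affect the first variation of the reduced
  action.\<close>

lemma ell_orth:
  assumes f: "f \<in> periodic T" and g: "g \<in> periodic T" and kr: "res \<Longrightarrow> Im \<kappa> = 0"
  shows "ip T (ell f) (Linv g) = 0"
proof -
  let ?l = "Re (avg T (\<lambda>s. of_real (Im (f s))))"
  have S0: "Re (avg T (Sop T 0 (bq g))) = 0"
    using Sop_pc0[OF bq_periodic[OF g] T0, of 0] by (simp add: pc_def)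
  have cS: "continuous_on UNIV (Sop T 0 (bq g))" by (rule Sop_cont[OF bq_periodic[OF g]])
  have two: "ravg T (\<lambda>s. ?l * Re (Sop T 0 (bq g) s)) = 0"
    by (subst ravg_cmul) (auto intro!: continuous_intros cS simp: ravg_Re[OF cS T0] S0)
  show ?thesis
  proof (cases res)
    case False
    then have "(\<lambda>s. ell f s \<bullet> Linv g s) = (\<lambda>s. ?l * Re (Sop T 0 (bq g) s))"
      by (auto simp: ell_def Linv_def inner_complex_def)
    then show ?thesis using two by (simp add: ip_def)
  next
    case True
    have k: "\<kappa> = of_real (Re \<kappa>)" using kr[OF True] by (simp add: complex_eq_iff)
    have r: "exp (\<i> * \<kappa> * of_real T) = 1" "exp (- \<i> * \<kappa> * of_real T) = 1" and k0: "\<kappa> \<noteq> 0"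
      using res_minus \<open>res\<close> by (auto simp: res_def)
    obtain A B where AB: "\<And>s. ell f s = Complex (A * cos (Re \<kappa> * s) + B * sin (Re \<kappa> * s)) ?l"
      using ell_res_form[OF True kr[OF True]] by blast
    define c1 c2 where "c1 = (of_real A - \<i> * of_real B) / 2" and "c2 = (of_real A + \<i> * of_real B) / (2::complex)"
    let ?ep = "\<lambda>s. exp (\<i> * \<kappa> * of_real s)" and ?em = "\<lambda>s. exp (- \<i> * \<kappa> * of_real s)"
    have e: "?ep s = cis (Re \<kappa> * s)" "?em s = cis (- (Re \<kappa> * s))" for s
      by (subst k, simp add: cis_conv_exp mult.assoc)+
    have tr: "c1 * ?ep s + c2 * ?em s = of_real (A * cos (Re \<kappa> * s) + B * sin (Re \<kappa> * s))" for s
      unfolding e by (simp add: c1_def c2_def complex_eq_iff) (simp add: field_simps)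
    note cY = periodicD(1)[OF Yq_periodic[OF g]]
    define W where "W = (\<lambda>s. c1 * (?ep s * Yq g s) + c2 * (?em s * Yq g s) + of_real (a0 g) * (c1 * ?ep s + c2 * ?em s))"
    have cW: "continuous_on UNIV W" unfolding W_def by (intro continuous_intros cY)
    have "ell f s \<bullet> Linv g s = Re (W s) + ?l * Re (Sop T 0 (bq g) s)" for s
    proof -
      have "W s = of_real (A * cos (Re \<kappa> * s) + B * sin (Re \<kappa> * s)) * (Yq g s + of_real (a0 g))"
        unfolding W_def tr[symmetric] by (simp add: algebra_simps)
      then show ?thesis unfolding AB by (simp add: Linv_def inner_complex_def)
    qed
    then have "ip T (ell f) (Linv g) = ravg T (\<lambda>s. Re (W s)) + ravg T (\<lambda>s. ?l * Re (Sop T 0 (bq g) s))"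
      unfolding ip_def by (simp only:) (intro ravg_add continuous_intros cW cS)
    also have "ravg T (\<lambda>s. Re (W s)) = Re (avg T W)" by (rule ravg_Re[OF cW T0])
    also have "avg T W = c1 * avg T (\<lambda>s. ?ep s * Yq g s) + c2 * avg T (\<lambda>s. ?em s * Yq g s) + of_real (a0 g) * (c1 * avg T ?ep + c2 * avg T ?em)"
      unfolding W_def by (subst avg_add avg_cmul; (intro continuous_intros cY)?)+ simp
    also have "avg T (\<lambda>s. ?ep s * Yq g s) = 0" using Yq_pc0(2)[OF g True] by (simp add: pc_def)
    also have "avg T (\<lambda>s. ?em s * Yq g s) = 0" using Yq_pc0(1)[OF g True] by (simp add: pc_def)
    also have "avg T ?ep = 0" using k0 r(1) by (intro avg_exp0) auto
    also have "avg T ?em = 0" using k0 r(2) by (intro avg_exp0) auto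
    finally show ?thesis using two by simp
  qed
qed

end

section \<open>The central force and its Taylor expansion\<close>

definition Fc :: "real \<Rightarrow> complex \<Rightarrow> complex" where
  "Fc \<mu> y = - (y * of_real (((norm y)\<^sup>2) powr (- \<mu>)))"

text \<open>The force at \<open>1 + z\<close>, in the rotating frame, minus its linearization at the
  circular orbit: what is left is quadratic in \<open>z\<close>.\<close>

definition Psi :: "real \<Rightarrow> complex \<Rightarrow> complex" where
  "Psi \<mu> z = Fc \<mu> (1 + z) + 1 + z - of_real (2 * \<mu> * Re z)"

text \<open>The force function in terms of the squared distance, so that the gradient of
  \<open>psi\<close> is \<open>Fc\<close>; the logarithm occurs for \<alpha> = 1.\<close>

definition pot :: "real \<Rightarrow> real \<Rightarrow> real" where
  "pot \<mu> \<rho> = (if \<mu> = 1 then - ln \<rho> / 2 else \<rho> powr (1 - \<mu>) / (2 * (\<mu> - 1)))"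

definition psi :: "real \<Rightarrow> complex \<Rightarrow> real" where
  "psi \<mu> y = pot \<mu> ((norm y)\<^sup>2)"

lemma Fc_rot: "norm u = 1 \<Longrightarrow> Fc \<mu> (u * y) = u * Fc \<mu> y"
  by (simp add: Fc_def norm_mult)

lemma psi_rot: "norm u = 1 \<Longrightarrow> psi \<mu> (u * y) = psi \<mu> y"
  by (simp add: psi_def norm_mult)

lemma pot_deriv: "\<rho> > 0 \<Longrightarrow> (pot \<mu> has_real_derivative (- (\<rho> powr (- \<mu>)) / 2)) (at \<rho>)"
proof (cases "\<mu> = 1")
  case True
  assume "\<rho> > 0"
  then have "((\<lambda>\<rho>. - ln \<rho> / 2) has_real_derivative (- (\<rho> powr (- \<mu>)) / 2)) (at \<rho>)"
    using True by (auto intro!: derivative_eq_intros simp: powr_minus_divide)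
  then show ?thesis using True by (simp add: pot_def[abs_def])
next
  case False
  assume r: "\<rho> > 0"
  have "((\<lambda>\<rho>. \<rho> powr (1 - \<mu>) / (2 * (\<mu> - 1))) has_real_derivative ((1 - \<mu>) * \<rho> powr (1 - \<mu> - 1) / (2 * (\<mu> - 1)))) (at \<rho>)"
    using r by (intro DERIV_cdivide has_real_derivative_powr)
  moreover have "(1 - \<mu>) * \<rho> powr (1 - \<mu> - 1) / (2 * (\<mu> - 1)) = - (\<rho> powr (- \<mu>)) / 2"
    using False by (simp add: field_simps)
  ultimately show ?thesis using False by (simp add: pot_def[abs_def])
qed

section \<open>Remainders of the binomial series\<close>

definition Rm :: "nat \<Rightarrow> real \<Rightarrow> real \<Rightarrow> real" where
  "Rm k \<mu> \<tau> = (1 + \<tau>) powr (- \<mu>) - (\<Sum>i<k. (- \<mu> gchoose i) * \<tau> ^ i)"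

text \<open>The absorption identity for binomial coefficients: differentiation lowers the order of
  the remainder by one and raises \<mu> by one.\<close>

lemma Rm_deriv:
  assumes "\<bar>\<tau>\<bar> \<le> 3/4"
  shows "(Rm (Suc k) \<mu> has_real_derivative (- \<mu> * Rm k (\<mu> + 1) \<tau>)) (at \<tau>)"
proof -
  have p: "((\<lambda>\<tau>. (1 + \<tau>) powr (- \<mu>)) has_real_derivative (- \<mu> * (1 + \<tau>) powr (- \<mu> - 1))) (at \<tau>)"
    using assms by (auto intro!: derivative_eq_intros)
  have q: "((\<lambda>\<tau>. \<Sum>i<Suc k. (- \<mu> gchoose i) * \<tau> ^ i) has_real_derivative (\<Sum>i<Suc k. (- \<mu> gchoose i) * (of_nat i * \<tau> ^ (i - 1)))) (at \<tau>)"
    by (rule derivative_eq_intros refl)+ (simp add: mult_ac del: sum.lessThan_Suc)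
  have "(\<Sum>i<Suc k. (- \<mu> gchoose i) * (of_nat i * \<tau> ^ (i - 1))) = (\<Sum>i<k. (- \<mu> gchoose Suc i) * (of_nat (Suc i) * \<tau> ^ i))"
    by (subst sum.lessThan_Suc_shift) simp
  also have "\<dots> = (\<Sum>i<k. - \<mu> * ((- (\<mu> + 1) gchoose i) * \<tau> ^ i))"
  proof (rule sum.cong[OF refl])
    fix i
    have *: "of_nat (Suc i) * (- \<mu> gchoose Suc i) = - \<mu> * (- (\<mu> + 1) gchoose i)"
      using gbinomial_absorption[of i "- \<mu>"] by simp
    show "(- \<mu> gchoose Suc i) * (of_nat (Suc i) * \<tau> ^ i) = - \<mu> * ((- (\<mu> + 1) gchoose i) * \<tau> ^ i)"
      using arg_cong[OF *, of "\<lambda>x. x * \<tau> ^ i"] by (simp only: mult_ac)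
  qed
  also have "\<dots> = - \<mu> * (\<Sum>i<k. (- (\<mu> + 1) gchoose i) * \<tau> ^ i)" by (rule sum_distrib_left[symmetric])
  finally have s: "(\<Sum>i<Suc k. (- \<mu> gchoose i) * (of_nat i * \<tau> ^ (i - 1))) = - \<mu> * (\<Sum>i<k. (- (\<mu> + 1) gchoose i) * \<tau> ^ i)" .
  have "- \<mu> * (1 + \<tau>) powr (- \<mu> - 1) - (\<Sum>i<Suc k. (- \<mu> gchoose i) * (of_nat i * \<tau> ^ (i - 1))) = - \<mu> * Rm k (\<mu> + 1) \<tau>"
  proof -
    have e: "- (\<mu> + 1) = - \<mu> - 1" by simp
    show ?thesis unfolding s Rm_def e right_diff_distrib by simp
  qed
  then show ?thesis using DERIV_diff[OF p q] by (simp add: Rm_def[abs_def] del: sum.lessThan_Suc)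
qed

lemma Rm_0: "Rm (Suc k) \<mu> 0 = 0"
  unfolding Rm_def by (subst sum.lessThan_Suc_shift) (simp add: sum.neutral)

text \<open>Induction on the order, bounding the derivative by the previous case; \<mu> has to be
  general because it moves. The range 3/4 keeps \<open>1 + \<tau>\<close> at least 1/4 and is the
  range of \<open>tq\<close> on the disc of radius 1/4.\<close>

lemma Rm_bound: "\<mu> \<ge> 0 \<Longrightarrow> \<exists>C\<ge>0. \<forall>\<tau>. \<bar>\<tau>\<bar> \<le> 3/4 \<longrightarrow> \<bar>Rm k \<mu> \<tau>\<bar> \<le> C * \<bar>\<tau>\<bar> ^ k"
proof (induction k arbitrary: \<mu>)
  case 0
  have "\<bar>(1 + \<tau>) powr (- \<mu>)\<bar> \<le> 4 powr \<mu>" if "\<bar>\<tau>\<bar> \<le> 3/4" for \<tau> :: real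
  proof -
    have "(1 + \<tau>) powr (- \<mu>) \<le> (1/4) powr (- \<mu>)"
      using that 0 by (intro powr_mono2') auto
    also have "(1/4) powr (- \<mu>) = 4 powr \<mu>" by (simp add: powr_minus_divide powr_divide)
    finally show ?thesis by simp
  qed
  then show ?case by (intro exI[of _ "4 powr \<mu>"]) (auto simp: Rm_def)
next
  case (Suc k)
  obtain C where C: "C \<ge> 0" "\<And>\<tau>. \<bar>\<tau>\<bar> \<le> 3/4 \<Longrightarrow> \<bar>Rm k (\<mu> + 1) \<tau>\<bar> \<le> C * \<bar>\<tau>\<bar> ^ k"
    using Suc.IH[of "\<mu> + 1"] Suc.prems by auto
  have "\<bar>Rm (Suc k) \<mu> \<tau>\<bar> \<le> (\<mu> * C) * \<bar>\<tau>\<bar> ^ Suc k" if t: "\<bar>\<tau>\<bar> \<le> 3/4" for \<tau>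
  proof -
    have "norm (Rm (Suc k) \<mu> \<tau> - Rm (Suc k) \<mu> 0) \<le> (\<mu> * (C * \<bar>\<tau>\<bar> ^ k)) * norm (\<tau> - 0)"
    proof (rule field_differentiable_bound)
      show "convex (cball (0::real) \<bar>\<tau>\<bar>)" by (rule convex_cball)
      fix x assume "x \<in> cball (0::real) \<bar>\<tau>\<bar>"
      then have x: "\<bar>x\<bar> \<le> \<bar>\<tau>\<bar>" by simp
      show "(Rm (Suc k) \<mu> has_field_derivative - \<mu> * Rm k (\<mu> + 1) x) (at x within cball 0 \<bar>\<tau>\<bar>)"
        by (rule has_field_derivative_at_within[OF Rm_deriv]) (use x t in linarith)
      have "\<bar>Rm k (\<mu> + 1) x\<bar> \<le> C * \<bar>x\<bar> ^ k" using C(2)[of x] x t by linarith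
      also have "\<dots> \<le> C * \<bar>\<tau>\<bar> ^ k" using x C(1) by (intro mult_left_mono power_mono) auto
      finally show "norm (- \<mu> * Rm k (\<mu> + 1) x) \<le> \<mu> * (C * \<bar>\<tau>\<bar> ^ k)"
        using Suc.prems by (simp add: abs_mult mult_left_mono)
    qed auto
    then show ?thesis by (simp add: Rm_0 mult_ac)
  qed
  then show ?case using Suc.prems C(1) by (intro exI[of _ "\<mu> * C"]) auto
qed

lemma Rm2_lipschitz:
  assumes "\<mu> \<ge> 0"
  shows "\<exists>C\<ge>0. \<forall>\<tau> \<sigma> B. \<bar>\<tau>\<bar> \<le> B \<longrightarrow> \<bar>\<sigma>\<bar> \<le> B \<longrightarrow> B \<le> 3/4 \<longrightarrow> \<bar>Rm 2 \<mu> \<tau> - Rm 2 \<mu> \<sigma>\<bar> \<le> C * B * \<bar>\<tau> - \<sigma>\<bar>"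
proof -
  obtain C where C: "C \<ge> 0" "\<And>\<tau>. \<bar>\<tau>\<bar> \<le> 3/4 \<Longrightarrow> \<bar>Rm 1 (\<mu> + 1) \<tau>\<bar> \<le> C * \<bar>\<tau>\<bar>"
    using Rm_bound[of "\<mu> + 1" 1] assms by auto
  have "\<bar>Rm 2 \<mu> \<tau> - Rm 2 \<mu> \<sigma>\<bar> \<le> (\<mu> * C) * B * \<bar>\<tau> - \<sigma>\<bar>" if b: "\<bar>\<tau>\<bar> \<le> B" "\<bar>\<sigma>\<bar> \<le> B" "B \<le> 3/4" for \<tau> \<sigma> B
  proof -
    have "norm (Rm 2 \<mu> \<tau> - Rm 2 \<mu> \<sigma>) \<le> (\<mu> * (C * B)) * norm (\<tau> - \<sigma>)"
    proof (rule field_differentiable_bound)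
      show "convex (cball (0::real) B)" by (rule convex_cball)
      fix x assume "x \<in> cball (0::real) B"
      then have x: "\<bar>x\<bar> \<le> B" by simp
      show "(Rm 2 \<mu> has_field_derivative - \<mu> * Rm 1 (\<mu> + 1) x) (at x within cball 0 B)"
      proof -
        have "\<bar>x\<bar> \<le> 3/4" using x b by linarith
        from has_field_derivative_at_within[OF Rm_deriv[OF this, of 1 \<mu>]] show ?thesis
          by (simp add: numeral_2_eq_2)
      qed
      have "\<bar>Rm 1 (\<mu> + 1) x\<bar> \<le> C * \<bar>x\<bar>" using C(2)[of x] x b by linarith
      also have "\<dots> \<le> C * B" using x C(1) by (intro mult_left_mono) auto
      finally show "norm (- \<mu> * Rm 1 (\<mu> + 1) x) \<le> \<mu> * (C * B)"
        using assms by (simp add: abs_mult mult_left_mono)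
    qed (use b in auto)
    then show ?thesis by (simp add: mult_ac)
  qed
  then show ?thesis using assms C(1) by (intro exI[of _ "\<mu> * C"]) auto
qed

definition tq :: "complex \<Rightarrow> real" where "tq z = 2 * Re z + (norm z)\<^sup>2"

lemma tq_eq: "(norm (1 + z))\<^sup>2 = 1 + tq z"
  unfolding tq_def cmod_power2 by (simp add: power2_eq_square algebra_simps)

lemma sq_le_quarter:
  assumes "0 \<le> n" "n \<le> 1/4" shows "n\<^sup>2 \<le> n / (4::real)"
  using mult_left_mono[OF assms(2,1)] by (simp add: power2_eq_square)

lemma tq_bound: "norm z \<le> 1/4 \<Longrightarrow> \<bar>tq z\<bar> \<le> 3 * norm z" "norm z \<le> 1/4 \<Longrightarrow> \<bar>tq z\<bar> \<le> 3/4"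
proof -
  assume a: "norm z \<le> 1/4"
  show "\<bar>tq z\<bar> \<le> 3 * norm z"
    using abs_Re_le_cmod[of z] sq_le_quarter[OF norm_ge_zero a] zero_le_power2[of "norm z"] norm_ge_zero[of z] unfolding tq_def by linarith
  then show "\<bar>tq z\<bar> \<le> 3/4" using a by linarith
qed

lemma nsq_diff: "\<bar>(norm z)\<^sup>2 - (norm w)\<^sup>2\<bar> \<le> (norm z + norm w) * norm (z - w)" for z w :: complex
proof -
  have "(norm z)\<^sup>2 - (norm w)\<^sup>2 = (norm z + norm w) * (norm z - norm w)" by (simp add: power2_eq_square algebra_simps)
  then show ?thesis using norm_triangle_ineq3[of z w] by (simp add: abs_mult mult_left_mono)
qed

text \<open>The linear part of \<open>tq\<close> cancels against the linearization, which leaves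
  explicit terms of degree two and three and a remainder of second order.\<close>

lemma Psi_form:
  "Psi \<mu> z = of_real (\<mu> * (norm z)\<^sup>2) + of_real (2 * \<mu> * Re z) * z + of_real (\<mu> * (norm z)\<^sup>2) * z
     - (1 + z) * of_real (Rm 2 \<mu> (tq z))"
proof -
  have R: "(1 + tq z) powr (- \<mu>) = 1 - \<mu> * tq z + Rm 2 \<mu> (tq z)"
    by (simp add: Rm_def numeral_2_eq_2)
  show ?thesis unfolding Psi_def Fc_def tq_eq R
    by (simp add: tq_def algebra_simps)
qed

text \<open>The factor \<open>norm z + norm w\<close> records that \<open>Psi\<close> has no linear
  part; on a disc of radius of order \<epsilon> it turns into a Lipschitz constant of order
  \<epsilon>.\<close>

lemma Psi_lipschitz:
  assumes "\<mu> \<ge> 0"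
  shows "\<exists>C\<ge>0. \<forall>z w. norm z \<le> 1/4 \<longrightarrow> norm w \<le> 1/4 \<longrightarrow> norm (Psi \<mu> z - Psi \<mu> w) \<le> C * (norm z + norm w) * norm (z - w)"
proof -
  obtain C1 where C1: "C1 \<ge> 0" "\<And>\<tau> \<sigma> B. \<bar>\<tau>\<bar> \<le> B \<Longrightarrow> \<bar>\<sigma>\<bar> \<le> B \<Longrightarrow> B \<le> 3/4 \<Longrightarrow> \<bar>Rm 2 \<mu> \<tau> - Rm 2 \<mu> \<sigma>\<bar> \<le> C1 * B * \<bar>\<tau> - \<sigma>\<bar>"
    using Rm2_lipschitz[OF assms] by blast
  have R20: "Rm 2 \<mu> 0 = 0" using Rm_0[of 1 \<mu>] by (simp add: numeral_2_eq_2)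
  \<comment> \<open>The explicit terms of \<open>Psi_form\<close> contribute
    \<open>\<mu> + 2 * \<mu> + \<mu>\<close>; the remainder contributes \<open>9 + 45/4\<close>
    times \<open>C1\<close>, rounded up to 21.\<close>
  define C where "C = 4 * \<mu> + 21 * C1"
  have "norm (Psi \<mu> z - Psi \<mu> w) \<le> C * (norm z + norm w) * norm (z - w)"
    if z: "norm z \<le> 1/4" and w: "norm w \<le> 1/4" for z w
  proof -
    define S D where "S = norm z + norm w" and "D = norm (z - w)"
    have S: "0 \<le> S" "S \<le> 1/2" "norm z \<le> S" "norm w \<le> S" and D: "0 \<le> D" using z w by (auto simp: S_def D_def)
    have n: "\<bar>(norm z)\<^sup>2 - (norm w)\<^sup>2\<bar> \<le> S * D" unfolding S_def D_def by (rule nsq_diff)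
    have a: "\<bar>Re z - Re w\<bar> \<le> D" unfolding D_def using abs_Re_le_cmod[of "z - w"] by simp
    have 1: "norm (of_real (\<mu> * (norm z)\<^sup>2) - complex_of_real (\<mu> * (norm w)\<^sup>2)) \<le> \<mu> * (S * D)"
    proof -
      have "norm (of_real (\<mu> * (norm z)\<^sup>2) - complex_of_real (\<mu> * (norm w)\<^sup>2)) = \<mu> * \<bar>(norm z)\<^sup>2 - (norm w)\<^sup>2\<bar>"
      proof -
        have "of_real (\<mu> * (norm z)\<^sup>2) - complex_of_real (\<mu> * (norm w)\<^sup>2) = complex_of_real (\<mu> * ((norm z)\<^sup>2 - (norm w)\<^sup>2))"
          by (simp add: algebra_simps)
        then show ?thesis using assms by (simp only: norm_of_real abs_mult abs_of_nonneg)
      qed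
      then show ?thesis using n assms by (simp add: mult_left_mono)
    qed
    have 2: "norm (of_real (2 * \<mu> * Re z) * z - of_real (2 * \<mu> * Re w) * w) \<le> 2 * \<mu> * (S * D)"
    proof -
      have e: "of_real (2 * \<mu> * Re z) * z - of_real (2 * \<mu> * Re w) * w = of_real (2 * \<mu>) * (of_real (Re z) * (z - w) + of_real (Re z - Re w) * w)"
        by (simp add: algebra_simps)
      have "norm (of_real (Re z) * (z - w) + of_real (Re z - Re w) * w) \<le> norm z * D + D * norm w"
        using abs_Re_le_cmod[of z] a D
        by (intro norm_triangle_le add_mono) (auto simp: norm_mult D_def simp del: of_real_diff intro!: mult_mono)
      then have "norm (of_real (Re z) * (z - w) + of_real (Re z - Re w) * w) \<le> S * D"
        by (simp add: S_def algebra_simps)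
      then show ?thesis unfolding e norm_mult norm_of_real using assms
        by (simp add: mult_left_mono del: of_real_diff)
    qed
    have 3: "norm (of_real (\<mu> * (norm z)\<^sup>2) * z - of_real (\<mu> * (norm w)\<^sup>2) * w) \<le> \<mu> * (S * D)"
    proof -
      have e: "of_real (\<mu> * (norm z)\<^sup>2) * z - of_real (\<mu> * (norm w)\<^sup>2) * w = of_real \<mu> * (of_real ((norm z)\<^sup>2) * (z - w) + of_real ((norm z)\<^sup>2 - (norm w)\<^sup>2) * w)"
        by (simp add: algebra_simps)
      have "norm (of_real ((norm z)\<^sup>2) * (z - w) + of_real ((norm z)\<^sup>2 - (norm w)\<^sup>2) * w) \<le> (norm z)\<^sup>2 * D + S * D * norm w"
        using n by (intro norm_triangle_le add_mono) (auto simp: norm_mult norm_power D_def mult_right_mono simp del: of_real_diff)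
      also have "\<dots> \<le> S / 4 * D + S * D * (1/4)"
        using sq_le_quarter[OF norm_ge_zero z] S D w z by (intro add_mono mult_right_mono mult_left_mono) auto
      also have "\<dots> \<le> S * D" using S D by (simp add: algebra_simps)
      finally show ?thesis unfolding e using assms by (simp add: norm_mult mult_left_mono)
    qed
    have tz: "\<bar>tq z\<bar> \<le> 3 * max (norm z) (norm w)" "\<bar>tq w\<bar> \<le> 3 * max (norm z) (norm w)" "3 * max (norm z) (norm w) \<le> 3/4"
      using tq_bound(1)[OF z] tq_bound(1)[OF w] z w by auto
    have mS: "max (norm z) (norm w) \<le> S" using S by auto
    have td: "\<bar>tq z - tq w\<bar> \<le> 3 * D"
    proof -
      have "\<bar>2 * a + x - (2 * b + y)\<bar> \<le> 2 * \<bar>a - b\<bar> + \<bar>x - y\<bar>" for a b x y :: real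
        using abs_triangle_ineq[of "2 * (a - b)" "x - y"] unfolding abs_mult by (simp add: algebra_simps)
      then have "\<bar>tq z - tq w\<bar> \<le> 2 * \<bar>Re z - Re w\<bar> + \<bar>(norm z)\<^sup>2 - (norm w)\<^sup>2\<bar>" unfolding tq_def .
      also have "\<dots> \<le> 2 * D + S * D" using a n by (intro add_mono) auto
      also have "S * D \<le> 1 * D" using S D by (intro mult_right_mono) auto
      finally show ?thesis by simp
    qed
    have Rd: "\<bar>Rm 2 \<mu> (tq z) - Rm 2 \<mu> (tq w)\<bar> \<le> 9 * C1 * (S * D)"
    proof -
      have "\<bar>Rm 2 \<mu> (tq z) - Rm 2 \<mu> (tq w)\<bar> \<le> C1 * (3 * max (norm z) (norm w)) * \<bar>tq z - tq w\<bar>" by (rule C1(2)[OF tz])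
      also have "\<dots> \<le> C1 * (3 * S) * (3 * D)"
      proof (rule mult_mono[OF mult_left_mono[OF _ C1(1)] td])
        show "3 * max (norm z) (norm w) \<le> 3 * S" using mS by simp
      qed (use C1(1) S in simp_all)
      finally show ?thesis by (simp add: algebra_simps)
    qed
    have Rz: "\<bar>Rm 2 \<mu> (tq z)\<bar> \<le> 9 * C1 * S"
    proof -
      have "\<bar>Rm 2 \<mu> (tq z) - Rm 2 \<mu> 0\<bar> \<le> C1 * (3/4) * \<bar>tq z - 0\<bar>"
        by (rule C1(2)) (use tq_bound(2)[OF z] in auto)
      also have "\<dots> \<le> C1 * (3/4) * (3 * S)" using tq_bound(1)[OF z] S C1(1) by (intro mult_left_mono) auto
      also have "\<dots> \<le> 9 * C1 * S" using C1(1) S mult_nonneg_nonneg[OF C1(1) S(1)] by (simp add: algebra_simps)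
      finally show ?thesis using R20 by simp
    qed
    have 4: "norm ((1 + z) * of_real (Rm 2 \<mu> (tq z)) - (1 + w) * of_real (Rm 2 \<mu> (tq w))) \<le> 21 * C1 * (S * D)"
    proof -
      have e: "(1 + z) * of_real (Rm 2 \<mu> (tq z)) - (1 + w) * of_real (Rm 2 \<mu> (tq w))
         = (z - w) * of_real (Rm 2 \<mu> (tq z)) + (1 + w) * of_real (Rm 2 \<mu> (tq z) - Rm 2 \<mu> (tq w))"
        by (simp add: algebra_simps)
      have w1: "norm (1 + w) \<le> 5/4" using norm_triangle_ineq[of 1 w] w by simp
      have "norm ((z - w) * of_real (Rm 2 \<mu> (tq z)) + (1 + w) * of_real (Rm 2 \<mu> (tq z) - Rm 2 \<mu> (tq w)))
          \<le> D * (9 * C1 * S) + 5/4 * (9 * C1 * (S * D))"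
      proof (rule norm_triangle_le[OF add_mono])
        show "norm ((z - w) * of_real (Rm 2 \<mu> (tq z))) \<le> D * (9 * C1 * S)"
          using mult_left_mono[OF Rz D] by (simp add: norm_mult D_def)
        show "norm ((1 + w) * of_real (Rm 2 \<mu> (tq z) - Rm 2 \<mu> (tq w))) \<le> 5/4 * (9 * C1 * (S * D))"
          unfolding norm_mult norm_of_real by (rule mult_mono[OF w1 Rd]) auto
      qed
      also have "\<dots> \<le> 21 * C1 * (S * D)" using mult_nonneg_nonneg[OF C1(1) mult_nonneg_nonneg[OF S(1) D]] by (simp add: algebra_simps)
      finally show ?thesis unfolding e .
    qed
    have dec: "Psi \<mu> z - Psi \<mu> w = (of_real (\<mu> * (norm z)\<^sup>2) - complex_of_real (\<mu> * (norm w)\<^sup>2))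
       + (of_real (2 * \<mu> * Re z) * z - of_real (2 * \<mu> * Re w) * w)
       + (of_real (\<mu> * (norm z)\<^sup>2) * z - of_real (\<mu> * (norm w)\<^sup>2) * w)
       - ((1 + z) * of_real (Rm 2 \<mu> (tq z)) - (1 + w) * of_real (Rm 2 \<mu> (tq w)))" (is "_ = ?A + ?B + ?C - ?E")
      unfolding Psi_form by (simp only: algebra_simps)
    have tri: "norm (a + b + c - e) \<le> norm a + norm b + norm c + norm e" for a b c e :: complex
      using norm_triangle_ineq4[of "a + b + c" e] norm_triangle_ineq[of "a + b" c] norm_triangle_ineq[of a b] by linarith
    have "norm (Psi \<mu> z - Psi \<mu> w) \<le> norm ?A + norm ?B + norm ?C + norm ?E" unfolding dec by (rule tri)
    also have "\<dots> \<le> \<mu> * (S * D) + 2 * \<mu> * (S * D) + \<mu> * (S * D) + 21 * C1 * (S * D)"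
      by (intro add_mono 1 2 3 4)
    also have "\<dots> = C * S * D" by (simp add: C_def algebra_simps)
    finally show ?thesis by (simp add: S_def D_def)
  qed
  moreover have "C \<ge> 0" using assms C1 by (simp add: C_def)
  ultimately show ?thesis by blast
qed

lemma Psi_0 [simp]: "Psi \<mu> 0 = 0"
  by (simp add: Psi_def Fc_def)

text \<open>The homogeneous second-degree part of \<open>Psi\<close>, and \<open>Cp\<close> the
  third-degree part, both written in \<open>z\<close> and \<open>cnj z\<close> so that the harmonics
  of an oscillation can be read off.\<close>

definition Qp :: "real \<Rightarrow> complex \<Rightarrow> complex" where
  "Qp \<mu> z = of_real (\<mu> * (1 - \<mu>) / 2) * z\<^sup>2 + of_real (\<mu> * (1 - \<mu>)) * (z * cnj z) - of_real (\<mu> * (\<mu> + 1) / 2) * (cnj z)\<^sup>2"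

definition Cp :: "real \<Rightarrow> complex \<Rightarrow> complex" where
  "Cp \<mu> z = - of_real ((1 - \<mu>) * \<mu> * (\<mu> + 1) / 6) * z ^ 3 - of_real ((1 - \<mu>) * \<mu>\<^sup>2 / 2) * (z\<^sup>2 * cnj z)
     - of_real ((1 - \<mu>) * \<mu> * (\<mu> + 1) / 2) * (z * (cnj z)\<^sup>2) + of_real (\<mu> * (\<mu> + 1) * (\<mu> + 2) / 6) * (cnj z) ^ 3"

text \<open>The expansion of the binomial up to third order in \<open>tq z\<close> contains all
  terms up to degree three in \<open>z\<close>; everything else has degree at least four.\<close>

lemma Psi_taylor:
  assumes "\<mu> \<ge> 0"
  shows "\<exists>C\<ge>0. \<forall>z. norm z \<le> 1/4 \<longrightarrow> norm (Psi \<mu> z - Qp \<mu> z - Cp \<mu> z) \<le> C * norm z ^ 4"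
proof -
  obtain C1 where C1: "C1 \<ge> 0" "\<And>\<tau>. \<bar>\<tau>\<bar> \<le> 3/4 \<Longrightarrow> \<bar>Rm 4 \<mu> \<tau>\<bar> \<le> C1 * \<bar>\<tau>\<bar> ^ 4"
    using Rm_bound[OF assms, of 4] by auto
  define c2 c3 where "c2 = \<mu> * (\<mu> + 1) / 2" and "c3 = \<mu> * (\<mu> + 1) * (\<mu> + 2) / 6"
  have c: "c2 \<ge> 0" "c3 \<ge> 0" using assms by (auto simp: c2_def c3_def)
  define C where "C = 6 * c2 + 46 * c3 + 2 * C1 * 81"
  have R: "(1 + \<tau>) powr (- \<mu>) = 1 - \<mu> * \<tau> + c2 * \<tau>\<^sup>2 - c3 * \<tau> ^ 3 + Rm 4 \<mu> \<tau>" for \<tau>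
    by (simp add: Rm_def eval_nat_numeral gbinomial_Suc c2_def c3_def field_simps prod.atLeast0_lessThan_Suc gbinomial_prod_rev)
  have "norm (Psi \<mu> z - Qp \<mu> z - Cp \<mu> z) \<le> C * norm z ^ 4" if z: "norm z \<le> 1/4" for z
  proof -
    define a n where "a = Re z" and "n = (norm z)\<^sup>2"
    define N where "N = norm z"
    have N: "0 \<le> N" "N \<le> 1/4" using z by (auto simp: N_def)
    have an: "\<bar>a\<bar> \<le> N" "\<bar>n\<bar> = N\<^sup>2" using abs_Re_le_cmod[of z] by (auto simp: a_def n_def N_def)
    \<comment> \<open>\<open>E1\<close> and \<open>z * E2\<close> collect the terms of degree four
      and more that arise from the polynomial part, because \<open>tq z\<close> mixes the degrees
      one and two.\<close>
    define E1 where "E1 = - c2 * n\<^sup>2 + c3 * (12 * a\<^sup>2 * n + 6 * a * n\<^sup>2 + n ^ 3)"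
    define E2 where "E2 = - c2 * (4 * a * n + n\<^sup>2) + c3 * (2 * a + n) ^ 3"
    have zc: "z = Complex a (Im z)" "n = a\<^sup>2 + (Im z)\<^sup>2" by (auto simp: a_def n_def cmod_power2)
    have id: "Psi \<mu> z - Qp \<mu> z - Cp \<mu> z = of_real E1 + z * of_real E2 - (1 + z) * of_real (Rm 4 \<mu> (tq z))"
    proof -
      have P: "Psi \<mu> z = - ((1 + z) * of_real (1 - \<mu> * (2 * a + n) + c2 * (2 * a + n)\<^sup>2 - c3 * (2 * a + n) ^ 3 + Rm 4 \<mu> (tq z))) + 1 + z - of_real (2 * \<mu> * a)"
        unfolding Psi_def Fc_def tq_eq R by (simp add: tq_def a_def n_def)
      have "- ((1 + z) * of_real (1 - \<mu> * (2 * a + n) + c2 * (2 * a + n)\<^sup>2 - c3 * (2 * a + n) ^ 3)) + 1 + z - of_real (2 * \<mu> * a) - Qp \<mu> z - Cp \<mu> z = of_real E1 + z * of_real E2"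
      proof -
        have cz: "of_real a = (z + cnj z) / 2" "of_real n = z * cnj z"
          by (simp add: a_def complex_add_cnj, simp only: n_def complex_norm_square)
        have m: "complex_of_real c2 = of_real \<mu> * (of_real \<mu> + 1) / 2" "complex_of_real c3 = of_real \<mu> * (of_real \<mu> + 1) * (of_real \<mu> + 2) / 6"
          by (simp_all add: c2_def c3_def)
        show ?thesis unfolding Qp_def Cp_def E1_def E2_def
          by (simp add: cz m) (simp add: field_simps power2_eq_square power3_eq_cube)
      qed
      then show ?thesis unfolding P by (simp add: algebra_simps)
    qed
    have p: "N ^ 5 \<le> N ^ 4" "N ^ 6 \<le> N ^ 4" "N ^ 3 \<le> N\<^sup>2" "N ^ 4 \<le> N ^ 3" "0 \<le> N ^ 3" "0 \<le> N ^ 4"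
      using N by (auto intro!: power_decreasing)
    have b1: "\<bar>E1\<bar> \<le> c2 * N ^ 4 + c3 * (19 * N ^ 4)"
    proof -
      have "\<bar>n\<^sup>2\<bar> \<le> N ^ 4" using an by (simp add: power2_abs[symmetric, of n] power_mult[symmetric] del: power2_abs)
      moreover have "\<bar>a\<^sup>2 * n\<bar> \<le> N\<^sup>2 * N\<^sup>2" unfolding abs_mult using an N by (intro mult_mono) (auto simp: abs_le_square_iff[symmetric])
      moreover have "\<bar>a * n\<^sup>2\<bar> \<le> N * N ^ 4" unfolding abs_mult using an N calculation(1) by (intro mult_mono) auto
      moreover have "\<bar>n ^ 3\<bar> \<le> N ^ 6" using an by (simp add: power_abs power_mult[symmetric])
      moreover have "N\<^sup>2 * N\<^sup>2 = N ^ 4" "N * N ^ 4 = N ^ 5" by (simp_all flip: power_add power_Suc)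
      ultimately have "\<bar>n\<^sup>2\<bar> \<le> N ^ 4" "\<bar>12 * a\<^sup>2 * n + 6 * a * n\<^sup>2 + n ^ 3\<bar> \<le> 19 * N ^ 4" using p by linarith+
      then have "\<bar>- c2 * n\<^sup>2\<bar> \<le> c2 * N ^ 4" "\<bar>c3 * (12 * a\<^sup>2 * n + 6 * a * n\<^sup>2 + n ^ 3)\<bar> \<le> c3 * (19 * N ^ 4)"
        using c by (auto simp: abs_mult mult_left_mono)
      then show ?thesis unfolding E1_def by linarith
    qed
    have tb: "\<bar>2 * a + n\<bar> \<le> 3 * N" using tq_bound(1)[OF z] by (simp add: tq_def a_def n_def N_def)
    have b2: "\<bar>E2\<bar> \<le> c2 * (5 * N ^ 3) + c3 * (27 * N ^ 3)"
    proof -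
      have "\<bar>a * n\<bar> \<le> N * N\<^sup>2" unfolding abs_mult using an N by (intro mult_mono) auto
      moreover have "\<bar>n\<^sup>2\<bar> \<le> N ^ 4" using an by (simp add: power2_abs[symmetric, of n] power_mult[symmetric] del: power2_abs)
      moreover have "N * N\<^sup>2 = N ^ 3" by (simp add: eval_nat_numeral)
      ultimately have 1: "\<bar>4 * a * n + n\<^sup>2\<bar> \<le> 5 * N ^ 3" using p by linarith
      have "\<bar>(2 * a + n) ^ 3\<bar> \<le> (3 * N) ^ 3" unfolding power_abs using tb by (intro power_mono) auto
      then have 2: "\<bar>(2 * a + n) ^ 3\<bar> \<le> 27 * N ^ 3" by (simp add: power_mult_distrib)
      have "\<bar>- c2 * (4 * a * n + n\<^sup>2)\<bar> \<le> c2 * (5 * N ^ 3)" "\<bar>c3 * (2 * a + n) ^ 3\<bar> \<le> c3 * (27 * N ^ 3)"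
        using c 1 2 by (auto simp: abs_mult mult_left_mono)
      then show ?thesis unfolding E2_def by linarith
    qed
    have b3: "\<bar>Rm 4 \<mu> (tq z)\<bar> \<le> C1 * (81 * N ^ 4)"
    proof -
      have "\<bar>tq z\<bar> ^ 4 \<le> (3 * N) ^ 4" using tq_bound(1)[OF z] by (intro power_mono) (auto simp: N_def)
      then show ?thesis using C1(2)[OF tq_bound(2)[OF z]] C1(1) by (simp add: power_mult_distrib) (meson mult_left_mono order_trans)
    qed
    have "norm (Psi \<mu> z - Qp \<mu> z - Cp \<mu> z) \<le> \<bar>E1\<bar> + N * \<bar>E2\<bar> + 2 * \<bar>Rm 4 \<mu> (tq z)\<bar>"
    proof -
      have "norm (1 + z) \<le> 2" using norm_triangle_ineq[of 1 z] z by simp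
      then have "norm ((1 + z) * of_real (Rm 4 \<mu> (tq z))) \<le> 2 * \<bar>Rm 4 \<mu> (tq z)\<bar>"
        by (simp add: norm_mult mult_right_mono)
      moreover have "norm (of_real E1 + z * of_real E2) \<le> \<bar>E1\<bar> + N * \<bar>E2\<bar>"
        by (rule norm_triangle_le) (simp add: norm_mult N_def)
      ultimately show ?thesis unfolding id by (meson norm_triangle_le_diff add_mono)
    qed
    also have "\<dots> \<le> (c2 * N ^ 4 + c3 * (19 * N ^ 4)) + N * (c2 * (5 * N ^ 3) + c3 * (27 * N ^ 3)) + 2 * (C1 * (81 * N ^ 4))"
      using b1 b2 b3 N by (intro add_mono mult_left_mono) auto
    also have "\<dots> = (6 * c2 + 46 * c3 + 2 * C1 * 81) * N ^ 4"
      by (simp add: algebra_simps eval_nat_numeral)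
    finally show ?thesis by (simp add: N_def C_def)
  qed
  moreover have "C \<ge> 0" using c C1 by (simp add: C_def)
  ultimately show ?thesis by blast
qed

lemma Fc_lipschitz:
  assumes "\<mu> \<ge> 0"
  shows "\<exists>C\<ge>0. \<forall>z w. norm z \<le> 1/4 \<longrightarrow> norm w \<le> 1/4 \<longrightarrow> norm (Fc \<mu> (1 + z) - Fc \<mu> (1 + w)) \<le> C * norm (z - w)"
proof -
  obtain C where C: "C \<ge> 0" "\<And>z w. norm z \<le> 1/4 \<Longrightarrow> norm w \<le> 1/4 \<Longrightarrow> norm (Psi \<mu> z - Psi \<mu> w) \<le> C * (norm z + norm w) * norm (z - w)"
    using Psi_lipschitz[OF assms] by blast
  have "norm (Fc \<mu> (1 + z) - Fc \<mu> (1 + w)) \<le> (C + 1 + 2 * \<mu>) * norm (z - w)"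
    if z: "norm z \<le> 1/4" and w: "norm w \<le> 1/4" for z w
  proof -
    have e: "Fc \<mu> (1 + z) - Fc \<mu> (1 + w) = (Psi \<mu> z - Psi \<mu> w) - (z - w) + of_real (2 * \<mu> * (Re z - Re w))"
      by (simp add: Psi_def algebra_simps)
    have "C * (norm z + norm w) * norm (z - w) \<le> C * 1 * norm (z - w)"
      using C(1) z w by (intro mult_right_mono mult_left_mono) auto
    then have 1: "norm (Psi \<mu> z - Psi \<mu> w) \<le> C * norm (z - w)" using C(2)[OF z w] by simp
    have "\<bar>Re (z - w)\<bar> \<le> norm (z - w)" by (rule abs_Re_le_cmod)
    then have 2: "norm (complex_of_real (2 * \<mu> * (Re z - Re w))) \<le> 2 * \<mu> * norm (z - w)"
      unfolding norm_of_real abs_mult using assms by (auto intro!: mult_left_mono)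
    have "norm (Fc \<mu> (1 + z) - Fc \<mu> (1 + w)) \<le> norm (Psi \<mu> z - Psi \<mu> w) + norm (z - w) + norm (complex_of_real (2 * \<mu> * (Re z - Re w)))"
      unfolding e by (meson add_right_mono norm_triangle_le norm_triangle_ineq4)
    then show ?thesis using 1 2 by (simp add: algebra_simps)
  qed
  then show ?thesis using C(1) assms by (intro exI[of _ "C + 1 + 2 * \<mu>"]) auto
qed

text \<open>Mean value theorem along the segment, which stays in the disc by convexity, combined
  with the Lipschitz bound on the gradient \<open>Fc\<close>.\<close>

lemma psi_taylor:
  assumes "\<mu> \<ge> 0"
  shows "\<exists>C\<ge>0. \<forall>z w. norm z \<le> 1/4 \<longrightarrow> norm w \<le> 1/4 \<longrightarrow>
     \<bar>psi \<mu> (1 + w) - psi \<mu> (1 + z) - Fc \<mu> (1 + z) \<bullet> (w - z)\<bar> \<le> C * (norm (w - z))\<^sup>2"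
proof -
  obtain C where C: "C \<ge> 0" "\<And>z w. norm z \<le> 1/4 \<Longrightarrow> norm w \<le> 1/4 \<Longrightarrow> norm (Fc \<mu> (1 + z) - Fc \<mu> (1 + w)) \<le> C * norm (z - w)"
    using Fc_lipschitz[OF assms] by blast
  have "\<bar>psi \<mu> (1 + w) - psi \<mu> (1 + z) - Fc \<mu> (1 + z) \<bullet> (w - z)\<bar> \<le> C * (norm (w - z))\<^sup>2"
    if z: "norm z \<le> 1/4" and w: "norm w \<le> 1/4" for z w
  proof -
    define g where "g = (\<lambda>t. psi \<mu> (1 + (z + t *\<^sub>R (w - z))))"
    have seg: "norm (z + t *\<^sub>R (w - z)) \<le> 1/4" if "0 \<le> t" "t \<le> 1" for t
    proof -
      have "z + t *\<^sub>R (w - z) = (1 - t) *\<^sub>R z + t *\<^sub>R w" by (simp add: algebra_simps)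
      then show ?thesis using convexD[OF convex_cball[of "0::complex" "1/4"], of z w "1 - t" t] z w that by simp
    qed
    have dg: "(g has_real_derivative (Fc \<mu> (1 + (z + t *\<^sub>R (w - z))) \<bullet> (w - z))) (at t)" if "0 \<le> t" "t \<le> 1" for t
    proof -
      define y where "y = 1 + (z + t *\<^sub>R (w - z))"
      have "norm y > 0" using norm_diff_ineq[of 1 "z + t *\<^sub>R (w - z)"] seg[OF that] unfolding y_def norm_one by linarith
      then have y: "(norm y)\<^sup>2 > 0" by simp
      have n: "((\<lambda>t. (norm (1 + (z + t *\<^sub>R (w - z))))\<^sup>2) has_real_derivative (2 * (y \<bullet> (w - z)))) (at t)"
        unfolding power2_norm_eq_inner y_def has_real_derivative_iff_has_vector_derivative
      proof -
        have d: "((\<lambda>t. 1 + (z + t *\<^sub>R (w - z))) has_vector_derivative (w - z)) (at t)"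
          by (auto intro!: derivative_eq_intros)
        show "((\<lambda>t. (1 + (z + t *\<^sub>R (w - z))) \<bullet> (1 + (z + t *\<^sub>R (w - z)))) has_vector_derivative 2 * ((1 + (z + t *\<^sub>R (w - z))) \<bullet> (w - z))) (at t)"
          using bounded_bilinear.has_vector_derivative[OF bounded_bilinear_inner d d] by (simp add: inner_commute)
      qed
      have "((pot \<mu> \<circ> (\<lambda>t. (norm (1 + (z + t *\<^sub>R (w - z))))\<^sup>2)) has_real_derivative (- (((norm y)\<^sup>2) powr (- \<mu>)) / 2 * (2 * (y \<bullet> (w - z))))) (at t)"
        using pot_deriv[OF y, of \<mu>] by (intro DERIV_chain n) (simp add: y_def)
      moreover have "- (((norm y)\<^sup>2) powr (- \<mu>)) / 2 * (2 * (y \<bullet> (w - z))) = Fc \<mu> y \<bullet> (w - z)"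
        by (simp add: Fc_def inner_complex_def algebra_simps)
      ultimately show ?thesis by (simp add: g_def psi_def[abs_def] o_def y_def)
    qed
    obtain t where t: "0 < t" "t < 1" "g 1 - g 0 = (1 - 0) * (Fc \<mu> (1 + (z + t *\<^sub>R (w - z))) \<bullet> (w - z))"
      using MVT2[of 0 1 g "\<lambda>t. Fc \<mu> (1 + (z + t *\<^sub>R (w - z))) \<bullet> (w - z)"] dg by auto
    have "psi \<mu> (1 + w) - psi \<mu> (1 + z) - Fc \<mu> (1 + z) \<bullet> (w - z) = (Fc \<mu> (1 + (z + t *\<^sub>R (w - z))) - Fc \<mu> (1 + z)) \<bullet> (w - z)"
      using t(3) by (simp add: g_def inner_diff_left)
    also have "\<bar>\<dots>\<bar> \<le> norm (Fc \<mu> (1 + (z + t *\<^sub>R (w - z))) - Fc \<mu> (1 + z)) * norm (w - z)"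
      by (rule Cauchy_Schwarz_ineq2)
    also have "\<dots> \<le> (C * norm (t *\<^sub>R (w - z))) * norm (w - z)"
      using C(2)[OF seg[of t] z] t by (intro mult_right_mono) auto
    also have "\<dots> \<le> (C * norm (w - z)) * norm (w - z)"
      using t C(1) by (intro mult_right_mono mult_left_mono) (auto simp: mult_left_le_one_le)
    finally show ?thesis by (simp add: power2_eq_square mult.assoc)
  qed
  then show ?thesis using C(1) by blast
qed

section \<open>Fixed points in the supremum norm\<close>

text \<open>Banach's theorem on the bounded continuous functions that are \<open>T\<close>-periodic
  and bounded by \<delta>: both conditions are pointwise and hence survive uniform limits.\<close>

lemma periodic_fixpoint:
  assumes \<delta>: "0 \<le> \<delta>"
    and self: "\<And>x. x \<in> periodic T \<Longrightarrow> (\<forall>s. norm (x s) \<le> \<delta>) \<Longrightarrow> \<Phi> x \<in> periodic T \<and> (\<forall>s. norm (\<Phi> x s) \<le> \<delta>)"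
    and lip: "\<And>x y B. x \<in> periodic T \<Longrightarrow> y \<in> periodic T \<Longrightarrow> (\<forall>s. norm (x s) \<le> \<delta>) \<Longrightarrow> (\<forall>s. norm (y s) \<le> \<delta>) \<Longrightarrow>
      (\<forall>s. norm (x s - y s) \<le> B) \<Longrightarrow> (\<forall>s. norm (\<Phi> x s - \<Phi> y s) \<le> B / 2)"
  shows "\<exists>x\<in>periodic T. (\<forall>s. norm (x s) \<le> \<delta>) \<and> \<Phi> x = x"
proof -
  define S where "S = {X :: real \<Rightarrow>\<^sub>C complex. (\<forall>s. X (s + T) = X s) \<and> (\<forall>s. norm (X s) \<le> \<delta>)}"
  have SD: "apply_bcontfun X \<in> periodic T" "norm (X s) \<le> \<delta>" if "X \<in> S" for X s
    using that by (auto simp: S_def periodic_def)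
  have b: "\<Phi> X \<in> bcontfun" if "X \<in> S" for X :: "real \<Rightarrow>\<^sub>C complex"
    using self[OF SD(1)[OF that]] SD(2)[OF that] unfolding bcontfun_def periodic_def bounded_iff by blast
  define F where "F X = Bcontfun (\<Phi> (apply_bcontfun X))" for X
  have F: "apply_bcontfun (F X) = \<Phi> X" if "X \<in> S" for X
    unfolding F_def by (rule Bcontfun_inverse[OF b[OF that]])
  have "closed S" unfolding closed_sequential_limits
  proof (intro allI impI, elim conjE)
    fix X :: "nat \<Rightarrow> real \<Rightarrow>\<^sub>C complex" and L assume X: "\<forall>n. X n \<in> S" "X \<longlonglongrightarrow> L"
    have lim: "(\<lambda>n. X n s) \<longlonglongrightarrow> L s" for s
      using tendsto_bcontfun_uniform_limit[OF X(2)] by (rule tendsto_uniform_limitI) simp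
    have "L (s + T) = L s" for s
      using lim[of "s + T"] lim[of s] X(1) unfolding S_def by (auto intro: LIMSEQ_unique)
    moreover have "norm (L s) \<le> \<delta>" for s
      using X(1) by (intro Lim_bounded[OF tendsto_norm[OF lim], of 0]) (auto simp: S_def)
    ultimately show "L \<in> S" by (simp add: S_def)
  qed
  then have "complete S" by (simp add: complete_eq_closed)
  moreover have "const_bcontfun 0 \<in> S" using \<delta> by (simp add: S_def const_bcontfun.rep_eq)
  then have "S \<noteq> {}" by blast
  moreover have "F ` S \<subseteq> S"
  proof (rule image_subsetI)
    fix X assume X: "X \<in> S"
    have "\<Phi> X \<in> periodic T \<and> (\<forall>s. norm (\<Phi> X s) \<le> \<delta>)"
      by (rule self[OF SD(1)[OF X]]) (use SD(2)[OF X] in blast)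
    then show "F X \<in> S" unfolding S_def mem_Collect_eq F[OF X] periodic_def by blast
  qed
  moreover have "dist (F X) (F Y) \<le> 1/2 * dist X Y" if "X \<in> S" "Y \<in> S" for X Y
  proof (rule dist_bound)
    fix s
    have "\<forall>s. norm (X s - Y s) \<le> dist X Y" using dist_bounded[of X _ Y] by (simp add: dist_norm)
    then show "dist (F X s) (F Y s) \<le> 1/2 * dist X Y"
      using lip[OF SD(1)[OF that(1)] SD(1)[OF that(2)], of "dist X Y"] SD(2)[OF that(1)] SD(2)[OF that(2)]
      unfolding F[OF that(1)] F[OF that(2)] dist_norm[of "\<Phi> X s"] by simp
  qed
  ultimately obtain X where X: "X \<in> S" "F X = X"
    using Banach_fix[of S "1/2" F] by auto
  then show ?thesis using SD[OF X(1)] F[OF X(1)] by (intro bexI[of _ "apply_bcontfun X"]) auto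
qed

text \<open>Applied with \<open>B\<close> the supremum itself. Comparing two fixed points this way
  gives Lipschitz dependence on parameters whatever fixed points were selected.\<close>

lemma halving_sup_bound:
  fixes x :: "real \<Rightarrow> complex"
  assumes "\<And>s. norm (x s) \<le> B0" and "\<And>B. (\<forall>s. norm (x s) \<le> B) \<Longrightarrow> (\<forall>s. norm (x s) \<le> B / 2 + D)"
  shows "norm (x s) \<le> 2 * D"
proof -
  define B where "B = (SUP s. norm (x s))"
  have bdd: "bdd_above (range (\<lambda>s. norm (x s)))" using assms(1) by (auto intro!: bdd_aboveI)
  have le: "norm (x s) \<le> B" for s unfolding B_def by (rule cSUP_upper[OF _ bdd]) simp
  then have "norm (x s) \<le> B / 2 + D" for s using assms(2) by blast
  then have "B \<le> B / 2 + D" unfolding B_def by (intro cSUP_least) (auto simp: B_def)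
  then show ?thesis using le[of s] by linarith
qed

text \<open>In contrast to \<open>Lsol\<close>, this equation in the rotating frame, \<open>y'' + 2 * \<i> * y' = y + g\<close>, is invariant under rotations of the plane.\<close>

definition rot_sol :: "real \<Rightarrow> (real \<Rightarrow> complex) \<Rightarrow> (real \<Rightarrow> complex) \<Rightarrow> bool" where
  "rot_sol \<mu> y g \<longleftrightarrow> Lsol \<mu> y (\<lambda>s. g s + y s - of_real (2 * \<mu> * Re (y s)))"

text \<open>Unlike the linearization, the equation is complex linear, so a constant factor passes
  through it. This allows solutions with different phases to be compared in one frame.\<close>

lemma rot_sol_rotate:
  assumes "Lsol \<mu> x f"
  shows "rot_sol \<mu> (\<lambda>s. u * (1 + x s)) (\<lambda>s. u * (f s + of_real (2 * \<mu> * Re (x s)) - (1 + x s)))"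
proof -
  obtain x' where x: "\<And>s. (x has_vector_derivative x' s) (at s)"
     "\<And>s. (x' has_vector_derivative (f s - 2 * \<i> * x' s + of_real (2 * \<mu> * Re (x s)))) (at s)"
    using assms unfolding Lsol_def by blast
  show ?thesis unfolding rot_sol_def Lsol_def
    by (rule exI[of _ "\<lambda>s. u * x' s"])
       (auto intro!: derivative_eq_intros x simp: algebra_simps)
qed

text \<open>The two forms of the equation differ by a symmetric term without derivatives, so the
  symmetry of \<open>Lsol\<close> carries over.\<close>

lemma rot_sol_symmetric:
  assumes "rot_sol \<mu> y g" "rot_sol \<mu> z k" "y \<in> periodic T" "z \<in> periodic T"
    and c: "continuous_on UNIV g" "continuous_on UNIV k"
  shows "ip T g z = ip T y k"
proof -
  note cy = periodicD(1)[OF assms(3)] and cz = periodicD(1)[OF assms(4)]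
  have "ip T (\<lambda>s. g s + y s - of_real (2 * \<mu> * Re (y s))) z = ip T y (\<lambda>s. k s + z s - of_real (2 * \<mu> * Re (z s)))"
    using assms(1,2) unfolding rot_sol_def
    by (rule Lsol_symmetric) (intro assms continuous_intros cy cz)+
  moreover have "ip T (\<lambda>s. g s + y s - of_real (2 * \<mu> * Re (y s))) z
     = ip T g z + ip T y z - ip T (\<lambda>s. of_real (2 * \<mu> * Re (y s))) z"
    by (subst ip_diff_left ip_add_left; (intro continuous_intros c cy cz)?)+ simp
  moreover have "ip T y (\<lambda>s. k s + z s - of_real (2 * \<mu> * Re (z s)))
     = ip T y k + ip T y z - ip T y (\<lambda>s. of_real (2 * \<mu> * Re (z s)))"
    by (subst ip_diff_right ip_add_right; (intro continuous_intros c cy cz)?)+ simp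
  moreover have "ip T (\<lambda>s. of_real (2 * \<mu> * Re (y s))) z = ip T y (\<lambda>s. of_real (2 * \<mu> * Re (z s)))"
    by (simp add: ip_def inner_complex_def mult_ac)
  ultimately show ?thesis by simp
qed

section \<open>Linearity and size of the unsolved part\<close>

context circ
begin

lemma hq_diff:
  assumes f: "f \<in> periodic T" and g: "g \<in> periodic T"
  shows "hq (\<lambda>s. f s - g s) = (\<lambda>s. hq f s - hq g s)"
proof -
  note c = periodicD(1)[OF f12(2)[OF f]] periodicD(1)[OF f12(2)[OF g]]
  have B: "Bq (\<lambda>s. f s - g s) = (\<lambda>s. Bq f s - Bq g s)"
    using Sop_diff[OF f12(1)[OF f] f12(1)[OF g]] by (auto simp: Bq_def)
  have A: "avg T (\<lambda>s. of_real (Re (f s - g s))) = avg T (\<lambda>s. of_real (Re (f s))) - avg T (\<lambda>s. of_real (Re (g s)))"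
    using avg_diff[OF c] by simp
  show ?thesis unfolding hq_def B A by (auto simp: algebra_simps)
qed

lemma pc_diff:
  assumes f: "f \<in> periodic T" and g: "g \<in> periodic T"
  shows "pc T \<nu> (\<lambda>s. f s - g s) = pc T \<nu> f - pc T \<nu> g"
  unfolding pc_def right_diff_distrib
  by (rule avg_diff) (intro continuous_intros periodicD(1)[OF f] periodicD(1)[OF g])+

lemma ell_diff:
  assumes f: "f \<in> periodic T" and g: "g \<in> periodic T"
  shows "ell (\<lambda>s. f s - g s) s = ell f s - ell g s"
proof -
  have "avg T (\<lambda>s. of_real (Im (f s - g s))) = avg T (\<lambda>s. of_real (Im (f s))) - avg T (\<lambda>s. of_real (Im (g s)))"
    using avg_diff[OF periodicD(1)[OF f12(1)[OF f]] periodicD(1)[OF f12(1)[OF g]]] by simp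
  then show ?thesis
    unfolding ell_def hq_diff[OF f g] pc_diff[OF hq_periodic[OF f] hq_periodic[OF g]]
    by (simp add: complex_eq_iff algebra_simps)
qed

lemma ell_bound: "\<exists>C\<ge>0. \<forall>f\<in>periodic T. \<forall>B. (\<forall>s. norm (f s) \<le> B) \<longrightarrow> (\<forall>s. norm (ell f s) \<le> C * B)"
proof -
  obtain C0 where C0: "C0 \<ge> 0" "\<And>h B s. h \<in> periodic T \<Longrightarrow> (\<And>s. norm (h s) \<le> B) \<Longrightarrow> norm (Sop T 0 h s) \<le> C0 * B"
    using Sop_bound[OF T0, of 0] by blast
  define E where "E = exp (norm \<kappa> * T)"
  have E: "norm (exp (c * \<kappa> * of_real s)) \<le> E" if "norm c = 1" "0 \<le> s" "s \<le> T" for c s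
  proof -
    have "norm (exp (c * \<kappa> * of_real s)) \<le> exp (norm (c * \<kappa> * of_real s))" by (rule norm_exp)
    also have "\<dots> \<le> E" unfolding E_def using that by (auto simp: norm_mult mult_left_mono)
    finally show ?thesis .
  qed
  have E0: "E \<ge> 0" by (simp add: E_def)
  define H where "H = 2 + 2 * C0"
  have H0: "H \<ge> 0" using C0 by (simp add: H_def)
  have "norm (ell f s) \<le> (2 * (E * (E * H)) + 1) * B" if f: "f \<in> periodic T" and B: "\<And>s. norm (f s) \<le> B" for f B s
  proof (rule periodic_reduce[OF ell_periodic[OF f] T0])
    fix s assume s: "0 \<le> s" "s \<le> T"
    have f1: "norm (complex_of_real (Re (f s))) \<le> B" "norm (complex_of_real (Im (f s))) \<le> B" for s
      using B[of s] abs_Re_le_cmod[of "f s"] abs_Im_le_cmod[of "f s"] by auto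
    have B0: "0 \<le> B" using B[of 0] norm_ge_zero order_trans by blast
    have Bq: "norm (Bq f s) \<le> C0 * B" for s unfolding Bq_def by (intro C0 f12 f f1)
    have av: "norm (avg T (\<lambda>s. of_real (Re (f s)))) \<le> B"
      by (rule avg_bound[OF periodicD(1)[OF f12(2)[OF f]] T0 f1(1)])
    have av2: "norm (avg T (\<lambda>s. of_real (Im (f s)))) \<le> B"
      by (rule avg_bound[OF periodicD(1)[OF f12(1)[OF f]] T0 f1(2)])
    have hq: "norm (hq f s) \<le> H * B" for s
    proof -
      have "norm (hq f s) \<le> norm (complex_of_real (Re (f s))) + norm (avg T (\<lambda>s. of_real (Re (f s)))) + norm (2 * Bq f s)"
        unfolding hq_def by (meson norm_triangle_le norm_triangle_ineq4 add_mono order_refl order_trans)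
      then show ?thesis using f1(1)[of s] av Bq[of s] by (simp add: norm_mult H_def algebra_simps)
    qed
    have p: "norm (pc T (c * \<kappa>) (hq f)) \<le> E * (H * B)" if c: "norm c = 1" for c
      unfolding pc_def
    proof (rule avg_bound[OF _ T0])
      show "continuous_on UNIV (\<lambda>s. exp (- (c * \<kappa>) * of_real s) * hq f s)"
        by (intro continuous_intros periodicD(1)[OF hq_periodic[OF f]])
      show "norm (exp (- (c * \<kappa>) * of_real s) * hq f s) \<le> E * (H * B)" if "0 \<le> s" "s \<le> T" for s
        unfolding norm_mult using E[of "- c" s] c that hq E0 by (intro mult_mono) auto
    qed
    have q: "norm (exp (c * \<kappa> * of_real s) * pc T (c * \<kappa>) (hq f)) \<le> E * (E * (H * B))" if "norm c = 1" for c
      unfolding norm_mult[of "exp _"] using E[OF that s] p[OF that] E0 by (intro mult_mono) auto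
    have re: "\<bar>Re (ell f s)\<bar> \<le> 2 * (E * (E * (H * B)))"
    proof (cases res)
      case True
      have "\<bar>Re (ell f s)\<bar> \<le> norm (exp (\<i> * \<kappa> * of_real s) * pc T (\<i> * \<kappa>) (hq f) + exp (- \<i> * \<kappa> * of_real s) * pc T (- \<i> * \<kappa>) (hq f))"
        using True abs_Re_le_cmod by (simp only: ell_def complex.sel if_True)
      also have "\<dots> \<le> norm (exp (\<i> * \<kappa> * of_real s) * pc T (\<i> * \<kappa>) (hq f)) + norm (exp (- \<i> * \<kappa> * of_real s) * pc T (- \<i> * \<kappa>) (hq f))"
        by (rule norm_triangle_ineq)
      also have "\<dots> \<le> E * (E * (H * B)) + E * (E * (H * B))" by (intro add_mono q) auto
      finally show ?thesis by (simp only: mult_2)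
    qed (use E0 H0 B0 in \<open>simp add: ell_def\<close>)
    have im: "\<bar>Im (ell f s)\<bar> \<le> B" using av2 abs_Re_le_cmod[of "avg T (\<lambda>s. of_real (Im (f s)))"] by (simp add: ell_def)
    show "norm (ell f s) \<le> (2 * (E * (E * H)) + 1) * B"
      using cmod_le[of "ell f s"] re im by (simp add: algebra_simps)
  qed
  then show ?thesis using E0 H0 by (intro exI[of _ "2 * (E * (E * H)) + 1"]) auto
qed

end

section \<open>Reduction to finitely many parameters\<close>

text \<open>\<open>d0 j\<close> is the rescaled position of a primary in the rotating frame; \<open>\<rho>\<close> is the radius of the ball of resonant amplitudes,
  which is \<open>0\<close> when there is no resonance.\<close>

locale perturbed_circ = circ +
  fixes n :: nat and m :: "nat \<Rightarrow> real" and d0 :: "nat \<Rightarrow> real \<Rightarrow> complex" and \<epsilon> \<rho> M CG CP :: real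
  assumes m0: "\<And>j. j < n \<Longrightarrow> m j \<ge> 0" and m1: "(\<Sum>j<n. m j) = 1"
    and d0_periodic: "\<And>j. j < n \<Longrightarrow> d0 j \<in> periodic T"
    and d0_sum: "\<And>s. (\<Sum>j<n. of_real (m j) * d0 j s) = 0"
    and d0_bound: "\<And>j s. j < n \<Longrightarrow> norm (d0 j s) \<le> M * \<epsilon>"
    and pos: "0 < \<epsilon>" "0 \<le> \<rho>" "0 \<le> M" "0 \<le> CG" "0 \<le> CP"
    and CG: "\<And>f B s. f \<in> periodic T \<Longrightarrow> (\<And>s. norm (f s) \<le> B) \<Longrightarrow> norm (Linv f s) \<le> CG * B"
    and CP: "\<And>z w. norm z \<le> 1/4 \<Longrightarrow> norm w \<le> 1/4 \<Longrightarrow> norm (Psi \<mu> z - Psi \<mu> w) \<le> CP * (norm z + norm w) * norm (z - w)"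
    and small1: "(1 + M) * \<epsilon> \<le> 1/16"
    and small2: "4 * CG * CP * (1 + M)\<^sup>2 * \<epsilon> \<le> 1"
    and small3: "(1 + 2 / \<bar>Re \<kappa>\<bar>) * \<rho> \<le> \<epsilon> / 2"
    and kre: "res \<Longrightarrow> Im \<kappa> = 0"
begin

section \<open>Kernel oscillations and the contraction\<close>

text \<open>The radial component is a free oscillation of frequency \<kappa>; the tangential one
  integrates \<open>(Im x)' = - 2 * Re x\<close>, whence the factor
  \<open>2 / Re \<kappa>\<close>.\<close>

definition "zeta z = (\<lambda>s. if res then Complex (Re (z * cis (Re \<kappa> * s))) (- (2 / Re \<kappa>) * Im (z * cis (Re \<kappa> * s))) else 0)"

definition "dd \<theta> j = (\<lambda>s. cis (- \<theta>) * d0 j s)"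

text \<open>The whole nonlinear right-hand side: as the masses sum to one and the weighted positions
  to zero, the linear parts of the forces add up to those of a unit mass at the origin. Therefore
  the forcing by the primaries starts at order \<open>\<epsilon>^2\<close>.\<close>

definition "Nf \<theta> x = (\<lambda>s. \<Sum>j<n. of_real (m j) * Psi \<mu> (x s - dd \<theta> j s))"

definition "Zc = 1 + 2 / \<bar>Re \<kappa>\<bar>"

lemma Zc1: "Zc \<ge> 1" by (simp add: Zc_def)

lemma kap_re: "res \<Longrightarrow> (Re \<kappa>)\<^sup>2 = 4 - 2 * \<mu>" "res \<Longrightarrow> Re \<kappa> \<noteq> 0" "res \<Longrightarrow> cis (Re \<kappa> * T) = 1"
proof -
  assume r: res
  have k: "\<kappa> = of_real (Re \<kappa>)" using kre[OF r] by (simp add: complex_eq_iff)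
  have "complex_of_real ((Re \<kappa>)\<^sup>2) = of_real (4 - 2 * \<mu>)" using kap k by simp
  then show "(Re \<kappa>)\<^sup>2 = 4 - 2 * \<mu>" using of_real_eq_iff by blast
  show "Re \<kappa> \<noteq> 0" using r k unfolding res_def by auto
  show "cis (Re \<kappa> * T) = 1" using r k unfolding res_def cis_conv_exp
    by (metis (no_types, lifting) mult.assoc of_real_mult)
qed

lemma zeta_bound: "norm (zeta z s) \<le> Zc * norm z"
proof (cases res)
  case True
  have "norm (zeta z s) \<le> \<bar>Re (zeta z s)\<bar> + \<bar>Im (zeta z s)\<bar>" by (rule cmod_le)
  also have "\<dots> \<le> norm (z * cis (Re \<kappa> * s)) + 2 / \<bar>Re \<kappa>\<bar> * norm (z * cis (Re \<kappa> * s))"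
    using abs_Re_le_cmod[of "z * cis (Re \<kappa> * s)"] abs_Im_le_cmod[of "z * cis (Re \<kappa> * s)"] True
    by (auto simp: zeta_def abs_mult simp del: times_complex.sel intro!: add_mono divide_right_mono)
  also have "\<dots> = Zc * norm z" by (simp add: Zc_def norm_mult algebra_simps)
  finally show ?thesis .
next
  case False then show ?thesis using Zc1 by (simp add: zeta_def)
qed

lemma zeta_diff: "zeta (z - w) s = zeta z s - zeta w s"
  by (auto simp: zeta_def complex_eq_iff algebra_simps)

lemma zeta_scale: "zeta (of_real r * z) s = of_real r * zeta z s"
  by (auto simp: zeta_def complex_eq_iff algebra_simps)

lemma zeta_periodic: "zeta z \<in> periodic T"
proof (cases res)
  case True
  have "cis (Re \<kappa> * (s + T)) = cis (Re \<kappa> * s)" for s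
    using kap_re(3)[OF True] by (simp add: distrib_left flip: cis_mult)
  then show ?thesis using True unfolding zeta_def periodic_def Complex_eq
    by (auto intro!: continuous_intros simp: kap_re(2)[OF True] simp del: times_complex.sel)
qed (auto simp: zeta_def periodic_def)

lemma zeta_Lsol: "Lsol \<mu> (zeta z) (\<lambda>s. 0)"
proof (cases res)
  case True
  define k where "k = Re \<kappa>"
  have k: "k\<^sup>2 = 4 - 2 * \<mu>" "k \<noteq> 0" using kap_re[OF True] by (auto simp: k_def)
  define w where "w = (\<lambda>s. z * cis (k * s))"
  have dw: "((\<lambda>s. Re (w s)) has_real_derivative (- k * Im (w s))) (at s)"
           "((\<lambda>s. Im (w s)) has_real_derivative (k * Re (w s))) (at s)" for s
    unfolding w_def by (auto intro!: derivative_eq_intros simp: algebra_simps)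
  define Z where "Z = (\<lambda>s. complex_of_real (Re (w s)) + \<i> * complex_of_real (- (2 / k) * Im (w s)))"
  have Z: "zeta z = Z" using True by (auto simp: zeta_def Z_def w_def k_def complex_eq_iff)
  define Z' where "Z' = (\<lambda>s. complex_of_real (- k * Im (w s)) + \<i> * complex_of_real (- 2 * Re (w s)))"
  have 1: "(Z has_vector_derivative Z' s) (at s)" for s
    unfolding Z_def Z'_def
    by (rule derivative_eq_intros has_vector_derivative_of_real dw refl)+ (use k in simp)
  have 2: "(Z' has_vector_derivative (complex_of_real (- k * (k * Re (w s))) + \<i> * complex_of_real (- 2 * (- k * Im (w s))))) (at s)" for s
    unfolding Z'_def
    by (rule derivative_eq_intros has_vector_derivative_of_real dw refl)+ simp
  have 3: "complex_of_real (- k * (k * Re (w s))) + \<i> * complex_of_real (- 2 * (- k * Im (w s)))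
      = 0 - 2 * \<i> * Z' s + of_real (2 * \<mu> * Re (Z s))" for s
  proof -
    have "k * (k * X) = (4 - 2 * \<mu>) * X" for X using k by (simp add: power2_eq_square mult.assoc[symmetric])
    from this[of "Re (w s)"] have "4 * Re (w s) = k * (k * Re (w s)) + 2 * \<mu> * Re (w s)" by (simp only: left_diff_distrib)
    then show ?thesis by (simp add: Z_def Z'_def complex_eq_iff)
  qed
  show ?thesis unfolding Z Lsol_def using 1 2 unfolding 3 by blast
qed (auto simp: zeta_def Lsol_def intro!: exI[of _ "\<lambda>_. 0"])

lemma dd_periodic: "j < n \<Longrightarrow> dd \<theta> j \<in> periodic T"
  unfolding dd_def by (intro periodic_mult periodic_const d0_periodic)

lemma dd_bound: "j < n \<Longrightarrow> norm (dd \<theta> j s) \<le> M * \<epsilon>"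
  using d0_bound by (simp add: dd_def norm_mult)

lemma dd_sum: "(\<Sum>j<n. of_real (m j) * dd \<theta> j s) = 0"
proof -
  have "(\<Sum>j<n. of_real (m j) * dd \<theta> j s) = cis (- \<theta>) * (\<Sum>j<n. of_real (m j) * d0 j s)"
    unfolding dd_def sum_distrib_left by (intro sum.cong) (auto simp: mult_ac)
  then show ?thesis by (simp add: d0_sum)
qed

lemma xd_bound:
  assumes "norm w \<le> \<epsilon>" "j < n"
  shows "norm (w - dd \<theta> j s) \<le> (1 + M) * \<epsilon>"
  using norm_triangle_ineq4[of w "dd \<theta> j s"] assms(1) dd_bound[OF assms(2), of \<theta> s] by (simp add: algebra_simps)

lemma xd_quarter: "norm w \<le> \<epsilon> \<Longrightarrow> j < n \<Longrightarrow> norm (w - dd \<theta> j s) \<le> 1/4"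
  using xd_bound[of w j \<theta> s] small1 by linarith

lemma weighted_norm:
  assumes "\<And>j. j < n \<Longrightarrow> norm (f j) \<le> B"
  shows "norm (\<Sum>j<n. of_real (m j) * f j :: complex) \<le> B"
proof -
  have "norm (\<Sum>j<n. of_real (m j) * f j) \<le> (\<Sum>j<n. m j * B)"
    using m0 assms by (intro sum_norm_le) (auto simp: norm_mult intro!: mult_left_mono)
  then show ?thesis by (simp add: m1 flip: sum_distrib_right)
qed

lemma Psi_cont_at:
  assumes "norm z < 1/4" shows "isCont (Psi \<mu>) z"
proof -
  have "1 + z \<noteq> 0" using norm_diff_ineq[of 1 z] assms by auto
  then show ?thesis unfolding Psi_def Fc_def
    by (intro continuous_intros) auto
qed

lemma Nf_periodic:
  assumes x: "x \<in> periodic T" "\<And>s. norm (x s) \<le> \<epsilon>"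
  shows "Nf \<theta> x \<in> periodic T"
proof (rule periodicI)
  show "continuous_on UNIV (Nf \<theta> x)" unfolding continuous_on_eq_continuous_at[OF open_UNIV]
  proof (intro ballI)
    fix s
    have "isCont (\<lambda>s. Psi \<mu> (x s - dd \<theta> j s)) s" if "j < n" for j
    proof (rule isCont_o2[of s _ "Psi \<mu>"])
      show "isCont (\<lambda>s. x s - dd \<theta> j s) s"
        using periodicD(1)[OF x(1)] periodicD(1)[OF dd_periodic[OF that]]
        by (auto simp: continuous_on_eq_continuous_at intro!: continuous_intros)
      show "isCont (Psi \<mu>) (x s - dd \<theta> j s)"
        using xd_bound[OF x(2) that, of s \<theta> s] small1 by (intro Psi_cont_at) linarith
    qed
    then show "isCont (Nf \<theta> x) s" unfolding Nf_def by (intro continuous_intros) auto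
  qed
  show "Nf \<theta> x (s + T) = Nf \<theta> x s" for s
    unfolding Nf_def using periodicD(2)[OF x(1)] periodicD(2)[OF dd_periodic] by (intro sum.cong) auto
qed

lemma Nf_bound:
  assumes "norm (x s) \<le> \<epsilon>"
  shows "norm (Nf \<theta> x s) \<le> CP * (1 + M)\<^sup>2 * \<epsilon>\<^sup>2"
  unfolding Nf_def
proof (rule weighted_norm)
  fix j assume j: "j < n"
  let ?w = "x s - dd \<theta> j s"
  have "norm (Psi \<mu> ?w - Psi \<mu> 0) \<le> CP * (norm ?w + norm (0::complex)) * norm (?w - 0)"
    using xd_quarter[OF assms j] by (intro CP) auto
  also have "\<dots> = CP * (norm ?w)\<^sup>2" by (simp add: power2_eq_square)
  also have "\<dots> \<le> CP * ((1 + M) * \<epsilon>)\<^sup>2" using xd_bound[OF assms j] pos by (intro mult_left_mono power_mono) auto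
  finally show "norm (Psi \<mu> ?w) \<le> CP * (1 + M)\<^sup>2 * \<epsilon>\<^sup>2" by (simp add: power_mult_distrib)
qed

text \<open>Both the function and the phase vary, since the reduced action is differentiated in
  \<theta> as well as in \<open>z\<close>.\<close>

lemma Nf_lip:
  assumes "norm (x s) \<le> \<epsilon>" "norm (y s) \<le> \<epsilon>"
  shows "norm (Nf \<theta> x s - Nf \<theta>' y s) \<le> CP * (2 * (1 + M) * \<epsilon>) * (norm (x s - y s) + \<bar>\<theta> - \<theta>'\<bar> * (M * \<epsilon>))"
proof -
  have e: "Nf \<theta> x s - Nf \<theta>' y s = (\<Sum>j<n. of_real (m j) * (Psi \<mu> (x s - dd \<theta> j s) - Psi \<mu> (y s - dd \<theta>' j s)))"
    unfolding Nf_def by (simp add: sum_subtractf right_diff_distrib)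
  show ?thesis unfolding e
  proof (rule weighted_norm)
    fix j assume j: "j < n"
    let ?w = "x s - dd \<theta> j s" and ?v = "y s - dd \<theta>' j s"
    have c: "norm (cis (- \<theta>) - cis (- \<theta>')) \<le> \<bar>\<theta> - \<theta>'\<bar>"
    proof -
      have "norm (cis (- \<theta>) - cis (- \<theta>')) \<le> 1 * norm (\<theta> - \<theta>')"
      proof (rule differentiable_bound[of UNIV _ "\<lambda>x h. h *\<^sub>R (- \<i> * cis (- x))"])
        show "((\<lambda>x. cis (- x)) has_derivative (\<lambda>h. h *\<^sub>R (- \<i> * cis (- x)))) (at x within UNIV)" for x
          unfolding has_vector_derivative_def[symmetric] cis_conv_exp
          using exp_deriv[of "- \<i>" x] by simp
        show "onorm (\<lambda>h. h *\<^sub>R (- \<i> * cis (- x))) \<le> 1" for x by (rule onorm_le) (simp add: norm_mult)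
      qed auto
      then show ?thesis by simp
    qed
    have "?w - ?v = (x s - y s) - (cis (- \<theta>) - cis (- \<theta>')) * d0 j s" by (simp add: dd_def algebra_simps)
    then have "norm (?w - ?v) \<le> norm (x s - y s) + norm (cis (- \<theta>) - cis (- \<theta>')) * norm (d0 j s)"
      by (metis norm_mult norm_triangle_ineq4)
    also have "\<dots> \<le> norm (x s - y s) + \<bar>\<theta> - \<theta>'\<bar> * (M * \<epsilon>)"
      using c d0_bound[OF j] by (intro add_left_mono mult_mono) auto
    finally have wv: "norm (?w - ?v) \<le> norm (x s - y s) + \<bar>\<theta> - \<theta>'\<bar> * (M * \<epsilon>)" .
    have "norm (Psi \<mu> ?w - Psi \<mu> ?v) \<le> CP * (norm ?w + norm ?v) * norm (?w - ?v)"
      by (intro CP xd_quarter assms j)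
    also have "\<dots> \<le> CP * (2 * (1 + M) * \<epsilon>) * (norm (x s - y s) + \<bar>\<theta> - \<theta>'\<bar> * (M * \<epsilon>))"
    proof (rule mult_mono[OF mult_left_mono wv])
      show "norm ?w + norm ?v \<le> 2 * (1 + M) * \<epsilon>"
        using add_mono[OF xd_bound[OF assms(1) j, of \<theta> s] xd_bound[OF assms(2) j, of \<theta>' s]] by (simp add: algebra_simps)
    qed (use pos in simp_all)
    finally show "norm (Psi \<mu> ?w - Psi \<mu> ?v) \<le> CP * (2 * (1 + M) * \<epsilon>) * (norm (x s - y s) + \<bar>\<theta> - \<theta>'\<bar> * (M * \<epsilon>))" .
  qed
qed

text \<open>The auxiliary equation of a Lyapunov-Schmidt reduction: the amplitude \<open>z\<close>
  in the kernel is prescribed and the defect \<open>ell (Nf \<theta> x)\<close> is ignored.\<close>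

definition "reduced_sol \<theta> z x \<longleftrightarrow> x \<in> periodic T \<and> (\<forall>s. norm (x s) \<le> \<epsilon>) \<and> (\<lambda>s. zeta z s + Linv (Nf \<theta> x) s) = x"

text \<open>These are the two uses of \<open>small2\<close>: a contraction factor 1/2, and a
  correction of at most \<open>\<epsilon> / 4\<close>, which together with the
  \<open>\<epsilon> / 2\<close> that \<open>small3\<close> allows the oscillation stays inside the
  ball of radius \<epsilon>.\<close>

lemma contraction_const: "CG * (CP * (2 * (1 + M) * \<epsilon>)) \<le> 1 / 2" "CG * (CP * (1 + M)\<^sup>2 * \<epsilon>\<^sup>2) \<le> \<epsilon> / 4"
proof -
  have "CG * (CP * (2 * (1 + M) * \<epsilon>)) \<le> CG * (CP * (2 * (1 + M)\<^sup>2 * \<epsilon>))"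
    using pos by (intro mult_left_mono mult_right_mono) (auto simp: power2_eq_square)
  then show "CG * (CP * (2 * (1 + M) * \<epsilon>)) \<le> 1 / 2" using small2 by (simp add: algebra_simps)
  have "(4 * CG * CP * (1 + M)\<^sup>2 * \<epsilon>) * \<epsilon> \<le> 1 * \<epsilon>" using small2 pos by (intro mult_right_mono) auto
  then show "CG * (CP * (1 + M)\<^sup>2 * \<epsilon>\<^sup>2) \<le> \<epsilon> / 4" by (simp add: algebra_simps power2_eq_square)
qed

lemma Linv_Nf_lip:
  assumes x: "x \<in> periodic T" "\<And>s. norm (x s) \<le> \<epsilon>" and y: "y \<in> periodic T" "\<And>s. norm (y s) \<le> \<epsilon>"
    and B: "\<And>s. norm (x s - y s) \<le> B"
  shows "norm (Linv (Nf \<theta> x) s - Linv (Nf \<theta>' y) s) \<le> B / 2 + \<bar>\<theta> - \<theta>'\<bar> * (M * \<epsilon>) / 2"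
proof -
  have "norm (Linv (\<lambda>s. Nf \<theta> x s - Nf \<theta>' y s) s) \<le> CG * (CP * (2 * (1 + M) * \<epsilon>) * (B + \<bar>\<theta> - \<theta>'\<bar> * (M * \<epsilon>)))"
  proof (rule CG[OF periodic_diff[OF Nf_periodic[OF x] Nf_periodic[OF y]]])
    fix s
    have "norm (Nf \<theta> x s - Nf \<theta>' y s) \<le> CP * (2 * (1 + M) * \<epsilon>) * (norm (x s - y s) + \<bar>\<theta> - \<theta>'\<bar> * (M * \<epsilon>))"
      by (rule Nf_lip[OF x(2) y(2)])
    also have "\<dots> \<le> CP * (2 * (1 + M) * \<epsilon>) * (B + \<bar>\<theta> - \<theta>'\<bar> * (M * \<epsilon>))"
      using B pos by (intro mult_left_mono) auto
    finally show "norm (Nf \<theta> x s - Nf \<theta>' y s) \<le> \<dots>" .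
  qed
  also have "\<dots> = CG * (CP * (2 * (1 + M) * \<epsilon>)) * (B + \<bar>\<theta> - \<theta>'\<bar> * (M * \<epsilon>))" by simp
  also have "\<dots> \<le> 1/2 * (B + \<bar>\<theta> - \<theta>'\<bar> * (M * \<epsilon>))"
    using contraction_const(1) pos order_trans[OF norm_ge_zero B] by (intro mult_right_mono) (auto intro!: add_nonneg_nonneg)
  finally show ?thesis using Linv_diff[OF Nf_periodic[OF x] Nf_periodic[OF y]] by (simp add: field_simps)
qed

lemma v_bound:
  assumes x: "x \<in> periodic T" "\<And>s. norm (x s) \<le> \<epsilon>"
  shows "norm (Linv (Nf \<theta> x) s) \<le> CG * (CP * (1 + M)\<^sup>2 * \<epsilon>\<^sup>2)"
  by (rule CG[OF Nf_periodic[OF x] Nf_bound[OF x(2)]])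

lemma reduced_sol_ex:
  assumes "norm z \<le> \<rho>"
  shows "\<exists>x. reduced_sol \<theta> z x"
proof -
  have "\<exists>x\<in>periodic T. (\<forall>s. norm (x s) \<le> \<epsilon>) \<and> (\<lambda>s. zeta z s + Linv (Nf \<theta> x) s) = x"
  proof (rule periodic_fixpoint)
    fix x assume x: "x \<in> periodic T" "\<forall>s. norm (x s) \<le> \<epsilon>"
    have "norm (zeta z s + Linv (Nf \<theta> x) s) \<le> \<epsilon>" for s
    proof -
      have "norm (zeta z s) \<le> \<epsilon> / 2"
        using zeta_bound[of z s] small3 mult_left_mono[OF assms, of Zc] Zc1 unfolding Zc_def by linarith
      moreover have "norm (Linv (Nf \<theta> x) s) \<le> \<epsilon> / 4"
        using v_bound[of x \<theta> s] x contraction_const(2) by fastforce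
      ultimately show ?thesis using norm_triangle_ineq[of "zeta z s" "Linv (Nf \<theta> x) s"] pos by linarith
    qed
    then show "(\<lambda>s. zeta z s + Linv (Nf \<theta> x) s) \<in> periodic T \<and> (\<forall>s. norm (zeta z s + Linv (Nf \<theta> x) s) \<le> \<epsilon>)"
      using x by (auto intro!: periodic_add zeta_periodic Linv_periodic Nf_periodic)
  next
    fix x y B assume *: "x \<in> periodic T" "y \<in> periodic T" "\<forall>s. norm (x s) \<le> \<epsilon>" "\<forall>s. norm (y s) \<le> \<epsilon>" "\<forall>s. norm (x s - y s) \<le> B"
    show "\<forall>s. norm (zeta z s + Linv (Nf \<theta> x) s - (zeta z s + Linv (Nf \<theta> y) s)) \<le> B / 2"
      using Linv_Nf_lip[of x y B \<theta> _ \<theta>] * by simp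
  qed (use pos in auto)
  then show ?thesis unfolding reduced_sol_def by blast
qed

lemma reduced_sol_lip:
  assumes "reduced_sol \<theta> z x" "reduced_sol \<theta>' z' y"
  shows "norm (x s - y s) \<le> 2 * (Zc * norm (z - z') + \<bar>\<theta> - \<theta>'\<bar> * (M * \<epsilon>) / 2)"
proof (rule halving_sup_bound)
  have x: "x \<in> periodic T" "\<And>s. norm (x s) \<le> \<epsilon>" "\<And>s. x s = zeta z s + Linv (Nf \<theta> x) s"
    using assms(1) unfolding reduced_sol_def by (auto simp: fun_eq_iff)
  have y: "y \<in> periodic T" "\<And>s. norm (y s) \<le> \<epsilon>" "\<And>s. y s = zeta z' s + Linv (Nf \<theta>' y) s"
    using assms(2) unfolding reduced_sol_def by (auto simp: fun_eq_iff)
  show "norm (x s - y s) \<le> 2 * \<epsilon>" for s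
    using norm_triangle_ineq4[of "x s" "y s"] x(2)[of s] y(2)[of s] by linarith
  fix B assume B: "\<forall>s. norm (x s - y s) \<le> B"
  show "\<forall>s. norm (x s - y s) \<le> B / 2 + (Zc * norm (z - z') + \<bar>\<theta> - \<theta>'\<bar> * (M * \<epsilon>) / 2)"
  proof
    fix s
    have "x s - y s = zeta (z - z') s + (Linv (Nf \<theta> x) s - Linv (Nf \<theta>' y) s)"
      by (subst x(3), subst y(3)) (simp add: zeta_diff)
    then have "norm (x s - y s) \<le> norm (zeta (z - z') s) + norm (Linv (Nf \<theta> x) s - Linv (Nf \<theta>' y) s)"
      by (simp add: norm_triangle_ineq)
    also have "\<dots> \<le> Zc * norm (z - z') + (B / 2 + \<bar>\<theta> - \<theta>'\<bar> * (M * \<epsilon>) / 2)"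
      using B by (intro add_mono zeta_bound Linv_Nf_lip x(1,2) y(1,2)) auto
    finally show "norm (x s - y s) \<le> B / 2 + (Zc * norm (z - z') + \<bar>\<theta> - \<theta>'\<bar> * (M * \<epsilon>) / 2)" by simp
  qed
qed

definition "sol \<theta> z = (SOME x. reduced_sol \<theta> z x)"

lemma sol: "norm z \<le> \<rho> \<Longrightarrow> reduced_sol \<theta> z (sol \<theta> z)"
  unfolding sol_def by (rule someI_ex[OF reduced_sol_ex])

text \<open>The phase enters only through \<open>cis\<close>, so the predicate from which the
  solution is chosen is literally the same.\<close>

lemma sol_shift: "sol (\<theta> + 2 * pi) z = sol \<theta> z"
proof -
  have "cis (- \<theta>) / cis (2 * pi) = cis (- \<theta> - 2 * pi)" by (rule cis_divide)
  then have "cis (- (\<theta> + 2 * pi)) = cis (- \<theta>)" by simp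
  then have "dd (\<theta> + 2 * pi) = dd \<theta>" unfolding dd_def by presburger
  then show ?thesis unfolding sol_def reduced_sol_def Nf_def by simp
qed

text \<open>The kinetic part of the action is eliminated through the equation of motion, \<open>rot_force\<close> being the force for which
  \<open>1 + x\<close> solves it exactly.\<close>

definition "rot_force \<theta> x = (\<lambda>s. Nf \<theta> x s - ell (Nf \<theta> x) s + of_real (2 * \<mu> * Re (x s)) - (1 + x s))"

definition "action y g \<theta> = ravg T (\<lambda>s. (\<Sum>j<n. m j * psi \<mu> (y s - dd \<theta> j s)) - (1/2) * (y s \<bullet> g s))"

definition "reduced_action \<theta> z = action (\<lambda>s. 1 + sol \<theta> z s) (rot_force \<theta> (sol \<theta> z)) \<theta>"

section \<open>Variation of the action\<close>

lemma psi_cont_at: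
  assumes "norm z < 1/4" shows "isCont (\<lambda>z. psi \<mu> (1 + z)) z"
proof -
  have "1 + z \<noteq> 0" using norm_diff_ineq[of 1 z] assms by auto
  then have p: "(norm (1 + z))\<^sup>2 > 0" by simp
  show ?thesis unfolding psi_def
    by (rule isCont_o2[of z "\<lambda>z. (norm (1 + z))\<^sup>2" "pot \<mu>"])
       (auto intro!: continuous_intros DERIV_isCont[OF pot_deriv[OF p]])
qed

lemma psi_dd_cont:
  assumes y: "continuous_on UNIV y" "\<And>s. norm (y s - 1) \<le> 1/8" and M: "M * \<epsilon> < 1/8" and j: "j < n"
  shows "continuous_on UNIV (\<lambda>s. psi \<mu> (y s - dd \<theta> j s))"
  unfolding continuous_on_eq_continuous_at[OF open_UNIV]
proof
  fix s
  have "isCont (\<lambda>s. psi \<mu> (1 + (y s - 1 - dd \<theta> j s))) s"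
  proof (rule isCont_o2[of s "\<lambda>s. y s - 1 - dd \<theta> j s" "\<lambda>z. psi \<mu> (1 + z)"])
    show "isCont (\<lambda>s. y s - 1 - dd \<theta> j s) s"
      using y(1) periodicD(1)[OF dd_periodic[OF j]]
      by (auto simp: continuous_on_eq_continuous_at intro!: continuous_intros)
    show "isCont (\<lambda>z. psi \<mu> (1 + z)) (y s - 1 - dd \<theta> j s)"
      using norm_triangle_ineq4[of "y s - 1" "dd \<theta> j s"] y(2)[of s] dd_bound[OF j, of \<theta> s] M
      by (intro psi_cont_at) linarith
  qed
  then show "isCont (\<lambda>s. psi \<mu> (y s - dd \<theta> j s)) s" by simp
qed

lemma Me: "M * \<epsilon> < 1/8" "\<epsilon> \<le> 1/16"
proof -
  have "\<epsilon> + M * \<epsilon> \<le> 1/16" using small1 by (simp add: algebra_simps)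
  then show "M * \<epsilon> < 1/8" "\<epsilon> \<le> 1/16" using pos mult_nonneg_nonneg[of M \<epsilon>] by linarith+
qed

text \<open>\<open>L\<close> is the residual of the equation of motion at \<open>y1\<close>. The
  potential is expanded to first order; the quadratic form in the remaining term is polarized by
  symmetry, so that its increment is controlled by the sup norms of \<open>y2 - y1\<close> and
  \<open>g2 - g1\<close>, with no velocity involved.\<close>

lemma action_variation:
  assumes y1: "y1 \<in> periodic T" "g1 \<in> periodic T" "rot_sol \<mu> y1 g1" "\<And>s. norm (y1 s - 1) \<le> 1/8"
    and y2: "y2 \<in> periodic T" "g2 \<in> periodic T" "rot_sol \<mu> y2 g2" "\<And>s. norm (y2 s - 1) \<le> 1/8"
    and D: "\<And>s. norm (y2 s - y1 s) \<le> D" "\<And>s. norm (g2 s - g1 s) \<le> D'"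
    and F: "\<And>s. L s = (\<Sum>j<n. of_real (m j) * Fc \<mu> (y1 s - dd \<theta> j s)) - g1 s"
    and CT: "\<And>z w. norm z \<le> 1/4 \<Longrightarrow> norm w \<le> 1/4 \<Longrightarrow>
      \<bar>psi \<mu> (1 + w) - psi \<mu> (1 + z) - Fc \<mu> (1 + z) \<bullet> (w - z)\<bar> \<le> CT * (norm (w - z))\<^sup>2" "CT \<ge> 0"
    and Lc: "continuous_on UNIV L"
  shows "\<bar>action y2 g2 \<theta> - action y1 g1 \<theta> - ip T L (\<lambda>s. y2 s - y1 s)\<bar> \<le> CT * D\<^sup>2 + D * D' / 2"
proof -
  note c = periodicD(1)[OF y1(1)] periodicD(1)[OF y1(2)] periodicD(1)[OF y2(1)] periodicD(1)[OF y2(2)]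
  have cs: "continuous_on UNIV (\<lambda>s. \<Sum>j<n. m j * psi \<mu> (y1 s - dd \<theta> j s))" "continuous_on UNIV (\<lambda>s. \<Sum>j<n. m j * psi \<mu> (y2 s - dd \<theta> j s))"
    by (intro continuous_intros psi_dd_cont c y1(4) y2(4) Me; simp)+
  have cF: "continuous_on UNIV (\<lambda>s. L s + g1 s)" by (intro continuous_intros Lc c)
  have D0: "0 \<le> D" using D(1)[of 0] norm_ge_zero order_trans by blast
  define er where "er = (\<lambda>s. (\<Sum>j<n. m j * psi \<mu> (y2 s - dd \<theta> j s)) - (\<Sum>j<n. m j * psi \<mu> (y1 s - dd \<theta> j s)) - (L s + g1 s) \<bullet> (y2 s - y1 s))"
  have cer: "continuous_on UNIV er" unfolding er_def by (intro continuous_intros cs cF c)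
  have er: "\<bar>er s\<bar> \<le> CT * D\<^sup>2" for s
  proof -
    have ers: "er s = (\<Sum>j<n. m j * (psi \<mu> (y2 s - dd \<theta> j s) - psi \<mu> (y1 s - dd \<theta> j s) - Fc \<mu> (y1 s - dd \<theta> j s) \<bullet> (y2 s - y1 s)))"
      unfolding er_def F
      by (simp add: sum_subtractf right_diff_distrib inner_sum_left scaleR_conv_of_real[symmetric])
    have "\<bar>er s\<bar> \<le> (\<Sum>j<n. m j * (CT * D\<^sup>2))"
      unfolding ers
    proof (rule order_trans[OF sum_abs sum_mono])
      fix j assume j: "j \<in> {..<n}"
      let ?z = "y1 s - 1 - dd \<theta> j s" and ?w = "y2 s - 1 - dd \<theta> j s"
      have "norm ?z \<le> 1/4" "norm ?w \<le> 1/4"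
        using norm_triangle_ineq4[of "y1 s - 1" "dd \<theta> j s"] norm_triangle_ineq4[of "y2 s - 1" "dd \<theta> j s"]
          y1(4)[of s] y2(4)[of s] dd_bound[of j \<theta> s] Me j by auto
      from CT(1)[OF this] have "\<bar>psi \<mu> (y2 s - dd \<theta> j s) - psi \<mu> (y1 s - dd \<theta> j s) - Fc \<mu> (y1 s - dd \<theta> j s) \<bullet> (y2 s - y1 s)\<bar> \<le> CT * (norm (y2 s - y1 s))\<^sup>2"
        by (simp add: algebra_simps)
      also have "\<dots> \<le> CT * D\<^sup>2" using D(1)[of s] CT(2) by (intro mult_left_mono power_mono) auto
      finally show "\<bar>m j * (psi \<mu> (y2 s - dd \<theta> j s) - psi \<mu> (y1 s - dd \<theta> j s) - Fc \<mu> (y1 s - dd \<theta> j s) \<bullet> (y2 s - y1 s))\<bar> \<le> m j * (CT * D\<^sup>2)"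
        using m0[of j] j by (simp add: abs_mult mult_left_mono)
    qed
    also have "\<dots> = CT * D\<^sup>2" by (simp add: m1 flip: sum_distrib_right)
    finally show ?thesis .
  qed
  \<comment> \<open>Takes the place of integrating the kinetic energy by parts.\<close>
  have sym: "ip T g1 y2 = ip T y1 g2"
    by (rule rot_sol_symmetric[OF y1(3) y2(3) y1(1) y2(1) c(2,4)])
  have "action y2 g2 \<theta> - action y1 g1 \<theta> = ravg T (\<lambda>s. er s + (L s + g1 s) \<bullet> (y2 s - y1 s)) - (1/2) * (ip T y2 g2 - ip T y1 g1)"
  proof -
    have e: "action y g \<theta> = ravg T (\<lambda>s. \<Sum>j<n. m j * psi \<mu> (y s - dd \<theta> j s)) - (1/2) * ip T y g"
      if "continuous_on UNIV y" "continuous_on UNIV g" "continuous_on UNIV (\<lambda>s. \<Sum>j<n. m j * psi \<mu> (y s - dd \<theta> j s))" for y g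
      unfolding action_def ip_def ravg_cmul[OF continuous_on_inner[OF that(1,2)], symmetric]
      by (rule ravg_diff[OF that(3)]) (intro continuous_intros that)
    have "(\<lambda>s. er s + (L s + g1 s) \<bullet> (y2 s - y1 s)) = (\<lambda>s. (\<Sum>j<n. m j * psi \<mu> (y2 s - dd \<theta> j s)) - (\<Sum>j<n. m j * psi \<mu> (y1 s - dd \<theta> j s)))"
      by (simp add: er_def)
    then show ?thesis by (simp add: e c cs ravg_diff diff_divide_distrib)
  qed
  also have "ravg T (\<lambda>s. er s + (L s + g1 s) \<bullet> (y2 s - y1 s)) = ravg T er + ip T (\<lambda>s. L s + g1 s) (\<lambda>s. y2 s - y1 s)"
    unfolding ip_def by (rule ravg_add) (intro continuous_intros cer cF c)+
  also have "ip T (\<lambda>s. L s + g1 s) (\<lambda>s. y2 s - y1 s) = ip T L (\<lambda>s. y2 s - y1 s) + ip T g1 (\<lambda>s. y2 s - y1 s)"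
    by (rule ip_add_left) (intro continuous_intros Lc c)+
  finally have *: "action y2 g2 \<theta> - action y1 g1 \<theta> - ip T L (\<lambda>s. y2 s - y1 s)
     = ravg T er + ip T g1 (\<lambda>s. y2 s - y1 s) - (1/2) * (ip T y2 g2 - ip T y1 g1)" by simp
  have "ip T (\<lambda>s. y2 s - y1 s) (\<lambda>s. g2 s - g1 s) = ip T y2 g2 - ip T y2 g1 - ip T y1 g2 + ip T y1 g1"
    by (simp add: ip_diff_left ip_diff_right c continuous_on_diff)
  moreover have "ip T g1 (\<lambda>s. y2 s - y1 s) = ip T g1 y2 - ip T g1 y1" by (simp add: ip_diff_right c)
  ultimately have **: "action y2 g2 \<theta> - action y1 g1 \<theta> - ip T L (\<lambda>s. y2 s - y1 s)
     = ravg T er - (1/2) * ip T (\<lambda>s. y2 s - y1 s) (\<lambda>s. g2 s - g1 s)"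
    unfolding * using sym ip_sym[of T g1 y2] ip_sym[of T g1 y1] by (simp add: field_simps)
  have "\<bar>ravg T er\<bar> \<le> CT * D\<^sup>2" by (rule ravg_bound[OF cer T0 er])
  moreover have "\<bar>ip T (\<lambda>s. y2 s - y1 s) (\<lambda>s. g2 s - g1 s)\<bar> \<le> D * D'"
    by (rule ip_bound[OF _ _ T0 D]) (intro continuous_intros c)+
  ultimately show ?thesis unfolding ** by (auto simp: abs_le_iff)
qed

lemma cis_m1: "norm (cis h - 1) \<le> \<bar>h\<bar>"
proof -
  have "norm (cis h - cis 0) \<le> 1 * norm (h - 0)"
  proof (rule differentiable_bound[of UNIV _ "\<lambda>x h. h *\<^sub>R (\<i> * cis x)"])
    show "(cis has_derivative (\<lambda>h. h *\<^sub>R (\<i> * cis x))) (at x within UNIV)" for x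
      unfolding has_vector_derivative_def[symmetric] cis_conv_exp[abs_def]
      using exp_deriv[of "\<i>" x] by simp
    show "onorm (\<lambda>h. h *\<^sub>R (\<i> * cis x)) \<le> 1" for x by (rule onorm_le) (simp add: norm_mult)
  qed auto
  then show ?thesis by simp
qed

text \<open>Rotating the orbit by \<open>h\<close> against fixed primaries amounts to advancing the
  phase by \<open>h\<close>, because potential and inner product are rotation invariant.\<close>

lemma action_rotate: "action (\<lambda>s. cis h * y s) (\<lambda>s. cis h * g s) \<theta> = action y g (\<theta> + h)"
proof -
  have p: "psi \<mu> (cis h * y s - dd \<theta> j s) = psi \<mu> (y s - dd (\<theta> + h) j s)" for j s
  proof -
    have "cis h * dd (\<theta> + h) j s = dd \<theta> j s"
      unfolding dd_def mult.assoc[symmetric] cis_mult by simp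
    then have "cis h * y s - dd \<theta> j s = cis h * (y s - dd (\<theta> + h) j s)" by (simp add: right_diff_distrib)
    then show ?thesis by (simp add: psi_rot)
  qed
  have i: "(cis h * a) \<bullet> (cis h * b) = a \<bullet> b" for a b
  proof -
    have "(Complex c s * a) \<bullet> (Complex c s * b) = (c\<^sup>2 + s\<^sup>2) * (a \<bullet> b)" for c s
      by (simp add: inner_complex_def power2_eq_square algebra_simps)
    from this[of "cos h" "sin h"] show ?thesis by (simp flip: cis.ctr)
  qed
  show ?thesis unfolding action_def p i ..
qed

lemma rot_force_periodic:
  assumes "x \<in> periodic T" "\<And>s. norm (x s) \<le> \<epsilon>"
  shows "rot_force \<theta> x \<in> periodic T"
proof -
  have "(\<lambda>s. of_real (2 * \<mu> * Re (x s))) \<in> periodic T"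
    using assms(1) by (auto simp: periodic_def intro!: continuous_intros)
  then show ?thesis unfolding rot_force_def
    by (intro periodic_add periodic_diff periodic_const Nf_periodic ell_periodic assms)
qed

lemma reduced_sol_Lsol:
  assumes "reduced_sol \<theta> z x"
  shows "Lsol \<mu> x (\<lambda>s. Nf \<theta> x s - ell (Nf \<theta> x) s)"
proof -
  have x: "x \<in> periodic T" "\<And>s. norm (x s) \<le> \<epsilon>" "(\<lambda>s. zeta z s + Linv (Nf \<theta> x) s) = x"
    using assms unfolding reduced_sol_def by auto
  show ?thesis using Lsol_add[OF zeta_Lsol[of z] Linv_Lsol[OF Nf_periodic[OF x(1,2), of \<theta>]]] unfolding x(3) by simp
qed

text \<open>The defect is the residual of the equation of motion, so it represents the derivative of
  the reduced action. The constant may depend on \<epsilon>: it serves only to justify continuity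
  and first-order conditions.\<close>

lemma reduced_action_variation:
  "\<exists>K\<ge>0. \<forall>\<theta> h z z'. norm z \<le> \<rho> \<longrightarrow> norm z' \<le> \<rho> \<longrightarrow> \<bar>h\<bar> \<le> 1/32 \<longrightarrow>
     \<bar>reduced_action (\<theta> + h) z' - reduced_action \<theta> z - ip T (ell (Nf \<theta> (sol \<theta> z))) (\<lambda>s. cis h * (1 + sol (\<theta> + h) z' s) - (1 + sol \<theta> z s))\<bar> \<le> K * (\<bar>h\<bar> + norm (z' - z))\<^sup>2
    \<and> \<bar>reduced_action (\<theta> + h) z' - reduced_action \<theta> z\<bar> \<le> K * (\<bar>h\<bar> + norm (z' - z))"
proof -
  obtain CT where CT: "CT \<ge> 0" "\<And>z w. norm z \<le> 1/4 \<Longrightarrow> norm w \<le> 1/4 \<Longrightarrow>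
      \<bar>psi \<mu> (1 + w) - psi \<mu> (1 + z) - Fc \<mu> (1 + z) \<bullet> (w - z)\<bar> \<le> CT * (norm (w - z))\<^sup>2"
    using psi_taylor[of \<mu>] mu0 by auto
  obtain CL where CL: "CL \<ge> 0" "\<And>f B s. f \<in> periodic T \<Longrightarrow> (\<And>s. norm (f s) \<le> B) \<Longrightarrow> norm (ell f s) \<le> CL * B"
    using ell_bound by blast
  define K1 where "K1 = 2 * Zc + M * \<epsilon>"
  define NB where "NB = CP * (1 + M)\<^sup>2 * \<epsilon>\<^sup>2"
  define K2 where "K2 = K1 + 2"
  define KN where "KN = CP * (2 * (1 + M) * \<epsilon>) * (K1 + M * \<epsilon>)"
  define KG where "KG = (NB + CL * NB + 2 * \<mu> + 2) + (KN + CL * KN + 2 * \<mu> * K1 + K1)"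
  have nn: "K1 \<ge> 0" "NB \<ge> 0" "K2 \<ge> 0" "KN \<ge> 0" "KG \<ge> 0"
    using Zc1 pos CL(1) mu0 by (auto simp: K1_def NB_def K2_def KN_def KG_def intro!: add_nonneg_nonneg mult_nonneg_nonneg)
  define K where "K = CT * K2\<^sup>2 + K2 * KG / 2"
  have K0: "K \<ge> 0" using CT nn by (simp add: K_def)
  define K' where "K' = CL * NB * K2 + K * (1 + 2 * \<rho>) + K"
  have K0': "K \<le> K'" "0 \<le> K'" using K0 CL nn pos by (auto simp: K'_def intro!: add_nonneg_nonneg mult_nonneg_nonneg)
  have main: "\<bar>reduced_action (\<theta> + h) z' - reduced_action \<theta> z - ip T (ell (Nf \<theta> (sol \<theta> z))) (\<lambda>s. cis h * (1 + sol (\<theta> + h) z' s) - (1 + sol \<theta> z s))\<bar> \<le> K * (\<bar>h\<bar> + norm (z' - z))\<^sup>2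
     \<and> \<bar>ip T (ell (Nf \<theta> (sol \<theta> z))) (\<lambda>s. cis h * (1 + sol (\<theta> + h) z' s) - (1 + sol \<theta> z s))\<bar> \<le> CL * NB * (K2 * (\<bar>h\<bar> + norm (z' - z)))"
    if z: "norm z \<le> \<rho>" "norm z' \<le> \<rho>" "\<bar>h\<bar> \<le> 1/32" for \<theta> h z z'
  proof -
    define \<delta> where "\<delta> = \<bar>h\<bar> + norm (z' - z)"
    have d: "\<bar>h\<bar> \<le> \<delta>" "norm (z' - z) \<le> \<delta>" "0 \<le> \<delta>" by (auto simp: \<delta>_def)
    define x1 where "x1 = sol \<theta> z"
    define x2 where "x2 = sol (\<theta> + h) z'"
    note f1 = sol[OF z(1), of \<theta>, folded x1_def] and f2 = sol[OF z(2), of "\<theta> + h", folded x2_def]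
    have x1: "x1 \<in> periodic T" "\<And>s. norm (x1 s) \<le> \<epsilon>" using f1 unfolding reduced_sol_def by auto
    have x2: "x2 \<in> periodic T" "\<And>s. norm (x2 s) \<le> \<epsilon>" using f2 unfolding reduced_sol_def by auto
    define g1 where "g1 = rot_force \<theta> x1"
    define G2 where "G2 = rot_force (\<theta> + h) x2"
    define y1 where "y1 = (\<lambda>s. 1 + x1 s)"
    \<comment> \<open>The phase is kept at \<theta> and the second orbit is rotated by
      \<open>h\<close> instead, so that both orbits enter \<open>action_variation\<close> with the
      same primaries.\<close>
    define y2 where "y2 = (\<lambda>s. cis h * (1 + x2 s))"
    define g2 where "g2 = (\<lambda>s. cis h * G2 s)"
    have gp: "g1 \<in> periodic T" "G2 \<in> periodic T" unfolding g1_def G2_def by (intro rot_force_periodic x1 x2)+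
    have yp: "y1 \<in> periodic T" "y2 \<in> periodic T" "g2 \<in> periodic T" unfolding y1_def y2_def g2_def
      by (intro periodic_add periodic_mult periodic_const x1 x2 gp)+
    have M1: "rot_sol \<mu> y1 g1"
      using rot_sol_rotate[OF reduced_sol_Lsol[OF f1], of 1] by (simp add: y1_def g1_def rot_force_def)
    have M2: "rot_sol \<mu> y2 g2"
      using rot_sol_rotate[OF reduced_sol_Lsol[OF f2], of "cis h"] by (simp add: y2_def g2_def G2_def rot_force_def)
    have xx: "norm (x2 s - x1 s) \<le> K1 * \<delta>" for s
    proof -
      have "norm (x2 s - x1 s) \<le> 2 * (Zc * norm (z' - z) + \<bar>\<theta> + h - \<theta>\<bar> * (M * \<epsilon>) / 2)"
        by (rule reduced_sol_lip[OF f2 f1])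
      also have "\<dots> = 2 * Zc * norm (z' - z) + \<bar>h\<bar> * (M * \<epsilon>)" by simp
      also have "\<dots> \<le> 2 * Zc * \<delta> + \<delta> * (M * \<epsilon>)"
        using d Zc1 pos by (intro add_mono mult_left_mono mult_right_mono) auto
      finally show ?thesis by (simp add: K1_def algebra_simps)
    qed
    have one: "norm (1 + x2 s) \<le> 2" for s
      using norm_triangle_ineq[of 1 "x2 s"] x2(2)[of s] Me by simp
    have cy: "norm ((cis h - 1) * (1 + x2 s)) \<le> \<bar>h\<bar> * 2" for s
      unfolding norm_mult using cis_m1[of h] one[of s] by (intro mult_mono) auto
    have yy: "norm (y2 s - y1 s) \<le> K2 * \<delta>" for s
    proof -
      have "y2 s - y1 s = (cis h - 1) * (1 + x2 s) + (x2 s - x1 s)" by (simp add: y2_def y1_def algebra_simps)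
      then have "norm (y2 s - y1 s) \<le> \<bar>h\<bar> * 2 + K1 * \<delta>"
        using norm_triangle_ineq[of "(cis h - 1) * (1 + x2 s)" "x2 s - x1 s"] cy[of s] xx[of s] by simp
      then show ?thesis using d by (simp add: K2_def algebra_simps)
    qed
    have y1b: "norm (y1 s - 1) \<le> 1/8" for s using x1(2)[of s] Me by (simp add: y1_def)
    \<comment> \<open>The bound 1/32 on \<open>h\<close> is made for this: rotation contributes at
      most \<open>2 * (1/32)\<close> and \<open>x2\<close> at most 1/16, together 1/8.\<close>
    have y2b: "norm (y2 s - 1) \<le> 1/8" for s
    proof -
      have "y2 s - 1 = (cis h - 1) * (1 + x2 s) + x2 s" by (simp add: y2_def algebra_simps)
      then show ?thesis
        using norm_triangle_ineq[of "(cis h - 1) * (1 + x2 s)" "x2 s"] cy[of s] x2(2)[of s] Me z(3) by simp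
    qed
    have Nb: "norm (Nf (\<theta> + h) x2 s) \<le> NB" "norm (Nf \<theta> x1 s) \<le> NB" for s
      unfolding NB_def by (rule Nf_bound[OF x2(2)], rule Nf_bound[OF x1(2)])
    have Nd: "norm (Nf (\<theta> + h) x2 s - Nf \<theta> x1 s) \<le> KN * \<delta>" for s
    proof -
      have "norm (Nf (\<theta> + h) x2 s - Nf \<theta> x1 s) \<le> CP * (2 * (1 + M) * \<epsilon>) * (norm (x2 s - x1 s) + \<bar>\<theta> + h - \<theta>\<bar> * (M * \<epsilon>))"
        by (rule Nf_lip[OF x2(2) x1(2)])
      also have "\<dots> \<le> CP * (2 * (1 + M) * \<epsilon>) * (K1 * \<delta> + \<delta> * (M * \<epsilon>))"
        using xx[of s] d pos by (intro mult_left_mono add_mono mult_right_mono) auto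
      finally show ?thesis by (simp add: KN_def algebra_simps)
    qed
    have eb: "norm (ell (Nf (\<theta> + h) x2) s) \<le> CL * NB" for s
      by (rule CL(2)[OF Nf_periodic[OF x2] Nb(1)])
    have eb1: "norm (ell (Nf \<theta> x1) s) \<le> CL * NB" for s
      by (rule CL(2)[OF Nf_periodic[OF x1] Nb(2)])
    have ed: "norm (ell (Nf (\<theta> + h) x2) s - ell (Nf \<theta> x1) s) \<le> CL * (KN * \<delta>)" for s
      using CL(2)[OF periodic_diff[OF Nf_periodic[OF x2] Nf_periodic[OF x1]] Nd]
      unfolding ell_diff[OF Nf_periodic[OF x2] Nf_periodic[OF x1]] .
    have G2b: "norm (G2 s) \<le> NB + CL * NB + 2 * \<mu> + 2" for s
    proof -
      have r: "norm (complex_of_real (2 * \<mu> * Re (x2 s))) \<le> 2 * \<mu>"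
      proof -
        have "\<bar>Re (x2 s)\<bar> \<le> 1" using abs_Re_le_cmod[of "x2 s"] x2(2)[of s] Me by linarith
        then show ?thesis unfolding norm_of_real abs_mult using mu0 by (auto intro: mult_left_le)
      qed
      have tri: "norm (a - b + c - d) \<le> norm a + norm b + norm c + norm d" for a b c d :: complex
        using norm_triangle_ineq4[of "a - b + c" d] norm_triangle_ineq[of "a - b" c] norm_triangle_ineq4[of a b] by linarith
      show ?thesis unfolding G2_def rot_force_def
        by (rule order_trans[OF tri]) (intro add_mono Nb eb r one)
    qed
    have Gd: "norm (G2 s - g1 s) \<le> (KN + CL * KN + 2 * \<mu> * K1 + K1) * \<delta>" for s
    proof -
      have e: "G2 s - g1 s = (Nf (\<theta> + h) x2 s - Nf \<theta> x1 s) - (ell (Nf (\<theta> + h) x2) s - ell (Nf \<theta> x1) s)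
          + of_real (2 * \<mu> * Re (x2 s - x1 s)) - (x2 s - x1 s)"
        by (simp add: G2_def g1_def rot_force_def algebra_simps)
      have r: "norm (complex_of_real (2 * \<mu> * Re (x2 s - x1 s))) \<le> 2 * \<mu> * (K1 * \<delta>)"
        unfolding norm_of_real abs_mult using order_trans[OF abs_Re_le_cmod xx[of s]] mu0
        by (auto intro!: mult_left_mono)
      have tri: "norm (a - b + c - d) \<le> norm a + norm b + norm c + norm d" for a b c d :: complex
        using norm_triangle_ineq4[of "a - b + c" d] norm_triangle_ineq[of "a - b" c] norm_triangle_ineq4[of a b] by linarith
      have "norm (G2 s - g1 s) \<le> KN * \<delta> + CL * (KN * \<delta>) + 2 * \<mu> * (K1 * \<delta>) + K1 * \<delta>"
        unfolding e by (rule order_trans[OF tri]) (intro add_mono Nd ed r xx)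
      then show ?thesis by (simp add: algebra_simps)
    qed
    have gd: "norm (g2 s - g1 s) \<le> KG * \<delta>" for s
    proof -
      have e: "g2 s - g1 s = (cis h - 1) * G2 s + (G2 s - g1 s)" by (simp add: g2_def algebra_simps)
      have "norm ((cis h - 1) * G2 s) \<le> \<delta> * (NB + CL * NB + 2 * \<mu> + 2)"
        unfolding norm_mult using order_trans[OF cis_m1 d(1)] G2b[of s] d by (intro mult_mono) auto
      then show ?thesis unfolding e using norm_triangle_ineq[of "(cis h - 1) * G2 s" "G2 s - g1 s"] Gd[of s]
        by (simp add: KG_def algebra_simps)
    qed
    \<comment> \<open>With unit total mass and the center of mass at the origin, force minus
      \<open>rot_force\<close> is exactly the defect.\<close>
    have L: "ell (Nf \<theta> x1) s = (\<Sum>j<n. of_real (m j) * Fc \<mu> (y1 s - dd \<theta> j s)) - g1 s" for s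
    proof -
      have "Nf \<theta> x1 s = (\<Sum>j<n. of_real (m j) * Fc \<mu> (y1 s - dd \<theta> j s) + (of_real (m j) * (1 + x1 s - of_real (2 * \<mu> * Re (x1 s))))
           - of_real (m j) * dd \<theta> j s + of_real (2 * \<mu> * Re (of_real (m j) * dd \<theta> j s)))"
        unfolding Nf_def Psi_def y1_def by (intro sum.cong refl) (simp add: algebra_simps)
      also have "\<dots> = (\<Sum>j<n. of_real (m j) * Fc \<mu> (y1 s - dd \<theta> j s)) + of_real (\<Sum>j<n. m j) * (1 + x1 s - of_real (2 * \<mu> * Re (x1 s)))
           - (\<Sum>j<n. of_real (m j) * dd \<theta> j s) + of_real (2 * \<mu> * Re (\<Sum>j<n. of_real (m j) * dd \<theta> j s))"
        by (simp add: sum.distrib sum_subtractf sum_distrib_right sum_distrib_left Re_sum del: Re_complex_of_real)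
      also have "\<dots> = (\<Sum>j<n. of_real (m j) * Fc \<mu> (y1 s - dd \<theta> j s)) + (1 + x1 s - of_real (2 * \<mu> * Re (x1 s)))"
        by (simp only: m1 dd_sum) simp
      finally show ?thesis by (simp add: g1_def rot_force_def algebra_simps)
    qed
    have "\<bar>action y2 g2 \<theta> - action y1 g1 \<theta> - ip T (ell (Nf \<theta> x1)) (\<lambda>s. y2 s - y1 s)\<bar> \<le> CT * (K2 * \<delta>)\<^sup>2 + (K2 * \<delta>) * (KG * \<delta>) / 2"
      by (rule action_variation[OF yp(1) gp(1) M1 y1b yp(2,3) M2 y2b yy gd L CT(2,1) periodicD(1)[OF ell_periodic[OF Nf_periodic[OF x1]]]])
    moreover have "CT * (K2 * \<delta>)\<^sup>2 + (K2 * \<delta>) * (KG * \<delta>) / 2 = K * \<delta>\<^sup>2"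
      by (simp add: K_def power2_eq_square algebra_simps)
    moreover have "action y2 g2 \<theta> = reduced_action (\<theta> + h) z'"
      unfolding y2_def g2_def action_rotate by (simp add: reduced_action_def x2_def G2_def)
    moreover have "action y1 g1 \<theta> = reduced_action \<theta> z" by (simp add: reduced_action_def y1_def x1_def g1_def)
    moreover have "\<bar>ip T (ell (Nf \<theta> x1)) (\<lambda>s. y2 s - y1 s)\<bar> \<le> CL * NB * (K2 * \<delta>)"
      by (rule ip_bound[OF _ _ T0 eb1 yy]) (intro continuous_intros periodicD(1)[OF ell_periodic[OF Nf_periodic[OF x1]]] periodicD(1)[OF yp(1)] periodicD(1)[OF yp(2)])+
    ultimately show ?thesis unfolding y1_def y2_def x1_def x2_def \<delta>_def by simp
  qed
  show ?thesis
  proof (intro exI[of _ K'] conjI allI impI)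
    fix \<theta> h :: real and z z' :: complex assume z: "norm z \<le> \<rho>" "norm z' \<le> \<rho>" "\<bar>h\<bar> \<le> 1/32"
    define \<delta> where "\<delta> = \<bar>h\<bar> + norm (z' - z)"
    define I where "I = ip T (ell (Nf \<theta> (sol \<theta> z))) (\<lambda>s. cis h * (1 + sol (\<theta> + h) z' s) - (1 + sol \<theta> z s))"
    have d: "0 \<le> \<delta>" "\<delta> \<le> 1 + 2 * \<rho>" using norm_triangle_ineq4[of z' z] z by (auto simp: \<delta>_def)
    note mm = main[OF z, of \<theta>, folded I_def \<delta>_def]
    have "K * \<delta>\<^sup>2 \<le> K' * \<delta>\<^sup>2" using K0' by (intro mult_right_mono) auto
    then show "\<bar>reduced_action (\<theta> + h) z' - reduced_action \<theta> z - I\<bar> \<le> K' * \<delta>\<^sup>2" using mm by linarith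
    have "K * \<delta>\<^sup>2 \<le> K * ((1 + 2 * \<rho>) * \<delta>)" unfolding power2_eq_square using d K0 by (intro mult_left_mono mult_right_mono) auto
    then have "\<bar>reduced_action (\<theta> + h) z' - reduced_action \<theta> z\<bar> \<le> CL * NB * (K2 * \<delta>) + K * ((1 + 2 * \<rho>) * \<delta>)" using mm by linarith
    also have "\<dots> \<le> K' * \<delta>" using K0 d by (simp add: K'_def algebra_simps)
    finally show "\<bar>reduced_action (\<theta> + h) z' - reduced_action \<theta> z\<bar> \<le> K' * \<delta>" .
  qed (use K0' in auto)
qed

section \<open>Minimization and vanishing of the defect\<close>

lemma quadratic_lower_bound_imp_zero_slope:
  fixes L K h0 :: real
  assumes "h0 > 0" "K \<ge> 0" "\<And>h. \<bar>h\<bar> \<le> h0 \<Longrightarrow> 0 \<le> h * L + K * h\<^sup>2"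
  shows "L = 0"
proof (rule ccontr)
  assume L: "L \<noteq> 0"
  \<comment> \<open>Small enough that, for a step of length \<open>r\<close> against the sign of
    \<open>L\<close>, the quadratic term cannot compensate the linear one.\<close>
  define r where "r = min h0 (\<bar>L\<bar> / (2 * (K + 1)))"
  have r: "0 < r" "r \<le> h0" "r \<le> \<bar>L\<bar> / (2 * (K + 1))" using assms L by (auto simp: r_def)
  then have rK: "r * (2 * (K + 1)) \<le> \<bar>L\<bar>" using assms(2) by (simp add: field_simps)
  define h where "h = - sgn L * r"
  have "\<bar>h\<bar> \<le> h0" using r L by (simp add: h_def abs_mult abs_sgn_eq)
  from assms(3)[OF this] have "0 \<le> h * L + K * h\<^sup>2" .
  moreover have "h * L = - (r * \<bar>L\<bar>)" by (simp add: h_def abs_sgn[of L] mult_ac)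
  moreover have "h\<^sup>2 = r\<^sup>2" using L by (simp add: h_def power_mult_distrib sgn_if)
  ultimately have "r * \<bar>L\<bar> \<le> r * (K * r)" by (simp add: power2_eq_square mult_ac)
  then have "\<bar>L\<bar> \<le> K * r" using r by simp
  moreover have "K * r < r * (2 * (K + 1))" using r(1) mult_nonneg_nonneg[OF assms(2), of r] by (simp add: algebra_simps)
  ultimately show False using rK by linarith
qed

text \<open>Compactness of a phase interval times the ball of amplitudes. Periodicity in \<theta>
  makes the minimum two-sided even when it is attained at an end of the interval.\<close>

lemma reduced_action_min:
  "\<exists>\<theta> z. norm z \<le> \<rho> \<and> (\<forall>h z'. \<bar>h\<bar> \<le> 1/32 \<longrightarrow> norm z' \<le> \<rho> \<longrightarrow> reduced_action \<theta> z \<le> reduced_action (\<theta> + h) z')"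
proof -
  obtain K where K: "K \<ge> 0" "\<And>\<theta> h z z'. norm z \<le> \<rho> \<Longrightarrow> norm z' \<le> \<rho> \<Longrightarrow> \<bar>h\<bar> \<le> 1/32 \<Longrightarrow> \<bar>reduced_action (\<theta> + h) z' - reduced_action \<theta> z\<bar> \<le> K * (\<bar>h\<bar> + norm (z' - z))"
    using reduced_action_variation by blast
  define S where "S = {0..2 * pi} \<times> cball (0::complex) \<rho>"
  have "continuous_on S (\<lambda>p. reduced_action (fst p) (snd p))"
  proof (rule continuous_onI)
    fix p e assume p: "p \<in> S" and e: "(0::real) < e"
    define d where "d = min (1/32) (e / (2 * (K + 1)))"
    have d: "d > 0" "d \<le> 1/32" "d \<le> e / (2 * (K + 1))" using K(1) e min.cobounded1 min.cobounded2 unfolding d_def by (simp, blast, blast)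
    then have dK: "2 * (K + 1) * d \<le> e" using K(1) by (simp add: pos_le_divide_eq mult.commute)
    show "\<exists>d>0. \<forall>q\<in>S. dist q p < d \<longrightarrow> dist (reduced_action (fst q) (snd q)) (reduced_action (fst p) (snd p)) \<le> e"
    proof (intro exI conjI ballI impI)
      fix q assume q: "q \<in> S" "dist q p < d"
      have f: "\<bar>fst q - fst p\<bar> < d" "norm (snd q - snd p) < d"
        using dist_fst_le[of q p] dist_snd_le[of q p] q(2) by (auto simp: dist_real_def dist_norm)
      have "\<bar>reduced_action (fst p + (fst q - fst p)) (snd q) - reduced_action (fst p) (snd p)\<bar> \<le> K * (\<bar>fst q - fst p\<bar> + norm (snd q - snd p))"
        using p q f d by (intro K) (auto simp: S_def)
      also have "\<dots> \<le> K * (2 * d)" using f K(1) by (intro mult_left_mono) auto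
      also have "\<dots> \<le> e" using d(1) dK by (simp add: algebra_simps)
      finally show "dist (reduced_action (fst q) (snd q)) (reduced_action (fst p) (snd p)) \<le> e" by (simp add: dist_real_def)
    qed (rule d(1))
  qed
  moreover have "compact S" unfolding S_def by (intro compact_Times) auto
  moreover have "(0, 0) \<in> S" using pos by (simp add: S_def)
  ultimately obtain p where p: "p \<in> S" "\<And>q. q \<in> S \<Longrightarrow> reduced_action (fst p) (snd p) \<le> reduced_action (fst q) (snd q)"
    using continuous_attains_inf[of S "\<lambda>p. reduced_action (fst p) (snd p)"] by blast
  have per: "reduced_action (\<theta> + 2 * pi) z = reduced_action \<theta> z" for \<theta> z
  proof -
    have "cis (- \<theta>) / cis (2 * pi) = cis (- \<theta> - 2 * pi)" by (rule cis_divide)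
    then have "cis (- (\<theta> + 2 * pi)) = cis (- \<theta>)" by simp
    then have "dd (\<theta> + 2 * pi) = dd \<theta>" unfolding dd_def by presburger
    then show ?thesis unfolding reduced_action_def action_def rot_force_def Nf_def sol_shift by simp
  qed
  have "reduced_action (fst p) (snd p) \<le> reduced_action (fst p + h) z'" if h: "\<bar>h\<bar> \<le> 1/32" "norm z' \<le> \<rho>" for h z'
  proof -
    have f: "0 \<le> fst p" "fst p \<le> 2 * pi" using p(1) by (auto simp: S_def)
    have pi: "1 < pi" using pi_gt3 by simp
    consider "fst p + h < 0" | "fst p + h > 2 * pi" | "0 \<le> fst p + h" "fst p + h \<le> 2 * pi" by linarith
    then show ?thesis
    proof cases
      case 1
      then have "(fst p + h + 2 * pi, z') \<in> S" using f h pi by (auto simp: S_def)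
      then show ?thesis using p(2) per[of "fst p + h"] by force
    next
      case 2
      then have "(fst p + h - 2 * pi, z') \<in> S" using f h pi by (auto simp: S_def)
      then show ?thesis using p(2) per[of "fst p + h - 2 * pi"] by force
    next
      case 3
      then have "(fst p + h, z') \<in> S" using h by (auto simp: S_def)
      then show ?thesis using p(2) by force
    qed
  qed
  moreover have "norm (snd p) \<le> \<rho>" using p(1) by (auto simp: S_def)
  ultimately show ?thesis by blast
qed

lemma sol_split:
  assumes "norm z \<le> \<rho>"
  shows "sol \<theta> z s = zeta z s + Linv (Nf \<theta> (sol \<theta> z)) s"
  using sol[OF assms, of \<theta>] unfolding reduced_sol_def by (auto simp: fun_eq_iff)

lemma sol_periodic:
  assumes "norm z \<le> \<rho>"
  shows "sol \<theta> z \<in> periodic T" "norm (sol \<theta> z s) \<le> \<epsilon>"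
  using sol[OF assms, of \<theta>] unfolding reduced_sol_def by auto

text \<open>Symmetry against the kernel element \<open>zeta z\<close>: what \<open>Linv\<close> does
  solve pairs to zero with it, hence the defect and the full right-hand side have the same
  pairing.\<close>

lemma ip_ell_zeta:
  assumes "f \<in> periodic T"
  shows "ip T (ell f) (zeta z) = ip T f (zeta z)"
proof -
  note c = periodicD(1)[OF assms] periodicD(1)[OF ell_periodic[OF assms]] periodicD(1)[OF zeta_periodic[of z]]
  have "ip T (\<lambda>s. f s - ell f s) (zeta z) = ip T (Linv f) (\<lambda>s. 0)"
    by (rule Lsol_symmetric[OF Linv_Lsol[OF assms] zeta_Lsol Linv_periodic[OF assms] zeta_periodic]) (intro continuous_intros c)+
  also have "\<dots> = 0" using T0 by (simp add: ip_def ravg_const)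
  finally show ?thesis using c by (simp add: ip_diff_left)
qed

text \<open>Stationarity in \<open>z\<close> and in the phase gives as many linear conditions as the
  defect has coefficients, and each coefficient is isolated by a suitable direction. Hypothesis
  \<open>b\<close> says that the radial derivative is positive on the boundary of the ball, which
  keeps the minimum inside.\<close>

lemma exists_solution:
  assumes b: "\<And>\<theta> z x. res \<Longrightarrow> norm z = \<rho> \<Longrightarrow> reduced_sol \<theta> z x \<Longrightarrow> ip T (Nf \<theta> x) (zeta z) > 0"
    and rr: "res \<longleftrightarrow> \<rho> > 0"
  shows "\<exists>\<theta> z x. norm z \<le> \<rho> \<and> reduced_sol \<theta> z x \<and> Lsol \<mu> x (Nf \<theta> x)"
proof -
  obtain K where K: "K \<ge> 0" "\<And>\<theta> h z z'. norm z \<le> \<rho> \<Longrightarrow> norm z' \<le> \<rho> \<Longrightarrow> \<bar>h\<bar> \<le> 1/32 \<Longrightarrow>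
     \<bar>reduced_action (\<theta> + h) z' - reduced_action \<theta> z - ip T (ell (Nf \<theta> (sol \<theta> z))) (\<lambda>s. cis h * (1 + sol (\<theta> + h) z' s) - (1 + sol \<theta> z s))\<bar> \<le> K * (\<bar>h\<bar> + norm (z' - z))\<^sup>2"
    using reduced_action_variation by blast
  obtain \<theta> z where z: "norm z \<le> \<rho>" and mn: "\<And>h z'. \<bar>h\<bar> \<le> 1/32 \<Longrightarrow> norm z' \<le> \<rho> \<Longrightarrow> reduced_action \<theta> z \<le> reduced_action (\<theta> + h) z'"
    using reduced_action_min by blast
  define x where "x = sol \<theta> z"
  define f where "f = Nf \<theta> x"
  define l where "l = ell f"
  have x: "x \<in> periodic T" "\<And>s. norm (x s) \<le> \<epsilon>" unfolding x_def by (rule sol_periodic[OF z])+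
  have fp: "f \<in> periodic T" unfolding f_def by (rule Nf_periodic[OF x])
  have lp: "l \<in> periodic T" unfolding l_def by (rule ell_periodic[OF fp])
  note lc = periodicD(1)[OF lp]
  have lv: "ip T l (Linv g) = 0" if "g \<in> periodic T" for g unfolding l_def by (rule ell_orth[OF fp that kre])
  \<comment> \<open>Two solutions differ by a kernel oscillation and two values of
    \<open>Linv\<close>; the latter are orthogonal to \<open>l\<close>.\<close>
  have lsol: "ip T l (\<lambda>s. sol \<theta>' z' s - sol \<theta> z s) = ip T l (zeta (z' - z))" if z': "norm z' \<le> \<rho>" for \<theta>' z'
  proof -
    have p: "Nf \<theta>' (sol \<theta>' z') \<in> periodic T" by (rule Nf_periodic[OF sol_periodic[OF z']])
    have "(\<lambda>s. sol \<theta>' z' s - sol \<theta> z s) = (\<lambda>s. zeta (z' - z) s + (Linv (Nf \<theta>' (sol \<theta>' z')) s - Linv f s))"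
    proof
      fix s show "sol \<theta>' z' s - sol \<theta> z s = zeta (z' - z) s + (Linv (Nf \<theta>' (sol \<theta>' z')) s - Linv f s)"
        unfolding f_def x_def by (subst sol_split[OF z'], subst sol_split[OF z]) (simp add: zeta_diff)
    qed
    then have "ip T l (\<lambda>s. sol \<theta>' z' s - sol \<theta> z s) = ip T l (zeta (z' - z)) + (ip T l (Linv (Nf \<theta>' (sol \<theta>' z'))) - ip T l (Linv f))"
      by (simp only:, (subst ip_add_right ip_diff_right; (intro continuous_intros lc periodicD(1)[OF zeta_periodic] periodicD(1)[OF Linv_periodic] p fp)?)+) (rule refl)
    then show ?thesis using lv[OF p] lv[OF fp] by simp
  qed
  have var0: "\<bar>reduced_action \<theta> z' - reduced_action \<theta> z - ip T l (zeta (z' - z))\<bar> \<le> K * (norm (z' - z))\<^sup>2" if z': "norm z' \<le> \<rho>" for z'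
    using K(2)[OF z z', of 0 \<theta>] lsol[OF z', of \<theta>] by (simp add: l_def f_def x_def)
  have zs: "ip T l (zeta (of_real t * w)) = t * ip T l (zeta w)" for t w
    unfolding zeta_scale[abs_def] by (rule ip_scale_right[OF lc periodicD(1)[OF zeta_periodic]])
  have lz: "ip T l (zeta w) = 0" for w
  proof (cases res)
    case False
    then show ?thesis using T0 by (simp add: zeta_def ip_def ravg_const)
  next
    case True
    \<comment> \<open>If the minimum lay on the boundary, shrinking \<open>z\<close> to
      \<open>(1 - t) * z\<close> would decrease the reduced action to first order in
      \<open>t\<close>, faster than the quadratic error can restore it.\<close>
    have zlt: "norm z < \<rho>"
    proof (rule ccontr)
      assume "\<not> norm z < \<rho>"
      then have zr: "norm z = \<rho>" using z by simp
      have "ip T f (zeta z) > 0" unfolding f_def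
        by (rule b[OF True zr]) (use sol[OF z] in \<open>simp add: x_def\<close>)
      then have p: "ip T l (zeta z) > 0" unfolding l_def ip_ell_zeta[OF fp] .
      have "ip T l (zeta z) \<le> t * (K * \<rho>\<^sup>2)" if t: "0 < t" "t \<le> 1" for t
      proof -
        define z' where "z' = of_real (1 - t) * z"
        have z': "norm z' \<le> \<rho>" using t zr pos by (simp add: z'_def norm_mult mult_left_le_one_le del: of_real_diff)
        have e: "z' - z = of_real (- t) * z" by (simp add: z'_def algebra_simps)
        have n: "norm (z' - z) = t * \<rho>" unfolding e norm_mult using t zr by simp
        have "0 \<le> ip T l (zeta (z' - z)) + K * (t * \<rho>)\<^sup>2"
          using var0[OF z'] mn[of 0 z'] z' unfolding n by simp
        then have "t * ip T l (zeta z) \<le> t * (t * (K * \<rho>\<^sup>2))"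
          unfolding e zs by (simp add: power2_eq_square mult_ac)
        then show ?thesis using t by simp
      qed
      then have le: "ip T l (zeta z) \<le> t * (K * \<rho>\<^sup>2)" if "0 < t" "t \<le> 1" for t using that by blast
      have KR: "0 \<le> K * \<rho>\<^sup>2" using K by simp
      define I where "I = ip T l (zeta z)"
      have "I \<le> min 1 (I / (2 * (K * \<rho>\<^sup>2 + 1))) * (K * \<rho>\<^sup>2)" unfolding I_def using p KR by (intro le) auto
      also have "\<dots> \<le> I / (2 * (K * \<rho>\<^sup>2 + 1)) * (K * \<rho>\<^sup>2)" using KR by (intro mult_right_mono) auto
      also have "\<dots> < I" using p KR unfolding I_def[symmetric] by (simp add: field_simps add_pos_nonneg)
      finally show False by simp
    qed
    show ?thesis
    proof (cases "w = 0")
      case True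
      then show ?thesis using zs[of 0 0] by simp
    next
      case False
      define h0 where "h0 = (\<rho> - norm z) / norm w"
      show ?thesis
      proof (rule quadratic_lower_bound_imp_zero_slope[of h0 "K * (norm w)\<^sup>2"])
        show "h0 > 0" using zlt False by (simp add: h0_def)
        show "0 \<le> K * (norm w)\<^sup>2" using K by simp
        fix h assume "\<bar>h\<bar> \<le> h0"
        then have "\<bar>h\<bar> * norm w \<le> \<rho> - norm z" using False by (simp add: h0_def pos_le_divide_eq)
        then have z': "norm (z + of_real h * w) \<le> \<rho>"
          using norm_triangle_ineq[of z "of_real h * w"] by (simp add: norm_mult)
        show "0 \<le> h * ip T l (zeta w) + K * (norm w)\<^sup>2 * h\<^sup>2"
        proof -
          have n: "z + of_real h * w - z = of_real h * w" by simp
          have nq: "(norm (of_real h * w))\<^sup>2 = (norm w)\<^sup>2 * h\<^sup>2" by (simp add: norm_mult power_mult_distrib)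
          have "\<bar>reduced_action \<theta> (z + of_real h * w) - reduced_action \<theta> z - h * ip T l (zeta w)\<bar> \<le> K * (norm w)\<^sup>2 * h\<^sup>2"
            using var0[OF z'] unfolding n zs nq by (simp add: mult.assoc)
          moreover have "reduced_action \<theta> z \<le> reduced_action \<theta> (z + of_real h * w)" using mn[of 0, OF _ z'] by simp
          ultimately show ?thesis by linarith
        qed
      qed
    qed
  qed
  \<comment> \<open>The phase direction: the infinitesimal rotation of \<open>1 + x\<close> is
    \<open>\<i> * (1 + x)\<close>. The change of the solution with the phase drops out by
    \<open>lsol\<close> and \<open>lz\<close>.\<close>
  have li: "ip T l (\<lambda>s. \<i> * (1 + x s)) = 0"
  proof -
    define KX where "KX = M * \<epsilon>"
    obtain CL where CL: "CL \<ge> 0" "\<And>s. norm (l s) \<le> CL"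
    proof -
      obtain C where "C \<ge> 0" "\<And>f B s. f \<in> periodic T \<Longrightarrow> (\<And>s. norm (f s) \<le> B) \<Longrightarrow> norm (ell f s) \<le> C * B"
        using ell_bound by blast
      then have "norm (l s) \<le> C * (CP * (1 + M)\<^sup>2 * \<epsilon>\<^sup>2)" for s
        unfolding l_def using fp Nf_bound[OF x(2)] by (auto simp: f_def)
      then show ?thesis using that order_trans[OF norm_ge_zero] by metis
    qed
    have KX0: "KX \<ge> 0" using pos by (simp add: KX_def)
    have *: "0 \<le> h * ip T l (\<lambda>s. \<i> * (1 + x s)) + (K + CL * (KX + 2)) * h\<^sup>2" if h: "\<bar>h\<bar> \<le> 1/32" for h
    proof -
      define y where "y = sol (\<theta> + h) z"
      have y: "y \<in> periodic T" "\<And>s. norm (y s) \<le> \<epsilon>" unfolding y_def by (rule sol_periodic[OF z])+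
      note c = lc periodicD(1)[OF x(1)] periodicD(1)[OF y(1)]
      \<comment> \<open>Quadratic in \<open>h\<close>: the first product has two factors of order
        \<open>h\<close>, in the second the linear part of \<open>cis h\<close> is
        subtracted.\<close>
      define rm where "rm = (\<lambda>s. (cis h - 1) * (y s - x s) + (cis h - 1 - \<i> * of_real h) * (1 + x s))"
      have crm: "continuous_on UNIV rm" unfolding rm_def by (intro continuous_intros c)
      have "ip T l (\<lambda>s. cis h * (1 + y s) - (1 + x s)) = ip T l (\<lambda>s. y s - x s) + (ip T l (\<lambda>s. of_real h * (\<i> * (1 + x s))) + ip T l rm)"
      proof -
        have dec: "(\<lambda>s. cis h * (1 + y s) - (1 + x s)) = (\<lambda>s. (y s - x s) + (of_real h * (\<i> * (1 + x s)) + rm s))"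
          by (rule ext) (simp add: rm_def algebra_simps)
        have c1: "continuous_on UNIV (\<lambda>s. y s - x s)" "continuous_on UNIV (\<lambda>s. of_real h * (\<i> * (1 + x s)))"
          by (intro continuous_intros c)+
        show ?thesis
          unfolding dec ip_add_right[OF c1(1) continuous_on_add[OF c1(2) crm] c(1)] ip_add_right[OF c1(2) crm c(1)] ..
      qed
      also have "ip T l (\<lambda>s. y s - x s) = 0"
        using lsol[OF z, of "\<theta> + h"] lz by (simp add: x_def y_def)
      also have "ip T l (\<lambda>s. of_real h * (\<i> * (1 + x s))) = h * ip T l (\<lambda>s. \<i> * (1 + x s))"
        by (rule ip_scale_right) (intro continuous_intros c)+
      finally have e1: "ip T l (\<lambda>s. cis h * (1 + y s) - (1 + x s)) = h * ip T l (\<lambda>s. \<i> * (1 + x s)) + ip T l rm" by simp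
      have yx: "norm (y s - x s) \<le> KX * \<bar>h\<bar>" for s
        using reduced_sol_lip[OF sol[OF z, of "\<theta> + h"] sol[OF z, of \<theta>], of s] by (simp add: x_def y_def KX_def mult_ac)
      have cis2: "norm (cis h - 1 - \<i> * of_real h) \<le> h\<^sup>2"
      proof -
        have "norm ((\<lambda>h. cis h - \<i> * of_real h) h - (\<lambda>h. cis h - \<i> * of_real h) 0) \<le> \<bar>h\<bar> * norm (h - 0)"
        proof (rule differentiable_bound[of "cball 0 \<bar>h\<bar>" _ "\<lambda>x h. h *\<^sub>R (\<i> * cis x - \<i>)"])
          show "((\<lambda>h. cis h - \<i> * of_real h) has_derivative (\<lambda>h. h *\<^sub>R (\<i> * cis x - \<i>))) (at x within cball 0 \<bar>h\<bar>)" for x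
          proof -
            have "((\<lambda>h. exp (\<i> * of_real h) - \<i> * of_real h) has_vector_derivative (\<i> * exp (\<i> * of_real x) - \<i> * of_real 1)) (at x)"
              by (intro has_vector_derivative_diff exp_deriv has_vector_derivative_mult_right has_vector_derivative_of_real DERIV_ident)
            then show ?thesis unfolding cis_conv_exp has_vector_derivative_def
              by (simp add: has_derivative_at_withinI)
          qed
          show "onorm (\<lambda>h. h *\<^sub>R (\<i> * cis x - \<i>)) \<le> \<bar>h\<bar>" if "x \<in> cball 0 \<bar>h\<bar>" for x
          proof (rule onorm_le)
            fix t :: real
            have "\<i> * cis x - \<i> = \<i> * (cis x - 1)" by (simp add: algebra_simps)
            then have "norm (\<i> * cis x - \<i>) \<le> \<bar>h\<bar>" using cis_m1[of x] that by (simp add: norm_mult)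
            then show "norm (t *\<^sub>R (\<i> * cis x - \<i>)) \<le> \<bar>h\<bar> * norm t"
              using mult_left_mono[of _ "\<bar>h\<bar>" "\<bar>t\<bar>"] by (simp add: mult.commute[of "\<bar>h\<bar>"])
          qed
        qed auto
        then show ?thesis by (simp add: power2_eq_square algebra_simps)
      qed
      have rmb: "norm (rm s) \<le> (KX + 2) * h\<^sup>2" for s
      proof -
        have 1: "norm ((cis h - 1) * (y s - x s)) \<le> \<bar>h\<bar> * (KX * \<bar>h\<bar>)"
          unfolding norm_mult using cis_m1[of h] yx[of s] by (intro mult_mono) auto
        have "norm (1 + x s) \<le> 2" using norm_triangle_ineq[of 1 "x s"] x(2)[of s] Me by simp
        then have 2: "norm ((cis h - 1 - \<i> * of_real h) * (1 + x s)) \<le> h\<^sup>2 * 2"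
          unfolding norm_mult using cis2 by (intro mult_mono) auto
        have e: "\<bar>h\<bar> * (KX * \<bar>h\<bar>) + h\<^sup>2 * 2 = (KX + 2) * h\<^sup>2" by (simp add: power2_eq_square algebra_simps)
        show ?thesis unfolding rm_def e[symmetric] by (rule norm_triangle_le[OF add_mono[OF 1 2]])
      qed
      have e2: "\<bar>ip T l rm\<bar> \<le> CL * ((KX + 2) * h\<^sup>2)" by (rule ip_bound[OF c(1) crm T0 CL(2) rmb])
      have "\<bar>reduced_action (\<theta> + h) z - reduced_action \<theta> z - ip T l (\<lambda>s. cis h * (1 + y s) - (1 + x s))\<bar> \<le> K * h\<^sup>2"
        using K(2)[OF z z h, of \<theta>] by (simp add: x_def y_def l_def f_def)
      then show ?thesis using mn[OF h z] e1 e2 by (simp add: algebra_simps)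
    qed
    show ?thesis
      by (rule quadratic_lower_bound_imp_zero_slope[of "1/32", OF _ _ *]) (use K(1) CL(1) KX0 in auto)
  qed
  obtain A B l0 where l: "\<And>s. l s = Complex (if res then A * cos (Re \<kappa> * s) + B * sin (Re \<kappa> * s) else 0) l0"
  proof (cases res)
    case True
    obtain A B where "\<forall>s. l s = Complex (A * cos (Re \<kappa> * s) + B * sin (Re \<kappa> * s)) (Re (avg T (\<lambda>s. of_real (Im (f s)))))"
      using ell_res_form[OF True kre[OF True]] unfolding l_def by blast
    then show ?thesis using that[of A B] True by simp
  next
    case False
    then show ?thesis using that[of 0 0] by (simp add: l_def ell_def)
  qed
  have AB: "A = 0 \<and> B = 0" if True: res
  proof -
    define k where "k = Re \<kappa>"
    have k: "k \<noteq> 0" "cis (k * T) = 1" using kap_re[OF True] by (auto simp: k_def)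
    \<comment> \<open>For this amplitude the real part of \<open>zeta w\<close> equals that of
      \<open>l\<close>, so the pairing is a mean square, \<open>(norm w)^2 / 2\<close>; the constant
      \<open>l0\<close> meets only an oscillation of mean zero.\<close>
    define w where "w = Complex A (- B)"
    have tr: "A * cos (k * s) + B * sin (k * s) = Re (w * cis (k * s))" for s by (simp add: w_def)
    have sq: "(Re v)\<^sup>2 = (norm v)\<^sup>2 / 2 + Re (v\<^sup>2) / 2" for v
      unfolding cmod_power2 by (simp add: power2_eq_square field_simps)
    have e: "cis (k * s) = exp (\<i> * of_real k * of_real s)" for s by (simp add: cis_conv_exp mult.assoc)
    have e1: "exp (\<i> * of_real k * of_real T) = 1" using k(2) e by simp
    have "l s \<bullet> zeta w s = (norm w)\<^sup>2 / 2 + Re (w\<^sup>2 / 2 * exp (2 * \<i> * of_real k * of_real s) + (\<i> * of_real (2 / k * l0)) * w * exp (\<i> * of_real k * of_real s))" for s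
    proof -
      have "l s \<bullet> zeta w s = (Re (w * cis (k * s)))\<^sup>2 - 2 / k * l0 * Im (w * cis (k * s))"
        using True tr[of s] by (simp add: l zeta_def inner_complex_def power2_eq_square flip: k_def del: times_complex.sel)
      also have "(Re (w * cis (k * s)))\<^sup>2 = (norm w)\<^sup>2 / 2 + Re (w\<^sup>2 * (cis (k * s))\<^sup>2) / 2"
        unfolding sq by (simp add: norm_mult power_mult_distrib)
      also have "(cis (k * s))\<^sup>2 = exp (2 * \<i> * of_real k * of_real s)"
        unfolding e by (simp add: power2_eq_square flip: exp_add) (simp add: algebra_simps)
      finally show ?thesis unfolding e using k(1) by (simp add: field_simps)
    qed
    then have "ip T l (zeta w) = ravg T (\<lambda>s. (norm w)\<^sup>2 / 2) + ravg T (\<lambda>s. Re (w\<^sup>2 / 2 * exp (2 * \<i> * of_real k * of_real s) + (\<i> * of_real (2 / k * l0)) * w * exp (\<i> * of_real k * of_real s)))"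
      unfolding ip_def by (simp only:) (intro ravg_add continuous_intros)
    also have "ravg T (\<lambda>s. Re (w\<^sup>2 / 2 * exp (2 * \<i> * of_real k * of_real s) + (\<i> * of_real (2 / k * l0)) * w * exp (\<i> * of_real k * of_real s)))
       = Re (w\<^sup>2 / 2 * avg T (\<lambda>s. exp (2 * \<i> * of_real k * of_real s)) + (\<i> * of_real (2 / k * l0)) * w * avg T (\<lambda>s. exp (\<i> * of_real k * of_real s)))"
      by (subst ravg_Re[OF _ T0], (intro continuous_intros)[1], (subst avg_add avg_cmul; (intro continuous_intros)?)+) (rule refl)
    also have "avg T (\<lambda>s. exp (\<i> * of_real k * of_real s)) = 0" using k e1 by (intro avg_exp0) auto
    also have "avg T (\<lambda>s. exp (2 * \<i> * of_real k * of_real s)) = 0"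
    proof (rule avg_exp0)
      have "exp (2 * \<i> * of_real k * of_real T) = exp (\<i> * of_real k * of_real T) * exp (\<i> * of_real k * of_real T)"
        by (simp flip: exp_add) (simp add: algebra_simps)
      then show "exp (2 * \<i> * of_real k * of_real T) = 1" using e1 by simp
    qed (use k in auto)
    finally have "(norm w)\<^sup>2 / 2 = 0" using lz[of w] T0 by (simp add: ravg_const)
    then have "w = 0" by simp
    then show ?thesis by (simp add: w_def complex_eq_iff)
  qed
  have l': "l = (\<lambda>s. \<i> * of_real l0)" using l AB by (auto simp: complex_eq_iff)
  \<comment> \<open>Pairing with the rotation direction gives \<open>l0\<close> times one plus the
    mean of \<open>Re x\<close>, and this mean is at most 1/16 in modulus.\<close>
  have "l0 = 0"
  proof -
    have "(\<lambda>s. l s \<bullet> (\<i> * (1 + x s))) = (\<lambda>s. l0 * (1 + Re (x s)))"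
      by (simp add: l' inner_complex_def)
    then have "ip T l (\<lambda>s. \<i> * (1 + x s)) = l0 * (1 + ravg T (\<lambda>s. Re (x s)))"
      unfolding ip_def using periodicD(1)[OF x(1)] T0
      by (simp add: ravg_cmul ravg_add ravg_const continuous_intros)
    moreover have "\<bar>ravg T (\<lambda>s. Re (x s))\<bar> \<le> \<epsilon>"
      using order_trans[OF abs_Re_le_cmod x(2)] periodicD(1)[OF x(1)] T0 by (intro ravg_bound continuous_intros) auto
    ultimately show ?thesis using li Me by auto
  qed
  then have "ell f = (\<lambda>s. 0)" using l' by (simp add: l_def)
  then have "Lsol \<mu> x f" using reduced_sol_Lsol[OF sol[OF z, of \<theta>]] by (simp add: x_def f_def)
  then show ?thesis using z sol[OF z, of \<theta>] unfolding f_def x_def by blast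
qed

end

section \<open>The resonant case\<close>

text \<open>The derivative of \<open>Cp\<close> at \<open>d\<close> in the direction
  \<open>x\<close>; quadratic in \<open>d\<close>, linear in \<open>x\<close>.\<close>

definition DC :: "real \<Rightarrow> complex \<Rightarrow> complex \<Rightarrow> complex" where
  "DC \<mu> d x = - of_real ((1 - \<mu>) * \<mu> * (\<mu> + 1) / 2) * (d\<^sup>2 * x)
     - of_real ((1 - \<mu>) * \<mu>\<^sup>2 / 2) * (2 * d * cnj d * x + d\<^sup>2 * cnj x)
     - of_real ((1 - \<mu>) * \<mu> * (\<mu> + 1) / 2) * (2 * d * cnj d * cnj x + (cnj d)\<^sup>2 * x)
     + of_real (\<mu> * (\<mu> + 1) * (\<mu> + 2) / 2) * ((cnj d)\<^sup>2 * cnj x)"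

text \<open>The symmetric bilinear form with \<open>Qb x x\<close> equal to twice
  \<open>Qp x\<close>.\<close>

definition Qb :: "real \<Rightarrow> complex \<Rightarrow> complex \<Rightarrow> complex" where
  "Qb \<mu> x d = of_real (\<mu> * (1 - \<mu>)) * (x * d) + of_real (\<mu> * (1 - \<mu>)) * (x * cnj d + cnj x * d)
     - of_real (\<mu> * (\<mu> + 1)) * (cnj x * cnj d)"

lemma Qp_add: "Qp \<mu> (x + d) = Qp \<mu> x + Qb \<mu> x d + Qp \<mu> d"
  unfolding Qp_def Qb_def by (simp add: power2_eq_square field_simps)

lemma Qp_sub: "Qp \<mu> (x - d) = Qp \<mu> x - Qb \<mu> x d + Qp \<mu> d"
  unfolding Qp_def Qb_def by (simp add: power2_eq_square field_simps)

lemma Cp_sub: "Cp \<mu> (x - d) = Cp \<mu> x - DC \<mu> x d + DC \<mu> d x - Cp \<mu> d"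
  unfolding Cp_def DC_def by (simp add: power2_eq_square power3_eq_cube field_simps)

lemma Qb_sum:
  fixes n :: nat
  shows "Qb \<mu> x (\<Sum>j<n. of_real (m j) * d j) = (\<Sum>j<n. of_real (m j) * Qb \<mu> x (d j))"
proof (induction n)
  case (Suc n)
  have "Qb \<mu> x (a + of_real r * b) = Qb \<mu> x a + of_real r * Qb \<mu> x b" for a b r
    unfolding Qb_def by (simp add: field_simps)
  then show ?case using Suc by simp
qed (simp add: Qb_def)

lemma DC_sum:
  fixes n :: nat
  shows "DC \<mu> x (\<Sum>j<n. of_real (m j) * d j) = (\<Sum>j<n. of_real (m j) * DC \<mu> x (d j))"
proof (induction n)
  case (Suc n)
  have "DC \<mu> x (a + of_real r * b) = DC \<mu> x a + of_real r * DC \<mu> x b" for a b r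
    unfolding DC_def by (simp add: field_simps)
  then show ?case using Suc by simp
qed (simp add: DC_def)

lemma DC_add: "DC \<mu> d (x + y) = DC \<mu> d x + DC \<mu> d y"
  unfolding DC_def by (simp add: field_simps)

text \<open>\<open>Qp\<close> is the gradient of a cubic form: its derivative is symmetric, and
  Euler's identity gives the factor 2. This is what turns the mixed term of oscillation and
  correction into a pairing of the correction with \<open>Qp (zeta z)\<close>.\<close>

lemma Qb_symm: "Qb \<mu> x v \<bullet> x = 2 * (Qp \<mu> x \<bullet> v)"
  unfolding Qb_def Qp_def
  by (simp add: inner_complex_def power2_eq_square field_simps)

definition cQ :: "real \<Rightarrow> real" where
  "cQ \<mu> = \<bar>\<mu> * (1 - \<mu>) / 2\<bar> + \<bar>\<mu> * (1 - \<mu>)\<bar> + \<bar>\<mu> * (\<mu> + 1) / 2\<bar>"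

definition cC :: "real \<Rightarrow> real" where
  "cC \<mu> = \<bar>(1 - \<mu>) * \<mu> * (\<mu> + 1) / 6\<bar> + \<bar>(1 - \<mu>) * \<mu>\<^sup>2 / 2\<bar> + \<bar>(1 - \<mu>) * \<mu> * (\<mu> + 1) / 2\<bar> + \<bar>\<mu> * (\<mu> + 1) * (\<mu> + 2) / 6\<bar>"

definition cD :: "real \<Rightarrow> real" where "cD \<mu> = 3 * cC \<mu>"

lemma c_nonneg: "0 \<le> cQ \<mu>" "0 \<le> cC \<mu>" "0 \<le> cD \<mu>"
  by (auto simp: cQ_def cC_def cD_def)

lemma norm_of_real_mult: "norm (of_real r * z) = \<bar>r\<bar> * norm z" for z :: complex
  by (simp add: norm_mult)

lemma norm4: "norm (- a - b - c + d) \<le> norm a + norm b + norm c + norm d" for a b c d :: complex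
  using norm_triangle_ineq[of "- a - b - c" d] norm_triangle_ineq4[of "- a - b" c] norm_triangle_ineq4[of "- a" b] by simp

lemma norm3: "norm (a + b - c) \<le> norm a + norm b + norm c" for a b c :: complex
  using norm_triangle_ineq4[of "a + b" c] norm_triangle_ineq[of a b] by simp

lemma Qp_bound: "norm (Qp \<mu> z) \<le> cQ \<mu> * (norm z)\<^sup>2"
  unfolding Qp_def cQ_def
  by (rule order_trans[OF norm3]) (simp only: norm_of_real_mult, simp add: norm_mult norm_power power2_eq_square distrib_right)

lemma Cp_bound: "norm (Cp \<mu> z) \<le> cC \<mu> * norm z ^ 3"
proof -
  have e: "Cp \<mu> z = - (of_real ((1 - \<mu>) * \<mu> * (\<mu> + 1) / 6) * z ^ 3) - of_real ((1 - \<mu>) * \<mu>\<^sup>2 / 2) * (z\<^sup>2 * cnj z)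
     - of_real ((1 - \<mu>) * \<mu> * (\<mu> + 1) / 2) * (z * (cnj z)\<^sup>2) + of_real (\<mu> * (\<mu> + 1) * (\<mu> + 2) / 6) * (cnj z) ^ 3"
    unfolding Cp_def by simp
  show ?thesis unfolding e cC_def
    by (rule order_trans[OF norm4]) (simp only: norm_of_real_mult, simp add: norm_mult norm_power power2_eq_square power3_eq_cube distrib_right)
qed

lemma DC_bound: "norm (DC \<mu> d x) \<le> cD \<mu> * ((norm d)\<^sup>2 * norm x)"
proof -
  let ?N = "(norm d)\<^sup>2 * norm x"
  have e: "DC \<mu> d x = - (of_real ((1 - \<mu>) * \<mu> * (\<mu> + 1) / 2) * (d\<^sup>2 * x))
     - of_real ((1 - \<mu>) * \<mu>\<^sup>2 / 2) * (2 * d * cnj d * x + d\<^sup>2 * cnj x)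
     - of_real ((1 - \<mu>) * \<mu> * (\<mu> + 1) / 2) * (2 * d * cnj d * cnj x + (cnj d)\<^sup>2 * x)
     + of_real (\<mu> * (\<mu> + 1) * (\<mu> + 2) / 2) * ((cnj d)\<^sup>2 * cnj x)"
    unfolding DC_def by simp
  have b: "norm (2 * d * cnj d * x + d\<^sup>2 * cnj x) \<le> 3 * ?N" "norm (2 * d * cnj d * cnj x + (cnj d)\<^sup>2 * x) \<le> 3 * ?N"
    by (rule order_trans[OF norm_triangle_ineq]; simp add: norm_mult norm_power power2_eq_square)+
  have "norm (DC \<mu> d x) \<le> \<bar>(1 - \<mu>) * \<mu> * (\<mu> + 1) / 2\<bar> * ?N + \<bar>(1 - \<mu>) * \<mu>\<^sup>2 / 2\<bar> * (3 * ?N)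
      + \<bar>(1 - \<mu>) * \<mu> * (\<mu> + 1) / 2\<bar> * (3 * ?N) + \<bar>\<mu> * (\<mu> + 1) * (\<mu> + 2) / 2\<bar> * ?N"
    unfolding e by (rule order_trans[OF norm4], simp only: norm_of_real_mult)
      (intro add_mono mult_left_mono b; simp add: norm_mult norm_power)
  also have "\<dots> = cD \<mu> * ?N" unfolding cD_def cC_def by (simp add: abs_mult algebra_simps)
  finally show ?thesis .
qed

section \<open>Averages over the fast time\<close>

lemma res_mean:
  assumes "\<nu> \<noteq> 0" "exp (\<i> * of_real \<nu> * of_real T) = (1::complex)"
  shows "avg T (\<lambda>s. exp (\<i> * of_real \<nu> * of_real s)) = 0"
  using assms by (intro avg_exp0) auto

lemma scaled_deriv:
  assumes "\<And>t. (G has_vector_derivative g t) (at t)" "\<omega> > 0"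
  shows "((\<lambda>s. of_real \<omega> * G (s / \<omega>)) has_vector_derivative (g (s / \<omega>) :: complex)) (at s)"
proof -
  have "((G \<circ> (\<lambda>s. s / \<omega>)) has_vector_derivative ((1 / \<omega>) *\<^sub>R g (s / \<omega>))) (at s)"
    using assms by (intro vector_diff_chain_at) (auto intro!: derivative_eq_intros)
  from has_vector_derivative_mult_right[OF this, of "of_real \<omega>"] show ?thesis
    using assms(2) by (simp add: o_def scaleR_conv_of_real)
qed

lemma scaled_periodic:
  assumes "g \<in> periodic P" "\<omega> > 0" "T = \<omega> * P * of_nat q"
  shows "(\<lambda>s. g (s / \<omega>)) \<in> periodic T"
proof (rule periodicI)
  show "continuous_on UNIV (\<lambda>s. g (s / \<omega>))"
    using assms(2) by (intro continuous_on_compose2[OF periodicD(1)[OF assms(1)]] continuous_intros) auto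
  have "g (t + P * of_nat q) = g t" for t
  proof (induction q)
    case (Suc q)
    have "g (t + P * of_nat (Suc q)) = g ((t + P * of_nat q) + P)" by (simp add: algebra_simps)
    then show ?case using Suc periodicD(2)[OF assms(1)] by simp
  qed simp
  moreover have "(s + T) / \<omega> = s / \<omega> + P * of_nat q" for s using assms by (simp add: field_simps)
  ultimately show "g ((s + T) / \<omega>) = g (s / \<omega>)" for s by simp
qed

text \<open>The slow period contains exactly \<open>q\<close> fast ones, so the identity holds
  without error. The proof exhibits a primitive of \<open>g\<close> minus its mean, namely a
  rescaled periodic function.\<close>

lemma scaled_avg:
  assumes g: "g \<in> periodic P" and P: "P > 0" and w: "\<omega> > 0" and T: "T = \<omega> * P * of_nat q" and q: "q > 0"
  shows "avg T (\<lambda>s. g (s / \<omega>)) = avg P g"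
proof -
  define h where "h = Sop P 0 g"
  have h: "h \<in> periodic P" unfolding h_def by (rule Sop_periodic[OF g P])
  have dh: "(h has_vector_derivative (g t - avg P g)) (at t)" for t
    using Sop_deriv[OF g, of 0 t] by (simp add: h_def pc_def)
  have T0: "T > 0" using w P q T by simp
  note cg = periodicD(1)[OF scaled_periodic[OF g w T]]
  have "prim (\<lambda>s. g (s / \<omega>) - avg P g) T = of_real \<omega> * h (T / \<omega>) - of_real \<omega> * h (0 / \<omega>)"
    by (rule prim_unique[OF scaled_deriv[OF dh w]]) (intro continuous_intros cg)
  also have "\<dots> = 0" using periodicD(2)[OF scaled_periodic[OF h w T], of 0] by simp
  finally have "avg T (\<lambda>s. g (s / \<omega>) - avg P g) = 0" by (simp add: avg_def)
  then show ?thesis using cg T0 by (simp add: avg_diff avg_const)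
qed

text \<open>Fast oscillations: two integrations by parts against the mean-zero primitives of \<open>g\<close>.\<close>

lemma fast_osc:
  assumes g: "g \<in> periodic P" "\<And>t. norm (g t) \<le> B" and P: "P > 0" and w: "\<omega> > 0" and T: "T = \<omega> * P * of_nat q" and q: "q > 0"
    and \<nu>: "\<nu> \<noteq> 0" "exp (\<i> * of_real \<nu> * of_real T) = (1::complex)"
    and CS: "\<And>h B s. h \<in> periodic P \<Longrightarrow> (\<And>s. norm (h s) \<le> B) \<Longrightarrow> norm (Sop P 0 h s) \<le> CS * B"
  shows "norm (avg T (\<lambda>s. exp (\<i> * of_real \<nu> * of_real s) * g (s / \<omega>))) \<le> \<omega>\<^sup>2 * \<nu>\<^sup>2 * (CS * (CS * B))"
proof -
  have T0: "T > 0" using w P q T by simp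
  define G1 where "G1 = Sop P 0 g"
  define G2 where "G2 = Sop P 0 G1"
  have G1: "G1 \<in> periodic P" unfolding G1_def by (rule Sop_periodic[OF g(1) P])
  have G2: "G2 \<in> periodic P" unfolding G2_def by (rule Sop_periodic[OF G1 P])
  have d1: "(G1 has_vector_derivative (g t - avg P g)) (at t)" for t
    using Sop_deriv[OF g(1), of 0 t] by (simp add: G1_def pc_def)
  have a1: "avg P G1 = 0" using Sop_pc0[OF g(1) P, of 0] by (simp add: pc_def G1_def)
  have d2: "(G2 has_vector_derivative G1 t) (at t)" for t
    using Sop_deriv[OF G1, of 0 t] a1 by (simp add: G2_def pc_def)
  have b2: "norm (G2 t) \<le> CS * (CS * B)" for t
    unfolding G2_def by (rule CS[OF G1]) (unfold G1_def, rule CS[OF g])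
  let ?n = "- (\<i> * of_real \<nu>)"
  have r: "exp (?n * of_real T) = 1" using \<nu>(2) by (simp add: exp_minus)
  have c: "continuous_on UNIV (\<lambda>s. g (s / \<omega>))" "continuous_on UNIV (\<lambda>s. G1 (s / \<omega>))" "continuous_on UNIV (\<lambda>s. G2 (s / \<omega>))"
    using scaled_periodic[OF _ w T] g(1) G1 G2 by (auto dest: periodicD(1))
  have s1: "pc T ?n (\<lambda>s. g (s / \<omega>) - avg P g) = ?n * pc T ?n (\<lambda>s. of_real \<omega> * G1 (s / \<omega>))"
    by (rule pc_deriv[OF _ scaled_deriv[OF d1 w] _ T0 r]) (intro continuous_intros c periodic_mult periodic_const scaled_periodic[OF G1 w T])+
  have s2: "pc T ?n (\<lambda>s. G1 (s / \<omega>)) = ?n * pc T ?n (\<lambda>s. of_real \<omega> * G2 (s / \<omega>))"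
    by (rule pc_deriv[OF _ scaled_deriv[OF d2 w] _ T0 r]) (intro continuous_intros c periodic_mult periodic_const scaled_periodic[OF G2 w T])+
  have m: "pc T ?n (\<lambda>s. of_real \<omega> * f s) = of_real \<omega> * pc T ?n f" if "continuous_on UNIV f" for f
  proof -
    have "(\<lambda>s. exp (- ?n * of_real s) * (of_real \<omega> * f s)) = (\<lambda>s. of_real \<omega> * (exp (- ?n * of_real s) * f s))" by (simp add: mult_ac)
    then show ?thesis unfolding pc_def by (simp only:) (intro avg_cmul continuous_intros that)
  qed
  have k: "pc T ?n (\<lambda>s. g (s / \<omega>) - avg P g) = avg T (\<lambda>s. exp (\<i> * of_real \<nu> * of_real s) * g (s / \<omega>))"
  proof -
    have "pc T ?n (\<lambda>s. g (s / \<omega>) - avg P g) = avg T (\<lambda>s. exp (\<i> * of_real \<nu> * of_real s) * g (s / \<omega>) - avg P g * exp (\<i> * of_real \<nu> * of_real s))"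
      unfolding pc_def by (simp add: algebra_simps)
    also have "\<dots> = avg T (\<lambda>s. exp (\<i> * of_real \<nu> * of_real s) * g (s / \<omega>)) - avg P g * avg T (\<lambda>s. exp (\<i> * of_real \<nu> * of_real s))"
      by (subst avg_diff avg_cmul; (intro continuous_intros c)?)+ (rule refl)
    finally show ?thesis using res_mean[OF \<nu>] by simp
  qed
  have "norm (pc T ?n (\<lambda>s. G2 (s / \<omega>))) \<le> CS * (CS * B)"
    unfolding pc_def
  proof (rule avg_bound[OF _ T0])
    show "norm (exp (- ?n * of_real s) * G2 (s / \<omega>)) \<le> CS * (CS * B)" for s
      using b2 by (simp add: norm_mult)
  qed (intro continuous_intros c)
  then have "\<omega>\<^sup>2 * \<nu>\<^sup>2 * norm (pc T ?n (\<lambda>s. G2 (s / \<omega>))) \<le> \<omega>\<^sup>2 * \<nu>\<^sup>2 * (CS * (CS * B))" by (intro mult_left_mono) auto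
  moreover have "norm (avg T (\<lambda>s. exp (\<i> * of_real \<nu> * of_real s) * g (s / \<omega>))) = \<omega>\<^sup>2 * \<nu>\<^sup>2 * norm (pc T ?n (\<lambda>s. G2 (s / \<omega>)))"
    unfolding k[symmetric] s1 m[OF c(2)] s2 m[OF c(3)]
    using w by (simp add: norm_mult power2_eq_square)
  ultimately show ?thesis by simp
qed

text \<open>After expansion the integrand has the slow frequencies \<beta> and
  \<open>\<beta> + k\<close>, \<open>\<beta> - k\<close>. Each nonzero one gains
  \<open>\<omega>^2\<close> against the fast factor; only \<beta> = 0 leaves a mean. The bound 6 on
  the frequencies yields the 36.\<close>

lemma osc3:
  fixes h0 h1 h2 :: complex
  assumes g: "g \<in> periodic P" "\<And>t. norm (g t) \<le> B" and P: "P > 0" and w: "\<omega> > 0" and T: "T = \<omega> * P * of_nat q" and q: "q > 0"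
    and k: "exp (\<i> * of_real k * of_real T) = (1::complex)" and b: "exp (\<i> * of_real \<beta> * of_real T) = (1::complex)"
    and ne: "\<beta> + k \<noteq> 0" "\<beta> - k \<noteq> 0" and sz: "\<bar>\<beta>\<bar> + \<bar>k\<bar> \<le> 6"
    and CS: "\<And>h B s. h \<in> periodic P \<Longrightarrow> (\<And>s. norm (h s) \<le> B) \<Longrightarrow> norm (Sop P 0 h s) \<le> CS * B" "CS \<ge> 0"
  defines "H \<equiv> \<lambda>s. h0 + h1 * exp (\<i> * of_real k * of_real s) + h2 * exp (- \<i> * of_real k * of_real s)"
  shows "norm (avg T (\<lambda>s. H s * (exp (\<i> * of_real \<beta> * of_real s) * g (s / \<omega>))) - (if \<beta> = 0 then h0 * avg P g else 0))
     \<le> 36 * CS\<^sup>2 * B * (norm h0 + norm h1 + norm h2) * \<omega>\<^sup>2"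
proof -
  have B0: "0 \<le> B" using g(2)[of 0] norm_ge_zero order_trans by blast
  note c = periodicD(1)[OF scaled_periodic[OF g(1) w T]]
  have e: "H s * (exp (\<i> * of_real \<beta> * of_real s) * g (s / \<omega>)) =
      h0 * (exp (\<i> * of_real \<beta> * of_real s) * g (s / \<omega>)) + h1 * (exp (\<i> * of_real (\<beta> + k) * of_real s) * g (s / \<omega>))
      + h2 * (exp (\<i> * of_real (\<beta> - k) * of_real s) * g (s / \<omega>))" for s
  proof -
    have "exp (\<i> * of_real (\<beta> + k) * of_real s) = exp (\<i> * of_real k * of_real s) * exp (\<i> * of_real \<beta> * of_real s)"
      "exp (\<i> * of_real (\<beta> - k) * of_real s) = exp (- \<i> * of_real k * of_real s) * exp (\<i> * of_real \<beta> * of_real s)"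
      by (simp_all flip: exp_add) (simp_all add: algebra_simps)
    then show ?thesis unfolding H_def by (simp add: algebra_simps)
  qed
  have r: "exp (\<i> * of_real (\<beta> + k) * of_real T) = (1::complex)" "exp (\<i> * of_real (\<beta> - k) * of_real T) = (1::complex)"
  proof -
    have "exp (\<i> * of_real (\<beta> + k) * of_real T) = exp (\<i> * of_real \<beta> * of_real T) * exp (\<i> * of_real k * of_real T)"
      "exp (\<i> * of_real (\<beta> - k) * of_real T) = exp (\<i> * of_real \<beta> * of_real T) / (exp (\<i> * of_real k * of_real T) :: complex)"
      by (simp_all flip: exp_add exp_diff) (simp_all add: algebra_simps)
    then show "exp (\<i> * of_real (\<beta> + k) * of_real T) = (1::complex)" "exp (\<i> * of_real (\<beta> - k) * of_real T) = (1::complex)" using k b by simp_all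
  qed
  define D where "D = 36 * CS\<^sup>2 * B * \<omega>\<^sup>2"
  have os: "norm (avg T (\<lambda>s. exp (\<i> * of_real \<nu> * of_real s) * g (s / \<omega>))) \<le> D"
    if "\<nu> \<noteq> 0" "exp (\<i> * of_real \<nu> * of_real T) = (1::complex)" "\<bar>\<nu>\<bar> \<le> 6" for \<nu>
  proof -
    have "\<nu>\<^sup>2 \<le> 36" using power_mono[OF that(3), of 2] by simp
    then have "\<omega>\<^sup>2 * \<nu>\<^sup>2 * (CS * (CS * B)) \<le> \<omega>\<^sup>2 * 36 * (CS * (CS * B))"
      using CS(2) B0 by (intro mult_right_mono mult_left_mono) auto
    then show ?thesis using fast_osc[OF g P w T q that(1,2) CS(1)] by (simp add: D_def power2_eq_square mult_ac)
  qed
  have D0: "0 \<le> D" using B0 by (simp add: D_def)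
  let ?a = "\<lambda>\<nu>. avg T (\<lambda>s. exp (\<i> * of_real \<nu> * of_real s) * g (s / \<omega>))"
  have av: "avg T (\<lambda>s. H s * (exp (\<i> * of_real \<beta> * of_real s) * g (s / \<omega>))) = h0 * ?a \<beta> + h1 * ?a (\<beta> + k) + h2 * ?a (\<beta> - k)"
    unfolding e by (subst avg_add avg_cmul; (intro continuous_intros c)?)+ (rule refl)
  have z: "norm (?a \<beta> - (if \<beta> = 0 then avg P g else 0)) \<le> D"
  proof (cases "\<beta> = 0")
    case True then show ?thesis using scaled_avg[OF g(1) P w T q] D0 by simp
  next
    case False then show ?thesis using os[of \<beta>] b sz by simp
  qed
  have "avg T (\<lambda>s. H s * (exp (\<i> * of_real \<beta> * of_real s) * g (s / \<omega>))) - (if \<beta> = 0 then h0 * avg P g else 0)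
     = h0 * (?a \<beta> - (if \<beta> = 0 then avg P g else 0)) + h1 * ?a (\<beta> + k) + h2 * ?a (\<beta> - k)"
    unfolding av by (simp add: right_diff_distrib)
  also have "norm \<dots> \<le> norm h0 * D + norm h1 * D + norm h2 * D"
  proof (intro norm_triangle_le add_mono)
    show "norm (h0 * (?a \<beta> - (if \<beta> = 0 then avg P g else 0))) \<le> norm h0 * D"
      unfolding norm_mult by (rule mult_left_mono[OF z]) simp
    show "norm (h1 * ?a (\<beta> + k)) \<le> norm h1 * D" unfolding norm_mult using sz by (intro mult_left_mono os ne r) auto
    show "norm (h2 * ?a (\<beta> - k)) \<le> norm h2 * D" unfolding norm_mult using sz by (intro mult_left_mono os ne r) auto
  qed
  finally show ?thesis by (simp add: D_def algebra_simps)
qed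

text \<open>The counterpart of \<open>osc3\<close> without a fast factor, where orthogonality of
  harmonics makes it exact.\<close>

lemma exact3:
  assumes T: "T > 0" and k: "exp (\<i> * of_real k * of_real T) = (1::complex)" and b: "exp (\<i> * of_real \<beta> * of_real T) = (1::complex)"
    and ne: "\<beta> + k \<noteq> 0" "\<beta> - k \<noteq> 0"
  shows "avg T (\<lambda>s. (h0 + h1 * exp (\<i> * of_real k * of_real s) + h2 * exp (- \<i> * of_real k * of_real s)) * exp (\<i> * of_real \<beta> * of_real s)) = (if \<beta> = 0 then h0 else 0)"
proof -
  have e: "(h0 + h1 * exp (\<i> * of_real k * of_real s) + h2 * exp (- \<i> * of_real k * of_real s)) * exp (\<i> * of_real \<beta> * of_real s) =
      h0 * exp (\<i> * of_real \<beta> * of_real s) + h1 * exp (\<i> * of_real (\<beta> + k) * of_real s) + h2 * exp (\<i> * of_real (\<beta> - k) * of_real s)" for s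
  proof -
    have "exp (\<i> * of_real (\<beta> + k) * of_real s) = exp (\<i> * of_real k * of_real s) * exp (\<i> * of_real \<beta> * of_real s)"
      "exp (\<i> * of_real (\<beta> - k) * of_real s) = exp (- \<i> * of_real k * of_real s) * exp (\<i> * of_real \<beta> * of_real s)"
      by (simp_all flip: exp_add) (simp_all add: algebra_simps)
    then show ?thesis by (simp add: algebra_simps)
  qed
  have r: "exp (\<i> * of_real (\<beta> + k) * of_real T) = (1::complex)" "exp (\<i> * of_real (\<beta> - k) * of_real T) = (1::complex)"
  proof -
    have "exp (\<i> * of_real (\<beta> + k) * of_real T) = exp (\<i> * of_real \<beta> * of_real T) * exp (\<i> * of_real k * of_real T)"
      "exp (\<i> * of_real (\<beta> - k) * of_real T) = exp (\<i> * of_real \<beta> * of_real T) / (exp (\<i> * of_real k * of_real T) :: complex)"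
      by (simp_all flip: exp_add exp_diff) (simp_all add: algebra_simps)
    then show "exp (\<i> * of_real (\<beta> + k) * of_real T) = (1::complex)" "exp (\<i> * of_real (\<beta> - k) * of_real T) = (1::complex)" using k b by simp_all
  qed
  have "avg T (\<lambda>s. exp (\<i> * of_real \<beta> * of_real s)) = (if \<beta> = 0 then 1 else 0)"
    using res_mean[OF _ b] T by (auto simp: avg_const)
  then show ?thesis unfolding e
    using res_mean[OF ne(1) r(1)] res_mean[OF ne(2) r(2)]
    by (subst avg_add avg_cmul; (intro continuous_intros)?)+ simp
qed

section \<open>Harmonics of the resonant oscillation\<close>

text \<open>Adds the explicit motion of the primaries: periodic in the fast time
  \<open>s / \<omega>\<close> and carried by the slow rotation of the frame. The relation
  \<open>\<omega> \<le> \<epsilon>\<close> converts a gain of \<open>\<omega>^2\<close> into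
  \<open>\<epsilon>^2\<close>.\<close>

locale resonant_circ = perturbed_circ +
  fixes qc :: "nat \<Rightarrow> real \<Rightarrow> complex" and \<omega> CR CS K :: real and p q :: nat
  assumes d0_def: "\<And>j s. j < n \<Longrightarrow> d0 j s = of_real \<epsilon> * exp (- \<i> * of_real s) * qc j (s / \<omega>)"
    and qc: "\<And>j. j < n \<Longrightarrow> qc j \<in> periodic (2 * pi)" "\<And>j t. j < n \<Longrightarrow> norm (qc j t) \<le> M"
    and om: "0 < \<omega>" "\<omega> \<le> \<epsilon>" and Tq: "T = \<omega> * (2 * pi) * of_nat q" "q > 0" and Tp: "T = 2 * pi * of_nat p"
    and CR: "\<And>z. norm z \<le> 1/4 \<Longrightarrow> norm (Psi \<mu> z - Qp \<mu> z - Cp \<mu> z) \<le> CR * norm z ^ 4" "CR \<ge> 0"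
    and CS: "\<And>h B s. h \<in> periodic (2 * pi) \<Longrightarrow> (\<And>s. norm (h s) \<le> B) \<Longrightarrow> norm (Sop (2 * pi) 0 h s) \<le> CS * B" "CS \<ge> 0"
    and isres: res and mu1: "\<mu> \<ge> 1" "\<mu> \<noteq> 3/2"
    and K: "\<rho> = K * \<epsilon>\<^sup>2" "K \<ge> 0"
begin

definition "k = Re \<kappa>"

lemma k2: "k\<^sup>2 = 4 - 2 * \<mu>" "k \<noteq> 0" using kap_re isres by (auto simp: k_def)

lemma mu_k: "\<mu> = (4 - k\<^sup>2) / 2" using k2 by simp

text \<open>Together with \<open>k_ne\<close> and \<open>k \<noteq> 0\<close> this excludes every
  integer value of \<open>k\<close>, hence any coincidence with the frequencies of the rotating
  frame.\<close>

lemma k_le: "\<bar>k\<bar> \<le> 3/2"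
proof -
  have "k\<^sup>2 \<le> (3/2)\<^sup>2" using k2 mu1 by (simp add: power2_eq_square)
  then show ?thesis using abs_le_square_iff[of k "3/2"] by simp
qed

text \<open>The place where \<alpha> = 2 is excluded: there the oscillation would have the frequency
  of the orbit itself, as for Kepler ellipses.\<close>

lemma k_ne: "\<bar>k\<bar> \<noteq> 1"
proof
  assume "\<bar>k\<bar> = 1"
  then have "k\<^sup>2 = 1" using power2_abs[of k] by simp
  then show False using k2 mu1 by simp
qed

lemma k_exp: "exp (\<i> * of_real k * of_real T) = (1::complex)" "exp (\<i> * of_real (2 * k) * of_real T) = (1::complex)"
   "exp (\<i> * of_real (- k) * of_real T) = (1::complex)"
proof -
  have "cis (k * T) = 1" using kap_re(3)[OF isres] by (simp add: k_def)
  then show *: "exp (\<i> * of_real k * of_real T) = (1::complex)" by (simp add: cis_conv_exp mult.assoc)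
  have "exp (\<i> * of_real (2 * k) * of_real T) = exp (\<i> * of_real k * of_real T) * exp (\<i> * of_real k * of_real T)"
    by (simp flip: exp_add) (simp add: algebra_simps)
  then show "exp (\<i> * of_real (2 * k) * of_real T) = (1::complex)" using * by simp
  show "exp (\<i> * of_real (- k) * of_real T) = (1::complex)" using * by (simp add: exp_minus)
qed

lemma int_exp: "exp (\<i> * of_real (of_int b) * of_real T) = (1::complex)"
proof -
  have "exp (\<i> * of_real (of_int b) * of_real T) = cis (of_int b * T)" by (simp add: cis_conv_exp mult.assoc)
  also have "of_int b * T = 2 * pi * of_int (b * int p)" unfolding Tp by simp
  finally show ?thesis using cis_multiple_2pi[of "of_int (b * int p)"] by simp
qed

text \<open>\<open>A1\<close> and \<open>B1\<close> are the coefficients of \<open>zeta z\<close>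
  along the harmonics of frequency \<open>k\<close> and \<open>- k\<close>.\<close>

definition "A1 = 1/2 - 1/k"
definition "B1 = 1/2 + 1/k"

definition "Ek z = (\<lambda>s. z * exp (\<i> * of_real k * of_real s))"

lemma cnj_exp: "cnj (exp (\<i> * of_real a * of_real s)) = exp (- \<i> * of_real a * of_real s)"
  by (simp add: exp_cnj)

lemma zeta_Ek: "zeta z s = of_real A1 * Ek z s + of_real B1 * cnj (Ek z s)"
proof -
  have c: "cis (k * s) = exp (\<i> * of_real k * of_real s)" by (simp add: cis_conv_exp mult.assoc)
  have "zeta z s = Complex (Re (Ek z s)) (- (2 / k) * Im (Ek z s))"
    using isres by (simp add: zeta_def Ek_def c flip: k_def del: times_complex.sel)
  also have "\<dots> = of_real A1 * Ek z s + of_real B1 * cnj (Ek z s)"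
    using k2 by (simp add: complex_eq_iff A1_def B1_def field_simps)
  finally show ?thesis .
qed

lemma norm_Ek: "norm (Ek z s) = norm z" by (simp add: Ek_def norm_mult)

lemma Ek_sq: "Ek z s * cnj (Ek z s) = of_real ((norm z)\<^sup>2)"
  using complex_norm_square[of "Ek z s"] norm_Ek[of z s] by simp

lemma Ek2: "(Ek z s)\<^sup>2 = z\<^sup>2 * exp (\<i> * of_real (2 * k) * of_real s)"
  "(cnj (Ek z s))\<^sup>2 = (cnj z)\<^sup>2 * exp (- \<i> * of_real (2 * k) * of_real s)"
proof -
  have "(exp (\<i> * of_real k * of_real s))\<^sup>2 = exp (\<i> * of_real (2 * k) * of_real s)"
    by (simp add: power2_eq_square flip: exp_add) (simp add: algebra_simps)
  moreover have "(exp (- \<i> * of_real k * of_real s))\<^sup>2 = exp (- \<i> * of_real (2 * k) * of_real s)"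
    by (simp add: power2_eq_square flip: exp_add) (simp add: algebra_simps)
  ultimately show "(Ek z s)\<^sup>2 = z\<^sup>2 * exp (\<i> * of_real (2 * k) * of_real s)"
    "(cnj (Ek z s))\<^sup>2 = (cnj z)\<^sup>2 * exp (- \<i> * of_real (2 * k) * of_real s)"
    unfolding Ek_def complex_cnj_mult cnj_exp power_mult_distrib by simp_all
qed

text \<open>Undetermined coefficients for the particular solution \<open>W\<close>:
  \<open>w0\<close> is its constant term, \<open>w1\<close> and \<open>w2\<close> are the sum and
  the difference of its coefficients at the frequencies \<open>2 * k\<close> and
  \<open>- 2 * k\<close>.\<close>

definition "w0 = (2 * \<mu> - 1) / 4 - 1 / k\<^sup>2"
definition "w1 = (2 * \<mu> - 1) * \<mu> / (6 * k\<^sup>2)"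
definition "w2 = (2 * \<mu> / k - 4 * k * w1) / (4 * k\<^sup>2)"

text \<open>The second harmonic: \<open>W z\<close> is mapped by the linearized operator to the quadratic part of the force along \<open>zeta z\<close>.\<close>

definition "W z = (\<lambda>s. of_real (w0 * (norm z)\<^sup>2) + of_real ((w1 + w2) / 2) * (Ek z s)\<^sup>2 + of_real ((w1 - w2) / 2) * (cnj (Ek z s))\<^sup>2)"

definition "q0 = \<mu> * (1 - \<mu>) * A1 * B1 + \<mu> * (1 - \<mu>) * (A1\<^sup>2 + B1\<^sup>2) - \<mu> * (\<mu> + 1) * A1 * B1"
definition "q1 = \<mu> * (1 - \<mu>) / 2 * A1\<^sup>2 + \<mu> * (1 - \<mu>) * A1 * B1 - \<mu> * (\<mu> + 1) / 2 * B1\<^sup>2"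
definition "q2 = \<mu> * (1 - \<mu>) / 2 * B1\<^sup>2 + \<mu> * (1 - \<mu>) * A1 * B1 - \<mu> * (\<mu> + 1) / 2 * A1\<^sup>2"

lemma Qp_zeta: "Qp \<mu> (zeta z s) = of_real (q0 * (norm z)\<^sup>2) + of_real q1 * (Ek z s)\<^sup>2 + of_real q2 * (cnj (Ek z s))\<^sup>2"
proof -
  have "Qp \<mu> (of_real a * e + of_real b * cnj e) =
     of_real (\<mu> * (1 - \<mu>) * a * b + \<mu> * (1 - \<mu>) * (a\<^sup>2 + b\<^sup>2) - \<mu> * (\<mu> + 1) * a * b) * (e * cnj e)
     + of_real (\<mu> * (1 - \<mu>) / 2 * a\<^sup>2 + \<mu> * (1 - \<mu>) * a * b - \<mu> * (\<mu> + 1) / 2 * b\<^sup>2) * e\<^sup>2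
     + of_real (\<mu> * (1 - \<mu>) / 2 * b\<^sup>2 + \<mu> * (1 - \<mu>) * a * b - \<mu> * (\<mu> + 1) / 2 * a\<^sup>2) * (cnj e)\<^sup>2" for a b e
    unfolding Qp_def by (simp add: power2_eq_square field_simps)
  from this[of A1 "Ek z s" B1] show ?thesis unfolding zeta_Ek Ek_sq q0_def q1_def q2_def by simp
qed

text \<open>The equations obtained by matching the frequencies 0, \<open>2 * k\<close> and
  \<open>- 2 * k\<close>; they become rational identities in \<open>k\<close> once \<mu> is replaced
  by \<open>(4 - k^2) / 2\<close>.\<close>

lemma w_eqs: "- 2 * \<mu> * w0 = q0" "(- 4 * k\<^sup>2 - 4 * k) * ((w1 + w2) / 2) - \<mu> * w1 = q1"
   "(- 4 * k\<^sup>2 + 4 * k) * ((w1 - w2) / 2) - \<mu> * w1 = q2"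
  unfolding q0_def q1_def q2_def w0_def w2_def w1_def A1_def B1_def
  unfolding mu_k using k2(2) by (simp_all add: field_simps power2_eq_square)

lemma dEk: "(Ek z has_vector_derivative (\<i> * of_real k * Ek z s)) (at s)"
  unfolding Ek_def using has_vector_derivative_mult_right[OF exp_deriv[of "\<i> * of_real k" s], of z]
  by (simp add: mult_ac)

lemma dcEk: "((\<lambda>s. cnj (Ek z s)) has_vector_derivative (- \<i> * of_real k * cnj (Ek z s))) (at s)"
  using bounded_linear.has_vector_derivative[OF bounded_linear_cnj dEk[of z s]] by simp

lemma W_Lsol: "Lsol \<mu> (W z) (\<lambda>s. Qp \<mu> (zeta z s))"
proof -
  define c1 where "c1 = (w1 + w2) / 2"
  define c2 where "c2 = (w1 - w2) / 2"
  define W' where "W' = (\<lambda>s. of_real c1 * (2 * \<i> * of_real k * (Ek z s)\<^sup>2) + of_real c2 * (- 2 * \<i> * of_real k * (cnj (Ek z s))\<^sup>2))"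
  have 1: "(W z has_vector_derivative W' s) (at s)" for s
    unfolding W_def W'_def c1_def[symmetric] c2_def[symmetric] power2_eq_square
    by (rule derivative_eq_intros dEk dcEk refl)+ (simp add: algebra_simps)
  have 2: "(W' has_vector_derivative (of_real (- 4 * k\<^sup>2 * c1) * (Ek z s)\<^sup>2 + of_real (- 4 * k\<^sup>2 * c2) * (cnj (Ek z s))\<^sup>2)) (at s)" for s
    unfolding W'_def power2_eq_square
    by (rule derivative_eq_intros dEk dcEk refl)+ (simp add: algebra_simps)
  have 3: "of_real (- 4 * k\<^sup>2 * c1) * (Ek z s)\<^sup>2 + of_real (- 4 * k\<^sup>2 * c2) * (cnj (Ek z s))\<^sup>2
     = Qp \<mu> (zeta z s) - 2 * \<i> * W' s + of_real (2 * \<mu> * Re (W z s))" for s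
  proof -
    let ?e = "(Ek z s)\<^sup>2"
    have re: "complex_of_real (2 * Re (W z s)) = of_real (2 * w0 * (norm z)\<^sup>2) + of_real w1 * (?e + cnj ?e)"
    proof -
      have "complex_of_real (2 * Re (of_real a + of_real b * e + of_real c * cnj e)) = of_real (2 * a) + of_real (b + c) * (e + cnj e)" for a b c e
        by (simp add: complex_eq_iff algebra_simps)
      from this[of "w0 * (norm z)\<^sup>2" "(w1 + w2) / 2" ?e "(w1 - w2) / 2"] show ?thesis
        unfolding W_def by (simp add: field_simps)
    qed
    have "of_real (2 * \<mu> * Re (W z s)) = of_real \<mu> * complex_of_real (2 * Re (W z s))" by simp
    also have "\<dots> = of_real (2 * \<mu> * w0 * (norm z)\<^sup>2) + of_real (\<mu> * w1) * (?e + cnj ?e)"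
      unfolding re by (simp add: algebra_simps)
    finally have r: "of_real (2 * \<mu> * Re (W z s)) = of_real (2 * \<mu> * w0 * (norm z)\<^sup>2) + of_real (\<mu> * w1) * (?e + (cnj (Ek z s))\<^sup>2)" by simp
    have q: "q0 = - 2 * \<mu> * w0" "q1 = (- 4 * k\<^sup>2 - 4 * k) * c1 - \<mu> * w1" "q2 = (- 4 * k\<^sup>2 + 4 * k) * c2 - \<mu> * w1"
      using w_eqs by (auto simp: c1_def c2_def)
    show ?thesis unfolding r Qp_zeta q W'_def by (simp add: algebra_simps)
  qed
  show ?thesis unfolding Lsol_def using 1 2 unfolding 3 by blast
qed

lemma W_periodic: "W z \<in> periodic T"
proof -
  have e: "(\<lambda>s. exp (\<i> * of_real k * of_real s)) \<in> periodic T" using exp_periodic[of "\<i> * of_real k" T] k_exp by simp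
  have E: "Ek z \<in> periodic T" unfolding Ek_def by (intro periodic_mult periodic_const e)
  have "(\<lambda>s. cnj (Ek z s)) \<in> periodic T" using E by (auto simp: periodic_def intro!: continuous_intros)
  then show ?thesis unfolding W_def power2_eq_square using E by (intro periodic_add periodic_mult periodic_const) auto
qed

definition "cW = \<bar>w0\<bar> + \<bar>(w1 + w2) / 2\<bar> + \<bar>(w1 - w2) / 2\<bar>"

lemma cW0: "0 \<le> cW" by (simp add: cW_def)

lemma W_bound: "norm (W z s) \<le> cW * (norm z)\<^sup>2"
proof -
  have "norm (W z s) \<le> norm (of_real w0 * of_real ((norm z)\<^sup>2) :: complex) + norm (of_real ((w1 + w2) / 2) * (Ek z s)\<^sup>2) + norm (of_real ((w1 - w2) / 2) * (cnj (Ek z s))\<^sup>2)"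
    unfolding W_def of_real_mult by (meson add_right_mono norm_triangle_ineq order_trans)
  also have "\<dots> = cW * (norm z)\<^sup>2"
    unfolding norm_of_real_mult norm_power complex_mod_cnj norm_Ek norm_of_real by (simp add: cW_def algebra_simps)
  finally show ?thesis .
qed

lemma ip_Re: "continuous_on UNIV a \<Longrightarrow> continuous_on UNIV b \<Longrightarrow> ip T a b = Re (avg T (\<lambda>s. cnj (b s) * a s))"
proof -
  assume c: "continuous_on UNIV a" "continuous_on UNIV b"
  have e: "(\<lambda>s. a s \<bullet> b s) = (\<lambda>s. Re (cnj (b s) * a s))" by (auto simp: inner_complex_def algebra_simps)
  show ?thesis unfolding ip_def e by (rule ravg_Re[OF _ T0]) (intro continuous_intros c)
qed

lemma cW3: "cnj (W z s) = of_real (w0 * (norm z)\<^sup>2) + (of_real ((w1 - w2) / 2) * z\<^sup>2) * exp (\<i> * of_real (2 * k) * of_real s)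
    + (of_real ((w1 + w2) / 2) * (cnj z)\<^sup>2) * exp (- \<i> * of_real (2 * k) * of_real s)"
proof -
  have "cnj (W z s) = of_real (w0 * (norm z)\<^sup>2) + of_real ((w1 - w2) / 2) * (Ek z s)\<^sup>2 + of_real ((w1 + w2) / 2) * (cnj (Ek z s))\<^sup>2"
    unfolding W_def by simp
  then show ?thesis unfolding Ek2 by (simp only: mult.assoc)
qed

lemma zeta3: "cnj (zeta z s) = 0 + (of_real B1 * z) * exp (\<i> * of_real k * of_real s) + (of_real A1 * cnj z) * exp (- \<i> * of_real k * of_real s)"
  unfolding zeta_Ek Ek_def by (simp add: exp_cnj)

text \<open>The quadratic part has frequencies 0 and \<open>2 * k\<close> up to sign, the
  oscillation has \<open>k\<close>. Without this orthogonality a term growing like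
  \<open>K^2\<close> would overwhelm the detuning, which is linear in \<open>K\<close>.\<close>

lemma ip_Qp_zeta0: "ip T (\<lambda>s. Qp \<mu> (zeta z s)) (zeta z) = 0"
proof -
  let ?H = "\<lambda>s. of_real (q0 * (norm z)\<^sup>2) + (of_real q1 * z\<^sup>2) * exp (\<i> * of_real (2 * k) * of_real s)
    + (of_real q2 * (cnj z)\<^sup>2) * exp (- \<i> * of_real (2 * k) * of_real s)"
  have Q: "Qp \<mu> (zeta z s) = ?H s" for s unfolding Qp_zeta Ek2 by simp
  have cH: "continuous_on UNIV ?H" by (intro continuous_intros)
  have e: "cnj (zeta z s) * Qp \<mu> (zeta z s) = (of_real B1 * z) * (?H s * exp (\<i> * of_real k * of_real s)) + (of_real A1 * cnj z) * (?H s * exp (\<i> * of_real (- k) * of_real s))" for s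
    unfolding Q zeta3 by (simp add: algebra_simps)
  have "avg T (\<lambda>s. ?H s * exp (\<i> * of_real k * of_real s)) = 0"
    using exact3[OF T0 k_exp(2) k_exp(1), of "of_real (q0 * (norm z)\<^sup>2)" "of_real q1 * z\<^sup>2" "of_real q2 * (cnj z)\<^sup>2"] k2 by simp
  moreover have "avg T (\<lambda>s. ?H s * exp (\<i> * of_real (- k) * of_real s)) = 0"
    using exact3[OF T0 k_exp(2) k_exp(3), of "of_real (q0 * (norm z)\<^sup>2)" "of_real q1 * z\<^sup>2" "of_real q2 * (cnj z)\<^sup>2"] k2 by simp
  ultimately have "avg T (\<lambda>s. cnj (zeta z s) * Qp \<mu> (zeta z s)) = 0"
    unfolding e by (subst avg_add avg_cmul; (intro continuous_intros cH)?)+ simp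
  moreover have "continuous_on UNIV (\<lambda>s. Qp \<mu> (zeta z s))" unfolding Q by (rule cH)
  ultimately show ?thesis by (simp add: ip_Re periodicD(1)[OF zeta_periodic])
qed

text \<open>The only common frequency is 0, where the constant of \<open>W\<close> is real and that
  of \<open>ell\<close> imaginary. So when the operator is moved onto \<open>W\<close>, the unsolved
  part does not show up.\<close>

lemma ip_W_ell: assumes f: "f \<in> periodic T" shows "ip T (ell f) (W z) = 0"
proof -
  obtain A B where AB: "\<And>s. ell f s = Complex (A * cos (k * s) + B * sin (k * s)) (Re (avg T (\<lambda>s. of_real (Im (f s)))))"
    using ell_res_form[OF isres kre[OF isres]] unfolding k_def by blast
  define l0 where "l0 = Re (avg T (\<lambda>s. of_real (Im (f s))))"
  define c1 c2 where "c1 = (of_real A - \<i> * of_real B) / 2" and "c2 = (of_real A + \<i> * of_real B) / (2::complex)"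
  have ex: "exp (\<i> * of_real k * of_real s) = cis (k * s)" "exp (\<i> * of_real (- k) * of_real s) = cis (- (k * s))" for s
    by (simp_all add: cis_conv_exp mult.assoc)
  have l: "ell f s = c1 * exp (\<i> * of_real k * of_real s) + c2 * exp (\<i> * of_real (- k) * of_real s) + (\<i> * of_real l0) * exp (\<i> * of_real 0 * of_real s)" for s
    unfolding ex AB l0_def[symmetric] by (simp add: c1_def c2_def complex_eq_iff) (simp add: field_simps)
  let ?H = "\<lambda>s. of_real (w0 * (norm z)\<^sup>2) + (of_real ((w1 - w2) / 2) * z\<^sup>2) * exp (\<i> * of_real (2 * k) * of_real s)
    + (of_real ((w1 + w2) / 2) * (cnj z)\<^sup>2) * exp (- \<i> * of_real (2 * k) * of_real s)"
  have cH: "continuous_on UNIV ?H" by (intro continuous_intros)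
  have e: "cnj (W z s) * ell f s = c1 * (?H s * exp (\<i> * of_real k * of_real s)) + c2 * (?H s * exp (\<i> * of_real (- k) * of_real s))
     + (\<i> * of_real l0) * (?H s * exp (\<i> * of_real 0 * of_real s))" for s
  proof -
    have "H * (c1 * a + c2 * b + c * d) = c1 * (H * a) + c2 * (H * b) + c * (H * d)" for H a b c d
      by (simp add: algebra_simps)
    then show ?thesis unfolding cW3 l .
  qed
  have av: "avg T (\<lambda>s. cnj (W z s) * ell f s) = c1 * avg T (\<lambda>s. ?H s * exp (\<i> * of_real k * of_real s)) + c2 * avg T (\<lambda>s. ?H s * exp (\<i> * of_real (- k) * of_real s))
     + (\<i> * of_real l0) * avg T (\<lambda>s. ?H s * exp (\<i> * of_real 0 * of_real s))"
    unfolding e by (subst avg_add avg_cmul; (intro continuous_intros cH)?)+ (rule refl)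
  note ee = exact3[OF T0 k_exp(2), of _ "of_real (w0 * (norm z)\<^sup>2)" "of_real ((w1 - w2) / 2) * z\<^sup>2" "of_real ((w1 + w2) / 2) * (cnj z)\<^sup>2"]
  have z1: "avg T (\<lambda>s. ?H s * exp (\<i> * of_real k * of_real s)) = 0" using ee[OF k_exp(1)] k2 by simp
  have z2: "avg T (\<lambda>s. ?H s * exp (\<i> * of_real (- k) * of_real s)) = 0" using ee[OF k_exp(3)] k2 by simp
  have z3: "avg T (\<lambda>s. ?H s * exp (\<i> * of_real 0 * of_real s)) = of_real (w0 * (norm z)\<^sup>2)" using ee[of 0] k2 by simp
  have "avg T (\<lambda>s. cnj (W z s) * ell f s) = \<i> * of_real l0 * of_real (w0 * (norm z)\<^sup>2)"
    unfolding av z1 z2 z3 by simp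
  then show ?thesis
    using periodicD(1)[OF ell_periodic[OF f]] periodicD(1)[OF W_periodic] by (simp add: ip_Re)
qed

lemma Qp_cont: "continuous_on UNIV f \<Longrightarrow> continuous_on UNIV (\<lambda>s. Qp \<mu> (f s))"
  and Cp_cont: "continuous_on UNIV f \<Longrightarrow> continuous_on UNIV (\<lambda>s. Cp \<mu> (f s))"
  and DC_cont: "continuous_on UNIV f \<Longrightarrow> continuous_on UNIV h \<Longrightarrow> continuous_on UNIV (\<lambda>s. DC \<mu> (f s) (h s))"
  and Qb_cont: "continuous_on UNIV f \<Longrightarrow> continuous_on UNIV h \<Longrightarrow> continuous_on UNIV (\<lambda>s. Qb \<mu> (f s) (h s))"
  unfolding Qp_def Cp_def DC_def Qb_def by (intro continuous_intros; assumption)+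

section \<open>Expansion in moments of the primaries\<close>

definition "SQ \<theta> = (\<lambda>s. \<Sum>j<n. of_real (m j) * Qp \<mu> (dd \<theta> j s))"
definition "SC \<theta> = (\<lambda>s. \<Sum>j<n. of_real (m j) * Cp \<mu> (dd \<theta> j s))"
definition "SD \<theta> x = (\<lambda>s. \<Sum>j<n. of_real (m j) * DC \<mu> (dd \<theta> j s) (x s))"
definition "rem \<theta> x = (\<lambda>s. \<Sum>j<n. of_real (m j) * (Psi \<mu> (x s - dd \<theta> j s) - Qp \<mu> (x s - dd \<theta> j s) - Cp \<mu> (x s - dd \<theta> j s)))"

lemma S_cont: "continuous_on UNIV (SQ \<theta>)" "continuous_on UNIV (SC \<theta>)"
  "continuous_on UNIV x \<Longrightarrow> continuous_on UNIV (SD \<theta> x)"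
  unfolding SQ_def SC_def SD_def
  by (intro continuous_on_sum continuous_on_mult continuous_on_const Qp_cont Cp_cont DC_cont periodicD(1)[OF dd_periodic]; simp)+

text \<open>The terms linear in the positions of the primaries disappear because the center of mass
  is at the origin; this removes \<open>Qb\<close> and one of the two mixed cubic terms.\<close>

lemma Nf_expand: "Nf \<theta> x s = Qp \<mu> (x s) + SQ \<theta> s - SC \<theta> s + Cp \<mu> (x s) + SD \<theta> x s + rem \<theta> x s"
proof -
  have "Nf \<theta> x s = (\<Sum>j<n. (of_real (m j) * Qp \<mu> (x s) + of_real (m j) * Qp \<mu> (dd \<theta> j s) - of_real (m j) * Cp \<mu> (dd \<theta> j s) + of_real (m j) * Cp \<mu> (x s)
      + of_real (m j) * DC \<mu> (dd \<theta> j s) (x s) + of_real (m j) * (Psi \<mu> (x s - dd \<theta> j s) - Qp \<mu> (x s - dd \<theta> j s) - Cp \<mu> (x s - dd \<theta> j s)))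
      - of_real (m j) * Qb \<mu> (x s) (dd \<theta> j s) - of_real (m j) * DC \<mu> (x s) (dd \<theta> j s))"
    unfolding Nf_def by (intro sum.cong refl) (simp add: Qp_sub Cp_sub algebra_simps)
  also have "\<dots> = of_real (\<Sum>j<n. m j) * Qp \<mu> (x s) + SQ \<theta> s - SC \<theta> s + of_real (\<Sum>j<n. m j) * Cp \<mu> (x s) + SD \<theta> x s + rem \<theta> x s
      - Qb \<mu> (x s) (\<Sum>j<n. of_real (m j) * dd \<theta> j s) - DC \<mu> (x s) (\<Sum>j<n. of_real (m j) * dd \<theta> j s)"
    unfolding Qb_sum DC_sum SQ_def SC_def SD_def rem_def
    by (simp only: sum.distrib sum_subtractf sum_distrib_right of_real_sum)
  finally show ?thesis by (simp add: m1 dd_sum Qb_def DC_def)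
qed

lemma rem_bound:
  assumes "norm (x s) \<le> \<epsilon>"
  shows "norm (rem \<theta> x s) \<le> CR * (1 + M) ^ 4 * \<epsilon> ^ 4"
  unfolding rem_def
proof (rule weighted_norm)
  fix j assume j: "j < n"
  let ?w = "x s - dd \<theta> j s"
  have "norm (Psi \<mu> ?w - Qp \<mu> ?w - Cp \<mu> ?w) \<le> CR * norm ?w ^ 4" by (rule CR(1)[OF xd_quarter[OF assms j]])
  also have "\<dots> \<le> CR * ((1 + M) * \<epsilon>) ^ 4" using xd_bound[OF assms j] CR(2) by (intro mult_left_mono power_mono) auto
  finally show "norm (Psi \<mu> ?w - Qp \<mu> ?w - Cp \<mu> ?w) \<le> CR * (1 + M) ^ 4 * \<epsilon> ^ 4" by (simp add: power_mult_distrib)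
qed

text \<open>Mass moments of second and third order in the inertial frame, as functions of the fast
  time.\<close>

definition "g2 t = (\<Sum>j<n. of_real (m j) * (qc j t)\<^sup>2)"
definition "g11 t = (\<Sum>j<n. of_real (m j) * (qc j t * cnj (qc j t)))"
definition "g3 t = (\<Sum>j<n. of_real (m j) * (qc j t) ^ 3)"
definition "g21 t = (\<Sum>j<n. of_real (m j) * ((qc j t)\<^sup>2 * cnj (qc j t)))"

text \<open>The time average of the moment of inertia of the primaries.\<close>

definition "I0 = Re (avg (2 * pi) g11)"

lemma qcnj: "j < n \<Longrightarrow> (\<lambda>t. cnj (qc j t)) \<in> periodic (2 * pi)"
  using qc(1) by (auto simp: periodic_def intro!: continuous_intros)

lemma periodic_sum: "(\<And>j. j < n \<Longrightarrow> f j \<in> periodic P) \<Longrightarrow> (\<lambda>t. \<Sum>j<n. of_real (m j) * f j t) \<in> periodic P"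
  unfolding periodic_def by (auto intro!: continuous_intros sum.cong)

lemma periodic_pow: "f \<in> periodic P \<Longrightarrow> (\<lambda>t. f t ^ i) \<in> periodic P"
  by (auto simp: periodic_def intro!: continuous_intros)

lemma g_periodic: "g2 \<in> periodic (2 * pi)" "g11 \<in> periodic (2 * pi)" "g3 \<in> periodic (2 * pi)" "g21 \<in> periodic (2 * pi)"
  unfolding g2_def[abs_def] g11_def[abs_def] g3_def[abs_def] g21_def[abs_def]
  by (intro periodic_sum periodic_mult periodic_pow qcnj qc; assumption)+

lemma cnj_periodic: "f \<in> periodic P \<Longrightarrow> (\<lambda>t. cnj (f t)) \<in> periodic P"
  by (auto simp: periodic_def intro!: continuous_intros)

definition "Ob = (1 + M) ^ 3"

lemma M_pow: "M\<^sup>2 \<le> Ob" "M ^ 3 \<le> Ob" "0 \<le> Ob"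
proof -
  have "M\<^sup>2 \<le> (1 + M)\<^sup>2" using pos by (intro power_mono) auto
  also have "\<dots> \<le> (1 + M) ^ 3" using pos by (intro power_increasing) auto
  finally show "M\<^sup>2 \<le> Ob" by (simp add: Ob_def)
  show "M ^ 3 \<le> Ob" "0 \<le> Ob" unfolding Ob_def using pos by (auto intro!: power_mono)
qed

lemma g_bound: "norm (g2 t) \<le> Ob" "norm (g11 t) \<le> Ob" "norm (g3 t) \<le> Ob" "norm (g21 t) \<le> Ob"
proof -
  have a: "norm (qc j t) ^ i \<le> M ^ i" if "j < n" for i j using qc(2)[OF that] by (intro power_mono) auto
  show "norm (g2 t) \<le> Ob" unfolding g2_def
    by (rule weighted_norm) (use a[of _ 2] M_pow in \<open>fastforce simp: norm_power\<close>)
  show "norm (g11 t) \<le> Ob" unfolding g11_def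
    by (rule weighted_norm) (use a[of _ 2] M_pow in \<open>fastforce simp: norm_mult power2_eq_square\<close>)
  show "norm (g3 t) \<le> Ob" unfolding g3_def
    by (rule weighted_norm) (use a[of _ 3] M_pow in \<open>fastforce simp: norm_power\<close>)
  show "norm (g21 t) \<le> Ob" unfolding g21_def
    by (rule weighted_norm) (use a[of _ 3] M_pow in \<open>fastforce simp: norm_mult norm_power power2_eq_square power3_eq_cube\<close>)
qed

definition "ue \<theta> = cis (- \<theta>)"

lemma ue: "norm (ue \<theta>) = 1" "ue \<theta> * cnj (ue \<theta>) = 1"
  by (simp_all add: ue_def cis_cnj cis_mult)

abbreviation "ex b s \<equiv> exp (\<i> * complex_of_real b * complex_of_real s)"

lemma dd_form: "j < n \<Longrightarrow> dd \<theta> j s = of_real \<epsilon> * (ue \<theta> * ex (- 1) s * qc j (s / \<omega>))"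
  by (simp add: dd_def d0_def ue_def mult_ac)

lemma ex_mult: "ex a s * ex b s = ex (a + b) s"
  by (simp flip: exp_add) (simp add: algebra_simps)

lemma ex_cnj: "cnj (ex a s) = ex (- a) s"
  by (simp add: exp_cnj)

text \<open>Each position brings one factor \<open>ex (- 1)\<close> from the rotating frame and one
  phase factor; a moment thus becomes a slow harmonic times a function of the fast time.\<close>

lemma sum_d2: "(\<Sum>j<n. of_real (m j) * (dd \<theta> j s)\<^sup>2) = of_real (\<epsilon>\<^sup>2) * ((ue \<theta>)\<^sup>2 * (ex (- 2) s * g2 (s / \<omega>)))"
proof -
  have "(ex (- 1) s)\<^sup>2 = ex (- 2) s" unfolding power2_eq_square ex_mult by simp
  then have "of_real (m j) * (dd \<theta> j s)\<^sup>2 = of_real (\<epsilon>\<^sup>2) * ((ue \<theta>)\<^sup>2 * (ex (- 2) s * (of_real (m j) * (qc j (s / \<omega>))\<^sup>2)))" if "j < n" for j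
    unfolding dd_form[OF that] power_mult_distrib by (simp add: mult_ac)
  then show ?thesis unfolding g2_def sum_distrib_left by (intro sum.cong) auto
qed

text \<open>Rotation and phase cancel in this moment, so its slow frequency is 0 and it is
  independent of \<theta>. It is the source of the detuning.\<close>

lemma sum_d11: "(\<Sum>j<n. of_real (m j) * (dd \<theta> j s * cnj (dd \<theta> j s))) = of_real (\<epsilon>\<^sup>2) * (ex 0 s * g11 (s / \<omega>))"
proof -
  have "of_real (m j) * (dd \<theta> j s * cnj (dd \<theta> j s)) = of_real (\<epsilon>\<^sup>2) * (ex 0 s * (of_real (m j) * (qc j (s / \<omega>) * cnj (qc j (s / \<omega>)))))" if "j < n" for j
  proof -
    have "dd \<theta> j s * cnj (dd \<theta> j s) = of_real (\<epsilon>\<^sup>2) * ((ue \<theta> * cnj (ue \<theta>)) * (ex (- 1) s * cnj (ex (- 1) s)) * (qc j (s / \<omega>) * cnj (qc j (s / \<omega>))))"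
      unfolding dd_form[OF that] by (simp add: power2_eq_square mult_ac)
    then show ?thesis unfolding ue(2) ex_cnj ex_mult by simp
  qed
  then show ?thesis unfolding g11_def sum_distrib_left by (intro sum.cong) auto
qed

lemma sum_d3: "(\<Sum>j<n. of_real (m j) * (dd \<theta> j s) ^ 3) = of_real (\<epsilon> ^ 3) * ((ue \<theta>) ^ 3 * (ex (- 3) s * g3 (s / \<omega>)))"
proof -
  have "(ex (- 1) s) ^ 3 = ex (- 3) s" unfolding power3_eq_cube ex_mult by simp
  then have "of_real (m j) * (dd \<theta> j s) ^ 3 = of_real (\<epsilon> ^ 3) * ((ue \<theta>) ^ 3 * (ex (- 3) s * (of_real (m j) * (qc j (s / \<omega>)) ^ 3)))" if "j < n" for j
    unfolding dd_form[OF that] power_mult_distrib by (simp add: mult_ac)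
  then show ?thesis unfolding g3_def sum_distrib_left by (intro sum.cong) auto
qed

lemma sum_d21: "(\<Sum>j<n. of_real (m j) * ((dd \<theta> j s)\<^sup>2 * cnj (dd \<theta> j s))) = of_real (\<epsilon> ^ 3) * (ue \<theta> * (ex (- 1) s * g21 (s / \<omega>)))"
proof -
  have "of_real (m j) * ((dd \<theta> j s)\<^sup>2 * cnj (dd \<theta> j s)) = of_real (\<epsilon> ^ 3) * (ue \<theta> * (ex (- 1) s * (of_real (m j) * ((qc j (s / \<omega>))\<^sup>2 * cnj (qc j (s / \<omega>))))))" if "j < n" for j
  proof -
    have "(dd \<theta> j s)\<^sup>2 * cnj (dd \<theta> j s) = of_real (\<epsilon> ^ 3) * ((ue \<theta> * (ue \<theta> * cnj (ue \<theta>))) * (ex (- 1) s * (ex (- 1) s * cnj (ex (- 1) s))) * ((qc j (s / \<omega>))\<^sup>2 * cnj (qc j (s / \<omega>))))"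
      unfolding dd_form[OF that] by (simp add: power2_eq_square power3_eq_cube mult_ac)
    then show ?thesis unfolding ue(2) ex_cnj ex_mult by simp
  qed
  then show ?thesis unfolding g21_def sum_distrib_left by (intro sum.cong) auto
qed

definition "S2 \<theta> s = of_real (\<epsilon>\<^sup>2) * ((ue \<theta>)\<^sup>2 * (ex (- 2) s * g2 (s / \<omega>)))"
definition "S11 s = of_real (\<epsilon>\<^sup>2) * (ex 0 s * g11 (s / \<omega>))"

lemma cnj_S2: "cnj (S2 \<theta> s) = of_real (\<epsilon>\<^sup>2) * ((cnj (ue \<theta>))\<^sup>2 * (ex 2 s * cnj (g2 (s / \<omega>))))"
  unfolding S2_def complex_cnj_mult complex_cnj_power ex_cnj by simp

lemma cnj_sum_m: "(\<Sum>j<n. of_real (m j) * cnj (f j)) = cnj (\<Sum>j<n. of_real (m j) * f j)"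
  by simp

lemma SQ_form: "SQ \<theta> s = of_real (\<mu> * (1 - \<mu>) / 2) * S2 \<theta> s + of_real (\<mu> * (1 - \<mu>)) * S11 s - of_real (\<mu> * (\<mu> + 1) / 2) * cnj (S2 \<theta> s)"
proof -
  have "SQ \<theta> s = of_real (\<mu> * (1 - \<mu>) / 2) * (\<Sum>j<n. of_real (m j) * (dd \<theta> j s)\<^sup>2) + of_real (\<mu> * (1 - \<mu>)) * (\<Sum>j<n. of_real (m j) * (dd \<theta> j s * cnj (dd \<theta> j s)))
     - of_real (\<mu> * (\<mu> + 1) / 2) * (\<Sum>j<n. of_real (m j) * cnj ((dd \<theta> j s)\<^sup>2))"
    unfolding SQ_def Qp_def sum_distrib_left sum.distrib[symmetric] sum_subtractf[symmetric]
    by (intro sum.cong refl) (simp add: distrib_left right_diff_distrib mult.left_commute)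
  then show ?thesis unfolding cnj_sum_m sum_d2 sum_d11 S2_def S11_def .
qed

lemma SC_form: "SC \<theta> s = - of_real ((1 - \<mu>) * \<mu> * (\<mu> + 1) / 6) * (of_real (\<epsilon> ^ 3) * ((ue \<theta>) ^ 3 * (ex (- 3) s * g3 (s / \<omega>))))
   - of_real ((1 - \<mu>) * \<mu>\<^sup>2 / 2) * (of_real (\<epsilon> ^ 3) * (ue \<theta> * (ex (- 1) s * g21 (s / \<omega>))))
   - of_real ((1 - \<mu>) * \<mu> * (\<mu> + 1) / 2) * (of_real (\<epsilon> ^ 3) * (cnj (ue \<theta>) * (ex 1 s * cnj (g21 (s / \<omega>)))))
   + of_real (\<mu> * (\<mu> + 1) * (\<mu> + 2) / 6) * (of_real (\<epsilon> ^ 3) * ((cnj (ue \<theta>)) ^ 3 * (ex 3 s * cnj (g3 (s / \<omega>)))))"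
proof -
  have "SC \<theta> s = - of_real ((1 - \<mu>) * \<mu> * (\<mu> + 1) / 6) * (\<Sum>j<n. of_real (m j) * (dd \<theta> j s) ^ 3)
     - of_real ((1 - \<mu>) * \<mu>\<^sup>2 / 2) * (\<Sum>j<n. of_real (m j) * ((dd \<theta> j s)\<^sup>2 * cnj (dd \<theta> j s)))
     - of_real ((1 - \<mu>) * \<mu> * (\<mu> + 1) / 2) * (\<Sum>j<n. of_real (m j) * cnj ((dd \<theta> j s)\<^sup>2 * cnj (dd \<theta> j s)))
     + of_real (\<mu> * (\<mu> + 1) * (\<mu> + 2) / 6) * (\<Sum>j<n. of_real (m j) * cnj ((dd \<theta> j s) ^ 3))"
    unfolding SC_def Cp_def sum_distrib_left sum.distrib[symmetric] sum_subtractf[symmetric]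
    by (intro sum.cong refl) (simp add: distrib_left right_diff_distrib mult.left_commute mult.commute[of "(cnj (dd _ _ _))\<^sup>2"])
  then show ?thesis unfolding cnj_sum_m sum_d3 sum_d21
    unfolding complex_cnj_mult complex_cnj_power ex_cnj by simp
qed

definition "e1 = (1 - \<mu>) * \<mu> * (\<mu> + 1) / 2"
definition "e2 = (1 - \<mu>) * \<mu>\<^sup>2 / 2"
definition "e3 = \<mu> * (\<mu> + 1) * (\<mu> + 2) / 2"

lemma SD_form: "SD \<theta> x s = S2 \<theta> s * (of_real (- e1) * x s + of_real (- e2) * cnj (x s))
    + S11 s * (of_real (- 2 * e2) * x s + of_real (- 2 * e1) * cnj (x s))
    + cnj (S2 \<theta> s) * (of_real (- e1) * x s + of_real e3 * cnj (x s))"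
proof -
  have "SD \<theta> x s = (\<Sum>j<n. of_real (m j) * (dd \<theta> j s)\<^sup>2) * (of_real (- e1) * x s + of_real (- e2) * cnj (x s))
    + (\<Sum>j<n. of_real (m j) * (dd \<theta> j s * cnj (dd \<theta> j s))) * (of_real (- 2 * e2) * x s + of_real (- 2 * e1) * cnj (x s))
    + (\<Sum>j<n. of_real (m j) * cnj ((dd \<theta> j s)\<^sup>2)) * (of_real (- e1) * x s + of_real e3 * cnj (x s))"
    unfolding SD_def DC_def sum_distrib_right sum.distrib[symmetric] e1_def[symmetric] e2_def[symmetric] e3_def[symmetric]
    by (intro sum.cong refl) (simp add: algebra_simps)
  then show ?thesis unfolding cnj_sum_m sum_d2 sum_d11 S2_def S11_def .
qed

text \<open>All integrands are sums of slow harmonics times a function of the fast time; \<open>OC\<close> is the common bound.\<close>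

definition "OC = 36 * CS\<^sup>2 * Ob"

lemma OC0: "0 \<le> OC" using M_pow by (simp add: OC_def)

lemma eps1: "\<epsilon> \<le> 1" using Me by simp

lemma om2: "\<omega>\<^sup>2 \<le> \<epsilon>\<^sup>2" using om by (intro power_mono) auto

section \<open>Averaged pairings with the oscillation\<close>

text \<open>An integer frequency never cancels \<open>k\<close> or \<open>- k\<close>, so every slow
  harmonic oscillates and the average gains \<open>\<omega>^2\<close>, hence
  \<open>\<epsilon>^2\<close>.\<close>

lemma osc_k:
  assumes g: "g \<in> periodic (2 * pi)" "\<And>t. norm (g t) \<le> Ob" and b: "b \<in> {-3, -2, -1, 0, 1, 2, 3}"
  shows "norm (avg T (\<lambda>s. cnj (zeta z s) * (ex b s * g (s / \<omega>)))) \<le> OC * (\<bar>A1\<bar> + \<bar>B1\<bar>) * norm z * \<epsilon>\<^sup>2"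
proof -
  have bi: "ex b T = 1" using b int_exp[of "-3"] int_exp[of "-2"] int_exp[of "-1"] int_exp[of 0] int_exp[of 1] int_exp[of 2] int_exp[of 3] by auto
  have ne: "b + k \<noteq> 0" "b - k \<noteq> 0" using b k_le k_ne k2(2) by (auto simp: abs_if split: if_splits)
  have sz: "\<bar>b\<bar> + \<bar>k\<bar> \<le> 6" using b k_le by auto
  have "norm (avg T (\<lambda>s. (0 + (of_real B1 * z) * ex k s + (of_real A1 * cnj z) * exp (- \<i> * of_real k * of_real s)) * (ex b s * g (s / \<omega>))) - (if b = 0 then 0 * avg (2 * pi) g else 0))
      \<le> 36 * CS\<^sup>2 * Ob * (norm (0::complex) + norm (of_real B1 * z) + norm (of_real A1 * cnj z)) * \<omega>\<^sup>2"
    by (rule osc3[OF g _ om(1) Tq k_exp(1) bi ne sz CS]) simp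
  moreover have i0: "(if b = 0 then 0 * avg (2 * pi) g else 0) = 0" by simp
  moreover have "norm (0::complex) + norm (of_real B1 * z) + norm (of_real A1 * cnj z) = (\<bar>A1\<bar> + \<bar>B1\<bar>) * norm z"
    by (simp add: norm_mult algebra_simps)
  ultimately have "norm (avg T (\<lambda>s. cnj (zeta z s) * (ex b s * g (s / \<omega>)))) \<le> 36 * CS\<^sup>2 * Ob * ((\<bar>A1\<bar> + \<bar>B1\<bar>) * norm z) * \<omega>\<^sup>2"
    unfolding zeta3 by (simp only: diff_zero)
  also have "\<dots> \<le> 36 * CS\<^sup>2 * Ob * ((\<bar>A1\<bar> + \<bar>B1\<bar>) * norm z) * \<epsilon>\<^sup>2"
    using om2 M_pow by (intro mult_left_mono) auto
  finally show ?thesis by (simp add: OC_def mult_ac)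
qed

text \<open>The weight with which a second moment enters once the contributions of \<open>W\<close>
  and of \<open>SD\<close> are merged.\<close>

definition "HH a b c z = (\<lambda>s. of_real a * cnj (W z s) + of_real b * (cnj (zeta z s) * zeta z s) + of_real c * (cnj (zeta z s))\<^sup>2)"

definition "hb a b c = \<bar>a * w0 + b * (A1\<^sup>2 + B1\<^sup>2) + 2 * c * A1 * B1\<bar> + \<bar>a * (w1 - w2) / 2 + b * A1 * B1 + c * B1\<^sup>2\<bar>
   + \<bar>a * (w1 + w2) / 2 + b * A1 * B1 + c * A1\<^sup>2\<bar>"

lemma HH_form: "HH a b c z s = of_real ((a * w0 + b * (A1\<^sup>2 + B1\<^sup>2) + 2 * c * A1 * B1) * (norm z)\<^sup>2)
    + (of_real (a * (w1 - w2) / 2 + b * A1 * B1 + c * B1\<^sup>2) * z\<^sup>2) * ex (2 * k) s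
    + (of_real (a * (w1 + w2) / 2 + b * A1 * B1 + c * A1\<^sup>2) * (cnj z)\<^sup>2) * exp (- \<i> * of_real (2 * k) * of_real s)"
proof -
  let ?E = "Ek z s"
  have 1: "cnj (W z s) = of_real (w0 * (norm z)\<^sup>2) + of_real ((w1 - w2) / 2) * ?E\<^sup>2 + of_real ((w1 + w2) / 2) * (cnj ?E)\<^sup>2"
    unfolding W_def by simp
  have 2: "cnj (zeta z s) * zeta z s = of_real (A1\<^sup>2 + B1\<^sup>2) * (?E * cnj ?E) + of_real (A1 * B1) * (?E\<^sup>2 + (cnj ?E)\<^sup>2)"
    unfolding zeta_Ek by (simp add: power2_eq_square algebra_simps)
  have 3: "(cnj (zeta z s))\<^sup>2 = of_real (2 * A1 * B1) * (?E * cnj ?E) + of_real (B1\<^sup>2) * ?E\<^sup>2 + of_real (A1\<^sup>2) * (cnj ?E)\<^sup>2"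
    unfolding zeta_Ek by (simp add: power2_eq_square algebra_simps)
  have "HH a b c z s = of_real ((a * w0 + b * (A1\<^sup>2 + B1\<^sup>2) + 2 * c * A1 * B1) * (norm z)\<^sup>2)
    + of_real (a * (w1 - w2) / 2 + b * A1 * B1 + c * B1\<^sup>2) * ?E\<^sup>2
    + of_real (a * (w1 + w2) / 2 + b * A1 * B1 + c * A1\<^sup>2) * (cnj ?E)\<^sup>2"
    unfolding HH_def 1 2 3 Ek_sq by (simp add: field_simps)
  then show ?thesis unfolding Ek2 by (simp only: mult.assoc)
qed

text \<open>The weight has frequencies 0 and \<open>2 * k\<close> up to sign, and
  \<open>2 * k\<close> is neither 0, 2 nor -2, so the constant of the weight against the mean of
  \<open>g\<close> is all that remains, and only for \<beta> = 0.\<close>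

lemma osc_H:
  assumes g: "g \<in> periodic (2 * pi)" "\<And>t. norm (g t) \<le> Ob" and b: "\<beta> \<in> {-2, 0, 2}"
  shows "norm (avg T (\<lambda>s. HH a b c z s * (ex \<beta> s * g (s / \<omega>))) -
     (if \<beta> = 0 then of_real ((a * w0 + b * (A1\<^sup>2 + B1\<^sup>2) + 2 * c * A1 * B1) * (norm z)\<^sup>2) * avg (2 * pi) g else 0)) \<le> OC * hb a b c * (norm z)\<^sup>2 * \<epsilon>\<^sup>2"
proof -
  have bi: "ex \<beta> T = 1" using b int_exp[of "-2"] int_exp[of 0] int_exp[of 2] by auto
  have ne: "\<beta> + 2 * k \<noteq> 0" "\<beta> - 2 * k \<noteq> 0" using b k_ne k2(2) by (auto simp: abs_if split: if_splits)
  have sz: "\<bar>\<beta>\<bar> + \<bar>2 * k\<bar> \<le> 6" using b k_le by auto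
  let ?h0 = "complex_of_real ((a * w0 + b * (A1\<^sup>2 + B1\<^sup>2) + 2 * c * A1 * B1) * (norm z)\<^sup>2)"
  let ?h1 = "of_real (a * (w1 - w2) / 2 + b * A1 * B1 + c * B1\<^sup>2) * z\<^sup>2"
  let ?h2 = "of_real (a * (w1 + w2) / 2 + b * A1 * B1 + c * A1\<^sup>2) * (cnj z)\<^sup>2"
  have "norm (avg T (\<lambda>s. HH a b c z s * (ex \<beta> s * g (s / \<omega>))) - (if \<beta> = 0 then ?h0 * avg (2 * pi) g else 0)) \<le> 36 * CS\<^sup>2 * Ob * (norm ?h0 + norm ?h1 + norm ?h2) * \<omega>\<^sup>2"
    unfolding HH_form by (rule osc3[OF g _ om(1) Tq k_exp(2) bi ne sz CS]) simp
  also have "norm ?h0 + norm ?h1 + norm ?h2 = hb a b c * (norm z)\<^sup>2"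
    unfolding norm_of_real_mult norm_of_real abs_mult[of _ "(norm z)\<^sup>2"] norm_power complex_mod_cnj hb_def by (simp add: distrib_right)
  also have "36 * CS\<^sup>2 * Ob * (hb a b c * (norm z)\<^sup>2) * \<omega>\<^sup>2 \<le> 36 * CS\<^sup>2 * Ob * (hb a b c * (norm z)\<^sup>2) * \<epsilon>\<^sup>2"
    using om2 M_pow by (intro mult_left_mono) (auto simp: hb_def)
  finally show ?thesis by (simp add: OC_def mult_ac)
qed

text \<open>The detuning coefficient whose sign decides the resonant case.\<close>

lemma signal_value: "2 * \<mu> * (1 - \<mu>) * w0 + (- 2 * e2) * (A1\<^sup>2 + B1\<^sup>2) + 2 * (- 2 * e1) * A1 * B1 = \<mu> * (\<mu> - 1)"
  unfolding e1_def e2_def w0_def A1_def B1_def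
  unfolding mu_k using k2(2) by (simp add: field_simps power2_eq_square)

lemma coef_bound0: "0 \<le> e \<Longrightarrow> norm X \<le> U \<Longrightarrow> norm (of_real a * (of_real e * X) :: complex) \<le> \<bar>a\<bar> * (e * U)"
  unfolding norm_of_real_mult by (intro mult_left_mono) (auto intro: mult_left_mono)

lemma coef_bound: "0 \<le> e \<Longrightarrow> norm X \<le> U \<Longrightarrow> norm u = 1 \<Longrightarrow> norm (of_real a * (of_real e * (u * X)) :: complex) \<le> \<bar>a\<bar> * (e * U)"
  by (rule coef_bound0) (simp_all add: norm_mult)

text \<open>The bound by norms would give \<open>norm z * \<epsilon>^2\<close>, more than the
  detuning; averaging supplies the missing \<open>\<epsilon>^2\<close>.\<close>

lemma ip_SQ_zeta: "\<bar>ip T (SQ \<theta>) (zeta z)\<bar> \<le> cQ \<mu> * (OC * (\<bar>A1\<bar> + \<bar>B1\<bar>) * norm z * \<epsilon>\<^sup>2) * \<epsilon>\<^sup>2"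
proof -
  define U where "U = OC * (\<bar>A1\<bar> + \<bar>B1\<bar>) * norm z * \<epsilon>\<^sup>2"
  note cz = periodicD(1)[OF zeta_periodic[of z]]
  have sp: "(\<lambda>s. g (s / \<omega>)) \<in> periodic T" if "g \<in> periodic (2 * pi)" for g using scaled_periodic[OF that om(1) Tq(1)] .
  note cg = periodicD(1)[OF sp[OF g_periodic(1)]] periodicD(1)[OF sp[OF g_periodic(2)]] periodicD(1)[OF sp[OF cnj_periodic[OF g_periodic(1)]]]
  define X1 where "X1 = avg T (\<lambda>s. cnj (zeta z s) * (ex (- 2) s * g2 (s / \<omega>)))"
  define X2 where "X2 = avg T (\<lambda>s. cnj (zeta z s) * (ex 0 s * g11 (s / \<omega>)))"
  define X3 where "X3 = avg T (\<lambda>s. cnj (zeta z s) * (ex 2 s * cnj (g2 (s / \<omega>))))"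
  have b1: "norm X1 \<le> U" unfolding X1_def U_def by (rule osc_k[OF g_periodic(1) g_bound(1)]) simp
  have b2: "norm X2 \<le> U" unfolding X2_def U_def by (rule osc_k[OF g_periodic(2) g_bound(2)]) simp
  have b3: "norm X3 \<le> U" unfolding X3_def U_def by (rule osc_k[OF cnj_periodic[OF g_periodic(1)]]) (use g_bound in auto)
  have e: "cnj (zeta z s) * SQ \<theta> s =
     of_real (\<mu> * (1 - \<mu>) / 2) * (of_real (\<epsilon>\<^sup>2) * ((ue \<theta>)\<^sup>2 * (cnj (zeta z s) * (ex (- 2) s * g2 (s / \<omega>)))))
     + of_real (\<mu> * (1 - \<mu>)) * (of_real (\<epsilon>\<^sup>2) * (cnj (zeta z s) * (ex 0 s * g11 (s / \<omega>))))
     - of_real (\<mu> * (\<mu> + 1) / 2) * (of_real (\<epsilon>\<^sup>2) * ((cnj (ue \<theta>))\<^sup>2 * (cnj (zeta z s) * (ex 2 s * cnj (g2 (s / \<omega>))))))" for s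
    unfolding SQ_form cnj_S2 unfolding S2_def S11_def distrib_left right_diff_distrib by (simp only: mult.left_commute[of "cnj (zeta z s)"])
  have eq: "avg T (\<lambda>s. cnj (zeta z s) * SQ \<theta> s) = of_real (\<mu> * (1 - \<mu>) / 2) * (of_real (\<epsilon>\<^sup>2) * ((ue \<theta>)\<^sup>2 * X1))
     + of_real (\<mu> * (1 - \<mu>)) * (of_real (\<epsilon>\<^sup>2) * X2) - of_real (\<mu> * (\<mu> + 1) / 2) * (of_real (\<epsilon>\<^sup>2) * ((cnj (ue \<theta>))\<^sup>2 * X3))" (is "_ = ?R")
    unfolding e X1_def X2_def X3_def
    by (subst avg_diff avg_add avg_cmul; (intro continuous_intros cz cg)?)+ (rule refl)
  have perturbed_circ: "norm ?R \<le> \<bar>\<mu> * (1 - \<mu>) / 2\<bar> * (\<epsilon>\<^sup>2 * U) + \<bar>\<mu> * (1 - \<mu>)\<bar> * (\<epsilon>\<^sup>2 * U) + \<bar>\<mu> * (\<mu> + 1) / 2\<bar> * (\<epsilon>\<^sup>2 * U)"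
    by (rule order_trans[OF norm3 add_mono[OF add_mono[OF coef_bound[OF _ b1] coef_bound0[OF _ b2]] coef_bound[OF _ b3]]])
      (simp_all add: norm_power ue)
  also have "\<dots> = cQ \<mu> * U * \<epsilon>\<^sup>2" by (simp add: cQ_def algebra_simps)
  finally have "norm (avg T (\<lambda>s. cnj (zeta z s) * SQ \<theta> s)) \<le> cQ \<mu> * U * \<epsilon>\<^sup>2" unfolding eq .
  then show ?thesis unfolding ip_Re[OF S_cont(1) cz] U_def using abs_Re_le_cmod order_trans by blast
qed

lemma ip_SC_zeta: "\<bar>ip T (SC \<theta>) (zeta z)\<bar> \<le> cC \<mu> * (OC * (\<bar>A1\<bar> + \<bar>B1\<bar>) * norm z * \<epsilon>\<^sup>2) * \<epsilon> ^ 3"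
proof -
  define U where "U = OC * (\<bar>A1\<bar> + \<bar>B1\<bar>) * norm z * \<epsilon>\<^sup>2"
  note cz = periodicD(1)[OF zeta_periodic[of z]]
  have sp: "(\<lambda>s. g (s / \<omega>)) \<in> periodic T" if "g \<in> periodic (2 * pi)" for g using scaled_periodic[OF that om(1) Tq(1)] .
  note cg = periodicD(1)[OF sp[OF g_periodic(3)]] periodicD(1)[OF sp[OF g_periodic(4)]] periodicD(1)[OF sp[OF cnj_periodic[OF g_periodic(3)]]] periodicD(1)[OF sp[OF cnj_periodic[OF g_periodic(4)]]]
  define X1 where "X1 = avg T (\<lambda>s. cnj (zeta z s) * (ex (- 3) s * g3 (s / \<omega>)))"
  define X2 where "X2 = avg T (\<lambda>s. cnj (zeta z s) * (ex (- 1) s * g21 (s / \<omega>)))"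
  define X3 where "X3 = avg T (\<lambda>s. cnj (zeta z s) * (ex 1 s * cnj (g21 (s / \<omega>))))"
  define X4 where "X4 = avg T (\<lambda>s. cnj (zeta z s) * (ex 3 s * cnj (g3 (s / \<omega>))))"
  have b1: "norm X1 \<le> U" unfolding X1_def U_def by (rule osc_k[OF g_periodic(3) g_bound(3)]) simp
  have b2: "norm X2 \<le> U" unfolding X2_def U_def by (rule osc_k[OF g_periodic(4) g_bound(4)]) simp
  have b3: "norm X3 \<le> U" unfolding X3_def U_def by (rule osc_k[OF cnj_periodic[OF g_periodic(4)]]) (use g_bound in auto)
  have b4: "norm X4 \<le> U" unfolding X4_def U_def by (rule osc_k[OF cnj_periodic[OF g_periodic(3)]]) (use g_bound in auto)
  define a1 where "a1 = (1 - \<mu>) * \<mu> * (\<mu> + 1) / 6"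
  define a2 where "a2 = (1 - \<mu>) * \<mu>\<^sup>2 / 2"
  define a3 where "a3 = (1 - \<mu>) * \<mu> * (\<mu> + 1) / 2"
  define a4 where "a4 = \<mu> * (\<mu> + 1) * (\<mu> + 2) / 6"
  have e: "cnj (zeta z s) * SC \<theta> s =
     of_real (- a1) * (of_real (\<epsilon> ^ 3) * ((ue \<theta>) ^ 3 * (cnj (zeta z s) * (ex (- 3) s * g3 (s / \<omega>)))))
     - of_real a2 * (of_real (\<epsilon> ^ 3) * (ue \<theta> * (cnj (zeta z s) * (ex (- 1) s * g21 (s / \<omega>)))))
     - of_real a3 * (of_real (\<epsilon> ^ 3) * (cnj (ue \<theta>) * (cnj (zeta z s) * (ex 1 s * cnj (g21 (s / \<omega>))))))
     + of_real a4 * (of_real (\<epsilon> ^ 3) * ((cnj (ue \<theta>)) ^ 3 * (cnj (zeta z s) * (ex 3 s * cnj (g3 (s / \<omega>))))))" for s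
    unfolding SC_form a1_def[symmetric] a2_def[symmetric] a3_def[symmetric] a4_def[symmetric] of_real_minus[symmetric]
    unfolding distrib_left right_diff_distrib
    by (simp only: mult.left_commute[of "cnj (zeta z s)"])
  have "avg T (\<lambda>s. cnj (zeta z s) * SC \<theta> s) = of_real (- a1) * (of_real (\<epsilon> ^ 3) * ((ue \<theta>) ^ 3 * X1))
     - of_real a2 * (of_real (\<epsilon> ^ 3) * (ue \<theta> * X2)) - of_real a3 * (of_real (\<epsilon> ^ 3) * (cnj (ue \<theta>) * X3))
     + of_real a4 * (of_real (\<epsilon> ^ 3) * ((cnj (ue \<theta>)) ^ 3 * X4))"
    unfolding e X1_def X2_def X3_def X4_def
    by (subst avg_diff avg_add avg_cmul; (intro continuous_intros cz cg)?)+ (rule refl)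
  also have "\<dots> = - (of_real a1 * (of_real (\<epsilon> ^ 3) * ((ue \<theta>) ^ 3 * X1)))
     - of_real a2 * (of_real (\<epsilon> ^ 3) * (ue \<theta> * X2)) - of_real a3 * (of_real (\<epsilon> ^ 3) * (cnj (ue \<theta>) * X3))
     + of_real a4 * (of_real (\<epsilon> ^ 3) * ((cnj (ue \<theta>)) ^ 3 * X4))" (is "_ = ?R") by simp
  finally have eq: "avg T (\<lambda>s. cnj (zeta z s) * SC \<theta> s) = ?R" .
  have "norm ?R \<le> \<bar>a1\<bar> * (\<epsilon> ^ 3 * U) + \<bar>a2\<bar> * (\<epsilon> ^ 3 * U) + \<bar>a3\<bar> * (\<epsilon> ^ 3 * U) + \<bar>a4\<bar> * (\<epsilon> ^ 3 * U)"
    by (rule order_trans[OF norm4 add_mono[OF add_mono[OF add_mono[OF coef_bound[OF _ b1] coef_bound[OF _ b2]] coef_bound[OF _ b3]] coef_bound[OF _ b4]]])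
      (use pos in \<open>simp_all add: norm_power ue\<close>)
  then have "norm (avg T (\<lambda>s. cnj (zeta z s) * SC \<theta> s)) \<le> cC \<mu> * U * \<epsilon> ^ 3"
    unfolding eq cC_def a1_def[symmetric] a2_def[symmetric] a3_def[symmetric] a4_def[symmetric] by (simp add: algebra_simps)
  then show ?thesis unfolding ip_Re[OF S_cont(2) cz] U_def using abs_Re_le_cmod order_trans by blast
qed

definition "hbt = hb (\<mu> * (1 - \<mu>)) (- e1) (- e2) + hb (2 * \<mu> * (1 - \<mu>)) (- 2 * e2) (- 2 * e1) + hb (- (\<mu> * (\<mu> + 1))) (- e1) e3"

lemma hb0: "0 \<le> hb a b c" by (simp add: hb_def)

text \<open>Two effects of equal order: the response of the second harmonic to the quadrupole and
  the direct action of the quadrupole on the oscillation. Merged into weights \<open>HH\<close>,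
  they leave the mean of the moment of inertia with the coefficient of
  \<open>signal_value\<close>.\<close>

lemma main_term:
  "\<bar>2 * ip T (SQ \<theta>) (W z) + ip T (SD \<theta> (zeta z)) (zeta z) - \<epsilon>\<^sup>2 * (\<mu> * (\<mu> - 1) * (norm z)\<^sup>2 * I0)\<bar> \<le> OC * hbt * (norm z)\<^sup>2 * \<epsilon> ^ 4"
proof -
  let ?H1 = "HH (\<mu> * (1 - \<mu>)) (- e1) (- e2) z"
  let ?H2 = "HH (2 * \<mu> * (1 - \<mu>)) (- 2 * e2) (- 2 * e1) z"
  let ?H3 = "HH (- (\<mu> * (\<mu> + 1))) (- e1) e3 z"
  note cz = periodicD(1)[OF zeta_periodic[of z]] and cw = periodicD(1)[OF W_periodic[of z]]
  have cH: "continuous_on UNIV (HH a b c z)" for a b c unfolding HH_def by (intro continuous_intros cz cw)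
  have sp: "(\<lambda>s. g (s / \<omega>)) \<in> periodic T" if "g \<in> periodic (2 * pi)" for g using scaled_periodic[OF that om(1) Tq(1)] .
  note cg = periodicD(1)[OF sp[OF g_periodic(1)]] periodicD(1)[OF sp[OF g_periodic(2)]] periodicD(1)[OF sp[OF cnj_periodic[OF g_periodic(1)]]]
  define X1 where "X1 = avg T (\<lambda>s. ?H1 s * (ex (- 2) s * g2 (s / \<omega>)))"
  define X2 where "X2 = avg T (\<lambda>s. ?H2 s * (ex 0 s * g11 (s / \<omega>)))"
  define X3 where "X3 = avg T (\<lambda>s. ?H3 s * (ex 2 s * cnj (g2 (s / \<omega>))))"
  define V where "V = complex_of_real (\<mu> * (\<mu> - 1) * (norm z)\<^sup>2) * avg (2 * pi) g11"
  have b1: "norm X1 \<le> OC * hb (\<mu> * (1 - \<mu>)) (- e1) (- e2) * (norm z)\<^sup>2 * \<epsilon>\<^sup>2"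
    using osc_H[OF g_periodic(1) g_bound(1), of "-2" "\<mu> * (1 - \<mu>)" "- e1" "- e2" z] by (simp add: X1_def)
  have b2: "norm (X2 - V) \<le> OC * hb (2 * \<mu> * (1 - \<mu>)) (- 2 * e2) (- 2 * e1) * (norm z)\<^sup>2 * \<epsilon>\<^sup>2"
    using osc_H[OF g_periodic(2) g_bound(2), of 0 "2 * \<mu> * (1 - \<mu>)" "- 2 * e2" "- 2 * e1" z] unfolding signal_value X2_def V_def by simp
  have b3: "norm X3 \<le> OC * hb (- (\<mu> * (\<mu> + 1))) (- e1) e3 * (norm z)\<^sup>2 * \<epsilon>\<^sup>2"
    using osc_H[OF cnj_periodic[OF g_periodic(1)], of 2 "- (\<mu> * (\<mu> + 1))" "- e1" e3 z] g_bound by (simp add: X3_def)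
  have e: "2 * (cnj (W z s) * SQ \<theta> s) + cnj (zeta z s) * SD \<theta> (zeta z) s
     = of_real (\<epsilon>\<^sup>2) * ((ue \<theta>)\<^sup>2 * (?H1 s * (ex (- 2) s * g2 (s / \<omega>))))
      + of_real (\<epsilon>\<^sup>2) * (?H2 s * (ex 0 s * g11 (s / \<omega>))) + of_real (\<epsilon>\<^sup>2) * ((cnj (ue \<theta>))\<^sup>2 * (?H3 s * (ex 2 s * cnj (g2 (s / \<omega>)))))" for s
  proof -
    have "2 * (cnj (W z s) * SQ \<theta> s) + cnj (zeta z s) * SD \<theta> (zeta z) s = ?H1 s * S2 \<theta> s + ?H2 s * S11 s + ?H3 s * cnj (S2 \<theta> s)"
      unfolding SQ_form SD_form HH_def by (simp add: power2_eq_square field_simps)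
    then show ?thesis unfolding cnj_S2 unfolding S2_def S11_def by (simp only: mult_ac)
  qed
  have "avg T (\<lambda>s. 2 * (cnj (W z s) * SQ \<theta> s) + cnj (zeta z s) * SD \<theta> (zeta z) s)
      = of_real (\<epsilon>\<^sup>2) * ((ue \<theta>)\<^sup>2 * X1) + of_real (\<epsilon>\<^sup>2) * X2 + of_real (\<epsilon>\<^sup>2) * ((cnj (ue \<theta>))\<^sup>2 * X3)"
    unfolding e X1_def X2_def X3_def
    by (subst avg_add avg_cmul; (intro continuous_intros cH cg)?)+ (rule refl)
  moreover have "2 * ip T (SQ \<theta>) (W z) + ip T (SD \<theta> (zeta z)) (zeta z) = Re (avg T (\<lambda>s. 2 * (cnj (W z s) * SQ \<theta> s) + cnj (zeta z s) * SD \<theta> (zeta z) s))"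
    unfolding ip_Re[OF S_cont(1) cw] ip_Re[OF S_cont(3)[OF cz] cz]
    by (subst avg_add avg_cmul; (intro continuous_intros cz cw S_cont)?)+ simp
  ultimately have "2 * ip T (SQ \<theta>) (W z) + ip T (SD \<theta> (zeta z)) (zeta z) - \<epsilon>\<^sup>2 * (\<mu> * (\<mu> - 1) * (norm z)\<^sup>2 * I0)
     = Re (of_real (\<epsilon>\<^sup>2) * ((ue \<theta>)\<^sup>2 * X1 + (X2 - V) + (cnj (ue \<theta>))\<^sup>2 * X3))"
    unfolding V_def I0_def by (simp add: algebra_simps)
  also have "\<bar>\<dots>\<bar> \<le> norm (of_real (\<epsilon>\<^sup>2) * ((ue \<theta>)\<^sup>2 * X1 + (X2 - V) + (cnj (ue \<theta>))\<^sup>2 * X3))" by (rule abs_Re_le_cmod)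
  also have "\<dots> \<le> \<epsilon>\<^sup>2 * (norm X1 + norm (X2 - V) + norm X3)"
  proof -
    have "norm ((ue \<theta>)\<^sup>2 * X1 + (X2 - V) + (cnj (ue \<theta>))\<^sup>2 * X3) \<le> norm ((ue \<theta>)\<^sup>2 * X1) + norm (X2 - V) + norm ((cnj (ue \<theta>))\<^sup>2 * X3)"
      by (intro norm_triangle_le add_mono order_refl)
    then have "norm ((ue \<theta>)\<^sup>2 * X1 + (X2 - V) + (cnj (ue \<theta>))\<^sup>2 * X3) \<le> norm X1 + norm (X2 - V) + norm X3"
      unfolding norm_mult norm_power complex_mod_cnj ue(1) by simp
    then show ?thesis unfolding norm_of_real_mult abs_power2 by (rule mult_left_mono) simp
  qed
  also have "\<dots> \<le> \<epsilon>\<^sup>2 * (OC * hb (\<mu> * (1 - \<mu>)) (- e1) (- e2) * (norm z)\<^sup>2 * \<epsilon>\<^sup>2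
       + OC * hb (2 * \<mu> * (1 - \<mu>)) (- 2 * e2) (- 2 * e1) * (norm z)\<^sup>2 * \<epsilon>\<^sup>2 + OC * hb (- (\<mu> * (\<mu> + 1))) (- e1) e3 * (norm z)\<^sup>2 * \<epsilon>\<^sup>2)"
    by (intro mult_left_mono add_mono b1 b2 b3) simp
  also have "\<dots> = OC * hbt * (norm z)\<^sup>2 * \<epsilon> ^ 4"
    by (simp add: hbt_def algebra_simps eval_nat_numeral)
  finally show ?thesis .
qed

section \<open>Sign on the boundary of the resonant ball\<close>

definition "C0 = CG * (CP * (1 + M)\<^sup>2)"
definition "XX = Zc * K + C0"
definition "Bn = cQ \<mu> * XX\<^sup>2 + cC \<mu> * M ^ 3 + cC \<mu> * XX ^ 3 + cD \<mu> * (M\<^sup>2 * XX) + CR * (1 + M) ^ 4"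
text \<open>Free of \<open>K\<close>, so that \<open>K\<close> can be chosen afterwards to dominate
  it. This works because \<open>C0\<close> bounds the correction using only that solutions have norm
  at most \<epsilon>. All errors involving \<open>K\<close> are in \<open>Bb\<close>, which carries
  an extra factor \<epsilon>.\<close>

definition "Aa = cQ \<mu> * C0\<^sup>2 * Zc + (cQ \<mu> + cC \<mu>) * (OC * (\<bar>A1\<bar> + \<bar>B1\<bar>)) + cD \<mu> * (M\<^sup>2 * C0) * Zc + CR * (1 + M) ^ 4 * Zc"
definition "Bb = OC * hbt * K + 2 * cW * K * Bn + cC \<mu> * XX ^ 3 * Zc"

lemma const_nonneg: "0 \<le> C0" "0 \<le> XX" "0 \<le> Bn" "0 \<le> Aa" "0 \<le> Bb"
  using pos Zc1 K(2) c_nonneg CR(2) OC0 hb0 cW0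
  by (auto simp: C0_def XX_def Bn_def Aa_def Bb_def hbt_def intro!: add_nonneg_nonneg mult_nonneg_nonneg)

text \<open>All terms of \<open>Nf_expand\<close> are paired with the oscillation after splitting
  the solution into \<open>zeta z\<close> and the correction \<open>v\<close>. Nothing but its size
  and its equation is known about \<open>v\<close>.\<close>

lemma boundary_estimate:
  assumes z: "norm z = \<rho>" and fx: "reduced_sol \<theta> z x"
  shows "ip T (Nf \<theta> x) (zeta z) \<ge> \<rho> * \<epsilon> ^ 4 * (K * (\<mu> * (\<mu> - 1)) * I0 - Aa - Bb * \<epsilon>)"
proof -
  have x: "x \<in> periodic T" "\<And>s. norm (x s) \<le> \<epsilon>" and xe: "\<And>s. zeta z s + Linv (Nf \<theta> x) s = x s"
    using fx unfolding reduced_sol_def by (auto simp: fun_eq_iff)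
  define v where "v = Linv (Nf \<theta> x)"
  have xv: "x s = zeta z s + v s" for s using xe[of s] by (simp add: v_def)
  have Np: "Nf \<theta> x \<in> periodic T" by (rule Nf_periodic[OF x])
  have vp: "v \<in> periodic T" unfolding v_def by (rule Linv_periodic[OF Np])
  note cx = periodicD(1)[OF x(1)] and cz = periodicD(1)[OF zeta_periodic[of z]] and cv = periodicD(1)[OF vp] and cN = periodicD(1)[OF Np] and cw = periodicD(1)[OF W_periodic[of z]]
  have zb: "norm (zeta z s) \<le> Zc * \<rho>" for s using zeta_bound[of z s] z by simp
  have vb: "norm (v s) \<le> C0 * \<epsilon>\<^sup>2" for s
    using v_bound[OF x, of \<theta> s] by (simp add: v_def C0_def mult.assoc)
  have xb: "norm (x s) \<le> XX * \<epsilon>\<^sup>2" for s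
    unfolding xv using norm_triangle_ineq[of "zeta z s" "v s"] zb[of s] vb[of s] K by (simp add: XX_def algebra_simps)
  have Wb: "norm (W z s) \<le> cW * \<rho>\<^sup>2" for s using W_bound[of z s] z by simp
  define rm where "rm = rem \<theta> x"
  have rmx: "rm s = Nf \<theta> x s - (Qp \<mu> (x s) + SQ \<theta> s - SC \<theta> s + Cp \<mu> (x s) + SD \<theta> x s)" for s
    unfolding rm_def by (subst Nf_expand) simp
  have crm: "continuous_on UNIV rm" unfolding rmx[abs_def]
    by (intro continuous_on_add continuous_on_diff cN Qp_cont Cp_cont S_cont cx)
  have rmb: "norm (rm s) \<le> CR * (1 + M) ^ 4 * \<epsilon> ^ 4" for s unfolding rm_def by (rule rem_bound[OF x(2)])
  have SCb: "norm (SC \<theta> s) \<le> cC \<mu> * M ^ 3 * \<epsilon> ^ 3" for s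
    unfolding SC_def
  proof (rule weighted_norm)
    fix j assume j: "j < n"
    have "norm (Cp \<mu> (dd \<theta> j s)) \<le> cC \<mu> * norm (dd \<theta> j s) ^ 3" by (rule Cp_bound)
    also have "\<dots> \<le> cC \<mu> * (M * \<epsilon>) ^ 3" using dd_bound[OF j] c_nonneg by (intro mult_left_mono power_mono) auto
    finally show "norm (Cp \<mu> (dd \<theta> j s)) \<le> cC \<mu> * M ^ 3 * \<epsilon> ^ 3" by (simp add: power_mult_distrib)
  qed
  have SDb: "norm (SD \<theta> y s) \<le> cD \<mu> * (M\<^sup>2 * Y) * \<epsilon> ^ 4" if "norm (y s) \<le> Y * \<epsilon>\<^sup>2" for y Y s
    unfolding SD_def
  proof (rule weighted_norm)
    fix j assume j: "j < n"
    have "norm (DC \<mu> (dd \<theta> j s) (y s)) \<le> cD \<mu> * ((norm (dd \<theta> j s))\<^sup>2 * norm (y s))" by (rule DC_bound)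
    also have "\<dots> \<le> cD \<mu> * ((M * \<epsilon>)\<^sup>2 * (Y * \<epsilon>\<^sup>2))" using dd_bound[OF j] c_nonneg that by (intro mult_left_mono mult_mono power_mono) auto
    also have "\<dots> = cD \<mu> * (M\<^sup>2 * Y) * \<epsilon> ^ 4" by (simp add: power_mult_distrib eval_nat_numeral)
    finally show "norm (DC \<mu> (dd \<theta> j s) (y s)) \<le> cD \<mu> * (M\<^sup>2 * Y) * \<epsilon> ^ 4" .
  qed
  have Qxb: "norm (Qp \<mu> (y s)) \<le> cQ \<mu> * Y\<^sup>2 * \<epsilon> ^ 4" if "norm (y s) \<le> Y * \<epsilon>\<^sup>2" for y Y s
  proof -
    have "norm (Qp \<mu> (y s)) \<le> cQ \<mu> * (Y * \<epsilon>\<^sup>2)\<^sup>2"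
      using order_trans[OF Qp_bound mult_left_mono[OF power_mono[OF that norm_ge_zero] c_nonneg(1)]] .
    then show ?thesis by (simp add: power_mult_distrib power_mult[symmetric])
  qed
  have Cxb: "norm (Cp \<mu> (x s)) \<le> cC \<mu> * XX ^ 3 * \<epsilon> ^ 6" for s
  proof -
    have "norm (Cp \<mu> (x s)) \<le> cC \<mu> * (XX * \<epsilon>\<^sup>2) ^ 3"
      using order_trans[OF Cp_bound mult_left_mono[OF power_mono[OF xb norm_ge_zero] c_nonneg(2)]] .
    then show ?thesis by (simp add: power_mult_distrib power_mult[symmetric])
  qed
  have e43: "\<epsilon> ^ 4 \<le> \<epsilon> ^ 3" "\<epsilon> ^ 6 \<le> \<epsilon> ^ 3" "\<epsilon> ^ 6 \<le> \<epsilon> ^ 5" "\<epsilon>\<^sup>2 * \<epsilon> ^ 3 \<le> \<epsilon> ^ 4"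
    using pos eps1 by (auto intro!: power_decreasing simp flip: power_add)
  have NSQ: "norm (Nf \<theta> x s - SQ \<theta> s) \<le> Bn * \<epsilon> ^ 3" for s
  proof -
    have tri: "norm (a - b + c + d + e) \<le> norm a + norm b + norm c + norm d + norm e" for a b c d e :: complex
      using norm_triangle_ineq[of "a - b + c + d" e] norm_triangle_ineq[of "a - b + c" d] norm_triangle_ineq[of "a - b" c] norm_triangle_ineq4[of a b] by linarith
    have "Nf \<theta> x s - SQ \<theta> s = Qp \<mu> (x s) - SC \<theta> s + Cp \<mu> (x s) + SD \<theta> x s + rm s" unfolding rm_def by (subst Nf_expand) simp
    then have "norm (Nf \<theta> x s - SQ \<theta> s) \<le> norm (Qp \<mu> (x s)) + norm (SC \<theta> s) + norm (Cp \<mu> (x s)) + norm (SD \<theta> x s) + norm (rm s)"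
      using tri by presburger
    also have "\<dots> \<le> cQ \<mu> * XX\<^sup>2 * \<epsilon> ^ 4 + cC \<mu> * M ^ 3 * \<epsilon> ^ 3 + cC \<mu> * XX ^ 3 * \<epsilon> ^ 6 + cD \<mu> * (M\<^sup>2 * XX) * \<epsilon> ^ 4 + CR * (1 + M) ^ 4 * \<epsilon> ^ 4"
      by (intro add_mono Qxb SCb Cxb SDb rmb xb)
    also have "\<dots> \<le> cQ \<mu> * XX\<^sup>2 * \<epsilon> ^ 3 + cC \<mu> * M ^ 3 * \<epsilon> ^ 3 + cC \<mu> * XX ^ 3 * \<epsilon> ^ 3 + cD \<mu> * (M\<^sup>2 * XX) * \<epsilon> ^ 3 + CR * (1 + M) ^ 4 * \<epsilon> ^ 3"
      using c_nonneg const_nonneg(2) CR(2) pos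
      by (intro add_mono mult_left_mono e43 order_refl) (auto intro!: mult_nonneg_nonneg)
    finally show ?thesis by (simp add: Bn_def algebra_simps)
  qed
  \<comment> \<open>\<open>Qp (zeta z)\<close> is the image of \<open>W z\<close>; symmetry moves
    the operator onto \<open>v\<close>, whose image is \<open>Nf \<theta> x\<close> minus a defect
    orthogonal to \<open>W z\<close>. Only \<open>SQ\<close> matters in \<open>Nf\<close> at this
    order.\<close>
  have QpN: "ip T (\<lambda>s. Qp \<mu> (zeta z s)) v = ip T (SQ \<theta>) (W z) + ip T (\<lambda>s. Nf \<theta> x s - SQ \<theta> s) (W z)"
  proof -
    have "ip T (\<lambda>s. Qp \<mu> (zeta z s)) v = ip T (W z) (\<lambda>s. Nf \<theta> x s - ell (Nf \<theta> x) s)"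
      using Lsol_symmetric[OF W_Lsol Linv_Lsol[OF Np] W_periodic Linv_periodic[OF Np] Qp_cont[OF cz]]
        continuous_on_diff[OF cN periodicD(1)[OF ell_periodic[OF Np]]] unfolding v_def by simp
    also have "\<dots> = ip T (W z) (Nf \<theta> x) - ip T (W z) (ell (Nf \<theta> x))"
      by (rule ip_diff_right[OF cN periodicD(1)[OF ell_periodic[OF Np]] cw])
    also have "ip T (W z) (ell (Nf \<theta> x)) = 0" using ip_W_ell[OF Np] ip_sym by metis
    also have "ip T (W z) (Nf \<theta> x) = ip T (Nf \<theta> x) (W z)" by (rule ip_sym)
    finally show ?thesis using ip_diff_left[OF cN S_cont(1)[of \<theta>] cw, of T] by simp
  qed
  have i1: "\<bar>ip T (\<lambda>s. Nf \<theta> x s - SQ \<theta> s) (W z)\<bar> \<le> (Bn * \<epsilon> ^ 3) * (cW * \<rho>\<^sup>2)"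
    by (rule ip_bound[OF _ cw T0 NSQ Wb]) (intro continuous_intros cN S_cont)
  \<comment> \<open>The mixed term is as large as the detuning and cannot be bounded away; by
    \<open>Qb_symm\<close> it reduces to the pairing just computed.\<close>
  have Qbv: "ip T (\<lambda>s. Qb \<mu> (zeta z s) (v s)) (zeta z) = 2 * ip T (\<lambda>s. Qp \<mu> (zeta z s)) v"
    unfolding ip_def Qb_symm by (rule ravg_cmul) (intro continuous_on_inner Qp_cont cz cv)
  have dec: "Nf \<theta> x = (\<lambda>s. Qp \<mu> (zeta z s) + (Qb \<mu> (zeta z s) (v s) + (Qp \<mu> (v s) + (SQ \<theta> s - SC \<theta> s
      + (Cp \<mu> (x s) + (SD \<theta> (zeta z) s + (SD \<theta> v s + rm s)))))))"
  proof
    fix s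
    have "SD \<theta> x s = SD \<theta> (zeta z) s + SD \<theta> v s"
      unfolding SD_def xv DC_add by (simp add: distrib_left sum.distrib)
    moreover have "Qp \<mu> (x s) = Qp \<mu> (zeta z s) + Qb \<mu> (zeta z s) (v s) + Qp \<mu> (v s)" unfolding xv by (rule Qp_add)
    ultimately show "Nf \<theta> x s = Qp \<mu> (zeta z s) + (Qb \<mu> (zeta z s) (v s) + (Qp \<mu> (v s) + (SQ \<theta> s - SC \<theta> s
      + (Cp \<mu> (x s) + (SD \<theta> (zeta z) s + (SD \<theta> v s + rm s))))))"
      using rmx[of s] by simp
  qed
  note cc = Qp_cont[OF cz] Qb_cont[OF cz cv] Qp_cont[OF cv] S_cont(1)[of \<theta>] S_cont(2)[of \<theta>] Cp_cont[OF cx] S_cont(3)[OF cz, of \<theta>] S_cont(3)[OF cv, of \<theta>] crm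
  have split: "ip T (Nf \<theta> x) (zeta z) = ip T (\<lambda>s. Qp \<mu> (zeta z s)) (zeta z) + (ip T (\<lambda>s. Qb \<mu> (zeta z s) (v s)) (zeta z) + (ip T (\<lambda>s. Qp \<mu> (v s)) (zeta z)
      + (ip T (SQ \<theta>) (zeta z) - ip T (SC \<theta>) (zeta z) + (ip T (\<lambda>s. Cp \<mu> (x s)) (zeta z) + (ip T (SD \<theta> (zeta z)) (zeta z) + (ip T (SD \<theta> v) (zeta z) + ip T rm (zeta z)))))))"
    unfolding dec by (subst ip_add_left ip_diff_left; (intro continuous_on_add continuous_on_diff cc cz)?)+ (rule refl)
  have i2: "\<bar>ip T (\<lambda>s. Qp \<mu> (v s)) (zeta z)\<bar> \<le> (cQ \<mu> * C0\<^sup>2 * \<epsilon> ^ 4) * (Zc * \<rho>)" by (rule ip_bound[OF cc(3) cz T0 Qxb[of v _ C0, OF vb] zb])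
  have i3: "\<bar>ip T (\<lambda>s. Cp \<mu> (x s)) (zeta z)\<bar> \<le> (cC \<mu> * XX ^ 3 * \<epsilon> ^ 6) * (Zc * \<rho>)" by (rule ip_bound[OF cc(6) cz T0 Cxb zb])
  have i4: "\<bar>ip T (SD \<theta> v) (zeta z)\<bar> \<le> (cD \<mu> * (M\<^sup>2 * C0) * \<epsilon> ^ 4) * (Zc * \<rho>)" by (rule ip_bound[OF cc(8) cz T0 SDb[of v _ C0, OF vb] zb])
  have i5: "\<bar>ip T rm (zeta z)\<bar> \<le> (CR * (1 + M) ^ 4 * \<epsilon> ^ 4) * (Zc * \<rho>)" by (rule ip_bound[OF cc(9) cz T0 rmb zb])
  define AB where "AB = OC * (\<bar>A1\<bar> + \<bar>B1\<bar>)"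
  have AB0: "0 \<le> AB" using OC0 by (simp add: AB_def)
  have i6: "\<bar>ip T (SQ \<theta>) (zeta z)\<bar> \<le> cQ \<mu> * AB * \<epsilon> ^ 4 * \<rho>"
    using ip_SQ_zeta[of \<theta> z] z by (simp add: AB_def eval_nat_numeral mult_ac)
  have i7: "\<bar>ip T (SC \<theta>) (zeta z)\<bar> \<le> cC \<mu> * AB * \<epsilon> ^ 4 * \<rho>"
  proof -
    have "\<bar>ip T (SC \<theta>) (zeta z)\<bar> \<le> (cC \<mu> * AB * \<rho>) * (\<epsilon>\<^sup>2 * \<epsilon> ^ 3)" using ip_SC_zeta[of \<theta> z] z by (simp add: AB_def mult_ac)
    also have "\<dots> \<le> (cC \<mu> * AB * \<rho>) * \<epsilon> ^ 4" using c_nonneg AB0 pos by (intro mult_left_mono e43) auto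
    finally show ?thesis by (simp add: mult_ac)
  qed
  have i8: "2 * ip T (SQ \<theta>) (W z) + ip T (SD \<theta> (zeta z)) (zeta z) \<ge> \<epsilon>\<^sup>2 * (\<mu> * (\<mu> - 1) * \<rho>\<^sup>2 * I0) - OC * hbt * \<rho>\<^sup>2 * \<epsilon> ^ 4"
    using main_term[of \<theta> z] unfolding z by linarith
  have i3': "(cC \<mu> * XX ^ 3 * \<epsilon> ^ 6) * (Zc * \<rho>) \<le> (cC \<mu> * XX ^ 3 * \<epsilon> ^ 5) * (Zc * \<rho>)"
    using c_nonneg const_nonneg pos Zc1 by (intro mult_right_mono mult_left_mono e43) auto
  have i8': "OC * hbt * \<rho>\<^sup>2 * \<epsilon> ^ 4 \<le> OC * hbt * (K * \<rho>) * \<epsilon> ^ 5"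
  proof -
    have "OC * hbt * \<rho>\<^sup>2 * \<epsilon> ^ 4 = (OC * hbt * (K * \<rho>)) * \<epsilon> ^ 6" using K by (simp add: eval_nat_numeral)
    also have "\<dots> \<le> (OC * hbt * (K * \<rho>)) * \<epsilon> ^ 5" using OC0 hb0 K(2) pos
      by (intro mult_left_mono e43) (auto simp: hbt_def intro!: mult_nonneg_nonneg add_nonneg_nonneg)
    finally show ?thesis .
  qed
  have "ip T (Nf \<theta> x) (zeta z) = 2 * ip T (SQ \<theta>) (W z) + ip T (SD \<theta> (zeta z)) (zeta z) + 2 * ip T (\<lambda>s. Nf \<theta> x s - SQ \<theta> s) (W z)
     + ip T (\<lambda>s. Qp \<mu> (v s)) (zeta z) + ip T (SQ \<theta>) (zeta z) - ip T (SC \<theta>) (zeta z) + ip T (\<lambda>s. Cp \<mu> (x s)) (zeta z) + ip T (SD \<theta> v) (zeta z) + ip T rm (zeta z)"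
    unfolding split Qbv QpN ip_Qp_zeta0 by simp
  then have "ip T (Nf \<theta> x) (zeta z) \<ge> \<epsilon>\<^sup>2 * (\<mu> * (\<mu> - 1) * \<rho>\<^sup>2 * I0) - OC * hbt * (K * \<rho>) * \<epsilon> ^ 5 - 2 * ((Bn * \<epsilon> ^ 3) * (cW * \<rho>\<^sup>2))
     - (cQ \<mu> * C0\<^sup>2 * \<epsilon> ^ 4) * (Zc * \<rho>) - cQ \<mu> * AB * \<epsilon> ^ 4 * \<rho> - cC \<mu> * AB * \<epsilon> ^ 4 * \<rho> - (cC \<mu> * XX ^ 3 * \<epsilon> ^ 5) * (Zc * \<rho>)
     - (cD \<mu> * (M\<^sup>2 * C0) * \<epsilon> ^ 4) * (Zc * \<rho>) - (CR * (1 + M) ^ 4 * \<epsilon> ^ 4) * (Zc * \<rho>)"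
    using i1 i2 i3 i4 i5 i6 i7 i8 i3' i8' by linarith
  also have "\<epsilon>\<^sup>2 * (\<mu> * (\<mu> - 1) * \<rho>\<^sup>2 * I0) = \<rho> * \<epsilon> ^ 4 * (K * (\<mu> * (\<mu> - 1)) * I0)"
    using K(1) by (simp add: eval_nat_numeral)
  also have "2 * ((Bn * \<epsilon> ^ 3) * (cW * \<rho>\<^sup>2)) = 2 * cW * K * Bn * \<rho> * \<epsilon> ^ 5"
    using K(1) by (simp add: eval_nat_numeral)
  finally show ?thesis unfolding Aa_def Bb_def AB_def[symmetric]
    by (simp add: algebra_simps eval_nat_numeral)
qed

end

section \<open>Existence of solutions\<close>

text \<open>Infinite descent on \<open>b\<close>.\<close>

lemma no_sqrt2: "(a::nat) * a = 2 * b * b \<Longrightarrow> b = 0"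
proof (induction b arbitrary: a rule: less_induct)
  case (less b)
  show ?case
  proof (rule ccontr)
    assume b: "b \<noteq> 0"
    have "even (a * a)" using less.prems by simp
    then obtain c where c: "a = 2 * c" by auto
    have bc: "b * b = 2 * c * c" using less.prems c by simp
    have "c < b"
    proof (rule ccontr)
      assume "\<not> c < b"
      then have "b * b \<le> c * c" by (intro mult_mono) auto
      then show False using bc b by simp
    qed
    from less.IH[OF this bc] have "c = 0" .
    then show False using bc b by simp
  qed
qed

text \<open>A unit exponential over a real period forces a real frequency. For \<mu> = 1 resonance
  would make \<open>sqrt 2 * p\<close> an integer.\<close>

lemma circ_res:
  assumes T: "T = 2 * pi * real p" "p \<ge> 1" and mu: "\<mu> \<ge> 1" and k: "\<kappa> = csqrt (of_real (4 - 2 * \<mu>))" and r: "circ.res T \<kappa>"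
  shows "Im \<kappa> = 0" "\<mu> > 1"
proof -
  have T0: "T > 0" using T by simp
  have c: "circ T \<mu> \<kappa>" using T0 mu k by unfold_locales auto
  have r': "\<kappa> \<noteq> 0" "exp (\<i> * \<kappa> * of_real T) = 1" using r unfolding circ.res_def[OF c] by auto
  then have e: "Im \<kappa> * T = 0" "\<exists>i. Re \<kappa> * T = of_int (2 * i) * pi" unfolding exp_eq_1 by auto
  then show "Im \<kappa> = 0" using T0 by simp
  show "\<mu> > 1"
  proof (rule ccontr)
    assume "\<not> \<mu> > 1"
    then have "\<mu> = 1" using mu by simp
    then have "\<kappa> = of_real (sqrt 2)" unfolding k using of_real_sqrt[of 2] by simp
    then obtain i where i: "sqrt 2 * T = of_int (2 * i) * pi" using e(2) by auto
    then have "(2 * pi) * (sqrt 2 * real p) = (2 * pi) * of_int i" unfolding T by (simp add: mult_ac)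
    then have "sqrt 2 * real p = of_int i" by simp
    then have "(sqrt 2 * real p)\<^sup>2 = (of_int i)\<^sup>2" by simp
    moreover have "(sqrt 2 * real p)\<^sup>2 = 2 * (real p * real p)" by (simp only: power_mult_distrib power2_eq_square) simp
    ultimately have "real (2 * p * p) = real_of_int (i * i)" by (simp add: power2_eq_square)
    then have "int (2 * p * p) = i * i" by linarith
    also have "i * i = int (nat \<bar>i\<bar> * nat \<bar>i\<bar>)" by (simp add: abs_mult_self_eq)
    finally have "nat \<bar>i\<bar> * nat \<bar>i\<bar> = 2 * p * p" by (simp only: of_nat_eq_iff)
    then have "p = 0" by (rule no_sqrt2)
    then show False using T(2) by simp
  qed
qed

text \<open>Fixes the order of the constants: bounds that depend on period, \<mu>, \<kappa> and
  primaries come before \<open>K\<close>, then \<open>Bb\<close>, and \<epsilon>0 comes last. None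
  of them depends on \<open>q\<close>, although the fast frequency does.\<close>

lemma complex_solution:
  fixes n p :: nat and m :: "nat \<Rightarrow> real" and qc :: "nat \<Rightarrow> real \<Rightarrow> complex"
  assumes p: "p \<ge> 1" and n: "n \<ge> 2" and mu: "\<mu> \<ge> 1" "\<mu> \<noteq> 3/2"
    and m: "\<And>j. j < n \<Longrightarrow> m j > 0" "(\<Sum>j<n. m j) = 1"
    and qa: "\<And>j. j < n \<Longrightarrow> qc j \<in> periodic (2 * pi)" "\<And>t. (\<Sum>j<n. of_real (m j) * qc j t) = 0" "\<And>t. qc 0 t \<noteq> qc 1 t"
  shows "\<exists>\<epsilon>0>0. \<exists>C>0. \<forall>\<epsilon> \<omega> q. 0 < \<epsilon> \<and> \<epsilon> \<le> \<epsilon>0 \<and> \<omega> = \<epsilon> powr \<mu> \<and> q > (0::nat) \<and> \<omega> = real p / real q \<longrightarrow>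
    (\<exists>\<theta> x. x \<in> periodic (2 * pi * real p) \<and> (\<forall>s. norm (x s) \<le> C * \<epsilon>\<^sup>2) \<and> (\<forall>s. norm (x s) \<le> 1/16) \<and>
      (\<forall>j<n. \<forall>s. norm (of_real \<epsilon> * qc j (s / \<omega>)) \<le> 1/16) \<and>
      Lsol \<mu> x (\<lambda>s. \<Sum>j<n. of_real (m j) * Psi \<mu> (x s - of_real \<epsilon> * cis (- (s + \<theta>)) * qc j (s / \<omega>))))"
proof -
  define T where "T = 2 * pi * real p"
  have T0: "T > 0" using p by (simp add: T_def)
  define \<kappa> where "\<kappa> = csqrt (of_real (4 - 2 * \<mu>))"
  interpret c: circ T \<mu> \<kappa> using T0 mu(1) by unfold_locales (auto simp: \<kappa>_def)
  note cr = circ_res[OF T_def p mu(1) \<kappa>_def]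
  obtain CG where CG: "CG \<ge> 0" "\<And>f B s. f \<in> periodic T \<Longrightarrow> (\<And>s. norm (f s) \<le> B) \<Longrightarrow> norm (c.Linv f s) \<le> CG * B"
    using c.Linv_bound by blast
  have mu0: "\<mu> \<ge> 0" using mu by simp
  obtain CP where CP: "CP \<ge> 0" "\<And>z w. norm z \<le> 1/4 \<Longrightarrow> norm w \<le> 1/4 \<Longrightarrow> norm (Psi \<mu> z - Psi \<mu> w) \<le> CP * (norm z + norm w) * norm (z - w)"
    using Psi_lipschitz[OF mu0] by blast
  obtain CR where CR: "CR \<ge> 0" "\<And>z. norm z \<le> 1/4 \<Longrightarrow> norm (Psi \<mu> z - Qp \<mu> z - Cp \<mu> z) \<le> CR * norm z ^ 4"
    using Psi_taylor[OF mu0] by blast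
  obtain CS where CS: "CS \<ge> 0" "\<And>h B s. h \<in> periodic (2 * pi) \<Longrightarrow> (\<And>s. norm (h s) \<le> B) \<Longrightarrow> norm (Sop (2 * pi) 0 h s) \<le> CS * B"
    using Sop_bound[of "2 * pi" 0] by auto
  obtain M where M: "M \<ge> 0" "\<And>j t. j < n \<Longrightarrow> norm (qc j t) \<le> M"
  proof -
    have "\<exists>B. \<forall>t. norm (qc j t) \<le> B" if j: "j < n" for j
    proof -
      have "compact (qc j ` {0..2 * pi})"
        using periodicD(1)[OF qa(1)[OF j]] by (intro compact_continuous_image) (auto intro: continuous_on_subset)
      then obtain B where B: "\<forall>x\<in>qc j ` {0..2 * pi}. norm x \<le> B"
        using compact_imp_bounded[of "qc j ` {0..2 * pi}"] unfolding bounded_iff by blast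
      have "norm (qc j t) \<le> B" for t
      proof (rule periodic_reduce[OF qa(1)[OF j], where P = "\<lambda>v. norm v \<le> B"])
        show "norm (qc j s) \<le> B" if "0 \<le> s" "s \<le> 2 * pi" for s using B that by simp
      qed simp
      then show ?thesis by blast
    qed
    then obtain B where B: "\<And>j t. j < n \<Longrightarrow> norm (qc j t) \<le> B j" by metis
    have "norm (qc j t) \<le> (\<Sum>j<n. \<bar>B j\<bar>)" if "j < n" for j t
      using B[OF that, of t] member_le_sum[of j "{..<n}" "\<lambda>j. \<bar>B j\<bar>"] that by force
    then show ?thesis by (intro that[of "\<Sum>j<n. \<bar>B j\<bar>"]) (auto intro: sum_nonneg)
  qed
  define Iq where "Iq = resonant_circ.I0 n m qc"
  define Aa where "Aa = resonant_circ.Aa \<mu> \<kappa> M CG CP CR CS"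
  \<comment> \<open>Makes the detuning exceed \<open>Aa\<close> by one. Without resonance the ball
    of amplitudes shrinks to a point.\<close>
  define K where "K = (if c.res then (\<bar>Aa\<bar> + 1) / (\<mu> * (\<mu> - 1) * \<bar>Iq\<bar>) else 0)"
  define Bb where "Bb = resonant_circ.Bb \<mu> \<kappa> M CG CP CR CS K"
  define Zv where "Zv = 1 + 2 / \<bar>Re \<kappa>\<bar>"
  have Zv: "Zv \<ge> 1" by (simp add: Zv_def)
  have K0: "K \<ge> 0" using mu(1) by (simp add: K_def)
  define C where "C = Zv * K + CG * (CP * (1 + M)\<^sup>2) + 1"
  \<comment> \<open>One summand of the denominator for each demand: \<open>small1\<close>,
    \<open>small2\<close>, \<open>small3\<close>, and a boundary error
    \<open>Bb * \<epsilon>\<close> of at most 1/2.\<close>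
  define \<epsilon>0 where "\<epsilon>0 = 1 / (16 * (1 + M) + 4 * CG * CP * (1 + M)\<^sup>2 + 2 * Zv * K + 2 * \<bar>Bb\<bar>)"
  define Dn where "Dn = 16 * (1 + M) + 4 * CG * CP * (1 + M)\<^sup>2 + 2 * Zv * K + 2 * \<bar>Bb\<bar>"
  have parts: "0 \<le> 4 * CG * CP * (1 + M)\<^sup>2" "0 \<le> 2 * Zv * K" "0 \<le> 2 * \<bar>Bb\<bar>" "16 \<le> 16 * (1 + M)" using CG(1) CP(1) M(1) Zv K0 by auto
  have D: "Dn \<ge> 16" unfolding Dn_def using parts by linarith
  have e0: "\<epsilon>0 > 0" "\<epsilon>0 = 1 / Dn" using D by (auto simp: \<epsilon>0_def Dn_def)
  have C0: "C > 0" unfolding C_def using Zv K0 CG(1) CP(1) M(1) by (auto intro!: add_nonneg_pos add_nonneg_nonneg mult_nonneg_nonneg)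
  show ?thesis
  proof (rule exI[of _ \<epsilon>0], rule conjI[OF e0(1)], rule exI[of _ C], rule conjI[OF C0], intro allI impI)
    fix \<epsilon> \<omega> :: real and q :: nat
    assume a: "0 < \<epsilon> \<and> \<epsilon> \<le> \<epsilon>0 \<and> \<omega> = \<epsilon> powr \<mu> \<and> q > 0 \<and> \<omega> = real p / real q"
    have Ds: "Dn * \<epsilon> \<le> 1" using a e0 D by (simp add: pos_le_divide_eq mult.commute)
    have s: "P * \<epsilon> \<le> 1" if "P \<le> Dn" for P
      using mult_right_mono[OF that, of \<epsilon>] a Ds by linarith
    have s1: "16 * (1 + M) * \<epsilon> \<le> 1" "4 * CG * CP * (1 + M)\<^sup>2 * \<epsilon> \<le> 1" "2 * Zv * K * \<epsilon> \<le> 1" "2 * \<bar>Bb\<bar> * \<epsilon> \<le> 1"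
      by (rule s, unfold Dn_def, use parts in linarith)+
    have eM: "\<epsilon> + M * \<epsilon> \<le> 1/16" using s1(1) by (simp add: algebra_simps)
    have M\<epsilon>: "0 \<le> M * \<epsilon>" using M(1) a by simp
    have eps1: "\<epsilon> \<le> 1" using eM M\<epsilon> by linarith
    have om: "0 < \<omega>" "\<omega> \<le> \<epsilon>" using a powr_mono'[of 1 \<mu> \<epsilon>] mu eps1 by auto
    have "\<omega> = real p / real q" "q > 0" using a by auto
    then have "\<omega> * real q = real p" by simp
    then have Tq: "T = \<omega> * (2 * pi) * of_nat q" by (simp add: T_def mult.commute mult.left_commute)
    define d0 where "d0 = (\<lambda>j s. of_real \<epsilon> * exp (- \<i> * of_real s) * qc j (s / \<omega>))"
    define \<rho> where "\<rho> = K * \<epsilon>\<^sup>2"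
    have rho: "Zv * \<rho> \<le> \<epsilon> / 2"
    proof -
      have "(2 * Zv * K * \<epsilon>) * \<epsilon> \<le> 1 * \<epsilon>" using s1(3) a by (intro mult_right_mono) auto
      then show ?thesis by (simp add: \<rho>_def power2_eq_square mult_ac)
    qed
    have ex: "(\<lambda>s. exp (- \<i> * of_real s)) \<in> periodic T"
    proof (rule exp_periodic)
      have "exp (- \<i> * of_real T) = cis (- T)" by (simp add: cis_conv_exp)
      also have "- T = 2 * pi * of_int (- int p)" by (simp add: T_def)
      finally show "exp (- \<i> * of_real T) = 1" using cis_multiple_2pi[of "of_int (- int p)"] by simp
    qed
    interpret perturbed_circ T \<mu> \<kappa> n m d0 \<epsilon> \<rho> M CG CP
    proof unfold_locales
      show "m j \<ge> 0" if "j < n" for j using m(1)[OF that] by simp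
      show "(\<Sum>j<n. m j) = 1" by (rule m(2))
      show "d0 j \<in> periodic T" if "j < n" for j
        unfolding d0_def by (intro periodic_mult periodic_const ex scaled_periodic[OF qa(1)[OF that] om(1) Tq])
      show "(\<Sum>j<n. of_real (m j) * d0 j s) = 0" for s
      proof -
        have "(\<Sum>j<n. of_real (m j) * d0 j s) = of_real \<epsilon> * exp (- \<i> * of_real s) * (\<Sum>j<n. of_real (m j) * qc j (s / \<omega>))"
          unfolding d0_def sum_distrib_left by (intro sum.cong) (auto simp: mult_ac)
        then show ?thesis by (simp add: qa(2))
      qed
      show "norm (d0 j s) \<le> M * \<epsilon>" if "j < n" for j s
        using M(2)[OF that, of "s / \<omega>"] a by (simp add: d0_def norm_mult)
      show "(1 + M) * \<epsilon> \<le> 1/16" using eM by (simp add: algebra_simps)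
      show "(1 + 2 / \<bar>Re \<kappa>\<bar>) * \<rho> \<le> \<epsilon> / 2" using rho by (simp add: Zv_def)
      show "0 \<le> \<rho>" using K0 by (simp add: \<rho>_def)
      show "norm (c.Linv f s) \<le> CG * B" if "f \<in> periodic T" "\<And>s. norm (f s) \<le> B" for f B s by (rule CG(2)[OF that])
      show "norm (Psi \<mu> z - Psi \<mu> w) \<le> CP * (norm z + norm w) * norm (z - w)" if "norm z \<le> 1/4" "norm w \<le> 1/4" for z w by (rule CP(2)[OF that])
      show "Im \<kappa> = 0" if c.res using cr(1)[OF that] .
    qed (use a M(1) CG(1) CP(1) s1(2) in auto)
    \<comment> \<open>Two primaries never coincide, so at each time one of them is away from the
      origin; the minimum of the moment of inertia over a period is then positive.\<close>
    have Iqpos: "Iq > 0" and resonant_circ: "resonant_circ T \<mu> \<kappa> n m d0 \<epsilon> \<rho> M CG CP qc \<omega> CR CS K p q" if res: c.res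
    proof -
      interpret resonant_circ T \<mu> \<kappa> n m d0 \<epsilon> \<rho> M CG CP qc \<omega> CR CS K p q
        by unfold_locales (use qa(1) M om Tq a CR CS res mu K0 in \<open>auto simp: d0_def T_def \<rho>_def\<close>)
      show "resonant_circ T \<mu> \<kappa> n m d0 \<epsilon> \<rho> M CG CP qc \<omega> CR CS K p q" ..
      define h where "h = (\<lambda>t. \<Sum>j<n. m j * (norm (qc j t))\<^sup>2)"
      have g: "g11 = (\<lambda>t. of_real (h t))"
      proof
        show "g11 t = of_real (h t)" for t
          unfolding g11_def h_def of_real_sum of_real_mult complex_norm_square ..
      qed
      have ch: "continuous_on UNIV h" unfolding h_def using qa(1) by (intro continuous_intros) (auto simp: periodic_def)
      have hp: "h t > 0" for t
      proof -
        have "qc 0 t \<noteq> 0 \<or> qc 1 t \<noteq> 0" using qa(3)[of t] by auto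
        moreover have "0 < n" "1 < n" using n by auto
        ultimately obtain i where i: "i < n" "qc i t \<noteq> 0" by blast
        have "0 < m i * (norm (qc i t))\<^sup>2" using m(1)[OF i(1)] i(2) by simp
        also have "\<dots> \<le> h t"
        proof -
          have "0 \<le> m j * (norm (qc j t))\<^sup>2" if "j < n" for j using less_imp_le[OF m(1)[OF that]] by simp
          then show ?thesis unfolding h_def using member_le_sum[of i "{..<n}" "\<lambda>j. m j * (norm (qc j t))\<^sup>2"] i(1) by simp
        qed
        finally show ?thesis .
      qed
      obtain t0 where t0: "t0 \<in> {0..2 * pi}" "\<And>t. t \<in> {0..2 * pi} \<Longrightarrow> h t0 \<le> h t"
        using continuous_attains_inf[of "{0..2 * pi}" h] continuous_on_subset[OF ch] by auto
      have "complex_of_real (integral {0..2 * pi} h) = of_real (2 * pi) * avg (2 * pi) g11"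
      proof -
        have "h integrable_on {0..2 * pi}" using ch by (intro integrable_continuous_interval) (auto intro: continuous_on_subset)
        from integral_linear[OF this bounded_linear_of_real]
        have "integral {0..2 * pi} g11 = complex_of_real (integral {0..2 * pi} h)" unfolding g by (simp add: o_def)
        moreover have "continuous_on UNIV g11" unfolding g by (intro continuous_intros ch)
        ultimately show ?thesis using avg_integral[of g11 "2 * pi"] by simp
      qed
      from arg_cong[OF this, of Re] have "integral {0..2 * pi} h = 2 * pi * Re (avg (2 * pi) g11)" by simp
      then have "integral {0..2 * pi} h = 2 * pi * Iq" unfolding Iq_def I0_def .
      moreover have "integral {0..2 * pi} (\<lambda>t. h t0) \<le> integral {0..2 * pi} h"
        using t0 ch by (intro integral_le integrable_continuous_interval) (auto intro: continuous_on_subset)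
      ultimately have "2 * pi * h t0 \<le> 2 * pi * Iq" by simp
      then show "Iq > 0" using hp[of t0] by simp
    qed
    have rr: "c.res \<longleftrightarrow> \<rho> > 0"
    proof (cases c.res)
      case True
      then have "K > 0" using Iqpos[OF True] cr(2)[OF True] by (simp add: K_def)
      then show ?thesis using True a by (simp add: \<rho>_def)
    qed (simp add: \<rho>_def K_def)
    have bd: "ip T (Nf \<theta> x) (zeta z) > 0" if res: c.res and z: "norm z = \<rho>" and fx: "reduced_sol \<theta> z x" for \<theta> z x
    proof -
      have "\<rho> * \<epsilon> ^ 4 * (K * (\<mu> * (\<mu> - 1)) * Iq - Aa - Bb * \<epsilon>) \<le> ip T (Nf \<theta> x) (zeta z)"
        using resonant_circ.boundary_estimate[OF resonant_circ[OF res] z fx] by (simp add: Iq_def Aa_def Bb_def)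
      moreover have "K * (\<mu> * (\<mu> - 1)) * Iq = \<bar>Aa\<bar> + 1"
        using res Iqpos[OF res] cr(2)[OF res] by (simp add: K_def)
      moreover have "Bb * \<epsilon> \<le> 1/2"
      proof -
        have "Bb * \<epsilon> \<le> \<bar>Bb\<bar> * \<epsilon>" by (rule mult_right_mono) (use a in auto)
        then show ?thesis using s1(4) by (simp only: mult.assoc)
      qed
      ultimately have "\<rho> * \<epsilon> ^ 4 * (\<bar>Aa\<bar> + 1 - Aa - Bb * \<epsilon>) \<le> ip T (Nf \<theta> x) (zeta z)" "\<bar>Aa\<bar> + 1 - Aa - Bb * \<epsilon> > 0" by (simp, linarith)
      moreover have "\<rho> * \<epsilon> ^ 4 > 0" using rr res a by simp
      ultimately show ?thesis by (meson less_le_trans mult_pos_pos)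
    qed
    obtain \<theta> z x where z: "norm z \<le> \<rho>" and fx: "reduced_sol \<theta> z x" and L: "Lsol \<mu> x (Nf \<theta> x)"
      using exists_solution[OF bd rr] by blast
    have x: "x \<in> periodic T" "\<And>s. norm (x s) \<le> \<epsilon>" "\<And>s. zeta z s + c.Linv (Nf \<theta> x) s = x s"
      using fx unfolding reduced_sol_def by (auto simp: fun_eq_iff)
    have xb: "norm (x s) \<le> C * \<epsilon>\<^sup>2" for s
    proof -
      have "norm (zeta z s) \<le> Zv * \<rho>"
      proof -
        have "norm (zeta z s) \<le> Zv * norm z" using zeta_bound[of z s] by (simp add: Zv_def Zc_def)
        also have "\<dots> \<le> Zv * \<rho>" using z Zv by (intro mult_left_mono) auto
        finally show ?thesis .
      qed
      moreover have "norm (c.Linv (Nf \<theta> x) s) \<le> CG * (CP * (1 + M)\<^sup>2 * \<epsilon>\<^sup>2)" by (rule v_bound[OF x(1,2)])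
      ultimately have "norm (x s) \<le> Zv * (K * \<epsilon>\<^sup>2) + CG * (CP * (1 + M)\<^sup>2 * \<epsilon>\<^sup>2)"
        using norm_triangle_ineq[of "zeta z s" "c.Linv (Nf \<theta> x) s"] unfolding x(3) \<rho>_def by linarith
      also have "\<dots> \<le> C * \<epsilon>\<^sup>2" by (simp add: C_def algebra_simps)
      finally show ?thesis .
    qed
    have dd: "dd \<theta> j s = of_real \<epsilon> * cis (- (s + \<theta>)) * qc j (s / \<omega>)" for j s
    proof -
      have "cis (- \<theta>) * exp (- \<i> * of_real s) = cis (- (s + \<theta>))"
        using cis_mult[of "- \<theta>" "- s"] by (simp add: cis_conv_exp add.commute)
      moreover have "dd \<theta> j s = of_real \<epsilon> * (cis (- \<theta>) * exp (- \<i> * of_real s)) * qc j (s / \<omega>)"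
        unfolding dd_def by (simp add: d0_def mult_ac)
      ultimately show ?thesis by (simp only:)
    qed
    have "norm (x s) \<le> 1/16" for s using x(2)[of s] eM M\<epsilon> by linarith
    moreover have "norm (of_real \<epsilon> * qc j (s / \<omega>)) \<le> 1/16" if "j < n" for j s
    proof -
      have "norm (of_real \<epsilon> * qc j (s / \<omega>)) \<le> M * \<epsilon>" using M(2)[OF that, of "s / \<omega>"] a by (simp add: norm_mult)
      then show ?thesis using eM a by linarith
    qed
    moreover have "Nf \<theta> x = (\<lambda>s. \<Sum>j<n. of_real (m j) * Psi \<mu> (x s - of_real \<epsilon> * cis (- (s + \<theta>)) * qc j (s / \<omega>)))"
      unfolding Nf_def dd ..
    ultimately show "\<exists>\<theta> x. x \<in> periodic (2 * pi * real p) \<and> (\<forall>s. norm (x s) \<le> C * \<epsilon>\<^sup>2) \<and> (\<forall>s. norm (x s) \<le> 1/16) \<and>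
      (\<forall>j<n. \<forall>s. norm (of_real \<epsilon> * qc j (s / \<omega>)) \<le> 1/16) \<and>
      Lsol \<mu> x (\<lambda>s. \<Sum>j<n. of_real (m j) * Psi \<mu> (x s - of_real \<epsilon> * cis (- (s + \<theta>)) * qc j (s / \<omega>)))"
      using x(1) xb L unfolding T_def by (intro exI[of _ \<theta>] exI[of _ x]) auto
  qed
qed

text \<open>The second coordinate is negated so that \<open>expJ\<close> becomes multiplication by \<open>cis\<close>.\<close>

definition toC :: "real^2 \<Rightarrow> complex" where "toC v = Complex (v $ 1) (- (v $ 2))"

definition fromC :: "complex \<Rightarrow> real^2" where "fromC z = (\<chi> i. if i = 1 then Re z else - Im z)"

lemma toC_fromC [simp]: "toC (fromC z) = z"
  by (simp add: toC_def fromC_def complex_eq_iff)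

lemma fromC_toC [simp]: "fromC (toC v) = v"
  by (simp add: toC_def fromC_def vec_eq_iff forall_2)

lemma norm_toC: "norm (toC v) = norm v"
  by (simp add: toC_def cmod_def norm_vec_def L2_set_def sum_2)

lemma norm_fromC: "norm (fromC z) = norm z"
  using norm_toC[of "fromC z"] by simp

lemma bl_toC: "bounded_linear toC"
  by (rule linear_conv_bounded_linear[THEN iffD1], rule linearI) (simp_all add: toC_def complex_eq_iff)

lemma bl_fromC: "bounded_linear fromC"
  by (rule linear_conv_bounded_linear[THEN iffD1], rule linearI) (simp_all add: fromC_def vec_eq_iff forall_2)

lemmas fromC_lin = linear_add[OF bounded_linear.linear[OF bl_fromC]] linear_scale[OF bounded_linear.linear[OF bl_fromC]]
  linear_sum[OF bounded_linear.linear[OF bl_fromC]]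
lemmas toC_lin = linear_diff[OF bounded_linear.linear[OF bl_toC]] linear_scale[OF bounded_linear.linear[OF bl_toC]]
  linear_sum[OF bounded_linear.linear[OF bl_toC]] linear_neg[OF bounded_linear.linear[OF bl_toC]]

lemma expJ_fromC: "expJ a *v x0 = fromC (cis a)"
  by (simp add: vec_eq_iff forall_2 expJ_def x0_def Jmat_def fromC_def matrix_vector_mult_def sum_2 mat_def)

lemma restricted_field_toC:
  "restricted_field n \<alpha> m qs t v = fromC (\<Sum>j<n. of_real (m j) * Fc ((\<alpha> + 1) / 2) (toC v - toC (qs j t)))"
proof -
  have f: "toC (- ((a / norm w powr (\<alpha> + 1)) *\<^sub>R w)) = of_real a * Fc ((\<alpha> + 1) / 2) (toC w)" for a w
  proof (cases "w = 0")
    case True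
    then show ?thesis by (simp add: Fc_def toC_def complex_eq_iff)
  next
    case False
    then have n: "norm w > 0" by simp
    have h: "2 * (- ((\<alpha> + 1) / 2)) = - (\<alpha> + 1)" by (simp add: field_simps)
    have "(norm w)\<^sup>2 = norm w powr 2" using n by simp
    then have "(norm w)\<^sup>2 powr (- ((\<alpha> + 1) / 2)) = norm w powr (- (\<alpha> + 1))" by (simp only: powr_powr h)
    also have "\<dots> = 1 / norm w powr (\<alpha> + 1)" by (rule powr_minus_divide)
    finally have e: "(norm w)\<^sup>2 powr (- ((\<alpha> + 1) / 2)) = 1 / norm w powr (\<alpha> + 1)" .
    show ?thesis unfolding Fc_def norm_toC toC_lin e
      by (simp add: scaleR_conv_of_real)
  qed
  have "toC (restricted_field n \<alpha> m qs t v) = (\<Sum>j<n. of_real (m j) * Fc ((\<alpha> + 1) / 2) (toC v - toC (qs j t)))"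
    unfolding restricted_field_def toC_lin(1)[symmetric] f[symmetric] sum_negf[symmetric]
    by (simp only: toC_lin)
  then show ?thesis by (metis fromC_toC)
qed

section \<open>Return to the restricted problem\<close>

text \<open>States the equation in the inertial frame, where it admits time shifts, and keeps the
  bounds on \<open>x\<close> that survive such a shift.\<close>

definition usol :: "nat \<Rightarrow> (nat \<Rightarrow> real) \<Rightarrow> real \<Rightarrow> real \<Rightarrow> real \<Rightarrow> (nat \<Rightarrow> real \<Rightarrow> complex) \<Rightarrow> nat \<Rightarrow> real \<Rightarrow> real \<Rightarrow> (real \<Rightarrow> complex) \<Rightarrow> bool" where
  "usol n m \<mu> \<epsilon> \<omega> qc p C \<theta> x \<longleftrightarrow> x \<in> periodic (2 * pi * real p) \<and> (\<forall>s. norm (x s) \<le> C * \<epsilon>\<^sup>2) \<and> (\<forall>s. norm (x s) \<le> 1/16) \<and>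
     (\<exists>u'. \<forall>s. ((\<lambda>s. cis (s + \<theta>) * (1 + x s)) has_vector_derivative u' s) (at s) \<and>
       (u' has_vector_derivative (\<Sum>j<n. of_real (m j) * Fc \<mu> (cis (s + \<theta>) * (1 + x s) - of_real \<epsilon> * qc j (s / \<omega>)))) (at s))"

lemma cis_shift_vd: "((\<lambda>s. cis (s + \<theta>)) has_vector_derivative (\<i> * cis (s + \<theta>))) (at s)"
proof -
  have "((\<lambda>s. cis \<theta> * exp (\<i> * of_real s)) has_vector_derivative (cis \<theta> * (\<i> * exp (\<i> * of_real s)))) (at s)"
    by (intro has_vector_derivative_mult_right exp_deriv)
  moreover have "cis \<theta> * exp (\<i> * of_real s) = cis (s + \<theta>)" for s
    by (simp add: cis_conv_exp[of s, symmetric] cis_mult add.commute)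
  ultimately show ?thesis by (simp add: mult.left_commute)
qed

text \<open>Undoes the rotating frame: the centrifugal and Coriolis terms come from differentiating
  \<open>cis (s + \<theta>)\<close>, and the subtracted linear parts reassemble into the forces of
  the primaries.\<close>

lemma usol_of_Lsol:
  assumes "x \<in> periodic (2 * pi * real p)" "\<And>s. norm (x s) \<le> C * \<epsilon>\<^sup>2" "\<And>s. norm (x s) \<le> 1/16"
    and m: "(\<Sum>j<n. m j) = 1" "\<And>t. (\<Sum>j<n. of_real (m j) * qc j t) = 0"
    and L: "Lsol \<mu> x (\<lambda>s. \<Sum>j<n. of_real (m j) * Psi \<mu> (x s - of_real \<epsilon> * cis (- (s + \<theta>)) * qc j (s / \<omega>)))"
  shows "usol n m \<mu> \<epsilon> \<omega> qc p C \<theta> x"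
proof -
  define d where "d = (\<lambda>j s. of_real \<epsilon> * cis (- (s + \<theta>)) * qc j (s / \<omega>))"
  obtain x' where x: "\<And>s. (x has_vector_derivative x' s) (at s)"
    "\<And>s. (x' has_vector_derivative ((\<Sum>j<n. of_real (m j) * Psi \<mu> (x s - d j s)) - 2 * \<i> * x' s + of_real (2 * \<mu> * Re (x s)))) (at s)"
    using L unfolding Lsol_def d_def by blast
  define c where "c = (\<lambda>s. cis (s + \<theta>))"
  have dc: "(c has_vector_derivative (\<i> * c s)) (at s)" for s unfolding c_def by (rule cis_shift_vd)
  define u' where "u' = (\<lambda>s. c s * x' s + (\<i> * c s) * (1 + x s))"
  have 1: "((\<lambda>s. c s * (1 + x s)) has_vector_derivative u' s) (at s)" for s
    unfolding u'_def by (rule derivative_eq_intros dc x refl)+ simp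
  have ds: "(\<Sum>j<n. of_real (m j) * d j s) = 0" for s
  proof -
    have "(\<Sum>j<n. of_real (m j) * d j s) = of_real \<epsilon> * cis (- (s + \<theta>)) * (\<Sum>j<n. of_real (m j) * qc j (s / \<omega>))"
      unfolding d_def sum_distrib_left by (intro sum.cong) (auto simp: mult_ac)
    then show ?thesis by (simp add: m)
  qed
  have F: "(\<Sum>j<n. of_real (m j) * Fc \<mu> (c s * (1 + x s) - of_real \<epsilon> * qc j (s / \<omega>))) = c s * ((\<Sum>j<n. of_real (m j) * Psi \<mu> (x s - d j s)) - (1 + x s) + of_real (2 * \<mu> * Re (x s)))" for s
  proof -
    have "Fc \<mu> (c s * (1 + x s) - of_real \<epsilon> * qc j (s / \<omega>)) = c s * Fc \<mu> (1 + (x s - d j s))" for j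
    proof -
      have "c s * cis (- (s + \<theta>)) = 1" by (simp add: c_def cis_mult)
      moreover have "c s * d j s = (c s * cis (- (s + \<theta>))) * (of_real \<epsilon> * qc j (s / \<omega>))" by (simp only: d_def mult_ac)
      ultimately have "c s * d j s = of_real \<epsilon> * qc j (s / \<omega>)" by simp
      then have "c s * (1 + x s) - of_real \<epsilon> * qc j (s / \<omega>) = c s * (1 + (x s - d j s))" by (simp add: algebra_simps)
      moreover have "norm (c s) = 1" by (simp add: c_def)
      ultimately show ?thesis by (simp only: Fc_rot)
    qed
    then have "(\<Sum>j<n. of_real (m j) * Fc \<mu> (c s * (1 + x s) - of_real \<epsilon> * qc j (s / \<omega>))) = c s * (\<Sum>j<n. of_real (m j) * Fc \<mu> (1 + (x s - d j s)))"
      by (simp add: sum_distrib_left mult.left_commute)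
    also have "(\<Sum>j<n. of_real (m j) * Fc \<mu> (1 + (x s - d j s))) = (\<Sum>j<n. of_real (m j) * Psi \<mu> (x s - d j s) - of_real (m j) * (1 + x s - of_real (2 * \<mu> * Re (x s)))
        + of_real (m j) * d j s - of_real (2 * \<mu> * Re (of_real (m j) * d j s)))"
      by (intro sum.cong refl) (simp add: Psi_def algebra_simps)
    also have "\<dots> = (\<Sum>j<n. of_real (m j) * Psi \<mu> (x s - d j s)) - of_real (\<Sum>j<n. m j) * (1 + x s - of_real (2 * \<mu> * Re (x s)))
        + (\<Sum>j<n. of_real (m j) * d j s) - of_real (2 * \<mu> * Re (\<Sum>j<n. of_real (m j) * d j s))"
      by (simp add: sum.distrib sum_subtractf sum_distrib_right sum_distrib_left Re_sum del: Re_complex_of_real)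
    finally show ?thesis by (simp add: ds m algebra_simps)
  qed
  have 2: "(u' has_vector_derivative (\<Sum>j<n. of_real (m j) * Fc \<mu> (c s * (1 + x s) - of_real \<epsilon> * qc j (s / \<omega>)))) (at s)" for s
    unfolding F u'_def by (rule derivative_eq_intros dc x refl)+ (simp add: algebra_simps)
  show ?thesis unfolding usol_def
    by (intro conjI allI exI[of _ u'] assms(1-3) 1[unfolded c_def] 2[unfolded c_def])
qed

text \<open>In the slow time the primaries have period \<open>2 * pi * \<omega>\<close>, so a delay
  by whole multiples yields another solution of the same equation, with the delay added to its
  phase.\<close>

lemma usol_shift:
  assumes u: "usol n m \<mu> \<epsilon> \<omega> qc p C \<theta> x" and w: "\<omega> > 0" and qc: "\<And>j. j < n \<Longrightarrow> qc j \<in> periodic (2 * pi)"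
  shows "usol n m \<mu> \<epsilon> \<omega> qc p C (\<theta> + 2 * pi * real k * \<omega>) (\<lambda>s. x (s + 2 * pi * real k * \<omega>))"
proof -
  define a where "a = 2 * pi * real k * \<omega>"
  have per: "qc j (t + 2 * pi * real k) = qc j t" if "j < n" for j t
  proof (induction k)
    case (Suc k)
    have "qc j (t + 2 * pi * real (Suc k)) = qc j ((t + 2 * pi * real k) + 2 * pi)" by (simp add: algebra_simps)
    then show ?case using Suc periodicD(2)[OF qc[OF that]] by simp
  qed simp
  have qs: "qc j ((s + a) / \<omega>) = qc j (s / \<omega>)" if "j < n" for j s
  proof -
    have "(s + a) / \<omega> = s / \<omega> + 2 * pi * real k" using w by (simp add: a_def add_divide_distrib)
    then show ?thesis using per[OF that] by simp
  qed
  obtain u' where u': "\<And>s. ((\<lambda>s. cis (s + \<theta>) * (1 + x s)) has_vector_derivative u' s) (at s)"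
    "\<And>s. (u' has_vector_derivative (\<Sum>j<n. of_real (m j) * Fc \<mu> (cis (s + \<theta>) * (1 + x s) - of_real \<epsilon> * qc j (s / \<omega>)))) (at s)"
    using u unfolding usol_def by blast
  have sh: "((\<lambda>s. f (s + a)) has_vector_derivative f' (s + a)) (at s)" if "\<And>s. (f has_vector_derivative f' s) (at s)" for f f' :: "real \<Rightarrow> complex" and s
  proof -
    have "((f \<circ> (\<lambda>s. s + a)) has_vector_derivative (1 *\<^sub>R f' (s + a))) (at s)"
      by (rule vector_diff_chain_at) (auto intro!: derivative_eq_intros that)
    then show ?thesis by (simp add: o_def)
  qed
  have e: "cis (s + (\<theta> + a)) = cis (s + a + \<theta>)" for s by (simp add: add_ac)
  have 1: "((\<lambda>s. cis (s + (\<theta> + a)) * (1 + x (s + a))) has_vector_derivative u' (s + a)) (at s)" for s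
    unfolding e using sh[OF u'(1)] .
  have "((\<lambda>s. u' (s + a)) has_vector_derivative (\<Sum>j<n. of_real (m j) * Fc \<mu> (cis (s + a + \<theta>) * (1 + x (s + a)) - of_real \<epsilon> * qc j ((s + a) / \<omega>)))) (at s)" for s
    using sh[OF u'(2)] .
  then have 2: "((\<lambda>s. u' (s + a)) has_vector_derivative (\<Sum>j<n. of_real (m j) * Fc \<mu> (cis (s + (\<theta> + a)) * (1 + x (s + a)) - of_real \<epsilon> * qc j (s / \<omega>)))) (at s)" for s
    unfolding e by (simp add: qs)
  have x: "x \<in> periodic (2 * pi * real p)" using u by (simp add: usol_def)
  have "(\<lambda>s. x (s + a)) \<in> periodic (2 * pi * real p)"
  proof (rule periodicI)
    show "continuous_on UNIV (\<lambda>s. x (s + a))"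
      by (rule continuous_on_compose2[OF periodicD(1)[OF x]]) (auto intro!: continuous_intros)
    show "x (s + 2 * pi * real p + a) = x (s + a)" for s
      using periodicD(2)[OF x, of "s + a"] by (simp add: add_ac)
  qed
  moreover have "norm (x s) \<le> C * \<epsilon>\<^sup>2" "norm (x s) \<le> 1/16" for s using u by (simp_all add: usol_def)
  ultimately show ?thesis unfolding usol_def a_def[symmetric]
    by (intro conjI allI exI[of _ "\<lambda>s. u' (s + a)"] 1 2)
qed

lemma cis_minus_period: "cis (t - 2 * pi * of_int i) = cis t"
proof -
  have "cis t / cis (2 * pi * of_int i) = cis (t - 2 * pi * of_int i)" by (rule cis_divide)
  then show ?thesis using cis_multiple_2pi[of "of_int i"] by simp
qed

lemma usol_mod:
  assumes "usol n m \<mu> \<epsilon> \<omega> qc p C \<theta> x"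
  shows "usol n m \<mu> \<epsilon> \<omega> qc p C (\<theta> - 2 * pi * of_int i) x"
proof -
  have "cis (s + (\<theta> - 2 * pi * of_int i)) = cis (s + \<theta>)" for s
    using cis_minus_period[of "s + \<theta>" i] by (simp add: algebra_simps)
  then show ?thesis using assms unfolding usol_def by simp
qed

text \<open>Homogeneity of degree \<open>1 - 2 * \<mu>\<close> of the force.\<close>

lemma Fc_scale:
  assumes "\<epsilon> > 0" shows "Fc \<mu> (of_real \<epsilon> * y) = of_real (\<epsilon> * (\<epsilon>\<^sup>2) powr (- \<mu>)) * Fc \<mu> y"
proof -
  have "(norm (of_real \<epsilon> * y))\<^sup>2 powr (- \<mu>) = (\<epsilon>\<^sup>2) powr (- \<mu>) * ((norm y)\<^sup>2) powr (- \<mu>)"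
    using assms by (simp add: norm_mult power_mult_distrib powr_mult)
  then show ?thesis unfolding Fc_def by (simp only: of_real_mult) (simp add: mult_ac)
qed

definition psol :: "real \<Rightarrow> real \<Rightarrow> real \<Rightarrow> (real \<Rightarrow> complex) \<Rightarrow> real \<Rightarrow> complex" where
  "psol \<epsilon> \<omega> \<theta> x t = of_real (1 / \<epsilon>) * (cis (\<omega> * t + \<theta>) * (1 + x (\<omega> * t)))"

lemma psol_restricted:
  assumes u: "usol n m ((\<alpha> + 1) / 2) \<epsilon> \<omega> (\<lambda>j t. toC (qs j t)) p C \<theta> x" and e: "\<epsilon> > 0" and w: "\<omega> = \<epsilon> powr ((\<alpha> + 1) / 2)"
    and nc: "\<And>j t. j < n \<Longrightarrow> norm (of_real \<epsilon> * toC (qs j t)) \<le> 1/16"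
  shows "restricted_solution n \<alpha> m qs (\<lambda>t. fromC (psol \<epsilon> \<omega> \<theta> x t))"
proof -
  define \<mu> where "\<mu> = (\<alpha> + 1) / 2"
  have w0: "\<omega> > 0" using e w by simp
  have xb: "norm (x s) \<le> 1/16" for s using u by (simp add: usol_def)
  obtain u' where u': "\<And>s. ((\<lambda>s. cis (s + \<theta>) * (1 + x s)) has_vector_derivative u' s) (at s)"
    "\<And>s. (u' has_vector_derivative (\<Sum>j<n. of_real (m j) * Fc \<mu> (cis (s + \<theta>) * (1 + x s) - of_real \<epsilon> * toC (qs j (s / \<omega>))))) (at s)"
    using u unfolding usol_def \<mu>_def by blast
  have sc: "((\<lambda>t. f (\<omega> * t)) has_vector_derivative of_real \<omega> * f' (\<omega> * t)) (at t)" if "\<And>s. (f has_vector_derivative f' s) (at s)" for f f' :: "real \<Rightarrow> complex" and t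
  proof -
    have "((f \<circ> (\<lambda>t. \<omega> * t)) has_vector_derivative (\<omega> *\<^sub>R f' (\<omega> * t))) (at t)"
      by (rule vector_diff_chain_at) (auto intro!: derivative_eq_intros that)
    then show ?thesis by (simp add: o_def scaleR_conv_of_real)
  qed
  define v where "v = (\<lambda>t. of_real (1 / \<epsilon>) * (of_real \<omega> * u' (\<omega> * t)))"
  have 1: "(psol \<epsilon> \<omega> \<theta> x has_vector_derivative v t) (at t)" for t
    unfolding psol_def[abs_def] v_def by (intro has_vector_derivative_mult_right sc u')
  have 2: "(v has_vector_derivative (\<Sum>j<n. of_real (m j) * Fc \<mu> (psol \<epsilon> \<omega> \<theta> x t - toC (qs j t)))) (at t)" for t
  proof -
    have d: "(v has_vector_derivative (of_real (1 / \<epsilon>) * (of_real \<omega> * (of_real \<omega> * (\<Sum>j<n. of_real (m j) * Fc \<mu> (cis (\<omega> * t + \<theta>) * (1 + x (\<omega> * t)) - of_real \<epsilon> * toC (qs j (\<omega> * t / \<omega>)))))))) (at t)"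
      unfolding v_def by (intro has_vector_derivative_mult_right sc u')
    have "cis (\<omega> * t + \<theta>) * (1 + x (\<omega> * t)) - of_real \<epsilon> * toC (qs j (\<omega> * t / \<omega>)) = of_real \<epsilon> * (psol \<epsilon> \<omega> \<theta> x t - toC (qs j t))" for j
      using e w0 by (simp add: psol_def field_simps)
    \<comment> \<open>Kepler's third law for this force: a circular orbit of radius
      \<open>1 / \<epsilon>\<close> has frequency \<open>\<epsilon> powr \<mu>\<close>.\<close>
    moreover have "(1 / \<epsilon>) * (\<omega> * (\<omega> * (\<epsilon> * (\<epsilon>\<^sup>2) powr (- \<mu>)))) = 1"
    proof -
      have "\<epsilon>\<^sup>2 = \<epsilon> powr 2" using e by simp
      then have "(\<epsilon>\<^sup>2) powr (- \<mu>) = \<epsilon> powr (- \<mu>) * \<epsilon> powr (- \<mu>)" by (simp only: powr_powr powr_add[symmetric]) simp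
      then have "\<omega> * (\<omega> * (\<epsilon>\<^sup>2) powr (- \<mu>)) = (\<epsilon> powr \<mu> * \<epsilon> powr (- \<mu>)) * (\<epsilon> powr \<mu> * \<epsilon> powr (- \<mu>))"
        by (simp add: w \<mu>_def mult_ac)
      also have "\<dots> = 1" using e by (simp flip: powr_add)
      finally show ?thesis using e by (simp add: mult_ac)
    qed
    ultimately have "of_real (1 / \<epsilon>) * (of_real \<omega> * (of_real \<omega> * (\<Sum>j<n. of_real (m j) * Fc \<mu> (cis (\<omega> * t + \<theta>) * (1 + x (\<omega> * t)) - of_real \<epsilon> * toC (qs j (\<omega> * t / \<omega>))))))
       = (\<Sum>j<n. of_real (m j) * Fc \<mu> (psol \<epsilon> \<omega> \<theta> x t - toC (qs j t)))"
    proof -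
      assume c: "\<And>j. cis (\<omega> * t + \<theta>) * (1 + x (\<omega> * t)) - of_real \<epsilon> * toC (qs j (\<omega> * t / \<omega>)) = of_real \<epsilon> * (psol \<epsilon> \<omega> \<theta> x t - toC (qs j t))"
        and o: "(1 / \<epsilon>) * (\<omega> * (\<omega> * (\<epsilon> * (\<epsilon>\<^sup>2) powr (- \<mu>)))) = 1"
      let ?S = "\<Sum>j<n. of_real (m j) * Fc \<mu> (psol \<epsilon> \<omega> \<theta> x t - toC (qs j t))"
      have "(\<Sum>j<n. of_real (m j) * Fc \<mu> (cis (\<omega> * t + \<theta>) * (1 + x (\<omega> * t)) - of_real \<epsilon> * toC (qs j (\<omega> * t / \<omega>)))) = of_real (\<epsilon> * (\<epsilon>\<^sup>2) powr (- \<mu>)) * ?S"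
        unfolding c Fc_scale[OF e] sum_distrib_left by (intro sum.cong refl) (simp only: mult.left_commute)
      then have "of_real (1 / \<epsilon>) * (of_real \<omega> * (of_real \<omega> * (\<Sum>j<n. of_real (m j) * Fc \<mu> (cis (\<omega> * t + \<theta>) * (1 + x (\<omega> * t)) - of_real \<epsilon> * toC (qs j (\<omega> * t / \<omega>))))))
         = of_real ((1 / \<epsilon>) * (\<omega> * (\<omega> * (\<epsilon> * (\<epsilon>\<^sup>2) powr (- \<mu>))))) * ?S"
        by (simp only: of_real_mult mult.assoc)
      then show ?thesis unfolding o by simp
    qed
    then show ?thesis using d by simp
  qed
  have "solves_2nd (\<lambda>t. fromC (psol \<epsilon> \<omega> \<theta> x t)) (restricted_field n \<alpha> m qs)"
    unfolding solves_2nd_def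
  proof (intro exI[of _ "\<lambda>t. fromC (v t)"] allI conjI)
    fix t
    show "((\<lambda>t. fromC (psol \<epsilon> \<omega> \<theta> x t)) has_vector_derivative fromC (v t)) (at t)"
      by (rule bounded_linear.has_vector_derivative[OF bl_fromC 1])
    show "((\<lambda>t. fromC (v t)) has_vector_derivative restricted_field n \<alpha> m qs t (fromC (psol \<epsilon> \<omega> \<theta> x t))) (at t)"
      unfolding restricted_field_toC toC_fromC \<mu>_def[symmetric]
      by (rule bounded_linear.has_vector_derivative[OF bl_fromC 2])
  qed
  \<comment> \<open>In rescaled length the orbit stays at distance at least 15/16 from the origin
    and the primaries within 1/16 of it.\<close>
  moreover have "fromC (psol \<epsilon> \<omega> \<theta> x t) \<noteq> qs j t" if "j < n" for j t
  proof
    assume "fromC (psol \<epsilon> \<omega> \<theta> x t) = qs j t"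
    then have "psol \<epsilon> \<omega> \<theta> x t = toC (qs j t)" by (metis toC_fromC)
    then have "cis (\<omega> * t + \<theta>) * (1 + x (\<omega> * t)) = of_real \<epsilon> * toC (qs j t)" using e by (simp add: psol_def field_simps)
    then have "norm (1 + x (\<omega> * t)) \<le> 1/16" using nc[OF that, of t] by (metis mult_1 norm_cis norm_mult)
    then show False using norm_diff_ineq[of 1 "x (\<omega> * t)"] xb[of "\<omega> * t"] by simp
  qed
  ultimately show ?thesis unfolding restricted_solution_def by blast
qed

theorem theorem2:
  fixes n :: nat and \<alpha> :: real and m :: "nat \<Rightarrow> real" and qs :: "nat \<Rightarrow> real \<Rightarrow> real^2"
  assumes "n \<ge> 2" and "\<alpha> \<ge> 1" and "\<alpha> \<noteq> 2"
    and "\<forall>j<n. m j > 0" and "(\<Sum>j<n. m j) = 1"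
    and "nbody_periodic n \<alpha> m qs"
  shows "\<forall>p::nat. p \<ge> 1 \<longrightarrow>
     (\<exists>q0::nat. \<exists>C>0. \<forall>q::nat. q > q0 \<longrightarrow>
        (let \<epsilon> = (real p / real q) powr (2 / (\<alpha> + 1)) in
         \<exists>sol :: nat \<Rightarrow> real \<Rightarrow> real^2. \<exists>\<theta> :: nat \<Rightarrow> real. \<exists>R :: nat \<Rightarrow> real \<Rightarrow> real^2.
           sol 1 \<noteq> sol 2 \<and>
           (\<forall>i\<in>{1,2}.
              restricted_solution n \<alpha> m qs (sol i) \<and>
              (\<forall>t. sol i (t + 2 * pi * real q) = sol i t) \<and>
              \<theta> i \<in> {0..2 * pi} \<and>
              (\<forall>t. R i (t + 2 * pi * real q) = R i t) \<and>
              (\<forall>t. norm (R i t) \<le> C * \<epsilon>) \<and>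
              (\<forall>t. sol i t = (1 / \<epsilon>) *\<^sub>R (expJ (\<theta> i + real p * t / real q) *v x0) + R i t))))"
proof (intro allI impI)
  fix p :: nat assume p: "p \<ge> 1"
  define \<mu> where "\<mu> = (\<alpha> + 1) / 2"
  define qc where "qc = (\<lambda>j t. toC (qs j t))"
  note perturbed_circ = assms(6)[unfolded nbody_periodic_def]
  have mu: "\<mu> \<ge> 1" "\<mu> \<noteq> 3/2" using assms(2,3) by (auto simp: \<mu>_def)
  have qcp: "qc j \<in> periodic (2 * pi)" if j: "j < n" for j
  proof (rule periodicI)
    obtain v where "\<And>t. (qs j has_vector_derivative v t) (at t)" using perturbed_circ j unfolding solves_2nd_def by blast
    then have "\<And>t. (qc j has_vector_derivative toC (v t)) (at t)"
      unfolding qc_def by (rule bounded_linear.has_vector_derivative[OF bl_toC])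
    then show "continuous_on UNIV (qc j)" by (rule has_vector_derivative_imp_continuous)
    show "qc j (s + 2 * pi) = qc j s" for s using perturbed_circ j by (simp add: qc_def)
  qed
  have qc0: "(\<Sum>j<n. of_real (m j) * qc j t) = 0" for t
  proof -
    have "(\<Sum>j<n. of_real (m j) * qc j t) = toC (\<Sum>j<n. m j *\<^sub>R qs j t)"
      unfolding qc_def toC_lin by (simp add: scaleR_conv_of_real)
    also have "(\<Sum>j<n. m j *\<^sub>R qs j t) = 0" using perturbed_circ by blast
    finally show ?thesis by (simp add: toC_def complex_eq_iff)
  qed
  have qc1: "qc 0 t \<noteq> qc 1 t" for t
  proof
    assume "qc 0 t = qc 1 t"
    then have "qs 0 t = qs 1 t" unfolding qc_def by (metis fromC_toC)
    then show False using perturbed_circ assms(1) by auto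
  qed
  obtain \<epsilon>0 C where e0: "\<epsilon>0 > 0" and C: "C > 0" and main: "\<And>\<epsilon> \<omega> q. 0 < \<epsilon> \<Longrightarrow> \<epsilon> \<le> \<epsilon>0 \<Longrightarrow> \<omega> = \<epsilon> powr \<mu> \<Longrightarrow> q > (0::nat) \<Longrightarrow> \<omega> = real p / real q \<Longrightarrow>
    (\<exists>\<theta> x. x \<in> periodic (2 * pi * real p) \<and> (\<forall>s. norm (x s) \<le> C * \<epsilon>\<^sup>2) \<and> (\<forall>s. norm (x s) \<le> 1/16) \<and>
      (\<forall>j<n. \<forall>s. norm (of_real \<epsilon> * qc j (s / \<omega>)) \<le> 1/16) \<and>
      Lsol \<mu> x (\<lambda>s. \<Sum>j<n. of_real (m j) * Psi \<mu> (x s - of_real \<epsilon> * cis (- (s + \<theta>)) * qc j (s / \<omega>))))"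
  proof -
    have "0 < m j" if "j < n" for j using assms(4) that by blast
    from complex_solution[OF p assms(1) mu this assms(5) qcp qc0 qc1] obtain \<epsilon>0 where "\<epsilon>0 > 0 \<and> (\<exists>C>0. \<forall>\<epsilon> \<omega> q. 0 < \<epsilon> \<and> \<epsilon> \<le> \<epsilon>0 \<and> \<omega> = \<epsilon> powr \<mu> \<and> q > (0::nat) \<and> \<omega> = real p / real q \<longrightarrow>
    (\<exists>\<theta> x. x \<in> periodic (2 * pi * real p) \<and> (\<forall>s. norm (x s) \<le> C * \<epsilon>\<^sup>2) \<and> (\<forall>s. norm (x s) \<le> 1/16) \<and>
      (\<forall>j<n. \<forall>s. norm (of_real \<epsilon> * qc j (s / \<omega>)) \<le> 1/16) \<and>
      Lsol \<mu> x (\<lambda>s. \<Sum>j<n. of_real (m j) * Psi \<mu> (x s - of_real \<epsilon> * cis (- (s + \<theta>)) * qc j (s / \<omega>)))))" ..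
    then obtain C where "\<epsilon>0 > 0" "C > 0" and *: "\<forall>\<epsilon> \<omega> q. 0 < \<epsilon> \<and> \<epsilon> \<le> \<epsilon>0 \<and> \<omega> = \<epsilon> powr \<mu> \<and> q > (0::nat) \<and> \<omega> = real p / real q \<longrightarrow>
    (\<exists>\<theta> x. x \<in> periodic (2 * pi * real p) \<and> (\<forall>s. norm (x s) \<le> C * \<epsilon>\<^sup>2) \<and> (\<forall>s. norm (x s) \<le> 1/16) \<and>
      (\<forall>j<n. \<forall>s. norm (of_real \<epsilon> * qc j (s / \<omega>)) \<le> 1/16) \<and>
      Lsol \<mu> x (\<lambda>s. \<Sum>j<n. of_real (m j) * Psi \<mu> (x s - of_real \<epsilon> * cis (- (s + \<theta>)) * qc j (s / \<omega>))))" by (elim conjE exE)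
    show thesis
      by (rule that[OF \<open>\<epsilon>0 > 0\<close> \<open>C > 0\<close>], rule *[rule_format], intro conjI)
  qed
  \<comment> \<open>The ceiling ensures \<open>\<epsilon> \<le> \<epsilon>0\<close>; the summand
    \<open>4 * p\<close> gives \<open>\<omega> < 1/4\<close>, which makes the phase steps fine
    enough to find the second solution.\<close>
  define q0 where "q0 = nat \<lceil>real p / (\<epsilon>0 powr \<mu>)\<rceil> + 4 * p"
  show "\<exists>q0::nat. \<exists>C>0. \<forall>q::nat. q > q0 \<longrightarrow>
        (let \<epsilon> = (real p / real q) powr (2 / (\<alpha> + 1)) in
         \<exists>sol :: nat \<Rightarrow> real \<Rightarrow> real^2. \<exists>\<theta> :: nat \<Rightarrow> real. \<exists>R :: nat \<Rightarrow> real \<Rightarrow> real^2.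
           sol 1 \<noteq> sol 2 \<and>
           (\<forall>i\<in>{1,2}.
              restricted_solution n \<alpha> m qs (sol i) \<and>
              (\<forall>t. sol i (t + 2 * pi * real q) = sol i t) \<and>
              \<theta> i \<in> {0..2 * pi} \<and>
              (\<forall>t. R i (t + 2 * pi * real q) = R i t) \<and>
              (\<forall>t. norm (R i t) \<le> C * \<epsilon>) \<and>
              (\<forall>t. sol i t = (1 / \<epsilon>) *\<^sub>R (expJ (\<theta> i + real p * t / real q) *v x0) + R i t)))"
  proof (rule exI[of _ q0], rule exI[of _ C], rule conjI[OF C], intro allI impI)
    fix q :: nat assume q: "q > q0"
    have q1: "real q > 4 * real p" "real q \<ge> real p / (\<epsilon>0 powr \<mu>)" "q > 0"
    proof -
      have "real q \<ge> real (nat \<lceil>real p / (\<epsilon>0 powr \<mu>)\<rceil>) + 4 * real p + 1" using q unfolding q0_def by linarith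
      moreover have "real (nat \<lceil>real p / (\<epsilon>0 powr \<mu>)\<rceil>) \<ge> real p / (\<epsilon>0 powr \<mu>)" by (rule real_nat_ceiling_ge)
      ultimately show "real q > 4 * real p" "real q \<ge> real p / (\<epsilon>0 powr \<mu>)" by linarith+
      show "q > 0" using q by simp
    qed
    define \<omega> where "\<omega> = real p / real q"
    define \<epsilon> where "\<epsilon> = \<omega> powr (2 / (\<alpha> + 1))"
    have w: "\<omega> > 0" "\<omega> < 1/4" using q1 p by (auto simp: \<omega>_def field_simps)
    have e: "\<epsilon> > 0" using w by (simp add: \<epsilon>_def)
    have we: "\<omega> = \<epsilon> powr \<mu>"
    proof -
      have "2 / (\<alpha> + 1) * \<mu> = 1" using assms(2) by (simp add: \<mu>_def)
      then show ?thesis unfolding \<epsilon>_def powr_powr using w by simp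
    qed
    have ee0: "\<epsilon> \<le> \<epsilon>0"
    proof (rule ccontr)
      assume "\<not> \<epsilon> \<le> \<epsilon>0"
      then have "\<epsilon>0 powr \<mu> < \<omega>" unfolding we using e0 mu by (intro powr_less_mono2) auto
      moreover have "\<omega> \<le> \<epsilon>0 powr \<mu>" using q1(2,3) e0 by (simp add: \<omega>_def pos_divide_le_eq mult.commute)
      ultimately show False by simp
    qed
    obtain \<theta>0 x0' where x0': "x0' \<in> periodic (2 * pi * real p)" "\<And>s. norm (x0' s) \<le> C * \<epsilon>\<^sup>2" "\<And>s. norm (x0' s) \<le> 1/16"
      and nc0: "\<And>j s. j < n \<Longrightarrow> norm (of_real \<epsilon> * qc j (s / \<omega>)) \<le> 1/16"
      and L: "Lsol \<mu> x0' (\<lambda>s. \<Sum>j<n. of_real (m j) * Psi \<mu> (x0' s - of_real \<epsilon> * cis (- (s + \<theta>0)) * qc j (s / \<omega>)))"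
      using main[OF e ee0 we q1(3) \<omega>_def] by blast
    have nc: "norm (of_real \<epsilon> * toC (qs j t)) \<le> 1/16" if "j < n" for j t
      using nc0[OF that, of "\<omega> * t"] w by (simp add: qc_def)
    have u0: "usol n m \<mu> \<epsilon> \<omega> qc p C \<theta>0 x0'" by (rule usol_of_Lsol[OF x0' assms(5) qc0 L])
    \<comment> \<open>The least multiple with \<open>k * \<omega> \<ge> 1/4\<close>; it overshoots
      by less than \<omega>, hence stays below 1/2, and the phase \<open>a\<close> lies between a
      quarter and a half turn.\<close>
    define k where "k = nat \<lceil>1 / (4 * \<omega>)\<rceil>"
    have "real k \<ge> 1 / (4 * \<omega>)" "real k < 1 / (4 * \<omega>) + 1"
      using w by (auto simp: k_def real_nat_ceiling_ge of_nat_ceiling) linarith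
    then have k: "1/4 \<le> real k * \<omega>" "real k * \<omega> \<le> 1/2" using w by (auto simp: field_simps)
    define a where "a = 2 * pi * real k * \<omega>"
    have ab: "pi / 2 \<le> a" "a \<le> pi"
      using mult_left_mono[OF k(1), of "2 * pi"] mult_left_mono[OF k(2), of "2 * pi"] by (auto simp: a_def mult_ac)
    define fl where "fl = (\<lambda>t. \<lfloor>t / (2 * pi)\<rfloor>)"
    define \<theta> where "\<theta> = (\<lambda>i::nat. if i = 1 then \<theta>0 - 2 * pi * of_int (fl \<theta>0) else (\<theta>0 + a) - 2 * pi * of_int (fl (\<theta>0 + a)))"
    define x where "x = (\<lambda>i::nat. if i = 1 then x0' else (\<lambda>s. x0' (s + a)))"
    have us: "usol n m \<mu> \<epsilon> \<omega> qc p C (\<theta> i) (x i)" for i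
      using usol_mod[OF u0, of "fl \<theta>0"] usol_mod[OF usol_shift[OF u0 w(1) qcp, of k, folded a_def], of "fl (\<theta>0 + a)"]
      by (simp add: \<theta>_def x_def)
    define sol where "sol = (\<lambda>i t. fromC (psol \<epsilon> \<omega> (\<theta> i) (x i) t))"
    \<comment> \<open>Dividing a deviation of order \<open>\<epsilon>^2\<close> by \<epsilon> leaves
      the required order \<epsilon>.\<close>
    define R where "R = (\<lambda>i t. fromC (of_real (1 / \<epsilon>) * (cis (\<omega> * t + \<theta> i) * x i (\<omega> * t))))"
    have xs: "x i (\<omega> * (t + 2 * pi * real q)) = x i (\<omega> * t)" "cis (\<omega> * (t + 2 * pi * real q) + \<theta> i) = cis (\<omega> * t + \<theta> i)" for i t
    proof -
      have wq: "\<omega> * (t + 2 * pi * real q) = \<omega> * t + 2 * pi * real p" using q1(3) by (simp add: \<omega>_def field_simps)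
      show "x i (\<omega> * (t + 2 * pi * real q)) = x i (\<omega> * t)"
        unfolding wq using us[of i] by (auto simp: usol_def dest: periodicD(2))
      show "cis (\<omega> * (t + 2 * pi * real q) + \<theta> i) = cis (\<omega> * t + \<theta> i)"
        unfolding wq using cis_minus_period[of "\<omega> * t + 2 * pi * real p + \<theta> i" "int p"] by (simp add: algebra_simps)
    qed
    have th: "t - 2 * pi * of_int (fl t) \<in> {0..2 * pi}" for t
    proof -
      have "of_int (fl t) \<le> t / (2 * pi)" "t / (2 * pi) < of_int (fl t) + 1" unfolding fl_def by linarith+
      then have "of_int (fl t) * (2 * pi) \<le> t" "t < (of_int (fl t) + 1) * (2 * pi)" by (simp_all add: pos_le_divide_eq pos_divide_less_eq)
      then show ?thesis by (simp add: algebra_simps)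
    qed
    have main_props: "restricted_solution n \<alpha> m qs (sol i) \<and>
              (\<forall>t. sol i (t + 2 * pi * real q) = sol i t) \<and>
              \<theta> i \<in> {0..2 * pi} \<and>
              (\<forall>t. R i (t + 2 * pi * real q) = R i t) \<and>
              (\<forall>t. norm (R i t) \<le> C * \<epsilon>) \<and>
              (\<forall>t. sol i t = (1 / \<epsilon>) *\<^sub>R (expJ (\<theta> i + real p * t / real q) *v x0) + R i t)" for i
    proof (intro conjI allI)
      show "restricted_solution n \<alpha> m qs (sol i)"
        unfolding sol_def by (rule psol_restricted[OF us[unfolded \<mu>_def qc_def] e we[unfolded \<mu>_def] nc])
      show "sol i (t + 2 * pi * real q) = sol i t" for t unfolding sol_def psol_def xs ..
      show "R i (t + 2 * pi * real q) = R i t" for t unfolding R_def xs ..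
      show "\<theta> i \<in> {0..2 * pi}" unfolding \<theta>_def using th by simp
      show "norm (R i t) \<le> C * \<epsilon>" for t
      proof -
        have "norm (x i (\<omega> * t)) \<le> C * \<epsilon>\<^sup>2" using us[of i] by (simp add: usol_def)
        then have "(1 / \<epsilon>) * norm (x i (\<omega> * t)) \<le> (1 / \<epsilon>) * (C * \<epsilon>\<^sup>2)" using e by (intro mult_left_mono) auto
        also have "\<dots> = C * \<epsilon>" using e by (simp add: power2_eq_square)
        finally show ?thesis using e unfolding R_def norm_fromC norm_mult norm_cis norm_of_real by simp
      qed
      show "sol i t = (1 / \<epsilon>) *\<^sub>R (expJ (\<theta> i + real p * t / real q) *v x0) + R i t" for t
      proof -
        have "\<theta> i + real p * t / real q = \<omega> * t + \<theta> i" by (simp add: \<omega>_def)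
        then show ?thesis unfolding expJ_fromC sol_def R_def psol_def fromC_lin(1,2)[symmetric]
          by (simp only: scaleR_conv_of_real distrib_left mult_1_right)
      qed
    qed
    \<comment> \<open>Compared at time 0: the phases differ by \<open>a\<close> with nonpositive
      cosine, which separates the circular positions by at least 1, while the deviations total at
      most 1/8.\<close>
    have "sol 1 \<noteq> sol 2"
    proof
      assume "sol 1 = sol 2"
      then have "fromC (psol \<epsilon> \<omega> (\<theta> 1) (x 1) 0) = fromC (psol \<epsilon> \<omega> (\<theta> 2) (x 2) 0)" unfolding sol_def by (rule fun_cong)
      then have "psol \<epsilon> \<omega> (\<theta> 1) (x 1) 0 = psol \<epsilon> \<omega> (\<theta> 2) (x 2) 0" by (metis toC_fromC)
      then have "cis (\<theta> 1) * (1 + x0' 0) = cis (\<theta> 2) * (1 + x0' a)" using e by (simp add: psol_def x_def)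
      moreover have "cis (\<theta> 1) = cis \<theta>0" "cis (\<theta> 2) = cis \<theta>0 * cis a"
        by (simp_all add: \<theta>_def cis_minus_period cis_mult)
      ultimately have "cis \<theta>0 * (1 + x0' 0) = cis \<theta>0 * (cis a * (1 + x0' a))" by simp
      then have eq: "1 + x0' 0 = cis a * (1 + x0' a)" by simp
      have "cos a \<le> 0" using ab cos_monotone_0_pi_le[of "pi / 2" a] by simp
      then have "1 \<le> Re (1 - cis a)" by simp
      also have "1 - cis a = cis a * x0' a - x0' 0" using eq by (simp add: algebra_simps)
      also have "Re (cis a * x0' a - x0' 0) \<le> norm (cis a * x0' a - x0' 0)" by (rule complex_Re_le_cmod)
      also have "\<dots> \<le> norm (cis a * x0' a) + norm (x0' 0)" by (rule norm_triangle_ineq4)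
      also have "\<dots> \<le> 1/16 + 1/16" using x0'(3) by (intro add_mono) (simp_all add: norm_mult)
      finally show False by simp
    qed
    then show "let \<epsilon> = (real p / real q) powr (2 / (\<alpha> + 1)) in
         \<exists>sol :: nat \<Rightarrow> real \<Rightarrow> real^2. \<exists>\<theta> :: nat \<Rightarrow> real. \<exists>R :: nat \<Rightarrow> real \<Rightarrow> real^2.
           sol 1 \<noteq> sol 2 \<and>
           (\<forall>i\<in>{1,2}.
              restricted_solution n \<alpha> m qs (sol i) \<and>
              (\<forall>t. sol i (t + 2 * pi * real q) = sol i t) \<and>
              \<theta> i \<in> {0..2 * pi} \<and>
              (\<forall>t. R i (t + 2 * pi * real q) = R i t) \<and>
              (\<forall>t. norm (R i t) \<le> C * \<epsilon>) \<and>
              (\<forall>t. sol i t = (1 / \<epsilon>) *\<^sub>R (expJ (\<theta> i + real p * t / real q) *v x0) + R i t))"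
      unfolding Let_def \<omega>_def[symmetric] \<epsilon>_def[symmetric] using main_props by blast
  qed
qed

end
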